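(* Let $X$ solve the SDE of the context. For each $\varepsilon>0$ let $\mathbf X=(X(\tilde t_0),\dots,X(\tilde t_m))$ be the data observed at $\tilde t_i=i\tilde\Delta(\varepsilon)$, $i=0,\dots,m$, $\tilde t_m=\varepsilon^{-1}$. Let $\hat\varsigma^\varepsilon$ be an estimator of $\varsigma$ based on $\mathbf X$ and let $\hat\mu^\varepsilon_{\mathrm{AMLE}}\in\arg\min_{\mu\in\mathbb M}\{-\varepsilon\ell^\varepsilon_A(\mu)+\gamma^\varepsilon(\mu)\}$ (see context). Assume that either $\mathbb S$ is open, or $\mathbb S$ is closed and each $\hat\varsigma^\varepsilon$ takes values in $\mathbb S$. Assume further: (A) There is a Lyapunov function $V:\mathbb R^d\to[1,\infty)$ such that for every $\theta=(\mu,\varsigma)\in\Theta$: $-\limsup_{\|x\|\to\infty}\mathcal L_\theta V(x)>0$; $\ \nabla^TV(x)a(\varsigma,x)\nabla V(x)/(V(x)|\mathcal L_\theta V(x)|)\to0$ as $\|x\|\to\infty$; and, for some exponent $q_{V,0}\ge 0$ and constant $J_{V,0}>0$, $\max\{\|\nabla V(x)\|,\|D^2V(x)\|\}\le J_{V,0}V(x)^{q_{V,0}}$ for all $x$. Moreover, for some locally bounded functions $J_{b,0},J_{b,1}:\mathbb M\to[0,\infty)$, $J_{\sigma,0},J_{\sigma,1},J_{a,0}:\mathbb S\to[0,\infty)$, exponents $q_{b,0},q_{b,1},q_{\sigma,0},q_{\sigma,1},q_{a,0}\ge0$ and $0<\alpha_b,\alpha_\sigma\le1$ (not depending on the parameters),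 for all $\mu\in\mathbb M,\varsigma\in\mathbb S,x,x'\in\mathbb R^d$: $\|b(\mu,x)\|\le J_{b,0}(\mu)V(x)^{q_{b,0}}$; $\|b(\mu,x)-b(\mu,x')\|\le J_{b,1}(\mu)(V(x)^{q_{b,1}}+V(x')^{q_{b,1}})\|x-x'\|^{\alpha_b}$; $\|\sigma(\varsigma,x)\|\le J_{\sigma,0}(\varsigma)V(x)^{q_{\sigma,0}}$; $\|\sigma(\varsigma,x)-\sigma(\varsigma,x')\|\le J_{\sigma,1}(\varsigma)(V(x)^{q_{\sigma,1}}+V(x')^{q_{\sigma,1}})\|x-x'\|^{\alpha_\sigma}$; $\|a^{-1}(\varsigma,x)\|\le J_{a,0}(\varsigma)V(x)^{q_{a,0}}$. Finally, the maps $(\mu,x)\in\mathbb M\times\mathbb R^d\mapsto b(\mu,x)$ and $(\varsigma,x)\in\mathbb S\times\mathbb R^d\mapsto a^{-1}(\varsigma,x)$ satisfy a local Hölder-type condition in $\mu$, respectively in $\varsigma$, with growth function $V$ (see context). (B) $\hat\varsigma^\varepsilon$ is consistent: for each $\theta_0=(\mu_0,\varsigma_0)\in\Theta$, $\hat\varsigma^\varepsilon\to\varsigma_0$ in $\mathbb P_{\theta_0}$-probability. (C) For each $\theta_0=(\mu_0,\varsigma_0)\in\Theta$ the function $\bar\Lambda_{\theta_0}:\mathbb M\to\mathbb R$, $$\bar\Lambda_{\theta_0}(\mu)=\tfrac12\int_{\mathbb R^d}(b(\mu,x)-b(\mu_0,x))^Ta^{-1}(\varsigma_0,x)(b(\mu,x)-b(\mu_0,x))\,\pi^{st}_{\theta_0}(dx),$$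 has a unique minimum, at $\mu=\mu_0$. (D) $\gamma^\varepsilon\to0$ in $C(\mathbb M,\mathbb R)$ as $\varepsilon\to0$. (E) Either (a) $\mathbb M$ is closed and $\{\hat\mu^\varepsilon_{\mathrm{AMLE}}\}$ is tight; or (b) $\mathbb M$ is open and convex, $\mu\mapsto b(\mu,x)$ (for each $x$) and $\mu\mapsto\gamma^\varepsilon(\mu)$ are differentiable on $\mathbb M$, and for every $m\geq 1$, $\mathbf x_{0:m}=(x_0,\dots,x_m)\in\mathbb R^{d\times(m+1)}$, $\varsigma\in\mathbb S$ and $0<\delta\le1$, the likelihood equation $-(m\delta)^{-1}\nabla_\mu\ell^{m,\delta}_D(\mu|\varsigma,\mathbf x_{0:m})+\nabla_\mu\gamma^{1/(m\delta)}(\mu)=0$ has a unique solution $\mu\in\mathbb M$. (F) $\tilde\Delta(\varepsilon)\to0$ as $\varepsilon\to0$. Then for each $\theta_0=(\mu_0,\varsigma_0)\in\Theta$, $\hat\mu^\varepsilon_{\mathrm{AMLE}}\to\mu_0$ in $\mathbb P_{\theta_0}$-probability as $\varepsilon\to0$.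
   Context: Setup. $\Theta=\mathbb M\times\mathbb S\subset\mathbb R^{n_0}\times\mathbb R^{n_1\times n_2}$; $b:\mathbb R^{n_0}\times\mathbb R^d\to\mathbb R^d$ and $\sigma:\mathbb R^{n_1\times n_2}\times\mathbb R^d\to\mathbb R^{d\times d}$ are measurable; $a(\varsigma,x)=\sigma(\varsigma,x)\sigma(\varsigma,x)^T$ is positive definite for all $\varsigma\in\mathbb S$, $x\in\mathbb R^d$; $a^{-1}(\varsigma,x)$ is its inverse (for $\varsigma\notin\mathbb S$ where $a$ may be singular, any fixed measurable convention is used). On $(\Omega,\mathcal F)$ there are probability measures $\mathbb P_\theta$, $\theta=(\mu,\varsigma)\in\Theta$, such that under $\mathbb P_\theta$ $$X(t)=x_0+\int_0^tb(\mu,X(s))ds+\int_0^t\sigma(\varsigma,X(s))dW(s),\quad x_0\in\mathbb R^d,$$ with $W$ a $d$-dimensional Brownian motion. For each $\theta\in\Theta$, $X$ is ergodic with unique stationary distribution $\pi^{st}_\theta$. The generator is $\mathcal L_\theta f(x)=\langle b(\mu,x),\nabla f(x)\rangle+\frac12\mathrm{tr}(a(\varsigma,x)D^2f(x))$. A Lyapunov function is a $C^2$ function $V:\mathbb R^d\to[1,\infty)$ with compact sublevel sets $\{V\le R\}$. Local Hölder-type condition. For $E$ a subset of a normed space and $F:E\times\mathbb R^d\to\mathbb U$ ($\mathbb U$ normed), $F$ satisfies a local Hölder-type condition in $\eta\in E$ with growth function $V$ if for every compact $\mathbb K\subset E$ there are a constant $K_{\mathbb K}$, $0<\nu\le1$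 and $q\ge0$ (all possibly depending on $\mathbb K$) with $\|F(\eta_1,x)-F(\eta_2,x)\|\le K_{\mathbb K}V(x)^q\|\eta_1-\eta_2\|^\nu$ for all $\eta_1,\eta_2\in\mathbb K$, $x\in\mathbb R^d$. A function is locally bounded if it is bounded on compact subsets of its domain. Likelihood. For $\mathbf x_{0:m}\in\mathbb R^{d\times(m+1)}$, $$\ell^{m,\delta}_D(\mu|\varsigma,\mathbf x_{0:m})=\sum_{i=1}^ma^{-1}(\varsigma,x_{i-1})b(\mu,x_{i-1})\cdot(x_i-x_{i-1})-\frac\delta2\sum_{i=1}^mb^T(\mu,x_{i-1})a^{-1}(\varsigma,x_{i-1})b(\mu,x_{i-1}).$$ Here $\tilde\Delta=\tilde\Delta(\varepsilon)$ and $m=(\varepsilon\tilde\Delta)^{-1}$ is assumed to be an integer. The estimator is $\hat\varsigma^\varepsilon=F^\varepsilon(\mathbf X)$ with $F^\varepsilon$ a deterministic measurable function, $\ell^\varepsilon_A(\mu)=\ell^{m,\tilde\Delta}_D(\mu|\hat\varsigma^\varepsilon,\mathbf X)$ with $m=(\varepsilon\tilde\Delta)^{-1}$, and $\gamma^\varepsilon:\mathbb M\to\mathbb R$ is a deterministic penalty function. The existence of the minimizer $\hat\mu^\varepsilon_{\mathrm{AMLE}}$ (a random variable) is assumed. $C(\mathbb M,\mathbb R)$ carries the topology of uniform convergence on compact sets. *)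

theory Defs
  imports "HOL-Probability.Probability"
begin

section \<open>Calculus on Euclidean space\<close>

definition grad :: "(real^'n \<Rightarrow> real) \<Rightarrow> real^'n \<Rightarrow> real^'n" where
  "grad f x = (\<chi> i. frechet_derivative f (at x) (axis i 1))"

definition hess :: "(real^'n \<Rightarrow> real) \<Rightarrow> real^'n \<Rightarrow> real^'n^'n" where
  "hess f x = (\<chi> i j. frechet_derivative (\<lambda>y. grad f y $ i) (at x) (axis j 1))"

definition C2 :: "(real^'n \<Rightarrow> real) \<Rightarrow> bool" where
  "C2 f \<longleftrightarrow> (\<forall>x. f differentiable at x) \<and> (\<forall>x. grad f differentiable at x)
     \<and> continuous_on UNIV (hess f)"

definition positive_definite :: "real^'n^'n \<Rightarrow> bool" where
  "positive_definite A \<longleftrightarrow> transpose A = A \<and> (\<forall>v. v \<noteq> 0 \<longrightarrow> v \<bullet> (A *v v) > 0)"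

definition lyapunov_function :: "(real^'d \<Rightarrow> real) \<Rightarrow> bool" where
  "lyapunov_function V \<longleftrightarrow> C2 V \<and> (\<forall>x. V x \<ge> 1) \<and> (\<forall>R. compact {x. V x \<le> R})"

definition locally_bounded_on :: "'a::topological_space set \<Rightarrow> ('a \<Rightarrow> 'b::metric_space) \<Rightarrow> bool" where
  "locally_bounded_on E J \<longleftrightarrow> (\<forall>K. compact K \<and> K \<subseteq> E \<longrightarrow> bounded (J ` K))"

definition local_holder_cond ::
  "'e::real_normed_vector set \<Rightarrow> ('x \<Rightarrow> real) \<Rightarrow> ('e \<Rightarrow> 'x \<Rightarrow> 'u::real_normed_vector) \<Rightarrow> bool" where
  "local_holder_cond E V G \<longleftrightarrow>
     (\<forall>K. compact K \<and> K \<subseteq> E \<longrightarrow>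
        (\<exists>C \<nu> q. 0 < \<nu> \<and> \<nu> \<le> 1 \<and> 0 \<le> q \<and>
           (\<forall>\<eta>1\<in>K. \<forall>\<eta>2\<in>K. \<forall>x.
              norm (G \<eta>1 x - G \<eta>2 x) \<le> C * V x powr q * norm (\<eta>1 - \<eta>2) powr \<nu>)))"


section \<open>Modes of convergence\<close>

definition tendsto_in_prob ::
  "'w measure \<Rightarrow> ('i \<Rightarrow> 'w \<Rightarrow> 'b::metric_space) \<Rightarrow> ('w \<Rightarrow> 'b) \<Rightarrow> 'i filter \<Rightarrow> bool" where
  "tendsto_in_prob M Y Z Fl \<longleftrightarrow>
     (\<forall>\<eta>>0. ((\<lambda>i. measure M {\<omega>\<in>space M. dist (Y i \<omega>) (Z \<omega>) > \<eta>}) \<longlongrightarrow> 0) Fl)"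

definition tight_family :: "'w measure \<Rightarrow> 'i set \<Rightarrow> ('i \<Rightarrow> 'w \<Rightarrow> 'b::topological_space) \<Rightarrow> bool" where
  "tight_family M I Y \<longleftrightarrow>
     (\<forall>\<eta>>0. \<exists>K. compact K \<and> (\<forall>i\<in>I. measure M {\<omega>\<in>space M. Y i \<omega> \<notin> K} \<le> \<eta>))"


section \<open>Brownian motion and the Ito integral\<close>

text \<open>Processes have index type \<^typ>\<open>real\<close>; only times \<open>t \<ge> 0\<close> matter. A filtration is a family of
  sub-\<open>\<sigma>\<close>-algebras; neither completeness nor right-continuity is required.\<close>

definition filtered_prob_space :: "'w measure \<Rightarrow> (real \<Rightarrow> 'w measure) \<Rightarrow> bool" where
  "filtered_prob_space M \<F> \<longleftrightarrow>
     prob_space M \<and> filtration (space M) \<F> \<and> (\<forall>t. subalgebra M (\<F> t))"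

definition adapted :: "(real \<Rightarrow> 'w measure) \<Rightarrow> (real \<Rightarrow> 'w \<Rightarrow> 'b::topological_space) \<Rightarrow> bool" where
  "adapted \<F> Y \<longleftrightarrow> (\<forall>t\<ge>0. Y t \<in> borel_measurable (\<F> t))"

definition brownian_motion ::
  "'w measure \<Rightarrow> (real \<Rightarrow> 'w measure) \<Rightarrow> (real \<Rightarrow> 'w \<Rightarrow> real^'d) \<Rightarrow> bool" where
  "brownian_motion M \<F> W \<longleftrightarrow>
     adapted \<F> W \<and>
     (AE \<omega> in M. W 0 \<omega> = 0 \<and> continuous_on {0..} (\<lambda>t. W t \<omega>)) \<and>
     (\<forall>s t. 0 \<le> s \<and> s < t \<longrightarrow>
        distributed M lborel (\<lambda>\<omega>. W t \<omega> - W s \<omega>)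
          (\<lambda>x. ennreal (\<Prod>i\<in>UNIV. normal_density 0 (sqrt (t - s)) (x $ i))) \<and>
        prob_space.indep_set M (sets (\<F> s))
          {(\<lambda>\<omega>. W t \<omega> - W s \<omega>) -` B \<inter> space M | B. B \<in> sets borel})"

definition progressive ::
  "'w measure \<Rightarrow> (real \<Rightarrow> 'w measure) \<Rightarrow> (real \<Rightarrow> 'w \<Rightarrow> 'b::topological_space) \<Rightarrow> bool" where
  "progressive M \<F> H \<longleftrightarrow>
     (\<forall>T\<ge>0. (\<lambda>(t, \<omega>). H t \<omega>) \<in>
        borel_measurable (restrict_space borel {0..T} \<Otimes>\<^sub>M \<F> T))"

text \<open>A simple integrand is given by a partition \<open>\<tau> 0 \<le> \<dots> \<le> \<tau> n\<close> and bounded values \<open>\<xi> i\<close>,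
  known at time \<open>\<tau> i\<close> and used on \<open>(\<tau> i, \<tau> (Suc i)]\<close>.\<close>

definition simple_integrand ::
  "'w measure \<Rightarrow> (real \<Rightarrow> 'w measure) \<Rightarrow> nat \<Rightarrow> (nat \<Rightarrow> real) \<Rightarrow> (nat \<Rightarrow> 'w \<Rightarrow> real^'d^'k) \<Rightarrow> bool" where
  "simple_integrand M \<F> n \<tau> \<xi> \<longleftrightarrow>
     0 \<le> \<tau> 0 \<and>
     (\<forall>i<n. \<tau> i \<le> \<tau> (Suc i) \<and> \<xi> i \<in> borel_measurable (\<F> (\<tau> i)) \<and> bounded (\<xi> i ` space M))"

definition simple_process ::
  "nat \<Rightarrow> (nat \<Rightarrow> real) \<Rightarrow> (nat \<Rightarrow> 'w \<Rightarrow> real^'d^'k) \<Rightarrow> real \<Rightarrow> 'w \<Rightarrow> real^'d^'k" where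
  "simple_process n \<tau> \<xi> t \<omega> = (\<Sum>i<n. indicat_real {\<tau> i<..\<tau> (Suc i)} t *\<^sub>R \<xi> i \<omega>)"

definition simple_integral ::
  "nat \<Rightarrow> (nat \<Rightarrow> real) \<Rightarrow> (nat \<Rightarrow> 'w \<Rightarrow> real^'d^'k) \<Rightarrow> (real \<Rightarrow> 'w \<Rightarrow> real^'d) \<Rightarrow> real \<Rightarrow> 'w \<Rightarrow> real^'k"
where
  "simple_integral n \<tau> \<xi> W t \<omega> =
     (\<Sum>i<n. \<xi> i \<omega> *v (W (min (\<tau> (Suc i)) t) \<omega> - W (min (\<tau> i) t) \<omega>))"

text \<open>\<open>I\<close> is (a continuous version of) \<open>\<integral>\<^sub>0\<^sup>t H dW\<close>: \<open>H\<close> is progressive with a.s. locally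
  square-integrable paths, and \<open>I t\<close> is the limit in probability of the integrals of simple integrands
  approximating \<open>H\<close> in \<open>L\<^sup>2[0,T]\<close>, in probability, for every \<open>T\<close>.\<close>

definition has_ito_integral ::
  "'w measure \<Rightarrow> (real \<Rightarrow> 'w measure) \<Rightarrow> (real \<Rightarrow> 'w \<Rightarrow> real^'d) \<Rightarrow>
   (real \<Rightarrow> 'w \<Rightarrow> real^'d^'k) \<Rightarrow> (real \<Rightarrow> 'w \<Rightarrow> real^'k) \<Rightarrow> bool" where
  "has_ito_integral M \<F> W H I \<longleftrightarrow>
     progressive M \<F> H \<and>
     (\<forall>T\<ge>0. AE \<omega> in M. (\<integral>\<^sup>+s\<in>{0..T}. ennreal ((norm (H s \<omega>))\<^sup>2) \<partial>lborel) < \<infinity>) \<and>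
     (\<forall>t\<ge>0. I t \<in> borel_measurable M) \<and>
     (AE \<omega> in M. continuous_on {0..} (\<lambda>t. I t \<omega>)) \<and>
     (\<exists>n \<tau> \<xi>.
        (\<forall>k. simple_integrand M \<F> (n k) (\<tau> k) (\<xi> k)) \<and>
        (\<forall>T\<ge>0. \<forall>\<eta>>0.
           (\<lambda>k::nat. measure M {\<omega>\<in>space M. ennreal \<eta> <
              (\<integral>\<^sup>+s\<in>{0..T}. ennreal ((norm (simple_process (n k) (\<tau> k) (\<xi> k) s \<omega> - H s \<omega>))\<^sup>2) \<partial>lborel)})
           \<longlonglongrightarrow> 0) \<and>
        (\<forall>t\<ge>0. tendsto_in_prob M (\<lambda>k. simple_integral (n k) (\<tau> k) (\<xi> k) W t) (I t) sequentially))"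


section \<open>Stochastic differential equations\<close>

text \<open>Under \<open>M\<close>, the process \<open>X\<close> satisfies
  \<open>X t = X 0 + \<integral>\<^sub>0\<^sup>t \<beta> (X s) ds + \<integral>\<^sub>0\<^sup>t \<rho> (X s) dW s\<close> for some Brownian motion \<open>W\<close> on \<open>M\<close>.\<close>

definition sde_solution ::
  "'w measure \<Rightarrow> (real^'d \<Rightarrow> real^'d) \<Rightarrow> (real^'d \<Rightarrow> real^'d^'d) \<Rightarrow> (real \<Rightarrow> 'w \<Rightarrow> real^'d) \<Rightarrow> bool" where
  "sde_solution M \<beta> \<rho> X \<longleftrightarrow>
     (\<exists>\<F> (W :: real \<Rightarrow> 'w \<Rightarrow> real^'d) I.
        filtered_prob_space M \<F> \<and> brownian_motion M \<F> W \<and>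
        adapted \<F> X \<and> (\<forall>\<omega>\<in>space M. continuous_on {0..} (\<lambda>t. X t \<omega>)) \<and>
        has_ito_integral M \<F> W (\<lambda>s \<omega>. \<rho> (X s \<omega>)) I \<and>
        (AE \<omega> in M. \<forall>t\<ge>0.
           set_integrable lborel {0..t} (\<lambda>s. \<beta> (X s \<omega>)) \<and>
           X t \<omega> = X 0 \<omega> + (LINT s:{0..t}|lborel. \<beta> (X s \<omega>)) + I t \<omega>))"

text \<open>A stationary distribution is the common one-dimensional law of a weak solution. The sample
  space type loses no generality: a solution \<open>X\<close> together with its Brownian motion \<open>W\<close> can be
  transported to the space of pairs of paths.\<close>

definition stationary_distribution ::
  "(real^'d \<Rightarrow> real^'d) \<Rightarrow> (real^'d \<Rightarrow> real^'d^'d) \<Rightarrow> (real^'d) measure \<Rightarrow> bool" where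
  "stationary_distribution \<beta> \<rho> \<pi> \<longleftrightarrow>
     prob_space \<pi> \<and> sets \<pi> = sets borel \<and>
     (\<exists>(M :: ((real \<Rightarrow> real^'d) \<times> (real \<Rightarrow> real^'d)) measure) X.
        sde_solution M \<beta> \<rho> X \<and> (\<forall>t\<ge>0. distr M borel (X t) = \<pi>))"

text \<open>Ergodicity of \<open>X\<close>, started anywhere: time averages of bounded observables converge a.s. to
  space averages. (Arbitrary \<open>\<pi>\<close>-integrable observables would be too much: from a fixed starting
  point \<open>x\<^sub>0\<close> their time integrals may diverge because of a singularity at \<open>x\<^sub>0\<close>.)\<close>

definition ergodic_process ::
  "'w measure \<Rightarrow> (real \<Rightarrow> 'w \<Rightarrow> real^'d) \<Rightarrow> (real^'d) measure \<Rightarrow> bool" where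
  "ergodic_process M X \<pi> \<longleftrightarrow>
     (\<forall>f :: real^'d \<Rightarrow> real. f \<in> borel_measurable borel \<and> bounded (range f) \<longrightarrow>
        (AE \<omega> in M. ((\<lambda>T. (1 / T) * (LINT s:{0..T}|lborel. f (X s \<omega>))) \<longlongrightarrow> (\<integral>x. f x \<partial>\<pi>)) at_top))"

definition diffusion_matrix :: "('s \<Rightarrow> real^'d \<Rightarrow> real^'d^'d) \<Rightarrow> 's \<Rightarrow> real^'d \<Rightarrow> real^'d^'d" where
  "diffusion_matrix \<sigma> vs x = \<sigma> vs x ** transpose (\<sigma> vs x)"

definition generator ::
  "('m \<Rightarrow> real^'d \<Rightarrow> real^'d) \<Rightarrow> ('s \<Rightarrow> real^'d \<Rightarrow> real^'d^'d) \<Rightarrow> 'm \<Rightarrow> 's \<Rightarrow>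
   (real^'d \<Rightarrow> real) \<Rightarrow> real^'d \<Rightarrow> real" where
  "generator b \<sigma> \<mu> vs f x =
     b \<mu> x \<bullet> grad f x + 1/2 * trace (diffusion_matrix \<sigma> vs x ** hess f x)"


section \<open>Likelihood and limiting contrast\<close>

text \<open>In both definitions the argument \<open>ainv\<close> stands for the inverse \<open>a\<^sup>-\<^sup>1\<close> of the diffusion matrix
  (extended arbitrarily to parameters for which that matrix may be singular).\<close>

definition loglik ::
  "('m \<Rightarrow> real^'d \<Rightarrow> real^'d) \<Rightarrow> ('s \<Rightarrow> real^'d \<Rightarrow> real^'d^'d) \<Rightarrow> nat \<Rightarrow> real \<Rightarrow>
   'm \<Rightarrow> 's \<Rightarrow> (nat \<Rightarrow> real^'d) \<Rightarrow> real" where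
  "loglik b ainv m \<delta> \<mu> vs x =
     (\<Sum>i=1..m. (ainv vs (x (i-1)) *v b \<mu> (x (i-1))) \<bullet> (x i - x (i-1)))
     - \<delta>/2 * (\<Sum>i=1..m. b \<mu> (x (i-1)) \<bullet> (ainv vs (x (i-1)) *v b \<mu> (x (i-1))))"

definition Lambda_bar ::
  "('m \<Rightarrow> real^'d \<Rightarrow> real^'d) \<Rightarrow> ('s \<Rightarrow> real^'d \<Rightarrow> real^'d^'d) \<Rightarrow> (real^'d) measure \<Rightarrow>
   'm \<Rightarrow> 's \<Rightarrow> 'm \<Rightarrow> real" where
  "Lambda_bar b ainv \<pi> \<mu>0 vs0 \<mu> =
     1/2 * (\<integral>x. (b \<mu> x - b \<mu>0 x) \<bullet> (ainv vs0 x *v (b \<mu> x - b \<mu>0 x)) \<partial>\<pi>)"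

end

theory Submission
 imports Defs
begin

text \<open>The contrast splits into an average of a function of the observations, a discretization error and a
 martingale term. The definition of the Ito integral as a limit in probability yields exponential
 supermartingales, hence sub-Gaussian tails for discretely weighted sums of increments of the integral, and,
 via Taylor expansion on fine grids, Dynkin's formula. Applied to truncated powers of \<open>V\<close> it bounds the
 time averages of all moments \<open>V powr q\<close>, so that ergodicity extends from bounded to polynomially growing
 functions and to discrete observations. Chaining over the parameters makes the convergence of the contrast
 to \<open>Lam\<close> uniform on compact sets, and \<open>Lambda_bar\<close> differs from \<open>Lam\<close> by a constant. In case (b) the
 perturbed contrast has a minimizer in a small ball around the true parameter, which solves the
 likelihood equation and is therefore the estimator.\<close>

text \<open>The estimator \<open>vshat\<close> depends on the whole path, so it cannot enter a
  stochastic integral as an adapted weight. Limits are therefore proved uniformly over pairs of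
  parameters in a compact product, and the random value is substituted afterwards, path by path.
  Uniformity calls for more than second moments: the number of links between dyadic nets grows
  geometrically, and sub-Gaussian tails, valid on an event of bounded quadratic variation, outweigh
  that growth. The integral is only a limit in probability of simple integrals; neither an isometry
  nor a martingale property is part of its definition. For simple integrands, however, the
  exponential of the integral, compensated by half its quadratic variation, has mean exactly one,
  and Fatou's lemma keeps the inequality in the limit. Every estimate of the integral is drawn from
  this one fact. Moments of the diffusion are not known to be finite beforehand either, so
  expectations of powers of \<open>V\<close> are kept as \<open>ennreal\<close> integrals. A last
  difficulty is the diffusion coefficient, which is bounded only on compact sets; hence all test
  functions have derivatives of compact support.\<close>

abbreviation EE :: "'a measure \<Rightarrow> ('a \<Rightarrow> real) \<Rightarrow> ennreal" where
 "EE M Y \<equiv> \<integral>\<^sup>+x. ennreal (Y x) \<partial>M"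

section \<open>Gaussian increments of Brownian motion\<close>

definition gaussian :: "real \<Rightarrow> (real^'d) measure" where
 "gaussian \<tau> = density lborel (\<lambda>x. ennreal (\<Prod>i\<in>UNIV. normal_density 0 (sqrt \<tau>) (x $ i)))"

lemma sets_gaussian [measurable_cong, simp]: "sets (gaussian \<tau>) = sets borel" by (simp add: gaussian_def)

lemma space_gaussian [simp]: "space (gaussian \<tau>) = UNIV" by (simp add: gaussian_def)

text \<open>Completing the square in each coordinate: the exponential tilt by \<open>u\<close>
  translates the centered density by \<open>\<tau> *\<^sub>R u\<close>.\<close>

lemma gaussian_density_shift:
 fixes x u :: "real^'d"
 assumes "\<tau> > 0"
 shows "(\<Prod>i\<in>UNIV. normal_density 0 (sqrt \<tau>) (x $ i)) * exp (u \<bullet> x - (norm u)^2 * \<tau> / 2)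
    = (\<Prod>i\<in>UNIV. normal_density 0 (sqrt \<tau>) ((x - \<tau> *\<^sub>R u) $ i))"
proof -
 have "exp (u \<bullet> x - (norm u)^2 * \<tau> / 2) = (\<Prod>i\<in>UNIV. exp (u $ i * x $ i - (u $ i)^2 * \<tau> / 2))"
  by (simp add: exp_sum[symmetric] inner_vec_def norm_vec_def L2_set_def sum_nonneg sum_subtractf
    sum_distrib_right sum_divide_distrib)
 moreover have "normal_density 0 (sqrt \<tau>) a * exp (v * a - v^2 * \<tau> / 2) = normal_density 0 (sqrt \<tau>) (a - \<tau> * v)" for a v :: real
  using assms unfolding normal_density_def by (simp add: mult_exp_exp power2_eq_square field_simps)
 ultimately show ?thesis by (simp add: prod.distrib[symmetric])
qed

text \<open>After the shift, translation invariance of Lebesgue measure leaves the total mass. That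
  this mass is one enters through \<open>prob\<close>, which the existence of a Brownian motion
  supplies later.\<close>

lemma gaussian_mgf:
 fixes u :: "real^'d"
 assumes \<tau>: "\<tau> > 0" and prob: "prob_space (gaussian \<tau> :: (real^'d) measure)"
 shows "(\<integral>\<^sup>+z. ennreal (exp (u \<bullet> z - (norm u)^2 * \<tau> / 2)) \<partial>gaussian \<tau>) = 1"
proof -
 let ?p = "\<lambda>x::real^'d. \<Prod>i\<in>UNIV. normal_density 0 (sqrt \<tau>) (x $ i)"
 have [measurable]: "?p \<in> borel_measurable borel" by measurable
 have "(\<integral>\<^sup>+z. ennreal (exp (u \<bullet> z - (norm u)^2 * \<tau> / 2)) \<partial>gaussian \<tau>)
   = (\<integral>\<^sup>+z. ennreal (?p (- (\<tau> *\<^sub>R u) + z)) \<partial>lborel)" unfolding gaussian_def by (subst nn_integral_density)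
    (auto simp: ennreal_mult[symmetric] prod_nonneg gaussian_density_shift[OF \<tau>] simp flip: diff_conv_add_uminus
     intro!: nn_integral_cong)
 also have "... = (\<integral>\<^sup>+z. ennreal (?p z) \<partial>distr lborel borel ((+) (- (\<tau> *\<^sub>R u))))"
  by (subst nn_integral_distr) auto
 also have "... = emeasure (gaussian \<tau>) (space (gaussian \<tau> :: (real^'d) measure))"
  unfolding lborel_distr_plus by (simp add: gaussian_def emeasure_density)
 finally show ?thesis using prob_space.emeasure_space_1[OF prob] by simp
qed

locale filtered_brownian =
 fixes M :: "'w measure" and \<F> :: "real \<Rightarrow> 'w measure" and W :: "real \<Rightarrow> 'w \<Rightarrow> real^'d"
 assumes filtered: "filtered_prob_space M \<F>" and brownian: "brownian_motion M \<F> W"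
begin

sublocale prob_space M using filtered by (simp add: filtered_prob_space_def)

lemma space_F [simp]: "space (\<F> t) = space M" using filtered by (simp add: filtered_prob_space_def filtration_def)

lemma sets_F: "s \<le> t \<Longrightarrow> sets (\<F> s) \<subseteq> sets (\<F> t)"
 using filtered by (simp add: filtered_prob_space_def filtration_def)

lemma subalg_F: "subalgebra M (\<F> t)" using filtered by (simp add: filtered_prob_space_def)

lemma measurable_F_mono: "s \<le> t \<Longrightarrow> f \<in> measurable (\<F> s) N \<Longrightarrow> f \<in> measurable (\<F> t) N"
 using sets_F[of s t] by (auto simp: measurable_def)

lemma measurable_F_M: "f \<in> measurable (\<F> s) N \<Longrightarrow> f \<in> measurable M N" using measurable_from_subalg[OF subalg_F] .

lemma W_meas_F: "0 \<le> s \<Longrightarrow> s \<le> t \<Longrightarrow> W s \<in> borel_measurable (\<F> t)"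
 using brownian measurable_F_mono[of s t "W s" borel] by (auto simp: brownian_motion_def adapted_def)

lemma W_meas: "0 \<le> s \<Longrightarrow> W s \<in> borel_measurable M" using W_meas_F measurable_F_M by blast

lemma distr_increment: "0 \<le> s \<Longrightarrow> s < t \<Longrightarrow> distr M borel (\<lambda>om. W t om - W s om) = gaussian (t - s)"
 using brownian unfolding brownian_motion_def distributed_def gaussian_def by (metis (no_types, lifting) distr_cong sets_lborel)

text \<open>No integral is computed: the measure is the law of the increment over the time span from
  0 to \<tau>.\<close>

lemma prob_gaussian:
 assumes "\<tau> > 0" shows "prob_space (gaussian \<tau> :: (real^'d) measure)"
proof -
 have "prob_space (distr M borel (\<lambda>om. W \<tau> om - W 0 om))" using assms by (intro prob_space_distr borel_measurable_diff W_meas) auto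
 thus ?thesis using distr_increment[of 0 \<tau>] assms by simp
qed

text \<open>The identity map into \<open>\<F> s\<close> records the whole past at once, so
  independence of the increment becomes a product formula for a single joint law. It suffices to
  test rectangles.\<close>

lemma distr_past_increment:
 assumes st: "0 \<le> s" "s < t"
 shows "distr M (\<F> s \<Otimes>\<^sub>M borel) (\<lambda>om. (om, W t om - W s om)) = distr M (\<F> s) (\<lambda>om. om) \<Otimes>\<^sub>M gaussian (t - s)"
proof -
 let ?Z = "\<lambda>om. W t om - W s om"
 have id: "(\<lambda>om. om) \<in> measurable M (\<F> s)" by (rule measurable_F_M[of _ s]) simp
 have Z: "?Z \<in> borel_measurable M" using st by (intro borel_measurable_diff W_meas) auto
 have indep: "indep_set (sets (\<F> s)) {?Z -` B \<inter> space M | B. B \<in> sets borel}" using brownian st by (auto simp: brownian_motion_def)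
 interpret F: prob_space "distr M (\<F> s) (\<lambda>om. om)" using id by (rule prob_space_distr)
 interpret G: prob_space "gaussian (t - s) :: (real^'d) measure" using st by (intro prob_gaussian) auto
 have pair: "(\<lambda>om. (om, ?Z om)) \<in> measurable M (\<F> s \<Otimes>\<^sub>M borel)" using id Z by (rule measurable_Pair)
 show ?thesis
 proof (rule pair_measure_eqI[symmetric])
  show "sigma_finite_measure (distr M (\<F> s) (\<lambda>om. om))" ..
  show "sigma_finite_measure (gaussian (t - s) :: (real^'d) measure)" ..
  show "sets (distr M (\<F> s) (\<lambda>om. om) \<Otimes>\<^sub>M gaussian (t - s))
    = sets (distr M (\<F> s \<Otimes>\<^sub>M borel) (\<lambda>om. (om, ?Z om)))" unfolding sets_distr by (rule sets_pair_measure_cong) auto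
  fix A :: "'w set" and B :: "(real^'d) set"
  assume "A \<in> sets (distr M (\<F> s) (\<lambda>om. om))" "B \<in> sets (gaussian (t - s))"
  hence A: "A \<in> sets (\<F> s)" and B: "B \<in> sets borel" by auto
  have AM: "A \<in> sets M" using A subalg_F by (auto simp: subalgebra_def)
  have ZB: "?Z -` B \<inter> space M \<in> sets M" using Z B by (rule measurable_sets)
  have "emeasure (distr M (\<F> s \<Otimes>\<^sub>M borel) (\<lambda>om. (om, ?Z om))) (A \<times> B)
    = emeasure M ((\<lambda>om. (om, ?Z om)) -` (A \<times> B) \<inter> space M)" using pair A B by (intro emeasure_distr) auto
  also have "(\<lambda>om. (om, ?Z om)) -` (A \<times> B) \<inter> space M = A \<inter> (?Z -` B \<inter> space M)"
   using sets.sets_into_space[OF AM] by auto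
  also have "emeasure M ... = emeasure M A * emeasure M (?Z -` B \<inter> space M)" using indep_setD[OF indep A, of "?Z -` B \<inter> space M"] B
   by (auto simp: emeasure_eq_measure ennreal_mult[symmetric])
  also have "emeasure M A = emeasure (distr M (\<F> s) (\<lambda>om. om)) A"
   using id A sets.sets_into_space[OF AM] by (simp add: emeasure_distr Int_absorb2)
  also have "emeasure M (?Z -` B \<inter> space M) = emeasure (gaussian (t - s)) B"
   using Z B by (simp add: emeasure_distr distr_increment[OF st, symmetric])
  finally show "emeasure (distr M (\<F> s) (\<lambda>om. om)) A * emeasure (gaussian (t - s)) B
    = emeasure (distr M (\<F> s \<Otimes>\<^sub>M borel) (\<lambda>om. (om, ?Z om))) (A \<times> B)" by simp
 qed
qed

text \<open>Freezing: under the product law the past is held fixed while the increment is integrated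
  out as a Gaussian vector. This stands in for conditioning on \<open>\<F> s\<close>.\<close>

lemma nn_integral_past_increment:
 assumes st: "0 \<le> s" "s < t" and g [measurable]: "g \<in> borel_measurable (\<F> s \<Otimes>\<^sub>M borel)"
 shows "(\<integral>\<^sup>+om. g (om, W t om - W s om) \<partial>M) = (\<integral>\<^sup>+om. \<integral>\<^sup>+z. g (om, z) \<partial>gaussian (t - s) \<partial>M)"
proof -
 interpret G: prob_space "gaussian (t - s) :: (real^'d) measure" using st by (intro prob_gaussian) auto
 have id [measurable]: "(\<lambda>om. om) \<in> measurable M (\<F> s)" by (rule measurable_F_M[of _ s]) simp
 have [measurable]: "(\<lambda>om. W t om - W s om) \<in> borel_measurable M" using st by (intro borel_measurable_diff W_meas) auto
 have [measurable]: "g \<in> borel_measurable (\<F> s \<Otimes>\<^sub>M gaussian (t - s))"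
  by (subst measurable_cong_sets[OF sets_pair_measure_cong[OF refl sets_gaussian] refl]) (rule g)
 have "(\<integral>\<^sup>+om. g (om, W t om - W s om) \<partial>M)
   = (\<integral>\<^sup>+y. g y \<partial>distr M (\<F> s \<Otimes>\<^sub>M borel) (\<lambda>om. (om, W t om - W s om)))"
  by (subst nn_integral_distr) auto
 also have "... = (\<integral>\<^sup>+om. \<integral>\<^sup>+z. g (om, z) \<partial>gaussian (t - s) \<partial>distr M (\<F> s) (\<lambda>om. om))"
  unfolding distr_past_increment[OF st] by (rule G.nn_integral_fst[symmetric])
    (subst measurable_cong_sets[OF sets_pair_measure_cong[OF sets_distr sets_gaussian] refl], rule g)
 also have "... = (\<integral>\<^sup>+om. \<integral>\<^sup>+z. g (om, z) \<partial>gaussian (t - s) \<partial>M)" by (subst nn_integral_distr) auto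
 finally show ?thesis .
qed

text \<open>With the past frozen, \<open>u\<close> is a constant vector and
  \<open>gaussian_mgf\<close> makes the extra factor integrate to one. The weight \<open>G\<close>
  carries whatever is known at time \<open>s\<close>, which is the form required by inductions over
  a grid.\<close>

lemma exp_increment:
 assumes st: "0 \<le> s" "s \<le> t"
  and G: "G \<in> borel_measurable (\<F> s)" and u: "s < t \<Longrightarrow> u \<in> borel_measurable (\<F> s)"
 shows "(\<integral>\<^sup>+om. G om * ennreal (exp (u om \<bullet> (W t om - W s om) - (norm (u om))^2 * (t - s) / 2)) \<partial>M)
    = (\<integral>\<^sup>+om. G om \<partial>M)"
proof (cases "s < t")
 case True
 note G [measurable] and u[OF True, measurable]
 have *: "(\<integral>\<^sup>+z. G om * ennreal (exp (u om \<bullet> z - (norm (u om))^2 * (t - s) / 2)) \<partial>gaussian (t - s)) = G om" for om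
 proof -
  have "(\<integral>\<^sup>+z. ennreal (exp (u om \<bullet> z - (norm (u om))^2 * (t - s) / 2)) \<partial>gaussian (t - s)) = 1"
   using True by (intro gaussian_mgf prob_gaussian) auto
  thus ?thesis by (subst nn_integral_cmult) simp_all
 qed
 have "(\<lambda>x. case x of (om, z) \<Rightarrow> G om * ennreal (exp (u om \<bullet> z - (norm (u om))^2 * (t - s) / 2)))
   \<in> borel_measurable (\<F> s \<Otimes>\<^sub>M borel)" by measurable
 from nn_integral_past_increment[OF st(1) True this]
 show ?thesis by (simp only: prod.case *)
next
 case False
 hence "s = t" using st by simp
 thus ?thesis by simp
qed

text \<open>The points \<open>s j\<close> with \<open>s j = s (Suc j)\<close> are exempt from the measurability requirement, so that
 partitions may be refined and clamped without removing repetitions.\<close>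

lemma exp_grid:
 assumes s: "0 \<le> s 0" "\<And>j. j < n \<Longrightarrow> s j \<le> s (Suc j)"
  and G: "G \<in> borel_measurable (\<F> (s 0))"
  and v: "\<And>j. j < n \<Longrightarrow> s j < s (Suc j) \<Longrightarrow> v j \<in> borel_measurable (\<F> (s j))"
 shows "(\<lambda>om. G om * ennreal (exp (\<Sum>j<n. v j om \<bullet> (W (s (Suc j)) om - W (s j) om)
       - (norm (v j om))^2 * (s (Suc j) - s j) / 2))) \<in> borel_measurable (\<F> (s n)) \<and>
     (\<integral>\<^sup>+om. G om * ennreal (exp (\<Sum>j<n. v j om \<bullet> (W (s (Suc j)) om - W (s j) om)
       - (norm (v j om))^2 * (s (Suc j) - s j) / 2)) \<partial>M) = (\<integral>\<^sup>+om. G om \<partial>M)" using s(2) v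
proof (induction n)
 case 0
 thus ?case using G by simp
next
 case (Suc n)
 let ?E = "\<lambda>n om. G om * ennreal (exp (\<Sum>j<n. v j om \<bullet> (W (s (Suc j)) om - W (s j) om)
       - (norm (v j om))^2 * (s (Suc j) - s j) / 2))"
 let ?e = "\<lambda>om. v n om \<bullet> (W (s (Suc n)) om - W (s n) om) - (norm (v n om))^2 * (s (Suc n) - s n) / 2"
 have IH: "?E n \<in> borel_measurable (\<F> (s n))" "(\<integral>\<^sup>+om. ?E n om \<partial>M) = (\<integral>\<^sup>+om. G om \<partial>M)"
  using Suc by auto
 have mono: "s i \<le> s j" if "i \<le> j" "j \<le> Suc n" for i j
  using that(1,2) by (induction rule: dec_induct) (use Suc.prems(1) in \<open>auto intro: order_trans\<close>)
 have nn: "0 \<le> s n" "s n \<le> s (Suc n)" using s(1) mono[of 0 n] Suc.prems(1) by auto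
 have eq: "?E (Suc n) om = ?E n om * ennreal (exp (?e om))" for om by (simp add: exp_add ennreal_mult mult.assoc)
 have e: "(\<lambda>om. ennreal (exp (?e om))) \<in> borel_measurable (\<F> (s (Suc n)))"
 proof (cases "s n < s (Suc n)")
  case True
  have [measurable]: "v n \<in> borel_measurable (\<F> (s (Suc n)))" using Suc.prems(2)[OF lessI True] by (rule measurable_F_mono[OF nn(2)])
  have [measurable]: "W (s (Suc n)) \<in> borel_measurable (\<F> (s (Suc n)))" using nn by (intro W_meas_F) simp_all
  have [measurable]: "W (s n) \<in> borel_measurable (\<F> (s (Suc n)))" using nn by (intro W_meas_F)
  show ?thesis by measurable
 next
  case False
  hence "s (Suc n) = s n" using nn by simp
  thus ?thesis by simp
 qed
 have "?E (Suc n) \<in> borel_measurable (\<F> (s (Suc n)))" unfolding eq using measurable_F_mono[OF nn(2) IH(1)] e by measurable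
 \<comment> \<open>The product of the first \<open>n\<close> factors is known at time
   \<open>s n\<close> and plays the role of \<open>G\<close> for the last cell.\<close>
 moreover have "(\<integral>\<^sup>+om. ?E (Suc n) om \<partial>M) = (\<integral>\<^sup>+om. G om \<partial>M)" unfolding eq IH(2)[symmetric]
  using nn IH(1) Suc.prems(2) by (intro exp_increment) auto
 ultimately show ?case by blast
qed

end

section \<open>Simple integrands\<close>

lemma inner_mult_transpose:
 fixes A :: "real^'d^'k"
 shows "u \<bullet> (A *v z) = (transpose A *v u) \<bullet> z" by (simp add: dot_lmul_matrix)

lemma continuous_on_matrix_vector_mult [continuous_intros]:
 fixes f :: "'a::topological_space \<Rightarrow> real^'n^'m"
 assumes "continuous_on S f" "continuous_on S g"
 shows "continuous_on S (\<lambda>x. f x *v g x)" unfolding matrix_vector_mult_def by (intro continuous_intros assms)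

lemma continuous_on_transpose [continuous_intros]:
 fixes f :: "'a::topological_space \<Rightarrow> real^'n^'m"
 assumes "continuous_on S f"
 shows "continuous_on S (\<lambda>x. transpose (f x))" unfolding transpose_def by (intro continuous_intros assms)

lemma borel_measurable_transpose_mult:
 fixes f :: "'a \<Rightarrow> real^'n^'m"
 assumes "f \<in> borel_measurable M" "g \<in> borel_measurable M"
 shows "(\<lambda>x. transpose (f x) *v g x) \<in> borel_measurable M" by (rule borel_measurable_continuous_Pair[OF assms]) (intro continuous_intros)

lemma grid_mono:
 fixes f :: "nat \<Rightarrow> real"
 assumes "\<And>i. i < n \<Longrightarrow> f i \<le> f (Suc i)" "p \<le> q" "q \<le> n"
 shows "f p \<le> f q" using assms(2,3)
proof (induction rule: dec_induct)
 case (step k)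
 thus ?case using assms(1)[of k] by simp
qed simp

text \<open>Consecutive half-open cells are disjoint, even when some of them are empty, so a single
  summand survives.\<close>

lemma sum_indicator_grid:
 fixes a :: "nat \<Rightarrow> 'b::real_vector" and \<tau> :: "nat \<Rightarrow> real"
 assumes mono: "\<And>i. i < n \<Longrightarrow> \<tau> i \<le> \<tau> (Suc i)" and i: "i < n" and x: "x \<in> {\<tau> i<..\<tau> (Suc i)}"
 shows "(\<Sum>j<n. indicat_real {\<tau> j<..\<tau> (Suc j)} x *\<^sub>R a j) = a i"
proof -
 have le: "\<tau> p \<le> \<tau> q" if "p \<le> q" "q \<le> n" for p q by (rule grid_mono[where f=\<tau> and n=n, OF mono that])
 have "indicat_real {\<tau> j<..\<tau> (Suc j)} x = (if j = i then 1 else 0)" if "j < n" for j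
 proof (cases j i rule: linorder_cases)
  case less
  thus ?thesis using le[of "Suc j" i] x i by (auto simp: indicator_def)
 next
  case greater
  thus ?thesis using le[of "Suc i" j] x that by (auto simp: indicator_def)
 qed (use x in auto)
 hence "(\<Sum>j<n. indicat_real {\<tau> j<..\<tau> (Suc j)} x *\<^sub>R a j) = (\<Sum>j<n. if j = i then a j else 0)" by (intro sum.cong) auto
 thus ?thesis using i by simp
qed

lemma simple_process_eq:
 assumes "simple_integrand M \<F> n \<tau> \<xi>" "i < n" "x \<in> {\<tau> i<..\<tau> (Suc i)}"
 shows "simple_process n \<tau> \<xi> x om = \<xi> i om" unfolding simple_process_def
 using assms by (intro sum_indicator_grid) (auto simp: simple_integrand_def)

lemma simple_process_outside:
 assumes simple: "simple_integrand M \<F> n \<tau> \<xi>" and x: "x \<le> \<tau> 0 \<or> \<tau> n < x"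
 shows "simple_process n \<tau> \<xi> x om = 0" unfolding simple_process_def
proof (rule sum.neutral, safe)
 fix i assume i: "i < n"
 have le: "\<tau> p \<le> \<tau> q" if "p \<le> q" "q \<le> n" for p q
  by (rule grid_mono[where f=\<tau> and n=n, OF _ that]) (use simple in \<open>auto simp: simple_integrand_def\<close>)
 show "indicat_real {\<tau> i<..\<tau> (Suc i)} x *\<^sub>R \<xi> i om = 0" using le[of 0 i] le[of "Suc i" n] i x by (auto simp: indicator_def)
qed

context filtered_brownian
begin

text \<open>Clamping the partition points to the interval from \<open>t\<close> to \<open>t'\<close>
  annihilates all increments outside it, while each value stays attached to its cell. The increment
  is thus again a sum over one grid.\<close>

lemma simple_integral_diff:
 fixes \<xi> :: "nat \<Rightarrow> 'w \<Rightarrow> real^'d^'k"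
 assumes simple: "simple_integrand M \<F> n \<tau> \<xi>" and t: "t \<le> t'"
 shows "simple_integral n \<tau> \<xi> W t' om - simple_integral n \<tau> \<xi> W t om
    = (\<Sum>j<n. \<xi> j om *v (W (max t (min (\<tau> (Suc j)) t')) om - W (max t (min (\<tau> j) t')) om))"
proof -
 have *: "W (max t (min r t')) om = W t om + (W (min r t') om - W (min r t) om)" for r
  using t by (cases "r \<le> t"; cases "r \<le> t'") (auto simp: max_def min_def)
 show ?thesis unfolding simple_integral_def * sum_subtractf[symmetric] matrix_vector_mult_diff_distrib[symmetric]
  by (intro sum.cong refl arg_cong[where f="\<lambda>z. _ *v z"]) simp
qed

text \<open>The interval is cut at the clamped partition points; on each piece the exponent is
  linear in the Brownian increment with a known coefficient, so \<open>exp_grid\<close> applies.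
  Only an upper bound of the quadratic term \<open>q\<close> by an integral is recorded, since that
  is what survives the later limit.\<close>

lemma exp_simple_interval:
 fixes \<xi> :: "nat \<Rightarrow> 'w \<Rightarrow> real^'d^'k"
 assumes simple: "simple_integrand M \<F> n \<tau> \<xi>" and t: "0 \<le> t" "t \<le> t'"
  and G: "G \<in> borel_measurable (\<F> t)" and u: "u \<in> borel_measurable (\<F> t)" and w: "w \<in> borel_measurable (\<F> t)"
 obtains q where
  "(\<lambda>om. G om * ennreal (exp (u om \<bullet> (simple_integral n \<tau> \<xi> W t' om - simple_integral n \<tau> \<xi> W t om)
    + w om \<bullet> (W t' om - W t om) - q om / 2))) \<in> borel_measurable (\<F> t')"
  "(\<integral>\<^sup>+om. G om * ennreal (exp (u om \<bullet> (simple_integral n \<tau> \<xi> W t' om - simple_integral n \<tau> \<xi> W t om)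
    + w om \<bullet> (W t' om - W t om) - q om / 2)) \<partial>M) = (\<integral>\<^sup>+om. G om \<partial>M)"
  "\<And>om. 0 \<le> q om"
  "\<And>om. ennreal (q om) \<le> (\<integral>\<^sup>+x\<in>{t..t'}. ennreal ((norm (transpose (simple_process n \<tau> \<xi> x om) *v u om + w om))^2) \<partial>lborel)"
proof -
 define c where "c r = max t (min r t')" for r
 \<comment> \<open>The grid consists of \<open>t\<close>, the \<open>n + 1\<close> clamped partition
   points and \<open>t'\<close>. Its first and last cells lie outside the support of the simple
   process and carry the weight \<open>w\<close> alone.\<close>
 define s where "s j = (case j of 0 \<Rightarrow> t | Suc i \<Rightarrow> if i \<le> n then c (\<tau> i) else t')" for j
 define v where "v j om = (case j of 0 \<Rightarrow> w om | Suc i \<Rightarrow> if i < n then transpose (\<xi> i om) *v u om + w om else w om)" for j om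
 define q where "q om = (\<Sum>j<Suc (Suc n). (norm (v j om))^2 * (s (Suc j) - s j))" for om
 have \<tau>: "\<tau> i \<le> \<tau> (Suc i)" if "i < n" for i using simple that by (auto simp: simple_integrand_def)
 have c: "c r \<le> c r'" "t \<le> c r" "c r \<le> t'" if "r \<le> r'" for r r' using t that by (auto simp: c_def)
 have c': "t \<le> c r" "c r \<le> t'" for r using t by (auto simp: c_def)
 have s_mono: "s j \<le> s (Suc j)" if "j < Suc (Suc n)" for j using that c(1)[OF \<tau>] c' by (auto simp: s_def split: nat.split)
 have s0: "s 0 = t" "s (Suc (Suc n)) = t'" by (auto simp: s_def)
 have v_meas: "v j \<in> borel_measurable (\<F> (s j))" if "j < Suc (Suc n)" "s j < s (Suc j)" for j
 proof (cases j)
  case 0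
  thus ?thesis using w by (simp add: v_def[abs_def] s_def)
 next
  case (Suc i)
  have w': "w \<in> borel_measurable (\<F> (s j))" and u': "u \<in> borel_measurable (\<F> (s j))"
   using Suc that c'(1) by (auto simp: s_def intro!: measurable_F_mono[OF _ w] measurable_F_mono[OF _ u])
  show ?thesis
  proof (cases "i < n")
   case True
   hence "c (\<tau> i) < c (\<tau> (Suc i))" using that Suc by (simp add: s_def)
   \<comment> \<open>A cell that stays nondegenerate after clamping starts before \<open>t'\<close>,
     so clamping can only move its left end to the right, where \<open>\<xi> i\<close> is already
     known.\<close>
   hence "\<tau> i \<le> c (\<tau> i)" by (auto simp: c_def max_def min_def split: if_splits)
   hence "\<xi> i \<in> borel_measurable (\<F> (s j))" using simple True Suc measurable_F_mono[of "\<tau> i" "s j" "\<xi> i" borel]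
    by (auto simp: simple_integrand_def s_def)
   hence "(\<lambda>om. transpose (\<xi> i om) *v u om + w om) \<in> borel_measurable (\<F> (s j))"
    using u' w' by (intro borel_measurable_add borel_measurable_transpose_mult)
   thus ?thesis using True Suc by (simp add: v_def[abs_def])
  next
   case False
   thus ?thesis using w' Suc by (simp add: v_def[abs_def])
  qed
 qed
 have exponent: "u om \<bullet> (simple_integral n \<tau> \<xi> W t' om - simple_integral n \<tau> \<xi> W t om)
    + w om \<bullet> (W t' om - W t om) - q om / 2
   = (\<Sum>j<Suc (Suc n). v j om \<bullet> (W (s (Suc j)) om - W (s j) om) - (norm (v j om))^2 * (s (Suc j) - s j) / 2)" for om
 proof -
  have "(\<Sum>j<Suc (Suc n). v j om \<bullet> (W (s (Suc j)) om - W (s j) om))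
   = (\<Sum>j<Suc (Suc n). w om \<bullet> (W (s (Suc j)) om - W (s j) om))
    + (\<Sum>j<Suc (Suc n). (v j om - w om) \<bullet> (W (s (Suc j)) om - W (s j) om))"
   unfolding sum.distrib[symmetric] by (simp add: inner_diff_left)
  also have "(\<Sum>j<Suc (Suc n). w om \<bullet> (W (s (Suc j)) om - W (s j) om)) = w om \<bullet> (W t' om - W t om)"
   using sum_lessThan_telescope[of "\<lambda>j. W (s j) om" "Suc (Suc n)"] by (simp only: inner_sum_right[symmetric] s0)
  also have "(\<Sum>j<Suc (Suc n). (v j om - w om) \<bullet> (W (s (Suc j)) om - W (s j) om))
    = (\<Sum>j<n. (v (Suc j) om - w om) \<bullet> (W (s (Suc (Suc j))) om - W (s (Suc j)) om))"
   by (subst sum.lessThan_Suc_shift, subst sum.lessThan_Suc) (simp add: v_def)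
  also have "... = (\<Sum>j<n. u om \<bullet> (\<xi> j om *v (W (c (\<tau> (Suc j))) om - W (c (\<tau> j)) om)))"
   by (intro sum.cong refl) (simp add: v_def s_def inner_mult_transpose)
  also have "... = u om \<bullet> (simple_integral n \<tau> \<xi> W t' om - simple_integral n \<tau> \<xi> W t om)"
   unfolding simple_integral_diff[OF simple t(2)] c_def inner_sum_right ..
  finally show ?thesis unfolding q_def sum_subtractf sum_divide_distrib by simp
 qed
 have s0': "0 \<le> s 0" using s0 t by simp
 have G': "G \<in> borel_measurable (\<F> (s 0))" using G s0 by simp
 note grid = exp_grid[of s "Suc (Suc n)" G v, OF s0' s_mono G' v_meas, folded exponent, unfolded s0]
 show ?thesis
 proof (rule that[of q])
  show "0 \<le> q om" for om unfolding q_def using s_mono by (intro sum_nonneg mult_nonneg_nonneg) auto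
  show "ennreal (q om) \<le> (\<integral>\<^sup>+x\<in>{t..t'}. ennreal ((norm (transpose (simple_process n \<tau> \<xi> x om) *v u om + w om))^2) \<partial>lborel)"
   (is "_ \<le> (\<integral>\<^sup>+x\<in>_. ?f x \<partial>_)") for om
  proof -
   \<comment> \<open>The quadratic term is written as the integral of a step function, which is then
     compared pointwise with the integrand on the right.\<close>
   have "ennreal (q om) = (\<Sum>j<Suc (Suc n). ennreal ((norm (v j om))^2) * emeasure lborel {s j<..s (Suc j)})"
    unfolding q_def using s_mono by (subst sum_ennreal[symmetric]) (auto simp: ennreal_mult)
   also have "... = (\<integral>\<^sup>+x. (\<Sum>j<Suc (Suc n). ennreal ((norm (v j om))^2) * indicator {s j<..s (Suc j)} x) \<partial>lborel)"
    by (subst nn_integral_sum) (auto simp: nn_integral_cmult_indicator)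
   also have "... \<le> (\<integral>\<^sup>+x\<in>{t..t'}. ?f x \<partial>lborel)"
   proof (intro nn_integral_mono)
    fix x
    have eq: "(\<Sum>j<Suc (Suc n). ennreal ((norm (v j om))^2) * indicator {s j<..s (Suc j)} x)
      = ennreal (\<Sum>j<Suc (Suc n). indicat_real {s j<..s (Suc j)} x *\<^sub>R (norm (v j om))^2)"
     by (subst sum_ennreal[symmetric]) (auto simp: indicator_def intro!: sum.cong)
    show "(\<Sum>j<Suc (Suc n). ennreal ((norm (v j om))^2) * indicator {s j<..s (Suc j)} x) \<le> ?f x * indicator {t..t'} x"
    proof (cases "\<exists>i<Suc (Suc n). x \<in> {s i<..s (Suc i)}")
     case False
     hence "(\<Sum>j<Suc (Suc n). ennreal ((norm (v j om))^2) * indicator {s j<..s (Suc j)} x) = 0" by (intro sum.neutral) (auto simp: indicator_def)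
     thus ?thesis by (simp only: zero_le)
    next
     case True
     then obtain i where i: "i < Suc (Suc n)" "x \<in> {s i<..s (Suc i)}" by blast
     have x: "x \<in> {t..t'}" and "transpose (simple_process n \<tau> \<xi> x om) *v u om + w om = v i om"
     proof -
      have le: "s p \<le> s q" if "p \<le> q" "q \<le> Suc (Suc n)" for p q by (rule grid_mono[where f=s and n="Suc (Suc n)", OF s_mono that])
      show "x \<in> {t..t'}" using le[of 0 i] le[of "Suc i" "Suc (Suc n)"] i s0 by auto
      show "transpose (simple_process n \<tau> \<xi> x om) *v u om + w om = v i om"
      proof (cases "i = 0 \<or> i = Suc n")
       case True
       moreover have "x \<le> \<tau> 0" if "i = 0" using i unfolding that by (auto simp: s_def c_def max_def min_def split: if_splits)
       moreover have "\<tau> n < x" if "i = Suc n" using i unfolding that by (auto simp: s_def c_def max_def min_def split: if_splits)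
       ultimately have "x \<le> \<tau> 0 \<or> \<tau> n < x" by blast
       hence "simple_process n \<tau> \<xi> x om = 0" by (rule simple_process_outside[OF simple])
       thus ?thesis using True by (auto simp: v_def transpose_def vec_eq_iff matrix_vector_mult_def)
      next
       case False
       then obtain k where k: "i = Suc k" "k < n" using i by (cases i) auto
       hence "x \<in> {\<tau> k<..\<tau> (Suc k)}" using i by (auto simp: s_def c_def max_def min_def split: if_splits)
       thus ?thesis using simple_process_eq[OF simple k(2)] k by (simp add: v_def)
      qed
     qed
     thus ?thesis unfolding eq using sum_indicator_grid[OF s_mono i, where a="\<lambda>j. (norm (v j om))^2"] by simp
    qed
   qed
   finally show ?thesis .
  qed
 qed (use grid in auto)
qed

end

section \<open>Norm inequalities, joint measurability and convergence in probability\<close>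

lemma norm_matrix_vector_mult_le:
 fixes A :: "real^'n^'m"
 shows "norm (A *v x) \<le> norm A * norm x"
proof -
 have "norm (A *v x) = L2_set (\<lambda>i. \<bar>A $ i \<bullet> x\<bar>) UNIV" unfolding norm_vec_def by (simp add: matrix_vector_mul_component)
 also have "... \<le> L2_set (\<lambda>i. norm (A $ i) * norm x) UNIV" by (intro L2_set_mono Cauchy_Schwarz_ineq2) auto
 also have "... = norm A * norm x" by (simp add: L2_set_left_distrib norm_vec_def)
 finally show ?thesis .
qed

lemma norm_transpose:
 fixes A :: "real^'n^'m"
 shows "norm (transpose A) = norm A"
proof -
 have "(norm (transpose A))^2 = (norm A)^2" unfolding norm_vec_def L2_set_def transpose_def by (simp add: sum_nonneg) (rule sum.swap)
 thus ?thesis by simp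
qed

lemma norm_transpose_mult_le:
 fixes A :: "real^'n^'m"
 shows "norm (transpose A *v x) \<le> norm A * norm x" using norm_matrix_vector_mult_le[of "transpose A" x] by (simp only: norm_transpose)

text \<open>Young's inequality with a free parameter: for small \<kappa> the coefficient of the main
  term approaches one at the price of a large coefficient for the error term.\<close>

lemma norm_add_square_le:
 fixes a b :: "'a::real_inner"
 assumes "\<kappa> > 0"
 shows "(norm (a + b))^2 \<le> (1 + \<kappa>) * (norm a)^2 + (1 + 1 / \<kappa>) * (norm b)^2"
proof -
 have "0 \<le> (sqrt \<kappa> * norm a - norm b / sqrt \<kappa>)^2" by simp
 also have "... = \<kappa> * (norm a)^2 + (norm b)^2 / \<kappa> - 2 * (norm a * norm b)"
  using assms by (simp add: power2_diff power_mult_distrib power_divide)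
 finally have "2 * (norm a * norm b) \<le> \<kappa> * (norm a)^2 + (norm b)^2 / \<kappa>" by simp
 moreover have "(norm (a + b))^2 \<le> (norm a + norm b)^2" by (intro power_mono norm_triangle_ineq) auto
 ultimately show ?thesis by (simp add: power2_sum algebra_simps)
qed

text \<open>Rounding the time down to multiples of \<open>1 / Suc n\<close> leaves countably many
  random variables to paste together; path continuity gives the limit. Freezing negative times at 0
  makes the process a function on the whole line.\<close>

lemma joint_measurable_continuous:
 fixes f :: "real \<Rightarrow> 'w \<Rightarrow> 'b::metric_space"
 assumes meas: "\<And>s. 0 \<le> s \<Longrightarrow> f s \<in> borel_measurable M"
  and cont: "\<And>om. om \<in> space M \<Longrightarrow> continuous_on {0..} (\<lambda>s. f s om)"
 shows "(\<lambda>(s, om). f (max 0 s) om) \<in> borel_measurable (borel \<Otimes>\<^sub>M M)"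
proof -
 define r where "r n s = real (nat \<lfloor>real (Suc n) * max 0 s\<rfloor>) / real (Suc n)" for n :: nat and s :: real
 have r: "(\<lambda>n. r n s) \<longlonglongrightarrow> max 0 s" for s
 proof (rule LIMSEQ_I)
  fix e :: real assume "e > 0"
  then obtain N where N: "inverse (real (Suc N)) < e" using reals_Archimedean by blast
  show "\<exists>N. \<forall>n\<ge>N. norm (r n s - max 0 s) < e"
  proof (intro exI allI impI)
   fix n assume "N \<le> n"
   have "real (nat \<lfloor>real (Suc n) * max 0 s\<rfloor>) = of_int \<lfloor>real (Suc n) * max 0 s\<rfloor>" by (simp add: of_nat_nat)
   hence "\<bar>real (nat \<lfloor>real (Suc n) * max 0 s\<rfloor>) - real (Suc n) * max 0 s\<bar> \<le> 1" by linarith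
   moreover have "r n s - max 0 s = (real (nat \<lfloor>real (Suc n) * max 0 s\<rfloor>) - real (Suc n) * max 0 s) / real (Suc n)"
    unfolding r_def by (subst diff_divide_distrib, subst nonzero_mult_div_cancel_left) simp_all
   ultimately have "\<bar>r n s - max 0 s\<bar> \<le> 1 / real (Suc n)" by (simp only: abs_divide abs_of_nat divide_right_mono of_nat_0_le_iff)
   also have "... \<le> inverse (real (Suc N))" using \<open>N \<le> n\<close> by (simp add: field_simps)
   finally show "norm (r n s - max 0 s) < e" using N by simp
  qed
 qed
 have r_nn: "0 \<le> r n s" for n s by (simp add: r_def)
 show ?thesis
 proof (rule borel_measurable_LIMSEQ_metric[where f="\<lambda>n (s, om). f (r n s) om"])
  fix n
  have "(\<lambda>p. f (real (nat \<lfloor>real (Suc n) * max 0 (fst p)\<rfloor>) / real (Suc n)) (snd p)) \<in> borel_measurable (borel \<Otimes>\<^sub>M M)"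
  proof (rule measurable_compose_countable[where f="\<lambda>k p. f (real k / real (Suc n)) (snd p)"])
   show "(\<lambda>p. f (real k / real (Suc n)) (snd p)) \<in> borel_measurable (borel \<Otimes>\<^sub>M M)" for k
    by (rule measurable_compose[OF measurable_snd meas]) simp
  qed measurable
  thus "(\<lambda>(s, om). f (r n s) om) \<in> borel_measurable (borel \<Otimes>\<^sub>M M)" by (simp add: r_def split_def)
 next
  fix p assume "p \<in> space ((borel :: real measure) \<Otimes>\<^sub>M M)"
  hence "snd p \<in> space M" by (auto simp: space_pair_measure)
  from cont[OF this] have "(\<lambda>n. f (r n (fst p)) (snd p)) \<longlonglongrightarrow> f (max 0 (fst p)) (snd p)"
   by (rule continuous_on_tendsto_compose[OF _ r]) (auto simp: r_nn)
  thus "(\<lambda>n. case p of (s, om) \<Rightarrow> f (r n s) om) \<longlonglongrightarrow> (case p of (s, om) \<Rightarrow> f (max 0 s) om)"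
   by (simp add: split_def)
 qed
qed

text \<open>Expectations of variables cut at 1 measure convergence in probability, also for
  variables that may be infinite.\<close>

lemma (in prob_space) integral_min_tendsto_0:
 fixes Y :: "nat \<Rightarrow> 'a \<Rightarrow> ennreal"
 assumes meas [measurable]: "\<And>k. Y k \<in> borel_measurable M"
  and lim: "\<And>\<eta>. \<eta> > 0 \<Longrightarrow> (\<lambda>k. measure M {om \<in> space M. ennreal \<eta> < Y k om}) \<longlonglongrightarrow> 0"
 shows "(\<lambda>k. \<integral>om. enn2real (min 1 (Y k om)) \<partial>M) \<longlonglongrightarrow> 0"
proof (rule LIMSEQ_I)
 fix e :: real assume e: "e > 0"
 then obtain K where K: "\<And>k. k \<ge> K \<Longrightarrow> measure M {om \<in> space M. ennreal (e/2) < Y k om} < e/2"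
  using LIMSEQ_D[OF lim[of "e/2"], of "e/2"] by auto
 have le1: "enn2real (min 1 (Y k om)) \<le> 1" for k om using enn2real_mono[of "min 1 (Y k om)" 1] by simp
 have int: "integrable M (\<lambda>om. enn2real (min 1 (Y k om)))" for k by (rule integrable_const_bound[where B=1]) (auto simp: le1)
 show "\<exists>K. \<forall>k\<ge>K. norm ((\<integral>om. enn2real (min 1 (Y k om)) \<partial>M) - 0) < e"
 proof (intro exI allI impI)
  fix k assume "K \<le> k"
  let ?A = "{om \<in> space M. ennreal (e/2) < Y k om}"
  have "(\<integral>om. enn2real (min 1 (Y k om)) \<partial>M) \<le> (\<integral>om. e/2 + indicat_real ?A om \<partial>M)"
  proof (intro integral_mono int)
   fix om assume om: "om \<in> space M"
   show "enn2real (min 1 (Y k om)) \<le> e/2 + indicat_real ?A om"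
   proof (cases "om \<in> ?A")
    case True thus ?thesis using le1[of k om] e by simp
   next
    case False
    hence "min 1 (Y k om) \<le> ennreal (e/2)" using om by (auto simp: min.coboundedI2)
    thus ?thesis using e False by (auto dest: enn2real_mono)
   qed
  qed (auto simp: emeasure_eq_measure)
  also have "... = e/2 + measure M ?A" by (subst Bochner_Integration.integral_add) (auto simp: emeasure_eq_measure prob_space)
  finally show "norm ((\<integral>om. enn2real (min 1 (Y k om)) \<partial>M) - 0) < e" using K[OF \<open>K \<le> k\<close>] by simp
 qed
qed

text \<open>The finite sum of the cut variables tends to zero in mean, and one almost surely
  convergent subsequence of the sum serves all members of the family.\<close>

lemma (in prob_space) AE_subsequence:
 fixes Y :: "'i \<Rightarrow> nat \<Rightarrow> 'a \<Rightarrow> ennreal"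
 assumes J: "finite J" and meas: "\<And>j k. j \<in> J \<Longrightarrow> Y j k \<in> borel_measurable M"
  and lim: "\<And>j \<eta>. j \<in> J \<Longrightarrow> \<eta> > 0 \<Longrightarrow> (\<lambda>k. measure M {om \<in> space M. ennreal \<eta> < Y j k om}) \<longlonglongrightarrow> 0"
 obtains r :: "nat \<Rightarrow> nat" where "strict_mono r" "AE om in M. \<forall>j\<in>J. (\<lambda>k. Y j (r k) om) \<longlonglongrightarrow> 0"
proof -
 define Z where "Z k om = (\<Sum>j\<in>J. enn2real (min 1 (Y j k om)))" for k om
 have le1: "enn2real (min 1 (Y j k om)) \<le> 1" for j k om using enn2real_mono[of "min 1 (Y j k om)" 1] by simp
 have int: "integrable M (\<lambda>om. enn2real (min 1 (Y j k om)))" if "j \<in> J" for j k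
  using meas[OF that] by (intro integrable_const_bound[where B=1]) (auto simp: le1)
 have Z_int: "integrable M (Z k)" for k unfolding Z_def using int by (intro Bochner_Integration.integrable_sum)
 have Z_nn: "0 \<le> Z k om" for k om unfolding Z_def by (intro sum_nonneg) simp
 have "(\<lambda>k. \<integral>om. norm (Z k om) \<partial>M) = (\<lambda>k. \<Sum>j\<in>J. \<integral>om. enn2real (min 1 (Y j k om)) \<partial>M)"
  using Z_nn int by (auto simp: Z_def Bochner_Integration.integral_sum)
 moreover have "... \<longlonglongrightarrow> (\<Sum>j\<in>J. 0)" using meas lim by (intro tendsto_sum integral_min_tendsto_0)
 ultimately have "(\<lambda>k. \<integral>om. norm (Z k om) \<partial>M) \<longlonglongrightarrow> 0" by simp
 from tendsto_L1_AE_subseq[OF Z_int this] obtain r where r: "strict_mono r"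
  and Z: "AE om in M. (\<lambda>k. Z (r k) om) \<longlonglongrightarrow> 0" by blast
 have "AE om in M. \<forall>j\<in>J. (\<lambda>k. Y j (r k) om) \<longlonglongrightarrow> 0" using Z
 proof eventually_elim
  case (elim om)
  show ?case
  proof
   fix j assume j: "j \<in> J"
   have "(\<lambda>k. enn2real (min 1 (Y j (r k) om))) \<longlonglongrightarrow> 0"
   proof (rule tendsto_sandwich[OF _ _ tendsto_const elim])
    show "\<forall>\<^sub>F k in sequentially. enn2real (min 1 (Y j (r k) om)) \<le> Z (r k) om"
     unfolding Z_def using j J by (intro always_eventually allI member_le_sum) auto
   qed auto
   hence "(\<lambda>k. ennreal (enn2real (min 1 (Y j (r k) om)))) \<longlonglongrightarrow> ennreal 0" by (rule tendsto_ennrealI)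
   hence lim: "(\<lambda>k. min 1 (Y j (r k) om)) \<longlonglongrightarrow> 0" by (simp add: min_less_iff_disj)
   \<comment> \<open>A limit below 1 makes the cut eventually inactive.\<close>
   hence "\<forall>\<^sub>F k in sequentially. min 1 (Y j (r k) om) < 1" by (rule order_tendstoD) simp
   hence "\<forall>\<^sub>F k in sequentially. min 1 (Y j (r k) om) = Y j (r k) om" by eventually_elim (auto simp: min_def split: if_splits)
   thus "(\<lambda>k. Y j (r k) om) \<longlonglongrightarrow> 0" using lim by (rule Lim_transform_eventually[rotated])
  qed
 qed
 with r show ?thesis by (rule that)
qed

section \<open>The exponential inequality for the Ito integral\<close>

context filtered_brownian
begin

lemma simple_integral_meas_F:
 fixes \<xi> :: "nat \<Rightarrow> 'w \<Rightarrow> real^'d^'k"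
 assumes simple: "simple_integrand M \<F> n \<tau> \<xi>" and t: "0 \<le> t"
 shows "simple_integral n \<tau> \<xi> W t \<in> borel_measurable M" unfolding simple_integral_def[abs_def]
proof (rule borel_measurable_sum)
 fix i assume "i \<in> {..<n}"
 hence i: "i < n" by simp
 have \<tau>: "0 \<le> \<tau> j" if "j \<le> n" for j
  using grid_mono[where f=\<tau> and n=n and p=0 and q=j] that simple by (auto simp: simple_integrand_def)
 have "\<xi> i \<in> borel_measurable M" using simple i measurable_F_M by (auto simp: simple_integrand_def)
 moreover have "(\<lambda>om. W (min (\<tau> (Suc i)) t) om - W (min (\<tau> i) t) om) \<in> borel_measurable M"
  using \<tau>[of i] \<tau>[of "Suc i"] i t by (intro borel_measurable_diff W_meas) auto
 ultimately show "(\<lambda>om. \<xi> i om *v (W (min (\<tau> (Suc i)) t) om - W (min (\<tau> i) t) om)) \<in> borel_measurable M"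
  by (rule borel_measurable_continuous_Pair) (intro continuous_intros)
qed

text \<open>Induction over the outer grid \<open>t\<close>, whose weights \<open>u i\<close> and
  \<open>w i\<close> may be random: the exponential collected so far is known at \<open>t N\<close>
  and becomes the weight \<open>G\<close> of the next interval. The outer grid is unrelated to the
  partition of the simple integrand.\<close>

lemma exp_simple:
 fixes \<xi> :: "nat \<Rightarrow> 'w \<Rightarrow> real^'d^'k"
 assumes simple: "simple_integrand M \<F> n \<tau> \<xi>" and t: "0 \<le> t 0" "\<And>i. i < N \<Longrightarrow> t i \<le> t (Suc i)"
  and u: "\<And>i. i < N \<Longrightarrow> u i \<in> borel_measurable (\<F> (t i))" and w: "\<And>i. i < N \<Longrightarrow> w i \<in> borel_measurable (\<F> (t i))"
 shows "\<exists>q. (\<lambda>om. ennreal (exp ((\<Sum>i<N. u i om \<bullet> (simple_integral n \<tau> \<xi> W (t (Suc i)) om - simple_integral n \<tau> \<xi> W (t i) om)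
    + w i om \<bullet> (W (t (Suc i)) om - W (t i) om)) - q om / 2))) \<in> borel_measurable (\<F> (t N)) \<and>
  (EE M (\<lambda>om. exp ((\<Sum>i<N. u i om \<bullet> (simple_integral n \<tau> \<xi> W (t (Suc i)) om - simple_integral n \<tau> \<xi> W (t i) om)
    + w i om \<bullet> (W (t (Suc i)) om - W (t i) om)) - q om / 2))) = 1 \<and>
  (\<forall>om. 0 \<le> q om \<and> ennreal (q om) \<le> (\<Sum>i<N. \<integral>\<^sup>+x\<in>{t i..t (Suc i)}.
    ennreal ((norm (transpose (simple_process n \<tau> \<xi> x om) *v u i om + w i om))^2) \<partial>lborel))" using t(2) u w
proof (induction N)
 case 0
 show ?case by (intro exI[of _ "\<lambda>_. 0"]) (simp add: emeasure_space_1)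
next
 case (Suc N)
 let ?e = "\<lambda>i om. u i om \<bullet> (simple_integral n \<tau> \<xi> W (t (Suc i)) om - simple_integral n \<tau> \<xi> W (t i) om)
    + w i om \<bullet> (W (t (Suc i)) om - W (t i) om)"
 have tN: "0 \<le> t N" "t N \<le> t (Suc N)" using grid_mono[where f=t and n="Suc N" and p=0 and q=N] Suc.prems(1) t(1) by auto
 have "\<exists>q. (\<lambda>om. ennreal (exp ((\<Sum>i<N. ?e i om) - q om / 2))) \<in> borel_measurable (\<F> (t N)) \<and>
  (EE M (\<lambda>om. exp ((\<Sum>i<N. ?e i om) - q om / 2))) = 1 \<and>
  (\<forall>om. 0 \<le> q om \<and> ennreal (q om) \<le> (\<Sum>i<N. \<integral>\<^sup>+x\<in>{t i..t (Suc i)}.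
    ennreal ((norm (transpose (simple_process n \<tau> \<xi> x om) *v u i om + w i om))^2) \<partial>lborel))" by (rule Suc.IH; rule Suc.prems; simp)
 then obtain q where
  IH1: "(\<lambda>om. ennreal (exp ((\<Sum>i<N. ?e i om) - q om / 2))) \<in> borel_measurable (\<F> (t N))" and
  IH2: "(EE M (\<lambda>om. exp ((\<Sum>i<N. ?e i om) - q om / 2))) = 1" and
  IH3: "\<And>om. 0 \<le> q om" "\<And>om. ennreal (q om) \<le> (\<Sum>i<N. \<integral>\<^sup>+x\<in>{t i..t (Suc i)}.
    ennreal ((norm (transpose (simple_process n \<tau> \<xi> x om) *v u i om + w i om))^2) \<partial>lborel)" by blast
 obtain q' where
  S1: "(\<lambda>om. ennreal (exp ((\<Sum>i<N. ?e i om) - q om / 2)) * ennreal (exp (?e N om - q' om / 2))) \<in> borel_measurable (\<F> (t (Suc N)))" and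
  S2: "(\<integral>\<^sup>+om. ennreal (exp ((\<Sum>i<N. ?e i om) - q om / 2)) * ennreal (exp (?e N om - q' om / 2)) \<partial>M)
    = (EE M (\<lambda>om. exp ((\<Sum>i<N. ?e i om) - q om / 2)))" and
  S3: "\<And>om. 0 \<le> q' om" "\<And>om. ennreal (q' om) \<le> (\<integral>\<^sup>+x\<in>{t N..t (Suc N)}.
    ennreal ((norm (transpose (simple_process n \<tau> \<xi> x om) *v u N om + w N om))^2) \<partial>lborel)"
  using exp_simple_interval[OF simple tN IH1 Suc.prems(2)[OF lessI] Suc.prems(3)[OF lessI]] by blast
 have eq: "ennreal (exp ((\<Sum>i<N. ?e i om) - q om / 2)) * ennreal (exp (?e N om - q' om / 2))
   = ennreal (exp ((\<Sum>i<Suc N. ?e i om) - (q om + q' om) / 2))" for om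
  unfolding ennreal_mult[OF exp_ge_zero exp_ge_zero, symmetric] exp_add[symmetric] by (simp add: add_divide_distrib algebra_simps)
 show ?case
 proof (intro exI[of _ "\<lambda>om. q om + q' om"] conjI allI)
  show "0 \<le> q om + q' om" for om using IH3 S3 by simp
  show "ennreal (q om + q' om) \<le> (\<Sum>i<Suc N. \<integral>\<^sup>+x\<in>{t i..t (Suc i)}.
    ennreal ((norm (transpose (simple_process n \<tau> \<xi> x om) *v u i om + w i om))^2) \<partial>lborel)" for om
   unfolding sum.lessThan_Suc ennreal_plus[OF IH3(1) S3(1)] by (intro add_mono IH3 S3)
 qed (use S1 S2 IH2 in \<open>simp_all only: eq\<close>)
qed

end

lemma joint_measurable_continuous':
 fixes f :: "real \<Rightarrow> 'w \<Rightarrow> 'b::metric_space"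
 assumes meas: "\<And>s. 0 \<le> s \<Longrightarrow> f s \<in> borel_measurable M"
  and cont: "\<And>om. om \<in> space M \<Longrightarrow> continuous_on {0..} (\<lambda>s. f s om)"
 shows "(\<lambda>p. f (max 0 (snd p)) (fst p)) \<in> borel_measurable (M \<Otimes>\<^sub>M lborel)"
proof -
 have "(\<lambda>p. (snd p, fst p)) \<in> measurable (M \<Otimes>\<^sub>M lborel) (borel \<Otimes>\<^sub>M M)" by measurable
 from measurable_compose[OF this joint_measurable_continuous[OF assms]] show ?thesis by simp
qed

lemma set_nn_integral_eq_LINT_continuous:
 fixes f :: "real \<Rightarrow> real"
 assumes "continuous_on {a..b} f" "\<And>x. x \<in> {a..b} \<Longrightarrow> 0 \<le> f x"
 shows "(\<integral>\<^sup>+x\<in>{a..b}. ennreal (f x) \<partial>lborel) = ennreal (LBINT x:{a..b}. f x)"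
proof -
 have "(\<integral>\<^sup>+x\<in>{a..b}. ennreal (f x) \<partial>lborel) = (\<integral>\<^sup>+x. ennreal (indicator {a..b} x *\<^sub>R f x) \<partial>lborel)"
  by (intro nn_integral_cong) (auto simp: indicator_def)
 also have "... = ennreal (LBINT x:{a..b}. f x)" unfolding set_lebesgue_integral_def using borel_integrable_atLeastAtMost'[OF assms(1)] assms(2)
  by (intro nn_integral_eq_integral) (auto simp: set_integrable_def indicator_def)
 finally show ?thesis .
qed

lemma borel_measurable_set_LINT:
 fixes f :: "real \<Rightarrow> 'w \<Rightarrow> 'b::{banach, second_countable_topology}"
 assumes a: "0 \<le> a" and meas: "\<And>s. 0 \<le> s \<Longrightarrow> f s \<in> borel_measurable M"
  and cont: "\<And>om. om \<in> space M \<Longrightarrow> continuous_on {0..} (\<lambda>s. f s om)"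
 shows "(\<lambda>om. LBINT s:{a..b}. f s om) \<in> borel_measurable M"
proof -
 have [measurable]: "(\<lambda>p. f (max 0 (snd p)) (fst p)) \<in> borel_measurable (M \<Otimes>\<^sub>M lborel)"
  by (rule joint_measurable_continuous'[OF meas cont])
 have "(\<lambda>om. LINT s|lborel. indicat_real {a..b} s *\<^sub>R f (max 0 s) om) \<in> borel_measurable M"
  by (rule lborel.borel_measurable_lebesgue_integral) (simp add: split_def)
 moreover have "indicat_real {a..b} s *\<^sub>R f (max 0 s) om = indicat_real {a..b} s *\<^sub>R f s om" for s om
  using a by (auto simp: indicator_def max_def)
 ultimately show ?thesis unfolding set_lebesgue_integral_def by simp
qed

text \<open>Continuity of the integrand makes its quadratic variation an integral of a continuous
  function over a compact interval, finite and measurable on every path.\<close>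

locale ito_process = filtered_brownian M \<F> W
 for M :: "'w measure" and \<F> and W :: "real \<Rightarrow> 'w \<Rightarrow> real^'d" +
 fixes H :: "real \<Rightarrow> 'w \<Rightarrow> real^'d^'k" and I :: "real \<Rightarrow> 'w \<Rightarrow> real^'k"
 assumes ito: "has_ito_integral M \<F> W H I"
  and H_adapted: "\<And>s. 0 \<le> s \<Longrightarrow> H s \<in> borel_measurable (\<F> s)"
  and H_cont: "\<And>om. om \<in> space M \<Longrightarrow> continuous_on {0..} (\<lambda>s. H s om)"
begin

lemma I_meas: "0 \<le> t \<Longrightarrow> I t \<in> borel_measurable M" using ito by (simp add: has_ito_integral_def)

lemma H_meas: "0 \<le> s \<Longrightarrow> H s \<in> borel_measurable M" using H_adapted measurable_F_M by blast

lemma continuous_on_QV_integrand: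
 assumes "om \<in> space M" "0 \<le> a"
 shows "continuous_on {a..b} (\<lambda>s. (norm (transpose (H s om) *v u + w))^2)"
 using assms by (intro continuous_intros continuous_on_subset[OF H_cont]) auto

lemma approx_meas:
 assumes simple: "simple_integrand M \<F> n \<tau> \<xi>"
 shows "(\<lambda>om. \<integral>\<^sup>+s\<in>{0..T}. ennreal ((norm (simple_process n \<tau> \<xi> s om - H s om))^2) \<partial>lborel) \<in> borel_measurable M"
proof -
 have [measurable]: "(\<lambda>p. H (max 0 (snd p)) (fst p)) \<in> borel_measurable (M \<Otimes>\<^sub>M lborel)"
  by (rule joint_measurable_continuous'[OF H_meas H_cont])
 have [measurable]: "(\<lambda>p. simple_process n \<tau> \<xi> (snd p) (fst p)) \<in> borel_measurable (M \<Otimes>\<^sub>M lborel)"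
  unfolding simple_process_def
 proof (rule borel_measurable_sum)
  fix i assume "i \<in> {..<n}"
  hence [measurable]: "\<xi> i \<in> borel_measurable M" using simple measurable_F_M by (auto simp: simple_integrand_def)
  show "(\<lambda>p. indicat_real {\<tau> i<..\<tau> (Suc i)} (snd p) *\<^sub>R \<xi> i (fst p)) \<in> borel_measurable (M \<Otimes>\<^sub>M lborel)"
   by measurable
 qed
 have "(\<lambda>om. \<integral>\<^sup>+s. ennreal ((norm (simple_process n \<tau> \<xi> s om - H (max 0 s) om))^2) * indicator {0..T} s \<partial>lborel) \<in> borel_measurable M"
  by (rule lborel.borel_measurable_nn_integral) (simp add: split_def)
 moreover have "ennreal ((norm (simple_process n \<tau> \<xi> s om - H (max 0 s) om))^2) * indicator {0..T} s
   = ennreal ((norm (simple_process n \<tau> \<xi> s om - H s om))^2) * indicator {0..T} s" for s om by (auto simp: indicator_def max_def)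
 ultimately show ?thesis by simp
qed

text \<open>Along a subsequence the simple integrals at all grid points converge almost surely, and
  so does the \<open>L2\<close> distance of the integrands. Young's inequality bounds the quadratic
  term of the approximation by \<open>1 + \<kappa>\<close> times the true one plus a vanishing
  error, and Fatou's lemma finishes. The equality for simple integrands survives only as an
  inequality.\<close>

lemma exp_ito_eps:
 assumes t: "0 \<le> t 0" "\<And>i. i < N \<Longrightarrow> t i \<le> t (Suc i)"
  and u: "\<And>i. i < N \<Longrightarrow> u i \<in> borel_measurable (\<F> (t i))" and w: "\<And>i. i < N \<Longrightarrow> w i \<in> borel_measurable (\<F> (t i))"
  and \<kappa>: "\<kappa> > 0"
 shows "(EE M (\<lambda>om. exp ((\<Sum>i<N. u i om \<bullet> (I (t (Suc i)) om - I (t i) om) + w i om \<bullet> (W (t (Suc i)) om - W (t i) om))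
   - (1 + \<kappa>) * (\<Sum>i<N. LBINT s:{t i..t (Suc i)}. (norm (transpose (H s om) *v u i om + w i om))^2) / 2))) \<le> 1"
proof -
 obtain n \<tau> and \<xi> :: "nat \<Rightarrow> nat \<Rightarrow> 'w \<Rightarrow> real^'d^'k" where
  simple: "\<And>k. simple_integrand M \<F> (n k) (\<tau> k) (\<xi> k)"
  and approx: "\<And>T \<eta>. 0 \<le> T \<Longrightarrow> 0 < \<eta> \<Longrightarrow> (\<lambda>k::nat. measure M {om\<in>space M. ennreal \<eta> <
       (\<integral>\<^sup>+s\<in>{0..T}. ennreal ((norm (simple_process (n k) (\<tau> k) (\<xi> k) s om - H s om))^2) \<partial>lborel)}) \<longlonglongrightarrow> 0"
  and lim: "\<And>t. 0 \<le> t \<Longrightarrow> tendsto_in_prob M (\<lambda>k. simple_integral (n k) (\<tau> k) (\<xi> k) W t) (I t) sequentially"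
  using ito unfolding has_ito_integral_def by blast
 have t_mono: "t p \<le> t q" if "p \<le> q" "q \<le> N" for p q by (rule grid_mono[where f=t and n=N, OF t(2) that])
 have t_nn: "0 \<le> t p" if "p \<le> N" for p using t(1) t_mono[OF _ that, of 0] by simp
 define T where "T = t N"
 have T: "0 \<le> T" using t_nn[of N] by (simp add: T_def)
 define S where "S k = simple_integral (n k) (\<tau> k) (\<xi> k) W" for k
 have S_meas: "S k s \<in> borel_measurable M" if "0 \<le> s" for k s unfolding S_def by (rule simple_integral_meas_F[OF simple that])
 define D where "D k om = (\<integral>\<^sup>+s\<in>{0..T}. ennreal ((norm (simple_process (n k) (\<tau> k) (\<xi> k) s om - H s om))^2) \<partial>lborel)" for k om
 \<comment> \<open>Indices up to \<open>N\<close> stand for the values at the grid points, index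
   \<open>Suc N\<close> for the distance of the integrands, so that one subsequence handles
   everything.\<close>
 define Y where "Y j k om = (if j \<le> N then ennreal (dist (S k (t j) om) (I (t j) om)) else D k om)" for j k om
 have "\<exists>r :: nat \<Rightarrow> nat. strict_mono r \<and> (AE om in M. \<forall>j\<in>{..Suc N}. (\<lambda>k. Y j (r k) om) \<longlonglongrightarrow> 0)"
 proof (rule AE_subsequence[of "{..Suc N}" Y])
  fix j k assume "j \<in> {..Suc N}"
  show "Y j k \<in> borel_measurable M"
  proof (cases "j \<le> N")
   case True
   have [measurable]: "S k (t j) \<in> borel_measurable M" "I (t j) \<in> borel_measurable M" using S_meas I_meas t_nn[OF True] by auto
   show ?thesis using True unfolding Y_def[abs_def] by simp
  next
   case False
   thus ?thesis using approx_meas[OF simple] unfolding Y_def[abs_def] D_def by simp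
  qed
 next
  fix j and \<eta> :: real assume "j \<in> {..Suc N}" and \<eta>: "\<eta> > 0"
  show "(\<lambda>k. measure M {om \<in> space M. ennreal \<eta> < Y j k om}) \<longlonglongrightarrow> 0"
  proof (cases "j \<le> N")
   case True
   thus ?thesis using lim[OF t_nn[OF True]] \<eta> by (simp add: Y_def S_def tendsto_in_prob_def ennreal_less_iff)
  next
   case False
   thus ?thesis using approx[OF T \<eta>] by (simp add: Y_def D_def)
  qed
 qed auto
 then obtain r where r: "AE om in M. \<forall>j\<in>{..Suc N}. (\<lambda>k. Y j (r k) om) \<longlonglongrightarrow> 0" by blast
 let ?E = "\<lambda>k om. \<Sum>i<N. u i om \<bullet> (S k (t (Suc i)) om - S k (t i) om) + w i om \<bullet> (W (t (Suc i)) om - W (t i) om)"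
 let ?E' = "\<lambda>om. \<Sum>i<N. u i om \<bullet> (I (t (Suc i)) om - I (t i) om) + w i om \<bullet> (W (t (Suc i)) om - W (t i) om)"
 let ?Q = "\<lambda>om. \<Sum>i<N. LBINT s:{t i..t (Suc i)}. (norm (transpose (H s om) *v u i om + w i om))^2"
 have "\<exists>q. \<forall>k. (\<lambda>om. ennreal (exp (?E k om - q k om / 2))) \<in> borel_measurable (\<F> (t N)) \<and>
  (EE M (\<lambda>om. exp (?E k om - q k om / 2))) = 1 \<and>
  (\<forall>om. 0 \<le> q k om \<and> ennreal (q k om) \<le> (\<Sum>i<N. \<integral>\<^sup>+x\<in>{t i..t (Suc i)}.
    ennreal ((norm (transpose (simple_process (n k) (\<tau> k) (\<xi> k) x om) *v u i om + w i om))^2) \<partial>lborel))"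
  unfolding S_def by (rule choice, rule allI, rule exp_simple[OF simple t u w])
 then obtain q where q1: "\<And>k. (\<lambda>om. ennreal (exp (?E k om - q k om / 2))) \<in> borel_measurable (\<F> (t N))"
  and q2: "\<And>k. (EE M (\<lambda>om. exp (?E k om - q k om / 2))) = 1"
  and q3: "\<And>k om. 0 \<le> q k om"
  and q4: "\<And>k om. ennreal (q k om) \<le> (\<Sum>i<N. \<integral>\<^sup>+x\<in>{t i..t (Suc i)}.
    ennreal ((norm (transpose (simple_process (n k) (\<tau> k) (\<xi> k) x om) *v u i om + w i om))^2) \<partial>lborel)" by blast
 have q_le: "ennreal (q k om) \<le> ennreal ((1 + \<kappa>) * ?Q om) + ennreal ((1 + 1 / \<kappa>) * (\<Sum>i<N. (norm (u i om))^2)) * D k om"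
  if om: "om \<in> space M" for k om
 proof -
  let ?P = "simple_process (n k) (\<tau> k) (\<xi> k)"
  let ?J = "\<lambda>i. {t i..t (Suc i)}" and ?c = "\<lambda>i. (1 + 1/\<kappa>) * (norm (u i om))^2" and ?h = "\<lambda>i x. (norm (transpose (?P x om) *v u i om + w i om))^2"
  \<comment> \<open>Cutting \<open>H\<close> off outside the cell gives a Borel function of time, as
    continuity is available on the cell.\<close>
  let ?H = "\<lambda>i x. indicat_real (?J i) x *\<^sub>R H x om"
  let ?k = "\<lambda>i x. ennreal ((norm (?P x om - ?H i x))^2) * indicator (?J i) x"
  let ?f = "\<lambda>i x. (norm (transpose (H x om) *v u i om + w i om))^2"
  let ?g = "\<lambda>x. (norm (?P x om - H x om))^2"
  have [measurable]: "(\<lambda>x. ?P x om) \<in> borel_measurable lborel" unfolding simple_process_def by measurable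
  have part: "(\<integral>\<^sup>+x\<in>?J i. ennreal (?h i x) \<partial>lborel)
   \<le> ennreal ((1 + \<kappa>) * (LBINT s:?J i. ?f i s)) + ennreal (?c i) * D k om"
   if i: "i < N" for i
  proof -
   have ti: "0 \<le> t i" "t (Suc i) \<le> T" using t_nn[of i] t_mono[of "Suc i" N] i by (auto simp: T_def)
   have cH: "continuous_on (?J i) (\<lambda>s. H s om)" by (rule continuous_on_subset[OF H_cont[OF om]]) (use ti in auto)
   have [measurable]: "(\<lambda>x. ?H i x) \<in> borel_measurable lborel"
    using borel_measurable_continuous_on_indicator[OF _ cH] by simp
   have pt: "ennreal (?h i x) * indicator (?J i) x
     \<le> ennreal (1 + \<kappa>) * (ennreal (?f i x) * indicator (?J i) x)
      + ennreal (?c i) * (?k i x)" for x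
   proof (cases "x \<in> ?J i")
    case True
    \<comment> \<open>The approximating integrand is split into the true one, which receives the
      factor \<open>1 + \<kappa>\<close>, and an error that \<open>D\<close> controls.\<close>
    have "transpose (?P x om) *v u i om + w i om = (transpose (H x om) *v u i om + w i om) + transpose (?P x om - H x om) *v u i om"
     by (simp add: vec_eq_iff matrix_vector_mult_def transpose_def algebra_simps sum_subtractf)
    hence "?h i x
     \<le> (1 + \<kappa>) * ?f i x + (1 + 1/\<kappa>) * (norm (transpose (?P x om - H x om) *v u i om))^2"
     using norm_add_square_le[OF \<kappa>, of "transpose (H x om) *v u i om + w i om" "transpose (?P x om - H x om) *v u i om"] by presburger
    also have "... \<le> (1 + \<kappa>) * ?f i x + (1 + 1/\<kappa>) * (norm (?P x om - H x om) * norm (u i om))^2"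
     using \<kappa> by (intro add_left_mono mult_left_mono power_mono norm_transpose_mult_le) auto
    also have "... = (1 + \<kappa>) * ?f i x + ?c i * ?g x" by (simp add: power_mult_distrib)
    finally have "ennreal (?h i x)
     \<le> ennreal ((1 + \<kappa>) * ?f i x + ?c i * ?g x)" by (rule ennreal_leI)
    also have "... = ennreal (1 + \<kappa>) * ennreal (?f i x) + ennreal (?c i) * ennreal (?g x)"
     using \<kappa> by (subst ennreal_plus) (auto simp: ennreal_mult)
    finally show ?thesis using True by simp
   qed simp
   have meas_f: "(\<lambda>x. ennreal (?f i x) * indicator (?J i) x) \<in> borel_measurable lborel"
   proof -
    have "(\<lambda>x. indicat_real (?J i) x *\<^sub>R ?f i x) \<in> borel_measurable lborel"
     using borel_measurable_continuous_on_indicator[OF _ continuous_on_QV_integrand[OF om ti(1)]] by simp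
    hence "(\<lambda>x. ennreal (indicat_real (?J i) x *\<^sub>R ?f i x)) \<in> borel_measurable lborel" by measurable
    also have "(\<lambda>x. ennreal (indicat_real (?J i) x *\<^sub>R ?f i x)) = (\<lambda>x. ennreal (?f i x) * indicator (?J i) x)"
     by (auto simp: indicator_def)
    finally show ?thesis .
   qed
   have "(\<integral>\<^sup>+x\<in>?J i. ennreal (?h i x) \<partial>lborel)
    \<le> (\<integral>\<^sup>+x. ennreal (1 + \<kappa>) * (ennreal (?f i x) * indicator (?J i) x)
      + ennreal (?c i) * (?k i x) \<partial>lborel)"
    by (rule nn_integral_mono) (rule pt)
   also have "... = ennreal (1 + \<kappa>) * (\<integral>\<^sup>+x\<in>?J i. ennreal (?f i x) \<partial>lborel)
    + ennreal (?c i) * (\<integral>\<^sup>+x\<in>?J i. ennreal ((norm (?P x om - ?H i x))^2) \<partial>lborel)"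
    using meas_f by (subst nn_integral_add, simp, simp, subst nn_integral_cmult, simp, subst nn_integral_cmult, simp_all)
   also have "... \<le> ennreal (1 + \<kappa>) * (\<integral>\<^sup>+x\<in>?J i. ennreal (?f i x) \<partial>lborel)
    + ennreal (?c i) * D k om"
    unfolding D_def using ti by (intro add_left_mono mult_left_mono nn_integral_mono) (auto simp: indicator_def)
   also have "(\<integral>\<^sup>+x\<in>?J i. ennreal (?f i x) \<partial>lborel) = ennreal (LBINT s:?J i. ?f i s)"
    by (rule set_nn_integral_eq_LINT_continuous[OF continuous_on_QV_integrand[OF om ti(1)]]) simp
   also have "ennreal (1 + \<kappa>) * ... = ennreal ((1 + \<kappa>) * (LBINT s:?J i. ?f i s))"
    using \<kappa> by (simp add: ennreal_mult')
   finally show ?thesis .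
  qed
  have nn: "0 \<le> (LBINT s:?J i. ?f i s)" for i unfolding set_lebesgue_integral_def by (intro integral_nonneg_AE) auto
  have "ennreal (q k om) \<le> (\<Sum>i<N. ennreal ((1 + \<kappa>) * (LBINT s:?J i. ?f i s)) + ennreal (?c i) * D k om)"
   by (rule order_trans[OF q4]) (intro sum_mono part, simp)
  also have "... = ennreal ((1 + \<kappa>) * ?Q om) + ennreal ((1 + 1 / \<kappa>) * (\<Sum>i<N. (norm (u i om))^2)) * D k om"
   unfolding sum.distrib sum_distrib_left sum_distrib_right[symmetric] using \<kappa> nn
   by (intro arg_cong2[where f="(+)"] arg_cong2[where f="(*)"] sum_ennreal refl) auto
  finally show ?thesis .
 qed
 have Q_nn: "0 \<le> ?Q om" for om unfolding set_lebesgue_integral_def by (intro sum_nonneg integral_nonneg_AE) auto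
 have AE_le: "AE om in M. ennreal (exp (?E' om - (1 + \<kappa>) * ?Q om / 2)) \<le> liminf (\<lambda>k. ennreal (exp (?E (r k) om - q (r k) om / 2)))"
  using r AE_space
 proof eventually_elim
  case (elim om)
  have D0: "(\<lambda>k. D (r k) om) \<longlonglongrightarrow> 0" using bspec[OF elim(1), of "Suc N"] by (simp add: Y_def)
  have SI: "(\<lambda>k. S (r k) (t j) om) \<longlonglongrightarrow> I (t j) om" if "j \<le> N" for j
  proof -
   have "(\<lambda>k. ennreal (dist (S (r k) (t j) om) (I (t j) om))) \<longlonglongrightarrow> ennreal 0"
    using bspec[OF elim(1), of j] that by (simp add: Y_def)
   hence "(\<lambda>k. dist (S (r k) (t j) om) (I (t j) om)) \<longlonglongrightarrow> 0" by (subst (asm) tendsto_ennreal_iff) auto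
   thus ?thesis by (rule tendsto_dist_iff[THEN iffD2])
  qed
  define d where "d k = enn2real (D (r k) om)" for k
  define c where "c = (1 + 1 / \<kappa>) * (\<Sum>i<N. (norm (u i om))^2)"
  have c: "0 \<le> c" unfolding c_def using \<kappa> by (intro mult_nonneg_nonneg sum_nonneg) auto
  \<comment> \<open>Once below 1 the distance is finite, so the \<open>ennreal\<close> bound can be
    read in the reals with \<open>d k\<close> in place of \<open>D\<close>.\<close>
  have "\<forall>\<^sub>F k in sequentially. D (r k) om < 1" using D0 by (rule order_tendstoD) simp
  hence ev: "\<forall>\<^sub>F k in sequentially. ennreal (exp (?E (r k) om - ((1 + \<kappa>) * ?Q om + c * d k) / 2)) \<le> ennreal (exp (?E (r k) om - q (r k) om / 2))"
  proof eventually_elim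
   case (elim k)
   hence "D (r k) om = ennreal (d k)" unfolding d_def using ennreal_enn2real[of "D (r k) om"] order.strict_trans[of "D (r k) om" 1 top] by simp
   hence "ennreal (q (r k) om) \<le> ennreal ((1 + \<kappa>) * ?Q om + c * d k)"
    using q_le[OF \<open>om \<in> space M\<close>, of "r k"] c \<kappa> Q_nn[of om] by (subst ennreal_plus) (auto simp: ennreal_mult c_def d_def)
   hence "q (r k) om \<le> (1 + \<kappa>) * ?Q om + c * d k" using c \<kappa> Q_nn[of om] by (subst (asm) ennreal_le_iff) (auto simp: d_def)
   thus ?case by (intro ennreal_leI) simp
  qed
  have d0: "d \<longlonglongrightarrow> 0" unfolding d_def by (rule tendsto_enn2real) (simp_all add: D0)
  have "(\<lambda>k. ennreal (exp (?E (r k) om - ((1 + \<kappa>) * ?Q om + c * d k) / 2))) \<longlonglongrightarrow> ennreal (exp (?E' om - ((1 + \<kappa>) * ?Q om + c * 0) / 2))"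
   by (intro tendsto_ennrealI tendsto_intros SI d0) auto
  hence "ennreal (exp (?E' om - (1 + \<kappa>) * ?Q om / 2)) = liminf (\<lambda>k. ennreal (exp (?E (r k) om - ((1 + \<kappa>) * ?Q om + c * d k) / 2)))"
   by (subst lim_imp_Liminf[OF sequentially_bot]) simp_all
  also have "... \<le> liminf (\<lambda>k. ennreal (exp (?E (r k) om - q (r k) om / 2)))" using ev by (rule Liminf_mono)
  finally show ?case .
 qed
 have "(EE M (\<lambda>om. exp (?E' om - (1 + \<kappa>) * ?Q om / 2))) \<le> (\<integral>\<^sup>+om. liminf (\<lambda>k. ennreal (exp (?E (r k) om - q (r k) om / 2))) \<partial>M)"
  by (rule nn_integral_mono_AE[OF AE_le])
 also have "... \<le> liminf (\<lambda>k. \<integral>\<^sup>+om. ennreal (exp (?E (r k) om - q (r k) om / 2)) \<partial>M)"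
  by (rule nn_integral_liminf) (rule measurable_F_M[OF q1])
 also have "... = 1" by (simp add: q2 Liminf_const)
 finally show ?thesis .
qed

text \<open>Quadratic variation over the interval from \<open>a\<close> to \<open>b\<close> of the
  combination of \<open>I\<close> and \<open>W\<close> with weights \<open>u\<close> and
  \<open>w\<close> frozen.\<close>

definition QV :: "real \<Rightarrow> real \<Rightarrow> real^'k \<Rightarrow> real^'d \<Rightarrow> 'w \<Rightarrow> real" where
 "QV a b u w om = (LBINT s:{a..b}. (norm (transpose (H s om) *v u + w))^2)"

lemma QV_nonneg: "0 \<le> QV a b u w om" unfolding QV_def set_lebesgue_integral_def by (intro integral_nonneg_AE) auto

lemma QV_meas:
 assumes "0 \<le> a" "u \<in> borel_measurable M" "w \<in> borel_measurable M"
 shows "(\<lambda>om. QV a b (u om) (w om) om) \<in> borel_measurable M" unfolding QV_def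
proof (rule borel_measurable_set_LINT[OF assms(1)])
 fix s :: real assume "0 \<le> s"
 hence [measurable]: "(\<lambda>om. transpose (H s om) *v u om + w om) \<in> borel_measurable M"
  using assms by (intro borel_measurable_add borel_measurable_transpose_mult H_meas)
 show "(\<lambda>om. (norm (transpose (H s om) *v u om + w om))^2) \<in> borel_measurable M" by measurable
next
 fix om assume "om \<in> space M"
 thus "continuous_on {0..} (\<lambda>s. (norm (transpose (H s om) *v u om + w om))^2)" by (intro continuous_intros H_cont)
qed

text \<open>A second application of Fatou's lemma, with \<kappa> tending to zero.\<close>

lemma exp_ito:
 assumes t: "0 \<le> t 0" "\<And>i. i < N \<Longrightarrow> t i \<le> t (Suc i)"
  and u: "\<And>i. i < N \<Longrightarrow> u i \<in> borel_measurable (\<F> (t i))" and w: "\<And>i. i < N \<Longrightarrow> w i \<in> borel_measurable (\<F> (t i))"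
 shows "(EE M (\<lambda>om. exp ((\<Sum>i<N. u i om \<bullet> (I (t (Suc i)) om - I (t i) om) + w i om \<bullet> (W (t (Suc i)) om - W (t i) om))
   - (\<Sum>i<N. QV (t i) (t (Suc i)) (u i om) (w i om) om) / 2))) \<le> 1"
proof -
 let ?E = "\<lambda>om. \<Sum>i<N. u i om \<bullet> (I (t (Suc i)) om - I (t i) om) + w i om \<bullet> (W (t (Suc i)) om - W (t i) om)"
 let ?Q = "\<lambda>om. \<Sum>i<N. QV (t i) (t (Suc i)) (u i om) (w i om) om"
 define \<kappa> where "\<kappa> n = 1 / real (Suc n)" for n
 have \<kappa>: "0 < \<kappa> n" for n by (simp add: \<kappa>_def)
 have t_nn: "0 \<le> t p" if "p \<le> N" for p using grid_mono[where f=t and n=N and p=0 and q=p] t that by fastforce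
 have E_meas: "?E \<in> borel_measurable M"
 proof (intro borel_measurable_sum borel_measurable_add borel_measurable_inner borel_measurable_diff)
  fix i assume "i \<in> {..<N}"
  hence i: "i < N" "0 \<le> t i" "0 \<le> t (Suc i)" using t_nn by auto
  show "u i \<in> borel_measurable M" "w i \<in> borel_measurable M" using measurable_F_M[OF u[OF i(1)]] measurable_F_M[OF w[OF i(1)]] .
  show "I (t i) \<in> borel_measurable M" "I (t (Suc i)) \<in> borel_measurable M"
   "W (t i) \<in> borel_measurable M" "W (t (Suc i)) \<in> borel_measurable M" using i by (simp_all add: I_meas W_meas)
 qed
 have Q_meas: "?Q \<in> borel_measurable M" by (intro borel_measurable_sum QV_meas) (auto simp: t_nn intro: measurable_F_M u w)
 have meas: "(\<lambda>om. ennreal (exp (?E om - (1 + \<kappa> n) * ?Q om / 2))) \<in> borel_measurable M" for n using E_meas Q_meas by measurable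
 have "ennreal (exp (?E om - ?Q om / 2)) = liminf (\<lambda>n. ennreal (exp (?E om - (1 + \<kappa> n) * ?Q om / 2)))" for om
 proof -
  have "(\<lambda>n. ennreal (exp (?E om - (1 + \<kappa> n) * ?Q om / 2))) \<longlonglongrightarrow> ennreal (exp (?E om - (1 + 0) * ?Q om / 2))"
   unfolding \<kappa>_def by (intro tendsto_ennrealI tendsto_intros LIMSEQ_Suc[OF lim_1_over_n]) simp
  from lim_imp_Liminf[OF sequentially_bot this] show ?thesis by simp
 qed
 hence "(EE M (\<lambda>om. exp (?E om - ?Q om / 2))) = (\<integral>\<^sup>+om. liminf (\<lambda>n. ennreal (exp (?E om - (1 + \<kappa> n) * ?Q om / 2))) \<partial>M)"
  by simp
 also have "... \<le> liminf (\<lambda>n. \<integral>\<^sup>+om. ennreal (exp (?E om - (1 + \<kappa> n) * ?Q om / 2)) \<partial>M)"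
  by (rule nn_integral_liminf[OF meas])
 also have "... \<le> liminf (\<lambda>n. 1)" unfolding QV_def using exp_ito_eps[OF t u w \<kappa>] by (intro Liminf_mono always_eventually allI)
 finally show ?thesis by (simp add: Liminf_const)
qed

end

section \<open>Tail and moment bounds from exponential inequalities\<close>

lemma exp_quartic:
 fixes y :: real
 obtains t where "\<bar>t\<bar> \<le> \<bar>y\<bar>" "exp y = 1 + y + y^2 / 2 + y ^ 3 / 6 + exp t * y ^ 4 / 24"
proof -
 obtain t where "\<bar>t\<bar> \<le> \<bar>y\<bar>" "exp y = (\<Sum>m<4. y ^ m / fact m) + exp t / fact 4 * y ^ 4"
  using Maclaurin_exp_le[of y 4] by blast
 thus ?thesis by (intro that[of t]) (auto simp: eval_nat_numeral lessThan_Suc)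
qed

lemma one_plus_square_le_cosh: "1 + y^2 / 2 \<le> cosh (y::real)"
proof -
 obtain t s where "exp y = 1 + y + y^2 / 2 + y ^ 3 / 6 + exp t * y ^ 4 / 24"
  "exp (-y) = 1 + (-y) + (-y)^2 / 2 + (-y) ^ 3 / 6 + exp s * (-y) ^ 4 / 24" using exp_quartic[of y] exp_quartic[of "-y"] by metis
 moreover have "(-y) ^ 3 = - (y ^ 3)" "(-y) ^ 4 = y ^ 4" by auto
 moreover have "0 \<le> exp t * y ^ 4 / 24" "0 \<le> exp s * y ^ 4 / 24" by auto
 ultimately show ?thesis unfolding cosh_def by simp
qed

text \<open>The odd terms cancel between the expansions at \<open>y\<close> and \<open>-y\<close>,
  and both remainders are at most \<open>2 * cosh y\<close> times the fourth-order term.\<close>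

lemma cosh_le_quartic: "cosh (y::real) \<le> 1 + y^2 / 2 + y ^ 4 * cosh y / 12"
proof -
 obtain t s where ts: "\<bar>t\<bar> \<le> \<bar>y\<bar>" "\<bar>s\<bar> \<le> \<bar>-y\<bar>"
  and e: "exp y = 1 + y + y^2 / 2 + y ^ 3 / 6 + exp t * y ^ 4 / 24"
  "exp (-y) = 1 + (-y) + (-y)^2 / 2 + (-y) ^ 3 / 6 + exp s * (-y) ^ 4 / 24" using exp_quartic[of y] exp_quartic[of "-y"] by metis
 have *: "exp r \<le> 2 * cosh y" if "\<bar>r\<bar> \<le> \<bar>y\<bar>" for r
 proof -
  have "exp r \<le> exp \<bar>y\<bar>" using that by simp
  also have "... \<le> exp y + exp (-y)" by (cases "y \<ge> 0") auto
  finally show ?thesis unfolding cosh_def by simp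
 qed
 have "exp t * y ^ 4 / 24 \<le> 2 * cosh y * y ^ 4 / 24" "exp s * y ^ 4 / 24 \<le> 2 * cosh y * y ^ 4 / 24"
  using ts by (intro divide_right_mono mult_right_mono *; simp)+
 moreover have "2 * cosh y = 2 + y^2 + exp t * y ^ 4 / 24 + exp s * y ^ 4 / 24" using e by (simp add: cosh_def)
 moreover have "2 * cosh y * y ^ 4 / 24 = y ^ 4 * cosh y / 12" by simp
 ultimately show ?thesis by linarith
qed

lemma quartic_le_cosh: "y ^ 4 \<le> 24 * cosh (y::real)"
proof -
 have even: "1 + z^2 / 2 + z ^ 4 / 24 \<le> cosh z" for z :: real
 proof -
  obtain t where t: "exp z = (\<Sum>m<6. z ^ m / fact m) + exp t / fact 6 * z ^ 6" using Maclaurin_exp_le[of z 6] by blast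
  obtain s where s: "exp (-z) = (\<Sum>m<6. (-z) ^ m / fact m) + exp s / fact 6 * (-z) ^ 6" using Maclaurin_exp_le[of "-z" 6] by blast
  have "0 \<le> exp t / fact 6 * z ^ 6" "0 \<le> exp s / fact 6 * (-z) ^ 6" by simp_all
  hence "(\<Sum>m<6. z ^ m / fact m) + (\<Sum>m<6. (-z) ^ m / fact m) \<le> 2 * cosh z" using s t by (simp add: cosh_def)
  thus ?thesis by (simp add: eval_nat_numeral lessThan_Suc fact_numeral)
 qed
 have "y ^ 4 / 24 \<le> 1 + y^2 / 2 + y ^ 4 / 24" by simp
 also have "... \<le> cosh y" by (rule even)
 finally show ?thesis by simp
qed

text \<open>Expanding the product of the factors \<open>1 + (x i)^2 / 2\<close> yields the left side
  plus nonnegative mixed terms.\<close>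

lemma one_plus_sum_square_le_prod_cosh:
 fixes x :: "'i \<Rightarrow> real"
 assumes "finite A"
 shows "1 + (\<Sum>i\<in>A. (x i)^2) / 2 \<le> (\<Prod>i\<in>A. cosh (x i))" using assms
proof (induction A rule: finite_induct)
 case (insert a A)
 let ?s = "\<Sum>i\<in>A. (x i)^2"
 have s: "0 \<le> ?s" by (simp add: sum_nonneg)
 have "1 + (\<Sum>i\<in>insert a A. (x i)^2) / 2 \<le> (1 + (x a)^2 / 2) * (1 + ?s / 2)" using insert s by (simp add: algebra_simps)
 also have "... \<le> cosh (x a) * (\<Prod>i\<in>A. cosh (x i))" using s by (intro mult_mono one_plus_square_le_cosh insert) auto
 finally show ?case using insert by simp
qed simp

context prob_space
begin

text \<open>Chernoff's bound for either sign. Because \<open>Q\<close> is random, the tail is only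
  claimed jointly with a bound on \<open>Q\<close>.\<close>

lemma exp_tail:
 assumes S [measurable]: "S \<in> borel_measurable M" and Q [measurable]: "Q \<in> borel_measurable M"
  and exp: "\<And>c. (EE M (\<lambda>om. exp (c * S om - c^2 * Q om / 2))) \<le> 1" and a: "a > 0" and v: "v > 0"
 shows "prob {om \<in> space M. a \<le> \<bar>S om\<bar> \<and> Q om \<le> v} \<le> 2 * exp (- (a^2 / (2 * v)))"
proof -
 have one: "prob {om \<in> space M. a \<le> s * S om \<and> Q om \<le> v} \<le> exp (- (a^2 / (2 * v)))" if s: "s = 1 \<or> s = -1" for s
 proof -
  let ?A = "{om \<in> space M. a \<le> s * S om \<and> Q om \<le> v}"
  \<comment> \<open>This choice maximizes the guaranteed exponent
    \<open>c * a - c^2 * v / 2\<close>.\<close>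
  define c where "c = a / v"
  have c: "0 < c" "c * a - c^2 * v / 2 = a^2 / (2 * v)" "s^2 = 1" using a v s by (auto simp: c_def power2_eq_square field_simps)
  have "ennreal (exp (a^2 / (2 * v))) * emeasure M ?A = (\<integral>\<^sup>+om. ennreal (exp (a^2 / (2 * v))) * indicator ?A om \<partial>M)"
   by (subst nn_integral_cmult_indicator) auto
  also have "... \<le> (EE M (\<lambda>om. exp ((c * s) * S om - (c * s)^2 * Q om / 2)))"
  proof (rule nn_integral_mono)
   fix om
   show "ennreal (exp (a^2 / (2 * v))) * indicator ?A om \<le> ennreal (exp ((c * s) * S om - (c * s)^2 * Q om / 2))"
   proof (cases "om \<in> ?A")
    case True
    hence "c * a \<le> c * (s * S om)" "c^2 * Q om \<le> c^2 * v" using c by (auto intro: mult_left_mono)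
    hence "a^2 / (2 * v) \<le> (c * s) * S om - (c * s)^2 * Q om / 2" unfolding c(2)[symmetric] by (simp add: power_mult_distrib c(3) mult.assoc)
    thus ?thesis using True by (simp add: ennreal_leI)
   qed simp
  qed
  also have "... \<le> ennreal 1" using exp[of "c * s"] by simp
  finally have "exp (a^2 / (2 * v)) * prob ?A \<le> 1" by (simp add: emeasure_eq_measure ennreal_mult[symmetric] del: ennreal_1)
  hence "prob ?A \<le> 1 / exp (a^2 / (2 * v))" by (simp add: field_simps)
  thus ?thesis by (simp add: exp_minus inverse_eq_divide)
 qed
 have "prob {om \<in> space M. a \<le> \<bar>S om\<bar> \<and> Q om \<le> v}
  \<le> prob ({om \<in> space M. a \<le> 1 * S om \<and> Q om \<le> v} \<union> {om \<in> space M. a \<le> - 1 * S om \<and> Q om \<le> v})"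
  by (rule finite_measure_mono) (auto simp: abs_if split: if_splits)
 also have "... \<le> prob {om \<in> space M. a \<le> 1 * S om \<and> Q om \<le> v} + prob {om \<in> space M. a \<le> - 1 * S om \<and> Q om \<le> v}"
  by (rule measure_Un_le) measurable
 also have "... \<le> 2 * exp (- (a^2 / (2 * v)))" using one[of 1] one[of "-1"] by simp
 finally show ?thesis .
qed

text \<open>Averaging over all choices of signs turns the exponential moments into products of hyperbolic
 cosines, which dominate the sum of squares.\<close>

lemma exp_signs:
 fixes y q :: "'i \<Rightarrow> 'a \<Rightarrow> real"
 assumes A: "finite A" and y [measurable]: "\<And>i. i \<in> A \<Longrightarrow> y i \<in> borel_measurable M"
  and q [measurable]: "\<And>i. i \<in> A \<Longrightarrow> q i \<in> borel_measurable M"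
  and exp: "\<And>c. (EE M (\<lambda>om. exp ((\<Sum>i\<in>A. c i * y i om) - (\<Sum>i\<in>A. (c i)^2 * q i om) / 2))) \<le> 1"
 shows "(EE M (\<lambda>om. (1 + c^2 * (\<Sum>i\<in>A. (y i om)^2) / 2) * exp (- (c^2 * (\<Sum>i\<in>A. q i om) / 2)))) \<le> 1"
proof -
 let ?P = "PiE A (\<lambda>_. {-1, 1::real})"
 have fin: "finite ?P" using A by (intro finite_PiE) auto
 have card: "card ?P = 2 ^ card A" using A by (simp add: card_PiE numeral_2_eq_2)
 let ?e = "\<lambda>om. exp (- (c^2 * (\<Sum>i\<in>A. q i om) / 2))"
 let ?p = "\<lambda>om. 1 + c^2 * (\<Sum>i\<in>A. (y i om)^2) / 2" and ?x = "\<lambda>s om. exp (\<Sum>i\<in>A. c * s i * y i om)"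
 let ?E = "\<lambda>s om. exp ((\<Sum>i\<in>A. (c * s i) * y i om) - (\<Sum>i\<in>A. (c * s i)^2 * q i om) / 2)"
 have "ennreal (2 ^ card A) * (EE M (\<lambda>om. ?p om * ?e om))
   = (EE M (\<lambda>om. 2 ^ card A * (?p om * ?e om)))"
  by (subst nn_integral_cmult[symmetric]) (auto simp: ennreal_mult'[symmetric])
 also have "... \<le> (\<integral>\<^sup>+om. (\<Sum>s\<in>?P. ennreal (?E s om)) \<partial>M)"
 proof (rule nn_integral_mono)
  fix om
  have sq: "(c * s i)^2 = c^2" if "s \<in> ?P" "i \<in> A" for s i
  proof -
   have "s i = -1 \<or> s i = 1" using PiE_mem[OF that] by auto
   thus ?thesis by auto
  qed
  have "2 ^ card A * ?p om \<le> 2 ^ card A * (\<Prod>i\<in>A. cosh (c * y i om))"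
   using one_plus_sum_square_le_prod_cosh[OF A, of "\<lambda>i. c * y i om"]
   by (intro mult_left_mono) (auto simp: power_mult_distrib sum_distrib_left)
  also have "... = (\<Prod>i\<in>A. 2 * cosh (c * y i om))" by (simp add: prod.distrib)
  also have "... = (\<Prod>i\<in>A. \<Sum>s\<in>{-1, 1}. exp (c * s * y i om))" by (intro prod.cong) (auto simp: cosh_def)
  \<comment> \<open>Multiplying out gives one summand for each pattern of signs.\<close>
  also have "... = (\<Sum>s\<in>?P. \<Prod>i\<in>A. exp (c * s i * y i om))" using A by (subst prod_sum_PiE) auto
  also have "... = (\<Sum>s\<in>?P. ?x s om)" using A by (simp add: exp_sum)
  finally have le: "2 ^ card A * ?p om \<le> (\<Sum>s\<in>?P. ?x s om)" .
  have "2 ^ card A * (?p om * ?e om) \<le> (\<Sum>s\<in>?P. ?x s om) * ?e om"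
   unfolding mult.assoc[symmetric] by (rule mult_right_mono[OF le]) simp
  also have "... = (\<Sum>s\<in>?P. ?E s om)"
   unfolding sum_distrib_right
  proof (intro sum.cong refl)
   fix s assume s: "s \<in> ?P"
   have "(\<Sum>i\<in>A. (c * s i)^2 * q i om) = c^2 * (\<Sum>i\<in>A. q i om)"
    unfolding sum_distrib_left by (intro sum.cong refl arg_cong2[where f="(*)"] sq s)
   thus "?x s om * ?e om = ?E s om"
    by (simp only: mult_exp_exp diff_conv_add_uminus)
  qed
  finally show "ennreal (2 ^ card A * (?p om * ?e om))
   \<le> (\<Sum>s\<in>?P. ennreal (?E s om))"
   by (subst sum_ennreal) (auto intro: ennreal_leI)
 qed
 also have "... = (\<Sum>s\<in>?P. \<integral>\<^sup>+om. ennreal (?E s om) \<partial>M)"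
  by (rule nn_integral_sum) measurable
 also have "... \<le> (\<Sum>s\<in>?P. 1)" by (intro sum_mono exp)
 also have "... = ennreal (2 ^ card A) * 1" using card by (simp add: ennreal_power[symmetric])
 finally show ?thesis by (subst (asm) ennreal_mult_le_mult_iff) auto
qed

text \<open>Markov's inequality for the bound of \<open>exp_signs\<close>. With
  \<open>c^2 = 2 / v\<close> the damping factor is at least \<open>exp (-1)\<close> on the event,
  which explains the constant \<open>exp 1\<close>.\<close>

lemma sum_square_tail:
 fixes y q :: "'i \<Rightarrow> 'a \<Rightarrow> real"
 assumes A: "finite A" and y [measurable]: "\<And>i. i \<in> A \<Longrightarrow> y i \<in> borel_measurable M"
  and q [measurable]: "\<And>i. i \<in> A \<Longrightarrow> q i \<in> borel_measurable M"
  and exp: "\<And>c. (EE M (\<lambda>om. exp ((\<Sum>i\<in>A. c i * y i om) - (\<Sum>i\<in>A. (c i)^2 * q i om) / 2))) \<le> 1"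
  and a: "a > 0" and v: "v > 0"
 shows "prob {om \<in> space M. a \<le> (\<Sum>i\<in>A. (y i om)^2) \<and> (\<Sum>i\<in>A. q i om) \<le> v} \<le> exp 1 * v / a"
proof -
 let ?A = "{om \<in> space M. a \<le> (\<Sum>i\<in>A. (y i om)^2) \<and> (\<Sum>i\<in>A. q i om) \<le> v}"
 define c where "c = sqrt (2 / v)"
 have c: "c^2 = 2 / v" using v by (simp add: c_def)
 have [measurable]: "?A \<in> sets M" by measurable
 have "ennreal (a / v * exp (- 1)) * emeasure M ?A = (\<integral>\<^sup>+om. ennreal (a / v * exp (- 1)) * indicator ?A om \<partial>M)"
  by (subst nn_integral_cmult_indicator) auto
 also have "... \<le> (EE M (\<lambda>om. (1 + c^2 * (\<Sum>i\<in>A. (y i om)^2) / 2) * exp (- (c^2 * (\<Sum>i\<in>A. q i om) / 2))))"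
 proof (rule nn_integral_mono)
  fix om
  show "ennreal (a / v * exp (- 1)) * indicator ?A om
   \<le> ennreal ((1 + c^2 * (\<Sum>i\<in>A. (y i om)^2) / 2) * exp (- (c^2 * (\<Sum>i\<in>A. q i om) / 2)))"
  proof (cases "om \<in> ?A")
   case True
   have "a / v \<le> 1 + c^2 * (\<Sum>i\<in>A. (y i om)^2) / 2" using True v unfolding c by (simp add: divide_right_mono add_increasing)
   moreover have "exp (- 1) \<le> exp (- (c^2 * (\<Sum>i\<in>A. q i om) / 2))" using True v unfolding c by simp
   ultimately have "a / v * exp (- 1) \<le> (1 + c^2 * (\<Sum>i\<in>A. (y i om)^2) / 2) * exp (- (c^2 * (\<Sum>i\<in>A. q i om) / 2))"
    by (rule mult_mono) (simp_all add: sum_nonneg)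
   thus ?thesis using True by (simp only: indicator_simps mult_1_right ennreal_leI)
  qed simp
 qed
 also have "... \<le> ennreal 1" using exp_signs[OF A y q exp] by simp
 finally have "a / v * exp (-1) * prob ?A \<le> 1" using a v by (simp add: emeasure_eq_measure ennreal_mult[symmetric] del: ennreal_1)
 thus ?thesis using a v by (simp add: exp_minus field_simps)
qed

text \<open>For one variable, \<open>exp_signs\<close> compares the damped second moment with the
  expectation of \<open>1 - exp (- (c^2 * Q / 2))\<close>, which is at most that of
  \<open>c^2 * Q / 2\<close>. Dividing by \<open>c^2 / 2\<close> and letting \<open>c\<close> tend
  to zero removes the damping by Fatou's lemma.\<close>

lemma second_moment_le:
 assumes S [measurable]: "S \<in> borel_measurable M" and Q [measurable]: "Q \<in> borel_measurable M" and Q_nn: "\<And>om. 0 \<le> Q om"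
  and exp: "\<And>c. (EE M (\<lambda>om. exp (c * S om - c^2 * Q om / 2))) \<le> 1"
 shows "(EE M (\<lambda>om. (S om)^2)) \<le> (EE M (\<lambda>om. Q om))"
proof -
 have step: "(EE M (\<lambda>om. (S om)^2 * exp (- (c^2 * Q om / 2)))) \<le> (EE M (\<lambda>om. Q om))" if c: "c > 0" for c
 proof -
  let ?e = "\<lambda>om. exp (- (c^2 * Q om / 2))"
  have e1: "?e om \<le> 1" for om using Q_nn[of om] by simp
  \<comment> \<open>Finiteness licenses the cancellation of this expectation on both sides in
    \<open>ennreal\<close>.\<close>
  have fin: "(EE M (\<lambda>om. ?e om)) \<noteq> \<infinity>"
  proof -
   have "(EE M (\<lambda>om. ?e om)) \<le> (\<integral>\<^sup>+om. 1 \<partial>M)" using e1 by (intro nn_integral_mono) (simp add: ennreal_le_1)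
   thus ?thesis by (auto simp: emeasure_space_1 top_unique)
  qed
  have "(EE M (\<lambda>om. (1 + c^2 * (S om)^2 / 2) * ?e om)) \<le> 1" using exp_signs[of "{()}" "\<lambda>_. S" "\<lambda>_. Q" c] exp by simp
  also have "(EE M (\<lambda>om. (1 + c^2 * (S om)^2 / 2) * ?e om)) = (EE M (\<lambda>om. ?e om)) + (EE M (\<lambda>om. c^2 * (S om)^2 / 2 * ?e om))"
   by (subst nn_integral_add[symmetric]) (auto simp: ennreal_plus[symmetric] algebra_simps simp del: ennreal_plus intro!: nn_integral_cong)
  also have "(1::ennreal) = (EE M (\<lambda>om. ?e om)) + (EE M (\<lambda>om. 1 - ?e om))"
   using e1 by (subst nn_integral_add[symmetric]) (auto simp: ennreal_plus[symmetric] emeasure_space_1 simp del: ennreal_plus)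
  finally have "(EE M (\<lambda>om. c^2 * (S om)^2 / 2 * ?e om)) \<le> (EE M (\<lambda>om. 1 - ?e om))"
   using fin by (simp add: ennreal_add_left_cancel_le)
  also have "... \<le> (EE M (\<lambda>om. c^2 / 2 * Q om))"
  proof (intro nn_integral_mono ennreal_leI)
   fix om show "1 - ?e om \<le> c^2 / 2 * Q om" using exp_ge_add_one_self[of "- (c^2 * Q om / 2)"] by simp
  qed
  also have "... = ennreal (c^2 / 2) * (EE M (\<lambda>om. Q om))" by (subst nn_integral_cmult[symmetric]) (auto simp: ennreal_mult'[symmetric])
  also have "(EE M (\<lambda>om. c^2 * (S om)^2 / 2 * ?e om)) = ennreal (c^2 / 2) * (EE M (\<lambda>om. (S om)^2 * ?e om))"
   by (subst nn_integral_cmult[symmetric]) (auto simp: ennreal_mult'[symmetric] intro!: nn_integral_cong)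
  finally show ?thesis using c by (subst (asm) ennreal_mult_le_mult_iff) auto
 qed
 have "ennreal ((S om)^2) = liminf (\<lambda>n. ennreal ((S om)^2 * exp (- ((1 / real (Suc n))^2 * Q om / 2))))" for om
 proof -
  have "(\<lambda>n. ennreal ((S om)^2 * exp (- ((1 / real (Suc n))^2 * Q om / 2)))) \<longlonglongrightarrow> ennreal ((S om)^2 * exp (- (0^2 * Q om / 2)))"
   by (intro tendsto_ennrealI tendsto_intros LIMSEQ_Suc[OF lim_1_over_n]) simp
  from lim_imp_Liminf[OF sequentially_bot this] show ?thesis by simp
 qed
 hence "(EE M (\<lambda>om. (S om)^2)) = (\<integral>\<^sup>+om. liminf (\<lambda>n. ennreal ((S om)^2 * exp (- ((1 / real (Suc n))^2 * Q om / 2)))) \<partial>M)"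
  by simp
 also have "... \<le> liminf (\<lambda>n. \<integral>\<^sup>+om. ennreal ((S om)^2 * exp (- ((1 / real (Suc n))^2 * Q om / 2))) \<partial>M)"
  by (rule nn_integral_liminf) measurable
 also have "... \<le> liminf (\<lambda>n. \<integral>\<^sup>+om. ennreal (Q om) \<partial>M)" by (intro Liminf_mono always_eventually allI step) simp
 finally show ?thesis by (simp add: Liminf_const)
qed

end

section \<open>Moments of Brownian increments\<close>

lemma Int_stable_vimage_sets: "Int_stable {f -` A \<inter> S | A. A \<in> sets N}"
proof (rule Int_stableI)
 fix a b assume "a \<in> {f -` A \<inter> S | A. A \<in> sets N}" "b \<in> {f -` A \<inter> S | A. A \<in> sets N}"
 then obtain A B where "a = f -` A \<inter> S" "b = f -` B \<inter> S" "A \<in> sets N" "B \<in> sets N" by blast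
 hence "a \<inter> b = f -` (A \<inter> B) \<inter> S" "A \<inter> B \<in> sets N" by auto
 thus "a \<inter> b \<in> {f -` A \<inter> S | A. A \<in> sets N}" by blast
qed

context prob_space
begin

text \<open>All moments are squeezed out of the Laplace transform by elementary inequalities instead
  of differentiation under the integral. The bound on the fourth moment is crude, but its order
  \<open>q^2\<close> is what matters later.\<close>

lemma gaussian_moments:
 assumes S [measurable]: "S \<in> borel_measurable M" and q: "q > 0"
  and exp: "\<And>c. (EE M (\<lambda>om. exp (c * S om - c^2 * q / 2))) = 1"
 shows "integrable M S" "expectation S = 0" "integrable M (\<lambda>om. (S om)^2)" "expectation (\<lambda>om. (S om)^2) = q"
  "integrable M (\<lambda>om. (S om) ^ 4)" "expectation (\<lambda>om. (S om) ^ 4) \<le> 48 * q^2"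
proof -
 have mgf: "has_bochner_integral M (\<lambda>om. exp (c * S om)) (exp (c^2 * q / 2))" for c
 proof (rule has_bochner_integral_nn_integral)
  have "(EE M (\<lambda>om. exp (c * S om))) = (\<integral>\<^sup>+om. ennreal (exp (c^2 * q / 2)) * ennreal (exp (c * S om - c^2 * q / 2)) \<partial>M)"
   by (simp add: ennreal_mult'[symmetric] exp_diff)
  also have "... = ennreal (exp (c^2 * q / 2))" by (subst nn_integral_cmult) (auto simp: exp)
  finally show "(EE M (\<lambda>om. exp (c * S om))) = ennreal (exp (c^2 * q / 2))" .
 qed auto
 have cosh: "has_bochner_integral M (\<lambda>om. cosh (c * S om)) (exp (c^2 * q / 2))" for c
  using has_bochner_integral_divide_zero[OF has_bochner_integral_add[OF mgf[of c] mgf[of "-c"]], of 2] by (simp add: cosh_def)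
 have cosh_int: "integrable M (\<lambda>om. cosh (c * S om))" and cosh_E: "expectation (\<lambda>om. cosh (c * S om)) = exp (c^2 * q / 2)" for c
  using cosh[of c] by (auto simp: has_bochner_integral_iff)
 have mgf_int: "integrable M (\<lambda>om. exp (c * S om))" and mgf_E: "expectation (\<lambda>om. exp (c * S om)) = exp (c^2 * q / 2)" for c
  using mgf[of c] by (auto simp: has_bochner_integral_iff)
 have S2_le: "(S om)^2 \<le> 2 * cosh (1 * S om)" for om using one_plus_square_le_cosh[of "S om"] by simp
 show S2: "integrable M (\<lambda>om. (S om)^2)" by (rule Bochner_Integration.integrable_bound[OF integrable_mult_right[OF cosh_int[of 1], of 2]])
    (use S2_le in \<open>auto intro!: AE_I2\<close>)
 show S1: "integrable M S" using S2 by (rule square_integrable_imp_integrable[rotated]) simp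
 show S4: "integrable M (\<lambda>om. (S om) ^ 4)"
  by (rule Bochner_Integration.integrable_bound[OF integrable_mult_right[OF cosh_int[of 1], of 24]])
    (use quartic_le_cosh in \<open>auto intro!: AE_I2\<close>)
 show "expectation (\<lambda>om. (S om) ^ 4) \<le> 48 * q^2"
 proof -
  \<comment> \<open>Scaling to unit variance turns the expected hyperbolic cosine into
    \<open>exp (1/2)\<close>, which is below 2; with the 24 of \<open>quartic_le_cosh\<close> this
    makes 48.\<close>
  define c where "c = 1 / sqrt q"
  have c: "c^2 = 1 / q" "c ^ 4 = 1 / q^2" using q by (simp_all add: c_def power_divide power4_eq_xxxx power2_eq_square) 
  have "expectation (\<lambda>om. (S om) ^ 4) \<le> expectation (\<lambda>om. 24 * q^2 * cosh (c * S om))"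
  proof (intro integral_mono S4 integrable_mult_right cosh_int)
   fix om
   have "c ^ 4 * (S om) ^ 4 \<le> 24 * cosh (c * S om)" using quartic_le_cosh[of "c * S om"] by (simp add: power_mult_distrib)
   thus "(S om) ^ 4 \<le> 24 * q^2 * cosh (c * S om)" using q unfolding c by (simp add: field_simps)
  qed
  also have "... = 24 * q^2 * exp (1/2)" using q by (simp add: cosh_E c)
  also have "... \<le> 24 * q^2 * 2"
  proof (intro mult_left_mono)
   have "exp (1/2 :: real) \<le> exp (ln 2)" by (subst exp_le_cancel_iff) (use ln2_ge_two_thirds in simp)
   thus "exp (1/2 :: real) \<le> 2" by simp
  qed simp
  finally show ?thesis by simp
 qed
 \<comment> \<open>Both signs of \<open>c\<close> are used below: dividing by \<open>c\<close> and
   letting it tend to zero bounds the mean from either side by zero.\<close>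
 have le: "1 + c * expectation S \<le> exp (c^2 * q / 2)" for c
 proof -
  have "1 + c * expectation S = expectation (\<lambda>om. 1 + c * S om)" using S1 by (simp add: prob_space)
  also have "... \<le> expectation (\<lambda>om. exp (c * S om))" using S1 mgf_int by (intro integral_mono) auto
  finally show ?thesis by (simp add: mgf_E)
 qed
 have lim: "((\<lambda>c. (exp (c^2 * q / 2) - 1) / c) \<longlongrightarrow> 0) (at_right 0)" by real_asymp
 have one: "s * expectation S \<le> 0" if s: "s^2 = 1" for s
 proof (rule tendsto_lowerbound[OF lim])
  show "\<forall>\<^sub>F c in at_right 0. s * expectation S \<le> (exp (c^2 * q / 2) - 1) / c" using eventually_at_right_less[of 0]
  proof eventually_elim
   case (elim c)
   thus ?case using le[of "c * s"] s by (simp add: power_mult_distrib field_simps)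
  qed
 qed simp
 show "expectation S = 0" using one[of 1] one[of "-1"] by simp
 have "expectation (\<lambda>om. (S om)^2) \<le> q"
 proof -
  have "(EE M (\<lambda>om. (S om)^2)) \<le> (\<integral>\<^sup>+om. ennreal q \<partial>M)" using q exp by (intro second_moment_le) auto
  hence "ennreal (expectation (\<lambda>om. (S om)^2)) \<le> ennreal q" using S2 by (simp add: nn_integral_eq_integral emeasure_space_1)
  thus ?thesis using q by simp
 qed
 moreover have "q \<le> expectation (\<lambda>om. (S om)^2)"
 proof -
  define K where "K = expectation (\<lambda>om. cosh (2 * S om))"
  have bound: "cosh (c * S om) \<le> 1 + c^2 * (S om)^2 / 2 + c ^ 4 * (2 * (1 + cosh (2 * S om)))" if c: "0 < c" "c \<le> 1" for c om
  proof -
   have "cosh (c * S om) \<le> 1 + (c * S om)^2 / 2 + (c * S om) ^ 4 * cosh (c * S om) / 12" by (rule cosh_le_quartic)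
   also have "(c * S om) ^ 4 * cosh (c * S om) / 12 = c ^ 4 * ((S om) ^ 4 * cosh (c * S om) / 12)" by (simp add: power_mult_distrib)
   also have "... \<le> c ^ 4 * (24 * cosh (S om) * cosh (S om) / 12)"
   proof (intro mult_left_mono divide_right_mono mult_mono quartic_le_cosh)
    have "cosh \<bar>c * S om\<bar> \<le> cosh \<bar>S om\<bar>" using c by (subst cosh_real_nonneg_le_iff) (auto simp: abs_mult mult_left_le_one_le)
    thus "cosh (c * S om) \<le> cosh (S om)" by (simp add: cosh_real_abs)
   qed auto
   also have "... \<le> c ^ 4 * (2 * (1 + cosh (2 * S om)))"
    using cosh_double_cosh[of "S om"] by (intro mult_left_mono) (auto simp: power2_eq_square)
   finally show ?thesis by (simp add: power_mult_distrib)
  qed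
  have le: "(exp (c^2 * q / 2) - 1) / c^2 * 2 \<le> expectation (\<lambda>om. (S om)^2) + 4 * c^2 * (1 + K)" if c: "0 < c" "c \<le> 1" for c
  proof -
   have "exp (c^2 * q / 2) \<le> expectation (\<lambda>om. 1 + c^2 * (S om)^2 / 2 + c ^ 4 * (2 * (1 + cosh (2 * S om))))"
    unfolding cosh_E[symmetric] using S2 cosh_int by (intro integral_mono bound[OF c]) auto
   also have "... = 1 + c^2 * expectation (\<lambda>om. (S om)^2) / 2 + c ^ 4 * (2 * (1 + K))"
    using S2 cosh_int[of 2] by (simp add: K_def prob_space)
   finally have "exp (c^2 * q / 2) - 1 \<le> c^2 * (expectation (\<lambda>om. (S om)^2) + 4 * c^2 * (1 + K)) / 2"
    by (simp add: algebra_simps power4_eq_xxxx power2_eq_square)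
   thus ?thesis using c by (simp add: field_simps)
  qed
  \<comment> \<open>The transform of the hyperbolic cosine, divided by \<open>c^2\<close>, has limit
    \<open>q\<close> up to the factor absorbed here, while the quartic error is of order
    \<open>c^2\<close>.\<close>
  have lim: "((\<lambda>c. (exp (c^2 * q / 2) - 1) / c^2 * 2 - 4 * c^2 * (1 + K)) \<longlongrightarrow> q) (at_right 0)" by real_asymp
  show ?thesis
  proof (rule tendsto_upperbound[OF lim])
   have "\<forall>\<^sub>F c :: real in at_right 0. c < 1" by (rule eventually_at_rightI[of 0 1]) auto
   thus "\<forall>\<^sub>F c in at_right 0. (exp (c^2 * q / 2) - 1) / c^2 * 2 - 4 * c^2 * (1 + K) \<le> expectation (\<lambda>om. (S om)^2)"
    using eventually_at_right_less[of 0] by eventually_elim (use le in \<open>auto simp: algebra_simps\<close>)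
  qed simp
 qed
 ultimately show "expectation (\<lambda>om. (S om)^2) = q" by simp
qed

end

context filtered_brownian
begin

lemma increment_moments_inner:
 assumes st: "0 \<le> s" "s < t" and v: "v \<noteq> 0"
 defines "S \<equiv> \<lambda>om. v \<bullet> (W t om - W s om)"
 shows "integrable M S" "expectation S = 0" "integrable M (\<lambda>om. (S om)^2)" "expectation (\<lambda>om. (S om)^2) = (norm v)^2 * (t - s)"
  "integrable M (\<lambda>om. (S om) ^ 4)" "expectation (\<lambda>om. (S om) ^ 4) \<le> 48 * ((norm v)^2 * (t - s))^2"
proof -
 have [measurable]: "W s \<in> borel_measurable M" "W t \<in> borel_measurable M" using st by (auto intro: W_meas)
 have meas: "S \<in> borel_measurable M" unfolding S_def by measurable
 have q: "(norm v)^2 * (t - s) > 0" using st v by simp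
 have exp: "(EE M (\<lambda>om. exp (c * S om - c^2 * ((norm v)^2 * (t - s)) / 2))) = 1" for c
  using exp_increment[of s t "\<lambda>_. 1" "\<lambda>_. c *\<^sub>R v"] st by (simp add: S_def emeasure_space_1 power_mult_distrib mult.assoc)
 show "integrable M S" "expectation S = 0" "integrable M (\<lambda>om. (S om)^2)" "expectation (\<lambda>om. (S om)^2) = (norm v)^2 * (t - s)"
  "integrable M (\<lambda>om. (S om) ^ 4)" "expectation (\<lambda>om. (S om) ^ 4) \<le> 48 * ((norm v)^2 * (t - s))^2"
  by (rule gaussian_moments[OF meas q exp])+
qed

text \<open>Coordinates are inner products with unit vectors; mixed moments follow by polarization
  with the sum of two of them.\<close>

lemma increment_moments:
 assumes st: "0 \<le> s" "s < t"
 shows "integrable M (\<lambda>om. (W t om - W s om) $ j)" "expectation (\<lambda>om. (W t om - W s om) $ j) = 0"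
  "integrable M (\<lambda>om. (W t om - W s om) $ j * (W t om - W s om) $ k)"
  "expectation (\<lambda>om. (W t om - W s om) $ j * (W t om - W s om) $ k) = (if j = k then t - s else 0)"
  "integrable M (\<lambda>om. ((W t om - W s om) $ j) ^ 4)" "expectation (\<lambda>om. ((W t om - W s om) $ j) ^ 4) \<le> 48 * (t - s)^2"
proof -
 let ?Z = "\<lambda>j om. (W t om - W s om) $ j"
 have nz: "axis j (1::real) \<noteq> 0" for j :: 'd by (simp add: axis_eq_0_iff)
 note 1 = increment_moments_inner[OF st nz, simplified inner_axis' norm_axis_1 real_norm_def, simplified]
 show "integrable M (?Z j)" "expectation (?Z j) = 0" "integrable M (\<lambda>om. (?Z j om) ^ 4)" "expectation (\<lambda>om. (?Z j om) ^ 4) \<le> 48 * (t - s)^2"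
  using 1[of j] by simp_all
 have sq: "integrable M (\<lambda>om. (?Z j om)^2)" "expectation (\<lambda>om. (?Z j om)^2) = t - s" for j using 1[of j] by simp_all
 have "integrable M (\<lambda>om. ?Z j om * ?Z k om) \<and> expectation (\<lambda>om. ?Z j om * ?Z k om) = (if j = k then t - s else 0)"
 proof (cases "j = k")
  case True
  thus ?thesis using sq[of k] by (simp add: power2_eq_square)
 next
  case False
  let ?v = "axis j 1 + axis k 1 :: real^'d"
  have v: "(norm ?v)^2 = 2" using False by (simp add: power2_norm_eq_inner inner_add_left inner_add_right inner_axis_axis)
  hence "?v \<noteq> 0" by auto
  note 2 = increment_moments_inner[OF st this, unfolded v inner_add_left inner_axis']
  have eq: "?Z j om * ?Z k om = ((?Z j om + ?Z k om)^2 - (?Z j om)^2 - (?Z k om)^2) / 2" for om by (simp add: power2_sum)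
  have "integrable M (\<lambda>om. (?Z j om + ?Z k om)^2)" "expectation (\<lambda>om. (?Z j om + ?Z k om)^2) = 2 * (t - s)" using 2(3,4) by simp_all
  thus ?thesis unfolding eq using sq False by (simp del: vector_minus_component)
 qed
 thus "integrable M (\<lambda>om. ?Z j om * ?Z k om)" "expectation (\<lambda>om. ?Z j om * ?Z k om) = (if j = k then t - s else 0)" by auto
qed

text \<open>Factors known at time \<open>s\<close> and functions of the increment generate
  subfamilies of two independent families of events, so expectations multiply.\<close>

lemma expectation_past_increment:
 fixes c :: "'w \<Rightarrow> real" and \<phi> :: "real^'d \<Rightarrow> real"
 assumes st: "0 \<le> s" "s < t" and c: "c \<in> borel_measurable (\<F> s)" and \<phi> [measurable]: "\<phi> \<in> borel_measurable borel"
  and int: "integrable M c" "integrable M (\<lambda>om. \<phi> (W t om - W s om))"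
 shows "integrable M (\<lambda>om. c om * \<phi> (W t om - W s om))"
  "expectation (\<lambda>om. c om * \<phi> (W t om - W s om)) = expectation c * expectation (\<lambda>om. \<phi> (W t om - W s om))"
proof -
 let ?Z = "\<lambda>om. W t om - W s om"
 have Z: "?Z \<in> borel_measurable M" using st by (intro borel_measurable_diff W_meas) auto
 have indep: "indep_set (sets (\<F> s)) {?Z -` B \<inter> space M | B. B \<in> sets borel}" using brownian st by (auto simp: brownian_motion_def)
 have "indep_var borel c borel (\<lambda>om. \<phi> (?Z om))" unfolding indep_var_eq
 proof (intro conjI indep_set_sigma_sets)
  show "random_variable borel c" "random_variable borel (\<lambda>om. \<phi> (?Z om))" using int by (simp_all add: borel_measurable_integrable)
  have 1: "{c -` A \<inter> space M | A. A \<in> sets borel} \<subseteq> sets (\<F> s)" using measurable_sets[OF c] by auto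
  have 2: "{(\<lambda>om. \<phi> (?Z om)) -` A \<inter> space M | A. A \<in> sets borel} \<subseteq> {?Z -` B \<inter> space M | B. B \<in> sets borel}"
  proof safe
   fix A :: "real set" assume "A \<in> sets borel"
   hence "\<phi> -` A \<in> sets borel" using measurable_sets[OF \<phi>, of A] by simp
   moreover have "(\<lambda>om. \<phi> (?Z om)) -` A \<inter> space M = ?Z -` (\<phi> -` A) \<inter> space M" by auto
   ultimately show "\<exists>B. (\<lambda>om. \<phi> (?Z om)) -` A \<inter> space M = ?Z -` B \<inter> space M \<and> B \<in> sets borel" by blast
  qed
  show "indep_set {c -` A \<inter> space M | A. A \<in> sets borel} {(\<lambda>om. \<phi> (?Z om)) -` A \<inter> space M | A. A \<in> sets borel}"
   using indep 1 2 unfolding indep_sets2_eq by (meson subset_iff)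
  show "Int_stable {c -` A \<inter> space M | A. A \<in> sets borel}" by (rule Int_stable_vimage_sets)
  show "Int_stable {(\<lambda>om. \<phi> (?Z om)) -` A \<inter> space M | A. A \<in> sets borel}" by (rule Int_stable_vimage_sets)
 qed
 from indep_var_integrable[OF this int] indep_var_lebesgue_integral[OF this int]
 show "integrable M (\<lambda>om. c om * \<phi> (?Z om))" "expectation (\<lambda>om. c om * \<phi> (?Z om)) = expectation c * expectation (\<lambda>om. \<phi> (?Z om))"
  by auto
qed

end

section \<open>Weighted sums of increments of the integral\<close>

lemma continuous_on_vector_matrix_mult [continuous_intros]:
 fixes f :: "'a::topological_space \<Rightarrow> real^'n^'m"
 assumes "continuous_on S f" "continuous_on S g"
 shows "continuous_on S (\<lambda>x. g x v* f x)" unfolding vector_matrix_mult_def by (intro continuous_intros assms)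

lemma borel_measurable_vec_nth:
 fixes f :: "'a \<Rightarrow> ('b::topological_space)^'n"
 assumes "f \<in> borel_measurable M"
 shows "(\<lambda>x. f x $ k) \<in> borel_measurable M"
 using borel_measurable_continuous_on[OF _ assms, of "\<lambda>v. v $ k"] by (simp add: continuous_on_component)

lemma norm_vec_square: "(norm (x :: real^'n))^2 = (\<Sum>i\<in>UNIV. (x $ i)^2)" by (simp add: norm_vec_def L2_set_def sum_nonneg)

lemma norm_transpose_axis_square:
 fixes A :: "real^'a^'b"
 shows "(\<Sum>k\<in>UNIV. (norm (transpose A *v axis k 1))^2) = (norm A)^2"
proof -
 have "transpose A *v axis k 1 = A $ k" for k by (simp add: vec_eq_iff matrix_vector_mult_basis column_def transpose_def del: transpose_matrix_vector)
 thus ?thesis by (simp add: norm_vec_def L2_set_def sum_nonneg)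
qed

context ito_process
begin

lemma QV_scale: "QV a b (c *\<^sub>R u) (c *\<^sub>R w) om = c^2 * QV a b u w om"
proof -
 have "transpose (H s om) *v (c *\<^sub>R u) + c *\<^sub>R w = c *\<^sub>R (transpose (H s om) *v u + w)" for s
  by (simp only: scaleR_right_distrib matrix_vector_mult_scaleR)
 hence "(norm (transpose (H s om) *v (c *\<^sub>R u) + c *\<^sub>R w))^2 = c^2 * (norm (transpose (H s om) *v u + w))^2" for s
  by (simp add: power_mult_distrib)
 thus ?thesis unfolding QV_def by simp
qed

text \<open>Increments of \<open>I\<close> and \<open>W\<close> are kept together because the error
  of freezing an integrand is a difference of the two.\<close>

definition ito_sum :: "(nat \<Rightarrow> real) \<Rightarrow> (nat \<Rightarrow> 'w \<Rightarrow> real^'k) \<Rightarrow> (nat \<Rightarrow> 'w \<Rightarrow> real^'d) \<Rightarrow> nat \<Rightarrow> 'w \<Rightarrow> real" where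
 "ito_sum t u w i om = u i om \<bullet> (I (t (Suc i)) om - I (t i) om) + w i om \<bullet> (W (t (Suc i)) om - W (t i) om)"

definition ito_QV :: "(nat \<Rightarrow> real) \<Rightarrow> (nat \<Rightarrow> 'w \<Rightarrow> real^'k) \<Rightarrow> (nat \<Rightarrow> 'w \<Rightarrow> real^'d) \<Rightarrow> nat \<Rightarrow> 'w \<Rightarrow> real" where
 "ito_QV t u w i om = QV (t i) (t (Suc i)) (u i om) (w i om) om"

context
 fixes t :: "nat \<Rightarrow> real" and N :: nat and u :: "nat \<Rightarrow> 'w \<Rightarrow> real^'k" and w :: "nat \<Rightarrow> 'w \<Rightarrow> real^'d"
 assumes t: "0 \<le> t 0" "\<And>i. i < N \<Longrightarrow> t i \<le> t (Suc i)"
  and u: "\<And>i. i < N \<Longrightarrow> u i \<in> borel_measurable (\<F> (t i))" and w: "\<And>i. i < N \<Longrightarrow> w i \<in> borel_measurable (\<F> (t i))"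
begin

lemma t_nonneg: "i \<le> N \<Longrightarrow> 0 \<le> t i" using grid_mono[where f=t and n=N and p=0 and q=i] t by fastforce

lemma ito_sum_meas:
 assumes "i < N" shows "ito_sum t u w i \<in> borel_measurable M"
proof -
 have [measurable]: "u i \<in> borel_measurable M" "w i \<in> borel_measurable M"
  using measurable_F_M[OF u[OF assms]] measurable_F_M[OF w[OF assms]] .
 have [measurable]: "I (t i) \<in> borel_measurable M" "I (t (Suc i)) \<in> borel_measurable M"
   "W (t i) \<in> borel_measurable M" "W (t (Suc i)) \<in> borel_measurable M"
  using t_nonneg[of i] t_nonneg[of "Suc i"] assms by (simp_all add: I_meas W_meas)
 show ?thesis unfolding ito_sum_def by measurable
qed

lemma ito_QV_meas: "i < N \<Longrightarrow> ito_QV t u w i \<in> borel_measurable M" unfolding ito_QV_def[abs_def] using t_nonneg[of i]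
 by (intro QV_meas measurable_F_M[OF u] measurable_F_M[OF w]) auto

text \<open>Individual factors for the cells feed the averaging over signs and so control sums of
  squares; a common factor controls the whole sum.\<close>

lemma exp_ito_scaled:
 "(EE M (\<lambda>om. exp ((\<Sum>i<N. c i * ito_sum t u w i om) - (\<Sum>i<N. (c i)^2 * ito_QV t u w i om) / 2))) \<le> 1"
proof -
 have "(EE M (\<lambda>om. exp ((\<Sum>i<N. (c i *\<^sub>R u i om) \<bullet> (I (t (Suc i)) om - I (t i) om) + (c i *\<^sub>R w i om) \<bullet> (W (t (Suc i)) om - W (t i) om))
   - (\<Sum>i<N. QV (t i) (t (Suc i)) (c i *\<^sub>R u i om) (c i *\<^sub>R w i om) om) / 2))) \<le> 1"
  by (rule exp_ito[OF t]) (auto intro: borel_measurable_scaleR u w)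
 thus ?thesis unfolding QV_scale ito_sum_def ito_QV_def by (simp add: distrib_left)
qed

lemma exp_ito_scaled_const:
 "(EE M (\<lambda>om. exp (c * (\<Sum>i<N. ito_sum t u w i om) - c^2 * (\<Sum>i<N. ito_QV t u w i om) / 2))) \<le> 1"
 using exp_ito_scaled[of "\<lambda>_. c"] by (simp add: sum_distrib_left)

lemma ito_sums_meas: "(\<lambda>om. \<Sum>i<N. ito_sum t u w i om) \<in> borel_measurable M" "(\<lambda>om. \<Sum>i<N. ito_QV t u w i om) \<in> borel_measurable M"
 by (auto intro!: borel_measurable_sum ito_sum_meas ito_QV_meas)

lemma ito_tail:
 assumes "a > 0" "v > 0"
 shows "prob {om \<in> space M. a \<le> \<bar>\<Sum>i<N. ito_sum t u w i om\<bar> \<and> (\<Sum>i<N. ito_QV t u w i om) \<le> v} \<le> 2 * exp (- (a^2 / (2 * v)))"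
 by (rule exp_tail[OF ito_sums_meas exp_ito_scaled_const assms])

lemma ito_sum_square_tail:
 assumes "a > 0" "v > 0"
 shows "prob {om \<in> space M. a \<le> (\<Sum>i<N. (ito_sum t u w i om)^2) \<and> (\<Sum>i<N. ito_QV t u w i om) \<le> v} \<le> exp 1 * v / a"
 by (rule sum_square_tail[OF _ _ _ exp_ito_scaled assms]) (auto intro: ito_sum_meas ito_QV_meas)

lemma ito_second_moment: "(EE M (\<lambda>om. (\<Sum>i<N. ito_sum t u w i om)^2)) \<le> (EE M (\<lambda>om. \<Sum>i<N. ito_QV t u w i om))"
 by (rule second_moment_le[OF ito_sums_meas _ exp_ito_scaled_const]) (auto intro!: sum_nonneg simp: ito_QV_def QV_nonneg)

end

text \<open>Coordinatewise second moments, summed over the unit vectors: the squared rows of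
  \<open>H\<close> add up to its squared norm. Only this half of the isometry is used.\<close>

lemma ito_isometry_le:
 assumes ab: "0 \<le> a" "a \<le> b"
 shows "(EE M (\<lambda>om. (norm (I b om - I a om))^2)) \<le> (EE M (\<lambda>om. LBINT s:{a..b}. (norm (H s om))^2))"
proof -
 let ?t = "\<lambda>i::nat. if i = 0 then a else b"
 have Im [measurable]: "I a \<in> borel_measurable M" "I b \<in> borel_measurable M" using ab by (auto intro: I_meas)
 have one: "(EE M (\<lambda>om. ((I b om - I a om) $ k)^2)) \<le> (EE M (\<lambda>om. QV a b (axis k 1) 0 om))" for k
  using ito_second_moment[of ?t 1 "\<lambda>_ _. axis k 1" "\<lambda>_ _. 0"] ab by (simp add: ito_sum_def ito_QV_def inner_axis')
 have "(EE M (\<lambda>om. (norm (I b om - I a om))^2)) = (\<integral>\<^sup>+om. (\<Sum>k\<in>UNIV. ennreal (((I b om - I a om) $ k)^2)) \<partial>M)"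
  by (intro nn_integral_cong) (simp add: norm_vec_square sum_ennreal del: vector_minus_component)
 also have "... = (\<Sum>k\<in>UNIV. \<integral>\<^sup>+om. ennreal (((I b om - I a om) $ k)^2) \<partial>M)"
  by (rule nn_integral_sum) (intro measurable_compose[OF _ measurable_ennreal] borel_measurable_power
    borel_measurable_vec_nth borel_measurable_diff Im)
 also have "... \<le> (\<Sum>k\<in>UNIV. \<integral>\<^sup>+om. ennreal (QV a b (axis k 1) 0 om) \<partial>M)" by (intro sum_mono one)
 also have "... = (\<integral>\<^sup>+om. (\<Sum>k\<in>UNIV. ennreal (QV a b (axis k 1) 0 om)) \<partial>M)"
  by (rule nn_integral_sum[symmetric]) (use QV_meas[OF ab(1), of "\<lambda>_. axis _ 1" "\<lambda>_. 0"] in measurable)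
 also have "... = (EE M (\<lambda>om. LBINT s:{a..b}. (norm (H s om))^2))"
 proof (rule nn_integral_cong)
  fix om assume om: "om \<in> space M"
  have "(\<Sum>k\<in>UNIV. ennreal (QV a b (axis k 1) 0 om)) = ennreal (\<Sum>k\<in>UNIV. QV a b (axis k 1) 0 om)"
   by (simp add: sum_ennreal QV_nonneg)
  also have "(\<Sum>k\<in>UNIV. QV a b (axis k 1) 0 om) = (LBINT s:{a..b}. (\<Sum>k\<in>UNIV. (norm (transpose (H s om) *v axis k 1 + 0))^2))"
   unfolding QV_def set_lebesgue_integral_def scaleR_sum_right by (rule Bochner_Integration.integral_sum[symmetric])
     (rule borel_integrable_atLeastAtMost'[OF continuous_on_QV_integrand[OF om ab(1)], unfolded set_integrable_def])
  finally show "(\<Sum>k\<in>UNIV. ennreal (QV a b (axis k 1) 0 om)) = ennreal (LBINT s:{a..b}. (norm (H s om))^2)"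
   by (simp only: add_0_right norm_transpose_axis_square)
 qed
 finally show ?thesis .
qed

text \<open>Each coordinate of the freezing error is an \<open>ito_sum\<close> with weights
  \<open>axis k 1\<close> and \<open>- (transpose (A i) *v axis k 1)\<close>, and its quadratic
  variation is governed by \<open>H - A i\<close>. The squared dimension arises from splitting
  \<open>a\<close> among the coordinates and then adding their probabilities.\<close>

lemma ito_increment_error_tail:
 fixes A :: "nat \<Rightarrow> 'w \<Rightarrow> real^'d^'k"
 assumes t: "0 \<le> t 0" "\<And>i. i < N \<Longrightarrow> t i \<le> t (Suc i)"
  and A: "\<And>i. i < N \<Longrightarrow> A i \<in> borel_measurable (\<F> (t i))" and a: "a > 0" and v: "v > 0"
 shows "prob {om \<in> space M. a \<le> (\<Sum>i<N. (norm (I (t (Suc i)) om - I (t i) om - A i om *v (W (t (Suc i)) om - W (t i) om)))^2)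
    \<and> (\<Sum>i<N. LBINT s:{t i..t (Suc i)}. (norm (H s om - A i om))^2) \<le> v} \<le> exp 1 * (real CARD('k))^2 * v / a"
proof -
 let ?J = "\<lambda>i om. I (t (Suc i)) om - I (t i) om - A i om *v (W (t (Suc i)) om - W (t i) om)"
 let ?u = "\<lambda>k i om. axis k 1 :: real^'k" and ?w = "\<lambda>k i om. - (transpose (A i om) *v axis k 1) :: real^'d"
 let ?y = "\<lambda>k i om. ito_sum t (?u k) (?w k) i om"
 let ?q = "\<lambda>k i om. ito_QV t (?u k) (?w k) i om"
 let ?V = "\<lambda>om. \<Sum>i<N. LBINT s:{t i..t (Suc i)}. (norm (H s om - A i om))^2"
 let ?E = "\<lambda>k. {om \<in> space M. a / CARD('k) \<le> (\<Sum>i<N. (?y k i om)^2) \<and> (\<Sum>i<N. ?q k i om) \<le> v}"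
 let ?A = "{om \<in> space M. a \<le> (\<Sum>i<N. (norm (?J i om))^2) \<and> ?V om \<le> v}"
 have u: "?u k i \<in> borel_measurable (\<F> (t i))" for k i by simp
 have w: "?w k i \<in> borel_measurable (\<F> (t i))" if "i < N" for k i
  by (intro borel_measurable_uminus borel_measurable_transpose_mult A[OF that]) simp
 have t_nn: "0 \<le> t i" if "i \<le> N" for i using grid_mono[where f=t and n=N and p=0 and q=i] t that by fastforce
 have y: "?y k i om = ?J i om $ k" for k i om using inner_mult_transpose[of "axis k 1" "A i om" "W (t (Suc i)) om - W (t i) om"]
  by (simp add: ito_sum_def inner_axis')
 have q: "(\<Sum>i<N. ?q k i om) \<le> ?V om" if om: "om \<in> space M" for k om
 proof (rule sum_mono)
  fix i assume "i \<in> {..<N}"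
  hence i: "0 \<le> t i" using t_nn by auto
  have cont: "continuous_on {t i..t (Suc i)} (\<lambda>s. H s om)" by (rule continuous_on_subset[OF H_cont[OF om]]) (use i in auto)
  show "?q k i om \<le> (LBINT s:{t i..t (Suc i)}. (norm (H s om - A i om))^2)" unfolding ito_QV_def QV_def
  proof (rule set_integral_mono)
   fix s
   have "transpose (H s om) *v axis k 1 + - (transpose (A i om) *v axis k 1) = transpose (H s om - A i om) *v axis k 1"
    by (simp add: vec_eq_iff matrix_vector_mult_def transpose_def algebra_simps sum_subtractf)
   thus "(norm (transpose (H s om) *v axis k 1 + - (transpose (A i om) *v axis k 1)))^2 \<le> (norm (H s om - A i om))^2"
    using norm_transpose_mult_le[of "H s om - A i om" "axis k (1::real)"] by (auto intro: power_mono)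
  qed (auto intro!: borel_integrable_atLeastAtMost' continuous_intros cont)
 qed
 have meas: "?E k \<in> sets M" for k
 proof -
  have [measurable]: "(\<lambda>om. \<Sum>i<N. (?y k i om)^2) \<in> borel_measurable M"
   by (intro borel_measurable_sum borel_measurable_power ito_sum_meas[where N=N]) (use t u w in auto)
  have [measurable]: "(\<lambda>om. \<Sum>i<N. ?q k i om) \<in> borel_measurable M"
   by (intro borel_measurable_sum ito_QV_meas[where N=N]) (use t u w in auto)
  show ?thesis by measurable
 qed
 have "prob ?A
  \<le> prob (\<Union>k\<in>UNIV. ?E k)"
 proof (rule finite_measure_mono)
  show "?A
   \<subseteq> (\<Union>k\<in>UNIV. ?E k)"
  proof
   fix om assume "om \<in> ?A"
   hence om: "om \<in> space M" "a \<le> (\<Sum>i<N. (norm (?J i om))^2)" "?V om \<le> v" by auto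
   have "(\<Sum>i<N. (norm (?J i om))^2) = (\<Sum>k\<in>UNIV. \<Sum>i<N. (?y k i om)^2)" unfolding y norm_vec_square by (rule sum.swap)
   hence sum: "(\<Sum>k\<in>(UNIV::'k set). a / CARD('k)) \<le> (\<Sum>k\<in>UNIV. \<Sum>i<N. (?y k i om)^2)" using om(2) by simp
   \<comment> \<open>Pigeonhole: if the total reaches \<open>a\<close>, some coordinate reaches its
     equal share.\<close>
   have "\<exists>k. a / CARD('k) \<le> (\<Sum>i<N. (?y k i om)^2)"
   proof (rule ccontr)
    assume "\<not> (\<exists>k. a / CARD('k) \<le> (\<Sum>i<N. (?y k i om)^2))"
    hence "(\<Sum>k\<in>UNIV. \<Sum>i<N. (?y k i om)^2) < (\<Sum>k\<in>(UNIV::'k set). a / CARD('k))" by (intro sum_strict_mono) (auto simp: not_le)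
    with sum show False by simp
   qed
   thus "om \<in> (\<Union>k\<in>UNIV. ?E k)"
    using om order_trans[OF q[OF om(1)] om(3)] by blast
  qed
 qed (use meas in auto)
 also have "... \<le> (\<Sum>k\<in>UNIV. prob (?E k))"
  by (rule finite_measure_subadditive_finite) (use meas in auto)
 also have "... \<le> (\<Sum>k\<in>(UNIV::'k set). exp 1 * v / (a / CARD('k)))" by (intro sum_mono ito_sum_square_tail) (use t u w a v in auto)
 also have "... = exp 1 * (real CARD('k))^2 * v / a" by (simp add: power2_eq_square)
 finally show ?thesis .
qed

end

section \<open>Taylor expansion of test functions\<close>

lemma inner_matrix_vector_mult_le:
 fixes A :: "real^'n^'m"
 shows "\<bar>u \<bullet> (A *v v)\<bar> \<le> norm u * (norm A * norm v)"
 using order_trans[OF Cauchy_Schwarz_ineq2 mult_left_mono[OF norm_matrix_vector_mult_le norm_ge_zero]] .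

text \<open>Only the derivatives vanish far out; \<open>f\<close> itself may stay nonzero there, as
  truncated powers of \<open>V\<close> do.\<close>

locale c2_test_function =
 fixes f :: "real^'d \<Rightarrow> real" and g :: "real^'d \<Rightarrow> real^'d" and D :: "real^'d \<Rightarrow> real^'d^'d" and r :: real
 assumes f_deriv: "\<And>x. (f has_derivative (\<lambda>h. g x \<bullet> h)) (at x)"
  and g_deriv: "\<And>x. (g has_derivative (\<lambda>h. D x *v h)) (at x)"
  and D_cont: "continuous_on UNIV D"
  and supp: "\<And>x. r \<le> norm x \<Longrightarrow> g x = 0 \<and> D x = 0"
begin

lemma f_cont: "continuous_on UNIV f" by (intro continuous_at_imp_continuous_on ballI has_derivative_continuous[OF f_deriv])

lemma g_cont: "continuous_on UNIV g" by (intro continuous_at_imp_continuous_on ballI has_derivative_continuous[OF g_deriv])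

lemma supp_bounded:
 fixes h :: "real^'d \<Rightarrow> 'b::real_normed_vector"
 assumes "continuous_on UNIV h" "\<And>x. r \<le> norm x \<Longrightarrow> h x = 0"
 obtains B where "0 < B" "\<And>x. norm (h x) \<le> B"
proof -
 have "compact (h ` cball 0 r)" by (intro compact_continuous_image continuous_on_subset[OF assms(1)]) auto
 then obtain B where B: "0 < B" "\<And>x. x \<in> cball 0 r \<Longrightarrow> norm (h x) \<le> B"
  by (auto dest!: compact_imp_bounded simp: bounded_pos)
 have "norm (h x) \<le> B" for x using B(2)[of x] B(1) assms(2)[of x] by (cases "norm x \<le> r") auto
 with B(1) show ?thesis by (rule that)
qed

text \<open>Uniform continuity holds on the ball of radius \<open>r + 1\<close>. Since \<rho> is at
  most 1, a pair with a member outside that ball lies wholly beyond radius \<open>r\<close>, where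
  \<open>D\<close> is zero.\<close>

lemma D_uniform: 
 assumes "e > 0"
 obtains \<rho> where "0 < \<rho>" "\<rho> \<le> 1" "\<And>x y. norm (y - x) \<le> \<rho> \<Longrightarrow> norm (D y - D x) \<le> e"
proof -
 have "uniformly_continuous_on (cball 0 (r + 1)) D" by (intro compact_uniformly_continuous continuous_on_subset[OF D_cont]) auto
 from this[unfolded uniformly_continuous_on_def, rule_format, OF assms]
 obtain d where d: "d > 0"
  "\<And>x y. x \<in> cball 0 (r + 1) \<Longrightarrow> y \<in> cball 0 (r + 1) \<Longrightarrow> dist y x < d \<Longrightarrow> dist (D y) (D x) < e"
  by blast
 show ?thesis
 proof (rule that[of "min 1 (d / 2)"])
  fix x y :: "real^'d" assume xy: "norm (y - x) \<le> min 1 (d / 2)"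
  show "norm (D y - D x) \<le> e"
  proof (cases "x \<in> cball 0 (r + 1) \<and> y \<in> cball 0 (r + 1)")
   case True
   thus ?thesis using d(2)[of x y] xy d(1) by (auto simp: dist_norm)
  next
   case False
   have "norm x \<le> norm y + 1" "norm y \<le> norm x + 1"
    using xy norm_triangle_ineq2[of x y] norm_triangle_ineq2[of y x] by (auto simp: norm_minus_commute)
   hence "r \<le> norm x" "r \<le> norm y" using False by auto
   thus ?thesis using supp assms by simp
  qed
 qed (use d in auto)
qed

text \<open>Lagrange's form of the remainder for the restriction of \<open>f\<close> to the segment
  from \<open>x\<close> to \<open>y\<close>.\<close>

lemma second_order_mean_value:
 obtains \<xi> where "0 < \<xi>" "\<xi> < 1"
  "f y = f x + g x \<bullet> (y - x) + (y - x) \<bullet> (D (x + \<xi> *\<^sub>R (y - x)) *v (y - x)) / 2"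
proof -
 let ?h = "y - x"
 define diff where "diff m s = (if m = 0 then f (x + s *\<^sub>R ?h) else if m = 1 then g (x + s *\<^sub>R ?h) \<bullet> ?h
   else ?h \<bullet> (D (x + s *\<^sub>R ?h) *v ?h))" for m :: nat and s :: real
 have line: "((\<lambda>s. x + s *\<^sub>R ?h) has_derivative (\<lambda>s. s *\<^sub>R ?h)) (at s)" for s :: real
  by (auto intro!: derivative_eq_intros)
 have 0: "((\<lambda>s. f (x + s *\<^sub>R ?h)) has_derivative (\<lambda>s'. g (x + s *\<^sub>R ?h) \<bullet> (s' *\<^sub>R ?h))) (at s)" for s
  by (rule has_derivative_compose[OF line f_deriv])
 have "((\<lambda>s. g (x + s *\<^sub>R ?h)) has_derivative (\<lambda>s'. D (x + s *\<^sub>R ?h) *v (s' *\<^sub>R ?h))) (at s)" for s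
  by (rule has_derivative_compose[OF line g_deriv])
 from has_derivative_inner_left[OF this]
 have 1: "((\<lambda>s. g (x + s *\<^sub>R ?h) \<bullet> ?h) has_derivative (\<lambda>s'. (D (x + s *\<^sub>R ?h) *v (s' *\<^sub>R ?h)) \<bullet> ?h)) (at s)" for s .
 have "\<exists>t>0. t < 1 \<and> diff 0 1 = (\<Sum>m<2. diff m 0 / fact m * 1 ^ m) + diff 2 t / fact 2 * 1 ^ 2"
 proof (rule Maclaurin[where f="diff 0" and diff=diff])
  show "\<forall>m t. m < 2 \<and> 0 \<le> t \<and> t \<le> 1 \<longrightarrow> (diff m has_real_derivative diff (Suc m) t) (at t)"
  proof (intro allI impI)
   fix m :: nat and t :: real assume "m < 2 \<and> 0 \<le> t \<and> t \<le> 1"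
   hence "m = 0 \<or> m = 1" by auto
   thus "(diff m has_real_derivative diff (Suc m) t) (at t)"
   proof
    assume "m = 0"
    thus ?thesis using 0[of t] by (simp add: diff_def[abs_def] has_field_derivative_def mult.commute[of _ "_ \<bullet> _"] cong: if_cong)
   next
    assume "m = 1"
    moreover have "(D (x + t *\<^sub>R ?h) *v (s' *\<^sub>R ?h)) \<bullet> ?h = (?h \<bullet> (D (x + t *\<^sub>R ?h) *v ?h)) * s'" for s'
     by (simp only: matrix_vector_mult_scaleR inner_scaleR_left) (simp add: inner_commute)
    ultimately show ?thesis using 1[of t] by (simp add: diff_def[abs_def] has_field_derivative_def cong: if_cong)
   qed
  qed
 qed auto
 then obtain t where "t > 0" "t < 1" and "diff 0 1 = (\<Sum>m<2. diff m 0 / fact m * 1 ^ m) + diff 2 t / fact 2 * 1 ^ 2" by blast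
 thus ?thesis by (intro that[of t]) (auto simp: diff_def numeral_2_eq_2)
qed

text \<open>Replacing the Hessian at the intermediate point by the one at \<open>x\<close> costs at
  most \<kappa> times the squared distance. The cut-off near the support is kept because the
  increments can only be controlled where the diffusion coefficient is bounded.\<close>

lemma taylor_remainder:
 assumes "\<kappa> > 0"
 obtains \<rho> where "0 < \<rho>"
  "\<And>x y. norm (y - x) \<le> \<rho> \<Longrightarrow> \<bar>f y - f x - g x \<bullet> (y - x) - (y - x) \<bullet> (D x *v (y - x)) / 2\<bar>
    \<le> \<kappa> * (if norm x \<le> r + 1 then (norm (y - x))^2 else 0)"
proof -
 obtain \<rho> where \<rho>: "0 < \<rho>" "\<rho> \<le> 1" "\<And>x y. norm (y - x) \<le> \<rho> \<Longrightarrow> norm (D y - D x) \<le> \<kappa>"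
  using D_uniform[OF assms] by blast
 show ?thesis
 proof (rule that[OF \<rho>(1)])
  fix x y :: "real^'d" assume xy: "norm (y - x) \<le> \<rho>"
  obtain \<xi> where \<xi>: "0 < \<xi>" "\<xi> < 1"
   "f y = f x + g x \<bullet> (y - x) + (y - x) \<bullet> (D (x + \<xi> *\<^sub>R (y - x)) *v (y - x)) / 2" by (rule second_order_mean_value)
  let ?z = "x + \<xi> *\<^sub>R (y - x)"
  have z: "norm (?z - x) \<le> \<rho>" using \<xi> xy mult_left_le_one_le[of "norm (y - x)" \<xi>] by simp
  have "f y - f x - g x \<bullet> (y - x) - (y - x) \<bullet> (D x *v (y - x)) / 2 = (y - x) \<bullet> ((D ?z - D x) *v (y - x)) / 2"
   unfolding \<xi>(3) by (simp add: matrix_vector_mult_diff_rdistrib inner_diff_right field_simps)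
  also have "\<bar>...\<bar> \<le> norm (y - x) * (norm (D ?z - D x) * norm (y - x)) / 2"
   using inner_matrix_vector_mult_le[of "y - x" "D ?z - D x" "y - x"] by simp
  also have "... \<le> \<kappa> * (if norm x \<le> r + 1 then (norm (y - x))^2 else 0)"
  proof (cases "norm x \<le> r + 1")
   case True
   have "norm (D ?z - D x) \<le> \<kappa>" by (rule \<rho>(3)[OF z])
   hence "norm (D ?z - D x) * (norm (y - x))^2 \<le> \<kappa> * (norm (y - x))^2" by (intro mult_right_mono) auto
   moreover have "0 \<le> \<kappa> * (norm (y - x))^2" using assms by simp
   ultimately show ?thesis using True by (simp add: power2_eq_square mult.left_commute)
  next
   case False
   have "norm x \<le> norm ?z + 1" using z \<rho>(2) norm_triangle_ineq2[of x ?z] by (simp add: norm_minus_commute)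
   hence "D ?z = 0" "D x = 0" using False supp by auto
   thus ?thesis using False by simp
  qed
  finally show "\<bar>f y - f x - g x \<bullet> (y - x) - (y - x) \<bullet> (D x *v (y - x)) / 2\<bar>
    \<le> \<kappa> * (if norm x \<le> r + 1 then (norm (y - x))^2 else 0)" .
 qed
qed

end

section \<open>Uniform grids and limits of expectations\<close>

text \<open>\<open>Suc n\<close> cells rather than \<open>n\<close>, so that the mesh makes sense
  for every \<open>n\<close> and the last grid point has index \<open>Suc n\<close>.\<close>

definition unif_grid :: "real \<Rightarrow> nat \<Rightarrow> nat \<Rightarrow> real" where
 "unif_grid T n i = real i * (T / real (Suc n))"

lemma unif_grid_simps [simp]:
 "unif_grid T n 0 = 0" "unif_grid T n (Suc n) = T" by (simp_all add: unif_grid_def)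

lemma unif_grid_step: "unif_grid T n (Suc i) - unif_grid T n i = T / real (Suc n)" by (simp add: unif_grid_def algebra_simps add_divide_distrib)

lemma unif_grid_mono: "0 \<le> T \<Longrightarrow> i \<le> j \<Longrightarrow> unif_grid T n i \<le> unif_grid T n j"
 unfolding unif_grid_def by (intro mult_right_mono) auto

lemma unif_grid_range:
 assumes "0 \<le> T" "i < Suc n"
 shows "0 \<le> unif_grid T n i" "unif_grid T n i \<le> unif_grid T n (Suc i)" "unif_grid T n (Suc i) \<le> T"
 using unif_grid_mono[OF assms(1), of 0 i n] unif_grid_mono[OF assms(1), of i "Suc i" n]
  unif_grid_mono[OF assms(1), of "Suc i" "Suc n" n] assms by simp_all

lemma unif_grid_approx:
 fixes f :: "real \<Rightarrow> 'b::metric_space"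
 assumes T: "0 \<le> T" and f: "continuous_on {0..T} f" and e: "e > 0"
 shows "\<forall>\<^sub>F n in sequentially. \<forall>i<Suc n. \<forall>s\<in>{unif_grid T n i..unif_grid T n (Suc i)}. dist (f s) (f (unif_grid T n i)) \<le> e"
proof -
 have "uniformly_continuous_on {0..T} f" by (rule compact_uniformly_continuous[OF f]) simp
 from this[unfolded uniformly_continuous_on_def, rule_format, OF e] obtain d where d: "d > 0"
  "\<And>s s'. s \<in> {0..T} \<Longrightarrow> s' \<in> {0..T} \<Longrightarrow> dist s' s < d \<Longrightarrow> dist (f s') (f s) < e" by blast
 have "(\<lambda>n. T / real (Suc n)) \<longlonglongrightarrow> 0" by (rule LIMSEQ_Suc[OF lim_const_over_n])
 hence "\<forall>\<^sub>F n in sequentially. T / real (Suc n) < d" by (rule order_tendstoD) (rule d)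
 thus ?thesis
 proof eventually_elim
  case (elim n)
  show ?case
  proof (intro allI impI ballI)
   fix i s assume i: "i < Suc n" and s: "s \<in> {unif_grid T n i..unif_grid T n (Suc i)}"
   have "dist s (unif_grid T n i) \<le> T / real (Suc n)" using s unif_grid_step[of T n i] by (simp add: dist_real_def)
   hence "dist s (unif_grid T n i) < d" using elim by simp
   hence "dist (f s) (f (unif_grid T n i)) < e" using unif_grid_range[OF T i] s by (intro d(2)) auto
   thus "dist (f s) (f (unif_grid T n i)) \<le> e" by simp
  qed
 qed
qed

lemma LINT_split_grid:
 fixes f :: "real \<Rightarrow> 'b::euclidean_space"
 assumes t: "\<And>i. i < N \<Longrightarrow> t i \<le> t (Suc i)" and f: "continuous_on {t 0..t N} f"
 shows "(LBINT s:{t 0..t N}. f s) = (\<Sum>i<N. LBINT s:{t i..t (Suc i)}. f s)" using assms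
proof (induction N)
 case 0
 show ?case using set_borel_integral_eq_integral(2)[OF borel_integrable_atLeastAtMost'[of "t 0" "t 0" f]] by simp
next
 case (Suc N)
 have tN: "t 0 \<le> t N" "t N \<le> t (Suc N)" using grid_mono[where f=t and n="Suc N" and p=0 and q=N] Suc.prems(1) by auto
 have eq: "(LBINT s:{a..b}. f s) = integral {a..b} f" if "t 0 \<le> a" "b \<le> t (Suc N)" for a b
  by (intro set_borel_integral_eq_integral(2) borel_integrable_atLeastAtMost' continuous_on_subset[OF Suc.prems(2)])
    (use that in auto)
 have "(LBINT s:{t 0..t (Suc N)}. f s) = (LBINT s:{t 0..t N}. f s) + (LBINT s:{t N..t (Suc N)}. f s)"
  using tN by (simp add: eq Henstock_Kurzweil_Integration.integral_combine integrable_continuous_real[OF Suc.prems(2)])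
 also have "(LBINT s:{t 0..t N}. f s) = (\<Sum>i<N. LBINT s:{t i..t (Suc i)}. f s)"
  by (rule Suc.IH[OF Suc.prems(1) continuous_on_subset[OF Suc.prems(2)]]) (use tN in auto)
 finally show ?case by simp
qed

lemma LINT_norm_le:
 fixes f :: "real \<Rightarrow> 'b::euclidean_space"
 assumes ab: "a \<le> b" and f: "continuous_on {a..b} f" and B: "\<And>s. s \<in> {a..b} \<Longrightarrow> norm (f s) \<le> B"
 shows "norm (LBINT s:{a..b}. f s) \<le> B * (b - a)"
proof -
 have "(LBINT s:{a..b}. f s) = integral {a..b} f" by (rule set_borel_integral_eq_integral(2)[OF borel_integrable_atLeastAtMost'[OF f]])
 also have "norm ... \<le> B * (b - a)" by (rule integral_bound[OF ab f B])
 finally show ?thesis .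
qed

lemma LINT_const_interval:
 fixes c :: "'b::euclidean_space"
 assumes "a \<le> b" shows "(LBINT s:{a..b}. c) = (b - a) *\<^sub>R c" using assms by (simp add: set_lebesgue_integral_def)

context prob_space
begin

lemma AE_tendsto_imp_prob_tendsto:
 fixes Y :: "nat \<Rightarrow> 'a \<Rightarrow> real"
 assumes [measurable]: "\<And>n. Y n \<in> borel_measurable M" and lim: "AE om in M. (\<lambda>n. Y n om) \<longlonglongrightarrow> 0" and \<eta>: "\<eta> > 0"
 shows "(\<lambda>n. prob {om \<in> space M. \<eta> \<le> Y n om}) \<longlonglongrightarrow> 0"
proof -
 have "(\<lambda>n. expectation (indicat_real {om \<in> space M. \<eta> \<le> Y n om})) \<longlonglongrightarrow> expectation (\<lambda>_. 0)"
 proof (rule integral_dominated_convergence[where w="\<lambda>_. 1"])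
  show "AE om in M. (\<lambda>n. indicat_real {om \<in> space M. \<eta> \<le> Y n om} om) \<longlonglongrightarrow> 0" using lim
  proof eventually_elim
   case (elim om)
   have "\<forall>\<^sub>F n in sequentially. Y n om < \<eta>" using elim by (rule order_tendstoD) (rule \<eta>)
   hence "\<forall>\<^sub>F n in sequentially. 0 = indicat_real {om \<in> space M. \<eta> \<le> Y n om} om"
    by eventually_elim (auto simp: indicator_def)
   thus ?case by (rule Lim_transform_eventually[OF tendsto_const])
  qed
 qed (auto simp: indicator_def)
 thus ?thesis by simp
qed

text \<open>Bounded second moments make the sequence uniformly integrable: the part above a level
  \<open>R\<close> contributes at most \<open>K / R\<close>.\<close>

lemma expectation_tendsto_0_square_bounded:
 fixes Y :: "nat \<Rightarrow> 'a \<Rightarrow> real"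
 assumes meas [measurable]: "\<And>n. Y n \<in> borel_measurable M" and nn: "\<And>n om. om \<in> space M \<Longrightarrow> 0 \<le> Y n om"
  and lim: "AE om in M. (\<lambda>n. Y n om) \<longlonglongrightarrow> 0"
  and int: "\<And>n. integrable M (\<lambda>om. (Y n om)^2)" and K: "\<And>n. expectation (\<lambda>om. (Y n om)^2) \<le> K"
 shows "(\<lambda>n. expectation (Y n)) \<longlonglongrightarrow> 0"
proof (rule LIMSEQ_I)
 fix e :: real assume e: "e > 0"
 have Kn: "0 \<le> K" using K[of 0] by (rule order_trans[rotated]) simp
 define R where "R = 2 * (K + 1) / e"
 have R: "R > 0" using e Kn by (simp add: R_def)
 have i: "integrable M (Y n)" for n using int by (rule square_integrable_imp_integrable[rotated]) simp
 have im: "integrable M (\<lambda>om. min (Y n om) R)" for n by (rule integrable_const_bound[where B=R]) (use nn R in auto)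
 have "(\<lambda>n. expectation (\<lambda>om. min (Y n om) R)) \<longlonglongrightarrow> expectation (\<lambda>_. 0)"
 proof (rule integral_dominated_convergence[where w="\<lambda>_. R"])
  show "AE om in M. (\<lambda>n. min (Y n om) R) \<longlonglongrightarrow> 0" using lim
  proof eventually_elim
   case (elim om)
   hence "(\<lambda>n. min (Y n om) R) \<longlonglongrightarrow> min 0 R" by (intro tendsto_min tendsto_const)
   thus ?case using R by simp
  qed
 qed (use nn R in auto)
 hence "(\<lambda>n. expectation (\<lambda>om. min (Y n om) R)) \<longlonglongrightarrow> 0" by simp
 from LIMSEQ_D[OF this, of "e/2"] e obtain N where N: "\<And>n. n \<ge> N \<Longrightarrow> \<bar>expectation (\<lambda>om. min (Y n om) R)\<bar> < e / 2" by auto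
 show "\<exists>N. \<forall>n\<ge>N. norm (expectation (Y n) - 0) < e"
 proof (intro exI allI impI)
  fix n assume n: "n \<ge> N"
  have "expectation (Y n) \<le> expectation (\<lambda>om. min (Y n om) R + (Y n om)^2 / R)"
  proof (intro integral_mono i Bochner_Integration.integrable_add im Bochner_Integration.integrable_divide int)
   fix om assume "om \<in> space M"
   show "Y n om \<le> min (Y n om) R + (Y n om)^2 / R"
   proof (cases "Y n om \<le> R")
    case False
    hence "Y n om * R \<le> (Y n om)^2" using R by (simp add: power2_eq_square)
    hence "Y n om \<le> (Y n om)^2 / R" using R by (simp add: field_simps)
    thus ?thesis using R False by simp
   qed (use R in simp)
  qed
  also have "... = expectation (\<lambda>om. min (Y n om) R) + expectation (\<lambda>om. (Y n om)^2) / R" using im int by simp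
  also have "... \<le> expectation (\<lambda>om. min (Y n om) R) + K / R" using K[of n] R by (intro add_left_mono divide_right_mono) auto
  also have "K / R < e / 2" using e Kn by (simp add: R_def field_simps)
  finally have "expectation (Y n) < e" using N[OF n] by simp
  moreover have "0 \<le> expectation (Y n)" using nn by (intro integral_nonneg_AE AE_I2)
  ultimately show "norm (expectation (Y n) - 0) < e" by simp
 qed
qed

end

text \<open>For double limits: \<open>n\<close> tends to infinity at a fixed level \<open>v\<close>,
  which then shrinks to zero.\<close>

lemma tendsto_0_by_split:
 fixes a :: "nat \<Rightarrow> real"
 assumes nn: "\<And>n. 0 \<le> a n" and C: "0 \<le> C" and le: "\<And>v n. v > 0 \<Longrightarrow> a n \<le> b v n + C * v"
  and b: "\<And>v. v > 0 \<Longrightarrow> b v \<longlonglongrightarrow> 0"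
 shows "a \<longlonglongrightarrow> 0"
proof (rule LIMSEQ_I)
 fix e :: real assume e: "e > 0"
 define v where "v = e / (2 * (C + 1))"
 have v: "v > 0" "C * v < e / 2" using e C by (auto simp: v_def field_simps)
 from LIMSEQ_D[OF b[OF v(1)], of "e/2"] e obtain N where N: "\<And>n. n \<ge> N \<Longrightarrow> \<bar>b v n\<bar> < e / 2" by auto
 show "\<exists>N. \<forall>n\<ge>N. norm (a n - 0) < e"
 proof (intro exI allI impI)
  fix n assume "n \<ge> N"
  thus "norm (a n - 0) < e" using N[of n] le[OF v(1), of n] nn[of n] v(2) by simp
 qed
qed

lemma (in c2_test_function) one_step_bound:
 fixes S :: "real^'d^'d"
 assumes \<kappa>: "\<kappa> > 0" and CD: "\<And>x. norm (D x) \<le> CD" and S: "norm x \<le> r + 1 \<Longrightarrow> norm S \<le> M1" and M1: "0 \<le> M1"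
  and rem: "\<bar>f y - f x - g x \<bullet> (y - x) - (y - x) \<bullet> (D x *v (y - x)) / 2\<bar>
    \<le> \<kappa> * (if norm x \<le> r + 1 then (norm (y - x))^2 else 0)"
  and y: "y - x = S *v w + (b + J)"
 shows "\<bar>f y - f x - ((transpose S *v g x) \<bullet> w + w \<bullet> ((transpose S ** (D x ** S)) *v w) / 2) - g x \<bullet> b - g x \<bullet> J\<bar>
  \<le> (CD + 2) * M1^2 * \<kappa> * (norm w)^2 + 2 * (CD / \<kappa> + CD + 2 * \<kappa>) * ((norm b)^2 + (norm J)^2)"
proof -
 define Y where "Y = S *v w"
 define R where "R = b + J"
 \<comment> \<open>The cut-off \<zeta> marks where \<open>S\<close> is bounded by \<open>M1\<close>;
   every factor \<open>D x\<close> brings it along.\<close>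
 define \<zeta> :: real where "\<zeta> = (if norm x \<le> r + 1 then 1 else 0)"
 have CD_nn: "0 \<le> CD" using CD[of x] norm_ge_zero[of "D x"] by linarith
 have dx: "y - x = Y + R" using y by (simp add: Y_def R_def)
 have gY: "g x \<bullet> Y = (transpose S *v g x) \<bullet> w" unfolding Y_def by (rule inner_mult_transpose)
 have YDY: "Y \<bullet> (D x *v Y) = w \<bullet> ((transpose S ** (D x ** S)) *v w)"
 proof -
  have "Y \<bullet> (D x *v Y) = (S *v w) \<bullet> ((D x ** S) *v w)" by (simp add: Y_def matrix_vector_mul_assoc)
  also have "... = w \<bullet> (transpose S *v ((D x ** S) *v w))" using inner_mult_transpose[of "(D x ** S) *v w" S w] by (simp add: inner_commute)
  also have "... = w \<bullet> ((transpose S ** (D x ** S)) *v w)" by (simp only: matrix_vector_mul_assoc)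
  finally show ?thesis .
 qed
 have Dx: "norm (D x) \<le> CD * \<zeta>" using CD[of x] supp[of x] by (auto simp: \<zeta>_def)
 have Ychi: "\<zeta> * norm Y \<le> M1 * norm w"
 proof (cases "norm x \<le> r + 1")
  case True
  hence "norm Y \<le> M1 * norm w" unfolding Y_def by (intro order_trans[OF norm_matrix_vector_mult_le] mult_right_mono S) auto
  thus ?thesis using True by (simp add: \<zeta>_def)
 qed (use M1 in \<open>simp add: \<zeta>_def\<close>)
 have R2: "(norm R)^2 \<le> 2 * ((norm b)^2 + (norm J)^2)" unfolding R_def using norm_add_square_le[of 1 b J] by simp
 have \<zeta>2: "\<zeta> * \<zeta> = \<zeta>" "0 \<le> \<zeta>" "\<zeta> \<le> 1" by (auto simp: \<zeta>_def)
 have prod: "\<zeta> * (norm Y * norm R) \<le> \<kappa> * (M1^2 * (norm w)^2) + (norm R)^2 / \<kappa>"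
 proof -
  have "\<zeta> * (norm Y * norm R) \<le> (M1 * norm w) * norm R" using mult_right_mono[OF Ychi norm_ge_zero[of R]] by (simp add: mult.assoc)
  also have "... \<le> \<kappa> * (M1 * norm w)^2 + (norm R)^2 / \<kappa>"
  proof -
   have "0 \<le> (\<kappa> * (M1 * norm w) - norm R)^2 + \<kappa> * (M1 * norm w) * norm R"
    using \<kappa> M1 by (intro add_nonneg_nonneg mult_nonneg_nonneg) auto
   hence "\<kappa> * ((M1 * norm w) * norm R) \<le> \<kappa> * (\<kappa> * (M1 * norm w)^2 + (norm R)^2 / \<kappa>)"
    using \<kappa> by (simp add: power2_diff power_mult_distrib algebra_simps power2_eq_square)
   thus ?thesis using \<kappa> by simp
  qed
  finally show ?thesis by (simp add: power_mult_distrib)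
 qed
 have cross: "\<bar>Y \<bullet> (D x *v R) + R \<bullet> (D x *v Y) + R \<bullet> (D x *v R)\<bar> / 2
   \<le> CD * (\<kappa> * (M1^2 * (norm w)^2) + (norm R)^2 / \<kappa>) + CD * (norm R)^2"
 proof -
  have "\<bar>Y \<bullet> (D x *v R) + R \<bullet> (D x *v Y) + R \<bullet> (D x *v R)\<bar>
   \<le> norm Y * (norm (D x) * norm R) + norm R * (norm (D x) * norm Y) + norm R * (norm (D x) * norm R)"
   using inner_matrix_vector_mult_le[of Y "D x" R] inner_matrix_vector_mult_le[of R "D x" Y]
    inner_matrix_vector_mult_le[of R "D x" R] by linarith
  also have "... = norm (D x) * (2 * (norm Y * norm R) + (norm R)^2)" by (simp add: power2_eq_square algebra_simps)
  also have "... \<le> CD * \<zeta> * (2 * (norm Y * norm R) + (norm R)^2)" by (intro mult_right_mono Dx) auto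
  also have "... = CD * (2 * (\<zeta> * (norm Y * norm R)) + \<zeta> * (norm R)^2)" by (simp add: algebra_simps)
  also have "... \<le> CD * (2 * (\<kappa> * (M1^2 * (norm w)^2) + (norm R)^2 / \<kappa>) + 1 * (norm R)^2)"
   using prod \<zeta>2 by (intro mult_left_mono add_mono mult_right_mono CD_nn) auto
  finally have le: "\<bar>Y \<bullet> (D x *v R) + R \<bullet> (D x *v Y) + R \<bullet> (D x *v R)\<bar>
   \<le> CD * (2 * (\<kappa> * (M1^2 * (norm w)^2) + (norm R)^2 / \<kappa>) + 1 * (norm R)^2)" .
  have "CD * (2 * p + 1 * q) = 2 * (CD * p) + CD * q" for p q by algebra
  note le[unfolded this]
  moreover have "a / 2 \<le> p + q" if "a \<le> 2 * p + q" "0 \<le> q" for a p q :: real using that by linarith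
  ultimately show ?thesis using mult_nonneg_nonneg[OF CD_nn zero_le_power2[of "norm R"]] by blast
 qed
 have rem': "\<kappa> * (if norm x \<le> r + 1 then (norm (y - x))^2 else 0) \<le> 2 * \<kappa> * (M1^2 * (norm w)^2) + 2 * \<kappa> * (norm R)^2"
 proof (cases "norm x \<le> r + 1")
  case True
  have "(norm (y - x))^2 \<le> 2 * (norm Y)^2 + 2 * (norm R)^2" unfolding dx using norm_add_square_le[of 1 Y R] by simp
  moreover have "(norm Y)^2 \<le> (M1 * norm w)^2" using Ychi True by (intro power_mono) (auto simp: \<zeta>_def)
  ultimately have "(norm (y - x))^2 \<le> 2 * (M1^2 * (norm w)^2) + 2 * (norm R)^2" by (simp add: power_mult_distrib)
  hence "\<kappa> * (norm (y - x))^2 \<le> \<kappa> * (2 * (M1^2 * (norm w)^2) + 2 * (norm R)^2)" using \<kappa> by (intro mult_left_mono) auto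
  thus ?thesis using True by (simp add: algebra_simps)
 qed (use \<kappa> in simp)
 have "f y - f x - ((transpose S *v g x) \<bullet> w + w \<bullet> ((transpose S ** (D x ** S)) *v w) / 2) - g x \<bullet> b - g x \<bullet> J
  = (f y - f x - g x \<bullet> (y - x) - (y - x) \<bullet> (D x *v (y - x)) / 2)
   + (Y \<bullet> (D x *v R) + R \<bullet> (D x *v Y) + R \<bullet> (D x *v R)) / 2" unfolding gY[symmetric] YDY[symmetric] dx
  by (simp add: R_def matrix_vector_right_distrib inner_add_left inner_add_right field_simps)
 also have "\<bar>...\<bar> \<le> (2 * \<kappa> * (M1^2 * (norm w)^2) + 2 * \<kappa> * (norm R)^2)
   + (CD * (\<kappa> * (M1^2 * (norm w)^2) + (norm R)^2 / \<kappa>) + CD * (norm R)^2)"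
 proof -
  have "\<bar>a + c / 2\<bar> \<le> B1 + B2" if "\<bar>a\<bar> \<le> B0" "B0 \<le> B1" "\<bar>c\<bar> / 2 \<le> B2" for a c B0 B1 B2 :: real
   using that by linarith
  from this[OF rem rem' cross] show ?thesis .
 qed
 also have "... = (CD + 2) * M1^2 * \<kappa> * (norm w)^2 + (CD / \<kappa> + CD + 2 * \<kappa>) * (norm R)^2" by (simp add: field_simps)
 also have "... \<le> (CD + 2) * M1^2 * \<kappa> * (norm w)^2 + (CD / \<kappa> + CD + 2 * \<kappa>) * (2 * ((norm b)^2 + (norm J)^2))"
  using CD_nn \<kappa> by (intro add_left_mono mult_left_mono R2) auto
 also have "... = (CD + 2) * M1^2 * \<kappa> * (norm w)^2 + 2 * (CD / \<kappa> + CD + 2 * \<kappa>) * ((norm b)^2 + (norm J)^2)"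
  by (simp only: mult.assoc mult.left_commute)
 finally show ?thesis .
qed

section \<open>Diffusions and expectations of frozen noise\<close>

locale diffusion = filtered_brownian M \<F> W
 for M :: "'w measure" and \<F> and W :: "real \<Rightarrow> 'w \<Rightarrow> real^'d" +
 fixes X :: "real \<Rightarrow> 'w \<Rightarrow> real^'d" and \<beta> :: "real^'d \<Rightarrow> real^'d" and \<rho> :: "real^'d \<Rightarrow> real^'d^'d"
  and I :: "real \<Rightarrow> 'w \<Rightarrow> real^'d"
 assumes X_adapted: "\<And>t. 0 \<le> t \<Longrightarrow> X t \<in> borel_measurable (\<F> t)"
  and X_cont: "\<And>om. om \<in> space M \<Longrightarrow> continuous_on {0..} (\<lambda>t. X t om)"
  and ito_X: "has_ito_integral M \<F> W (\<lambda>s om. \<rho> (X s om)) I"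
  and X_eq: "AE om in M. \<forall>t\<ge>0. X t om = X 0 om + (LBINT s:{0..t}. \<beta> (X s om)) + I t om"
  and \<beta>_cont: "continuous_on UNIV \<beta>" and \<rho>_cont: "continuous_on UNIV \<rho>"
begin

lemma X_comp_adapted:
 fixes h :: "real^'d \<Rightarrow> 'b::topological_space"
 assumes "continuous_on UNIV h" "0 \<le> t"
 shows "(\<lambda>om. h (X t om)) \<in> borel_measurable (\<F> t)" by (rule borel_measurable_continuous_on[OF assms(1) X_adapted[OF assms(2)]])

lemma X_comp_meas:
 fixes h :: "real^'d \<Rightarrow> 'b::topological_space"
 assumes "continuous_on UNIV h" "0 \<le> t"
 shows "(\<lambda>om. h (X t om)) \<in> borel_measurable M" by (rule measurable_F_M[OF X_comp_adapted[OF assms]])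

lemma X_comp_cont:
 assumes "continuous_on UNIV h" "om \<in> space M" "S \<subseteq> {0..}"
 shows "continuous_on S (\<lambda>t. h (X t om))"
 by (rule continuous_on_compose2[OF assms(1) continuous_on_subset[OF X_cont[OF assms(2)] assms(3)]]) simp

sublocale ito_process M \<F> W "\<lambda>s om. \<rho> (X s om)" I by unfold_locales (auto intro: ito_X X_comp_adapted \<rho>_cont X_comp_cont)

lemma X_meas: "0 \<le> t \<Longrightarrow> X t \<in> borel_measurable M" by (rule measurable_F_M[OF X_adapted])

text \<open>One null set serves all pairs of times, since \<open>X_eq\<close> quantifies over time
  inside the almost sure statement.\<close>

lemma X_increment:
 "AE om in M. \<forall>s t. 0 \<le> s \<longrightarrow> s \<le> t \<longrightarrow> X t om - X s om = (LBINT u:{s..t}. \<beta> (X u om)) + (I t om - I s om)"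
 using X_eq AE_space
proof eventually_elim
 case (elim om)
 show ?case
 proof (intro allI impI)
  fix s t :: real assume st: "0 \<le> s" "s \<le> t"
  have c: "continuous_on {a..b} (\<lambda>u. \<beta> (X u om))" if "0 \<le> a" for a b
   by (rule X_comp_cont[OF \<beta>_cont elim(2)]) (use that in auto)
  have eq: "(LBINT u:{a..b}. \<beta> (X u om)) = integral {a..b} (\<lambda>u. \<beta> (X u om))" if "0 \<le> a" for a b
   by (intro set_borel_integral_eq_integral(2) borel_integrable_atLeastAtMost' c that)
  have split: "(LBINT u:{0..t}. \<beta> (X u om)) = (LBINT u:{0..s}. \<beta> (X u om)) + (LBINT u:{s..t}. \<beta> (X u om))"
   using st by (simp add: eq Henstock_Kurzweil_Integration.integral_combine integrable_continuous_real[OF c])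
  have "a - d = e + (c - c')" if "b = b' + e" "a = x + b + c" "d = x + b' + c'" for a b c d e x b' c' :: "real^'d" using that by simp
  from this[OF split elim(1)[rule_format, OF order_trans[OF st]] elim(1)[rule_format, OF st(1)]]
  show "X t om - X s om = (LBINT u:{s..t}. \<beta> (X u om)) + (I t om - I s om)" .
 qed
qed

end

lemma norm_power4_le:
 fixes z :: "real^'n"
 shows "(norm z) ^ 4 \<le> real CARD('n) * (\<Sum>j\<in>UNIV. (z $ j) ^ 4)"
proof -
 have "(norm z) ^ 4 = (\<Sum>j\<in>UNIV. (z $ j)^2)^2" using power_mult[of "norm z" 2 2] by (simp add: norm_vec_square)
 also have "... \<le> (\<Sum>j\<in>UNIV. ((z $ j)^2)^2) * (\<Sum>j\<in>(UNIV::'n set). 1^2)"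
  using Cauchy_Schwarz_ineq_sum[of "\<lambda>j. (z $ j)^2" "\<lambda>_. 1" UNIV] by simp
 finally show ?thesis by (simp add: mult.commute)
qed

context filtered_brownian
begin

lemma increment_norm_moments:
 assumes st: "0 \<le> s" "s < t"
 shows "integrable M (\<lambda>om. (norm (W t om - W s om))^2)"
  "expectation (\<lambda>om. (norm (W t om - W s om))^2) = real CARD('d) * (t - s)"
  "integrable M (\<lambda>om. (norm (W t om - W s om)) ^ 4)"
  "expectation (\<lambda>om. (norm (W t om - W s om)) ^ 4) \<le> 48 * (real CARD('d))^2 * (t - s)^2"
proof -
 let ?Z = "\<lambda>om. W t om - W s om"
 have [measurable]: "?Z \<in> borel_measurable M" using st by (intro borel_measurable_diff W_meas) auto
 have n2: "(norm (?Z om))^2 = (\<Sum>j\<in>UNIV. ?Z om $ j * ?Z om $ j)" for om by (simp add: norm_vec_def L2_set_def sum_nonneg power2_eq_square)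
 show "integrable M (\<lambda>om. (norm (?Z om))^2)" "expectation (\<lambda>om. (norm (?Z om))^2) = real CARD('d) * (t - s)"
  unfolding n2 using increment_moments(3)[OF st] increment_moments(4)[OF st]
  by (simp_all add: Bochner_Integration.integral_sum del: vector_minus_component)
 have i4: "integrable M (\<lambda>om. real CARD('d) * (\<Sum>j\<in>UNIV. (?Z om $ j) ^ 4))"
  using increment_moments(5)[OF st] by (simp del: vector_minus_component)
 show int: "integrable M (\<lambda>om. (norm (?Z om)) ^ 4)"
  by (rule Bochner_Integration.integrable_bound[OF i4]) (auto intro!: AE_I2 order_trans[OF norm_power4_le])
 have "expectation (\<lambda>om. (norm (?Z om)) ^ 4) \<le> expectation (\<lambda>om. real CARD('d) * (\<Sum>j\<in>UNIV. (?Z om $ j) ^ 4))"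
  by (intro integral_mono int i4 norm_power4_le)
 also have "... = real CARD('d) * (\<Sum>j\<in>UNIV. expectation (\<lambda>om. (?Z om $ j) ^ 4))"
  using increment_moments(5)[OF st] by (simp add: Bochner_Integration.integral_sum del: vector_minus_component)
 also have "... \<le> real CARD('d) * (\<Sum>j\<in>(UNIV::'d set). 48 * (t - s)^2)"
  by (intro mult_left_mono sum_mono increment_moments(6)[OF st]) auto
 finally show "expectation (\<lambda>om. (norm (?Z om)) ^ 4) \<le> 48 * (real CARD('d))^2 * (t - s)^2" by (simp only: sum_constant power2_eq_square)
qed

lemma expectation_linear_increment:
 assumes st: "0 \<le> s" "s < t" and p: "p \<in> borel_measurable (\<F> s)" and B: "\<And>om. norm (p om) \<le> C"
 shows "integrable M (\<lambda>om. p om \<bullet> (W t om - W s om))" "expectation (\<lambda>om. p om \<bullet> (W t om - W s om)) = 0"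
proof -
 let ?Z = "\<lambda>om. W t om - W s om"
 have c: "(\<lambda>om. p om $ j) \<in> borel_measurable (\<F> s)" for j by (rule borel_measurable_vec_nth[OF p])
 have ci: "integrable M (\<lambda>om. p om $ j)" for j
  using measurable_F_M[OF c] B by (intro integrable_const_bound[where B=C]) (auto intro!: AE_I2 order_trans[OF component_le_norm_cart])
 have \<phi>: "(\<lambda>z :: real^'d. z $ j) \<in> borel_measurable borel" for j by (rule borel_measurable_vec_nth) simp
 have "integrable M (\<lambda>om. p om $ j * (?Z om $ j)) \<and> expectation (\<lambda>om. p om $ j * (?Z om $ j)) = 0" for j
  using expectation_past_increment[OF st c \<phi> ci increment_moments(1)[OF st], of j j] increment_moments(2)[OF st, of j]
  by (simp del: vector_minus_component)
 thus "integrable M (\<lambda>om. p om \<bullet> ?Z om)" "expectation (\<lambda>om. p om \<bullet> ?Z om) = 0"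
  unfolding inner_vec_def by (simp_all add: Bochner_Integration.integral_sum del: vector_minus_component)
qed

text \<open>Independence separates the known matrix from the increment, whose covariance is a
  multiple of the identity; of the double sum only the trace remains.\<close>

lemma expectation_quadratic_increment:
 fixes B :: "'w \<Rightarrow> real^'d^'d"
 assumes st: "0 \<le> s" "s < t" and B: "B \<in> borel_measurable (\<F> s)" and C: "\<And>om. norm (B om) \<le> C"
 shows "integrable M (\<lambda>om. (W t om - W s om) \<bullet> (B om *v (W t om - W s om)))"
  "expectation (\<lambda>om. (W t om - W s om) \<bullet> (B om *v (W t om - W s om))) = expectation (\<lambda>om. trace (B om)) * (t - s)"
  "integrable M (\<lambda>om. trace (B om))"
proof -
 let ?Z = "\<lambda>om. W t om - W s om"
 have c: "(\<lambda>om. B om $ i $ j) \<in> borel_measurable (\<F> s)" for i j by (intro borel_measurable_vec_nth B)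
 have ci: "integrable M (\<lambda>om. B om $ i $ j)" for i j using measurable_F_M[OF c] C by (intro integrable_const_bound[where B=C])
    (auto intro!: AE_I2 intro: order_trans[OF component_le_norm_cart order_trans[OF Finite_Cartesian_Product.norm_nth_le]])
 have \<phi>: "(\<lambda>z :: real^'d. z $ i * z $ j) \<in> borel_measurable borel" for i j
  by (intro borel_measurable_times borel_measurable_vec_nth) simp_all
 have one: "integrable M (\<lambda>om. B om $ i $ j * (?Z om $ i * ?Z om $ j))"
  "expectation (\<lambda>om. B om $ i $ j * (?Z om $ i * ?Z om $ j)) = expectation (\<lambda>om. B om $ i $ j) * (if i = j then t - s else 0)" for i j
  using expectation_past_increment[OF st c \<phi> ci increment_moments(3)[OF st], of i j i j] increment_moments(4)[OF st, of i j]
  by (simp_all del: vector_minus_component)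
 have eq: "?Z om \<bullet> (B om *v ?Z om) = (\<Sum>i\<in>UNIV. \<Sum>j\<in>UNIV. B om $ i $ j * (?Z om $ i * ?Z om $ j))" for om
  unfolding inner_vec_def matrix_vector_mult_def by (simp add: sum_distrib_left mult.left_commute del: vector_minus_component)
 show "integrable M (\<lambda>om. ?Z om \<bullet> (B om *v ?Z om))" unfolding eq using one(1) by (intro Bochner_Integration.integrable_sum)
 show "integrable M (\<lambda>om. trace (B om))" unfolding trace_def using ci by (intro Bochner_Integration.integrable_sum)
 have "expectation (\<lambda>om. ?Z om \<bullet> (B om *v ?Z om)) = (\<Sum>i\<in>UNIV. \<Sum>j\<in>UNIV. expectation (\<lambda>om. B om $ i $ j) * (if i = j then t - s else 0))"
  unfolding eq using one by (simp add: Bochner_Integration.integral_sum del: vector_minus_component)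
 also have "... = (\<Sum>i\<in>UNIV. expectation (\<lambda>om. B om $ i $ i) * (t - s))" by (simp add: if_distrib cong: if_cong)
 also have "... = expectation (\<lambda>om. trace (B om)) * (t - s)"
  unfolding trace_def using ci by (simp add: Bochner_Integration.integral_sum sum_distrib_right)
 finally show "expectation (\<lambda>om. ?Z om \<bullet> (B om *v ?Z om)) = expectation (\<lambda>om. trace (B om)) * (t - s)" .
qed

end

lemma matrix_mult_continuous [continuous_intros]:
 fixes f :: "'a::topological_space \<Rightarrow> real^'n^'m" and g :: "'a \<Rightarrow> real^'k^'n"
 assumes "continuous_on S f" "continuous_on S g"
 shows "continuous_on S (\<lambda>x. f x ** g x)" unfolding matrix_matrix_mult_def by (intro continuous_intros assms)

lemma trace_continuous [continuous_intros]:
 fixes f :: "'a::topological_space \<Rightarrow> real^'n^'n"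
 assumes "continuous_on S f"
 shows "continuous_on S (\<lambda>x. trace (f x))" unfolding trace_def by (intro continuous_intros assms)

lemma Riemann_sum_tendsto:
 fixes h :: "real \<Rightarrow> real"
 assumes T: "0 \<le> T" and h: "continuous_on {0..T} h"
 shows "(\<lambda>n. \<Sum>i<Suc n. h (unif_grid T n i) * (T / real (Suc n))) \<longlonglongrightarrow> (LBINT s:{0..T}. h s)"
proof (rule LIMSEQ_I)
 fix e :: real assume e: "e > 0"
 define d where "d = e / (2 * (T + 1))"
 have d: "d > 0" "d * T < e" using e T by (auto simp: d_def field_simps intro: add_nonneg_pos)
 from unif_grid_approx[OF T h d(1)] obtain n0 where n0: "\<And>n i s. n \<ge> n0 \<Longrightarrow> i < Suc n \<Longrightarrow>
   s \<in> {unif_grid T n i..unif_grid T n (Suc i)} \<Longrightarrow> dist (h s) (h (unif_grid T n i)) \<le> d"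
  unfolding eventually_sequentially by blast
 show "\<exists>n0. \<forall>n\<ge>n0. norm ((\<Sum>i<Suc n. h (unif_grid T n i) * (T / real (Suc n))) - (LBINT s:{0..T}. h s)) < e"
 proof (intro exI allI impI)
  fix n assume n: "n \<ge> n0"
  let ?t = "unif_grid T n"
  have c: "continuous_on {?t i..?t (Suc i)} h" if "i < Suc n" for i by (rule continuous_on_subset[OF h]) (use unif_grid_range[OF T that] in auto)
  have "(LBINT s:{0..T}. h s) = (\<Sum>i<Suc n. LBINT s:{?t i..?t (Suc i)}. h s)"
   using LINT_split_grid[of "Suc n" ?t h] unif_grid_range[OF T] h by simp
  moreover have "(\<Sum>i<Suc n. h (?t i) * (T / real (Suc n))) = (\<Sum>i<Suc n. LBINT s:{?t i..?t (Suc i)}. h (?t i))"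
   using unif_grid_range(2)[OF T] unif_grid_step[of T n] by (intro sum.cong refl) (simp add: LINT_const_interval mult.commute)
  ultimately have "norm ((\<Sum>i<Suc n. h (?t i) * (T / real (Suc n))) - (LBINT s:{0..T}. h s))
   = norm (\<Sum>i<Suc n. (LBINT s:{?t i..?t (Suc i)}. h (?t i)) - (LBINT s:{?t i..?t (Suc i)}. h s))" by (simp only: sum_subtractf)
  also have "... \<le> (\<Sum>i<Suc n. d * (T / real (Suc n)))"
  proof (rule sum_norm_le)
   fix i assume "i \<in> {..<Suc n}"
   hence i: "i < Suc n" by simp
   have "(LBINT s:{?t i..?t (Suc i)}. h (?t i)) - (LBINT s:{?t i..?t (Suc i)}. h s) = (LBINT s:{?t i..?t (Suc i)}. h (?t i) - h s)"
    by (rule set_integral_diff(2)[symmetric]) (auto intro!: borel_integrable_atLeastAtMost' c[OF i])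
   also have "norm ... \<le> d * (?t (Suc i) - ?t i)" using n0[OF n i] unif_grid_range[OF T i]
    by (intro LINT_norm_le continuous_intros c[OF i]) (auto simp: dist_real_def abs_minus_commute)
   finally show "norm ((LBINT s:{?t i..?t (Suc i)}. h (?t i)) - (LBINT s:{?t i..?t (Suc i)}. h s)) \<le> d * (T / real (Suc n))"
    by (simp only: unif_grid_step)
  qed
  also have "... = d * T" by simp
  finally show "norm ((\<Sum>i<Suc n. h (?t i) * (T / real (Suc n))) - (LBINT s:{0..T}. h s)) < e" using d by simp
 qed
qed

section \<open>Dynkin's formula\<close>

locale diffusion_test = diffusion M \<F> W X \<beta> \<rho> I + c2_test_function f g D r
 for M :: "'w measure" and \<F> and W :: "real \<Rightarrow> 'w \<Rightarrow> real^'d" and X \<beta> \<rho> I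
  and f :: "real^'d \<Rightarrow> real" and g D r +
 fixes T :: real
 assumes T: "T > 0"
begin

text \<open>\<open>lin\<close> and \<open>quad\<close> are the coefficients of the first- and
  second-order terms of the increment of \<open>f\<close> caused by frozen noise.\<close>

definition "lin x = transpose (\<rho> x) *v g x"
definition "quad x = transpose (\<rho> x) ** (D x ** \<rho> x)"

abbreviation "tg \<equiv> unif_grid T"
abbreviation "XG n i \<equiv> X (tg n i)"
abbreviation "ss Z n om \<equiv> \<Sum>i<Suc n. (norm (Z n i om))^2"
abbreviation "gs Z n om \<equiv> \<Sum>i<Suc n. g (XG n i om) \<bullet> Z n i om"
definition "dW n i om = W (tg n (Suc i)) om - W (tg n i) om"
definition "dI n i om = I (tg n (Suc i)) om - I (tg n i) om - \<rho> (XG n i om) *v dW n i om"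
definition "db n i om = (LBINT s:{tg n i..tg n (Suc i)}. \<beta> (X s om))"

definition "approx n om = (\<Sum>i<Suc n. lin (XG n i om) \<bullet> dW n i om
  + dW n i om \<bullet> (quad (XG n i om) *v dW n i om) / 2)"

text \<open>The total quadratic variation of the freezing errors \<open>dI\<close>; its smallness
  controls them in probability.\<close>

definition "osc n om = (\<Sum>i<Suc n. LBINT s:{tg n i..tg n (Suc i)}. (norm (\<rho> (X s om) - \<rho> (XG n i om)))^2)"

lemma T': "0 \<le> T" using T by simp

lemma grid_lt: "tg n i < tg n (Suc i)"
proof -
 have "0 < T / real (Suc n)" using T by simp
 thus ?thesis using unif_grid_step[of T n i] by linarith
qed

lemma grid_nn: "0 \<le> tg n i" using T by (simp add: unif_grid_def)

lemma lin_cont: "continuous_on UNIV lin" unfolding lin_def[abs_def] by (intro continuous_intros \<rho>_cont g_cont)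

lemma quad_cont: "continuous_on UNIV quad" unfolding quad_def[abs_def] by (intro continuous_intros \<rho>_cont D_cont)

lemma lin_supp: "r \<le> norm x \<Longrightarrow> lin x = 0" using supp by (simp add: lin_def)

lemma quad_supp: "r \<le> norm x \<Longrightarrow> quad x = 0" using supp by (simp add: quad_def)

lemma dW_meas: "dW n i \<in> borel_measurable M" unfolding dW_def[abs_def] by (intro borel_measurable_diff W_meas grid_nn)

lemma dI_meas: "dI n i \<in> borel_measurable M" unfolding dI_def[abs_def]
 by (intro borel_measurable_diff I_meas grid_nn borel_measurable_continuous_Pair[OF X_comp_meas[OF \<rho>_cont grid_nn] dW_meas] continuous_intros)

lemma approx_meas': "approx n \<in> borel_measurable M"
proof -
 have "(\<lambda>om. quad (XG n i om) *v dW n i om) \<in> borel_measurable M" for i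
  by (intro borel_measurable_continuous_Pair[OF X_comp_meas[OF quad_cont grid_nn] dW_meas] continuous_intros)
 thus ?thesis unfolding approx_def[abs_def]
  by (intro borel_measurable_sum borel_measurable_add borel_measurable_divide borel_measurable_inner dW_meas
    X_comp_meas[OF lin_cont grid_nn]) simp_all
qed

text \<open>The linear terms have mean zero and each quadratic term contributes its trace times the
  mesh, so a Riemann sum of the second-order part of the generator appears.\<close>

lemma approx_expectation:
 "integrable M (approx n)"
 "expectation (approx n) = (\<Sum>i<Suc n. expectation (\<lambda>om. trace (quad (XG n i om))) * (T / real (Suc n))) / 2"
proof -
 obtain B1 where B1: "\<And>x. norm (lin x) \<le> B1" using supp_bounded[OF lin_cont lin_supp] by metis
 obtain B2 where B2: "\<And>x. norm (quad x) \<le> B2" using supp_bounded[OF quad_cont quad_supp] by metis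
 note l = expectation_linear_increment[OF grid_nn grid_lt X_comp_adapted[OF lin_cont grid_nn] B1, folded dW_def]
 note q = expectation_quadratic_increment[OF grid_nn grid_lt X_comp_adapted[OF quad_cont grid_nn] B2, folded dW_def]
 show "integrable M (approx n)" unfolding approx_def[abs_def] using l(1) q(1) by simp
 show "expectation (approx n) = (\<Sum>i<Suc n. expectation (\<lambda>om. trace (quad (XG n i om))) * (T / real (Suc n))) / 2"
  unfolding approx_def using l q(1,2) by (simp add: Bochner_Integration.integral_sum unif_grid_step sum_divide_distrib del: sum.lessThan_Suc)
qed

text \<open>A bound uniform in \<open>n\<close> will permit limits under the expectation. The linear
  part is an \<open>ito_sum\<close> with deterministic bounds on its quadratic variation; for the
  quadratic part Cauchy-Schwarz loses a factor \<open>Suc n\<close>, which the fourth moments of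
  order \<open>(T / Suc n)^2\<close> recover.\<close>

lemma approx_square_bounded:
 obtains K where "\<And>n. integrable M (\<lambda>om. (approx n om)^2)" "\<And>n. expectation (\<lambda>om. (approx n om)^2) \<le> K"
proof -
 obtain B1 where B1: "0 < B1" "\<And>x. norm (lin x) \<le> B1" using supp_bounded[OF lin_cont lin_supp] by metis
 obtain B2 where B2: "0 < B2" "\<And>x. norm (quad x) \<le> B2" using supp_bounded[OF quad_cont quad_supp] by metis
 define K where "K = 2 * (B1^2 * T) + B2^2 / 2 * (48 * (real CARD('d))^2 * T^2)"
 have "integrable M (\<lambda>om. (approx n om)^2) \<and> expectation (\<lambda>om. (approx n om)^2) \<le> K" for n
 proof -
  let ?t = "tg n"
  let ?L = "\<lambda>om. \<Sum>i<Suc n. lin (X (?t i) om) \<bullet> dW n i om"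
  let ?Q = "\<lambda>om. ss dW n om"
  have L_meas: "?L \<in> borel_measurable M" by (intro borel_measurable_sum borel_measurable_inner dW_meas X_comp_meas lin_cont grid_nn)
  have "(EE M (\<lambda>om. (?L om)^2)) \<le> (EE M (\<lambda>om. \<Sum>i<Suc n. ito_QV ?t (\<lambda>_ _. 0) (\<lambda>i om. lin (X (?t i) om)) i om))"
   using ito_second_moment[of ?t "Suc n" "\<lambda>_ _. 0" "\<lambda>i om. lin (X (?t i) om)"] less_imp_le[OF grid_lt] X_comp_adapted[OF lin_cont grid_nn]
   unfolding ito_sum_def dW_def by simp
  also have "... \<le> (EE M (\<lambda>om. B1^2 * T))"
  proof (intro nn_integral_mono ennreal_leI)
   fix om
   have "(\<Sum>i<Suc n. ito_QV ?t (\<lambda>_ _. 0) (\<lambda>i om. lin (X (?t i) om)) i om) = (\<Sum>i<Suc n. (T / real (Suc n)) * (norm (lin (X (?t i) om)))^2)"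
    unfolding ito_QV_def QV_def using grid_lt[of n] by (intro sum.cong refl) (simp add: LINT_const_interval less_imp_le unif_grid_step)
   also have "... \<le> (\<Sum>i<Suc n. (T / real (Suc n)) * B1^2)" using T by (intro sum_mono mult_left_mono power_mono B1) auto
   also have "... = B1^2 * T" by simp
   finally show "(\<Sum>i<Suc n. ito_QV ?t (\<lambda>_ _. 0) (\<lambda>i om. lin (X (?t i) om)) i om) \<le> B1^2 * T" .
  qed
  finally have L: "(EE M (\<lambda>om. (?L om)^2)) \<le> ennreal (B1^2 * T)" by (simp add: emeasure_space_1)
  have L_int: "integrable M (\<lambda>om. (?L om)^2)"
   using L L_meas by (intro integrableI_bounded) (auto simp: top_unique less_top[symmetric] intro: le_less_trans)
  have L_E: "expectation (\<lambda>om. (?L om)^2) \<le> B1^2 * T" using L T by (subst (asm) nn_integral_eq_integral[OF L_int]) auto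
  have Q4: "(?Q om)^2 \<le> real (Suc n) * (\<Sum>i<Suc n. (norm (dW n i om)) ^ 4)" for om
  proof -
   have "(?Q om)^2 \<le> (\<Sum>i<Suc n. ((norm (dW n i om))^2)^2) * (\<Sum>i<Suc n. 1^2)"
    using Cauchy_Schwarz_ineq_sum[of "\<lambda>i. (norm (dW n i om))^2" "\<lambda>_. 1" "{..<Suc n}"] by simp
   thus ?thesis by (simp add: mult.commute power_mult[symmetric] del: sum.lessThan_Suc)
  qed
  note m4 = increment_norm_moments(3,4)[OF grid_nn grid_lt, of n, folded dW_def, unfolded unif_grid_step]
  have R_int: "integrable M (\<lambda>om. real (Suc n) * (\<Sum>i<Suc n. (norm (dW n i om)) ^ 4))"
   using m4(1) by (intro integrable_mult_right Bochner_Integration.integrable_sum)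
  have Q_meas: "?Q \<in> borel_measurable M" using dW_meas by measurable
  have Q_int: "integrable M (\<lambda>om. (?Q om)^2)"
   by (rule Bochner_Integration.integrable_bound[OF R_int]) (use Q4 Q_meas in \<open>auto intro!: AE_I2 order_trans[OF _ abs_ge_self] simp del: sum.lessThan_Suc\<close>)
  have "expectation (\<lambda>om. (?Q om)^2) \<le> expectation (\<lambda>om. real (Suc n) * (\<Sum>i<Suc n. (norm (dW n i om)) ^ 4))"
   by (intro integral_mono Q_int R_int Q4)
  also have "... = real (Suc n) * (\<Sum>i<Suc n. expectation (\<lambda>om. (norm (dW n i om)) ^ 4))"
   using m4(1) by (simp add: Bochner_Integration.integral_sum del: sum.lessThan_Suc)
  also have "... \<le> real (Suc n) * (\<Sum>i<Suc n. 48 * (real CARD('d))^2 * (T / real (Suc n))^2)" by (intro mult_left_mono sum_mono m4(2)) simp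
  also have "... = 48 * (real CARD('d))^2 * T^2" by (simp add: power_divide power2_eq_square field_simps del: of_nat_Suc)
  finally have Q_E: "expectation (\<lambda>om. (?Q om)^2) \<le> 48 * (real CARD('d))^2 * T^2" .
  have le: "(approx n om)^2 \<le> 2 * (?L om)^2 + B2^2 / 2 * (?Q om)^2" for om
  proof -
   let ?q = "\<Sum>i<Suc n. dW n i om \<bullet> (quad (X (?t i) om) *v dW n i om) / 2"
   have "\<bar>?q\<bar> \<le> (\<Sum>i<Suc n. B2 * (norm (dW n i om))^2 / 2)"
   proof (rule order_trans[OF sum_abs sum_mono])
    fix i
    have "\<bar>dW n i om \<bullet> (quad (X (?t i) om) *v dW n i om)\<bar> \<le> norm (dW n i om) * (norm (quad (X (?t i) om)) * norm (dW n i om))"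
     by (rule inner_matrix_vector_mult_le)
    also have "... \<le> norm (dW n i om) * (B2 * norm (dW n i om))" by (intro mult_left_mono mult_right_mono B2) auto
    finally show "\<bar>dW n i om \<bullet> (quad (X (?t i) om) *v dW n i om) / 2\<bar> \<le> B2 * (norm (dW n i om))^2 / 2"
     by (simp add: power2_eq_square mult.left_commute)
   qed
   also have "... = B2 / 2 * ?Q om" by (simp add: sum_distrib_left mult.commute del: sum.lessThan_Suc)
   finally have "?q^2 \<le> (B2 / 2 * ?Q om)^2"
    using B2(1) by (intro power2_le_iff_abs_le[THEN iffD2]) (auto intro!: mult_nonneg_nonneg sum_nonneg simp del: sum.lessThan_Suc)
   moreover have "approx n om = ?L om + ?q" unfolding approx_def sum.distrib ..
   moreover have "(?L om + ?q)^2 \<le> 2 * (?L om)^2 + 2 * ?q^2" using norm_add_square_le[of 1 "?L om" ?q] by (simp del: sum.lessThan_Suc)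
   ultimately show ?thesis by (simp add: power_mult_distrib power_divide del: sum.lessThan_Suc)
  qed
  have S_int: "integrable M (\<lambda>om. 2 * (?L om)^2 + B2^2 / 2 * (?Q om)^2)"
   using L_int Q_int by (intro Bochner_Integration.integrable_add integrable_mult_right)
  have int: "integrable M (\<lambda>om. (approx n om)^2)" by (rule Bochner_Integration.integrable_bound[OF S_int])
     (use le approx_meas' in \<open>auto intro!: AE_I2 order_trans[OF _ abs_ge_self] simp del: sum.lessThan_Suc\<close>)
  have "expectation (\<lambda>om. (approx n om)^2) \<le> expectation (\<lambda>om. 2 * (?L om)^2 + B2^2 / 2 * (?Q om)^2)"
   by (intro integral_mono int S_int le)
  also have "... = 2 * expectation (\<lambda>om. (?L om)^2) + B2^2 / 2 * expectation (\<lambda>om. (?Q om)^2)"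
   using L_int Q_int by (simp del: sum.lessThan_Suc)
  also have "... \<le> K" unfolding K_def by (intro add_mono mult_left_mono L_E Q_E) auto
  finally show ?thesis using int by blast
 qed
 thus ?thesis by (intro that[of K]) auto
qed

lemma osc_meas: "osc n \<in> borel_measurable M" unfolding osc_def[abs_def]
proof (intro borel_measurable_sum borel_measurable_set_LINT grid_nn)
 fix i s assume "0 \<le> (s::real)"
 hence [measurable]: "(\<lambda>om. \<rho> (X s om)) \<in> borel_measurable M" "(\<lambda>om. \<rho> (XG n i om)) \<in> borel_measurable M"
  by (auto intro!: X_comp_meas \<rho>_cont grid_nn)
 show "(\<lambda>om. (norm (\<rho> (X s om) - \<rho> (XG n i om)))^2) \<in> borel_measurable M" by measurable
qed (intro continuous_intros X_comp_cont \<rho>_cont order_refl)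

lemma osc_tendsto_0:
 assumes om: "om \<in> space M"
 shows "(\<lambda>n. osc n om) \<longlonglongrightarrow> 0"
proof (rule LIMSEQ_I)
 fix e :: real assume e: "e > 0"
 define d where "d = sqrt (e / (2 * T))"
 have d: "d > 0" "d^2 * T < e" using e T by (auto simp: d_def field_simps)
 have c: "continuous_on S (\<lambda>s. \<rho> (X s om))" if "S \<subseteq> {0..}" for S by (rule X_comp_cont[OF \<rho>_cont om that])
 from unif_grid_approx[OF T' c d(1)] obtain n0 where n0: "\<And>n i s. n \<ge> n0 \<Longrightarrow> i < Suc n \<Longrightarrow>
   s \<in> {tg n i..tg n (Suc i)} \<Longrightarrow> dist (\<rho> (X s om)) (\<rho> (XG n i om)) \<le> d"
  unfolding eventually_sequentially by (meson atLeastAtMost_iff atLeast_iff subsetI)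
 show "\<exists>n0. \<forall>n\<ge>n0. norm (osc n om - 0) < e"
 proof (intro exI allI impI)
  fix n assume n: "n \<ge> n0"
  let ?t = "tg n"
  have "norm (osc n om) \<le> (\<Sum>i<Suc n. d^2 * (T / real (Suc n)))" unfolding osc_def
  proof (rule sum_norm_le)
   fix i assume "i \<in> {..<Suc n}"
   hence i: "i < Suc n" by simp
   have "norm (LBINT s:{?t i..?t (Suc i)}. (norm (\<rho> (X s om) - \<rho> (X (?t i) om)))^2) \<le> d^2 * (?t (Suc i) - ?t i)"
   proof (intro LINT_norm_le continuous_intros c)
    fix s assume "s \<in> {?t i..?t (Suc i)}"
    thus "norm ((norm (\<rho> (X s om) - \<rho> (X (?t i) om)))^2) \<le> d^2" using n0[OF n i] by (auto simp: dist_norm intro: power_mono)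
   qed (use unif_grid_range[OF T' i] in auto)
   thus "norm (LBINT s:{?t i..?t (Suc i)}. (norm (\<rho> (X s om) - \<rho> (X (?t i) om)))^2) \<le> d^2 * (T / real (Suc n))"
    by (simp only: unif_grid_step)
  qed
  also have "... = d^2 * T" by simp
  finally show "norm (osc n om - 0) < e" using d by simp
 qed
qed

text \<open>Both error sums are split according to the size of \<open>osc\<close>: on
  \<open>osc \<le> v\<close> the tail bounds are proportional to \<open>v\<close>, and the
  complementary event vanishes as \<open>n\<close> grows.\<close>

lemma error_prob_tendsto:
 assumes a: "a > 0"
 shows "(\<lambda>n. prob {om \<in> space M. a < ss dI n om}) \<longlonglongrightarrow> 0"
  "(\<lambda>n. prob {om \<in> space M. a < \<bar>gs dI n om\<bar>}) \<longlonglongrightarrow> 0"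
proof -
 let ?O = "\<lambda>v n. {om \<in> space M. v \<le> osc n om}"
 have osc0: "(\<lambda>n. prob (?O v n)) \<longlonglongrightarrow> 0" if "v > 0" for v
  by (rule AE_tendsto_imp_prob_tendsto[OF osc_meas _ that]) (auto intro: osc_tendsto_0)
 have split: "prob {om \<in> space M. a < S om} \<le> prob (?O v n) + prob {om \<in> space M. a \<le> S om \<and> osc n om \<le> v}"
  if [measurable]: "S \<in> borel_measurable M" for S n v
 proof -
  note osc_meas[of n, measurable]
  have "prob {om \<in> space M. a < S om} \<le> prob (?O v n \<union> {om \<in> space M. a \<le> S om \<and> osc n om \<le> v})"
   by (rule finite_measure_mono) auto
  also have "... \<le> prob (?O v n) + prob {om \<in> space M. a \<le> S om \<and> osc n om \<le> v}"
   by (rule measure_Un_le) measurable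
  finally show ?thesis .
 qed
 show "(\<lambda>n. prob {om \<in> space M. a < ss dI n om}) \<longlonglongrightarrow> 0"
 proof (rule tendsto_0_by_split[OF _ _ _ osc0])
  fix v :: real and n assume v: "v > 0"
  have m: "ss dI n \<in> borel_measurable M" using dI_meas by measurable
  have "prob {om \<in> space M. a \<le> ss dI n om \<and> osc n om \<le> v} \<le> exp 1 * (real CARD('d))^2 * v / a"
   unfolding osc_def dI_def dW_def
   by (rule ito_increment_error_tail[OF _ _ _ a v]) (use less_imp_le[OF grid_lt] X_comp_adapted[OF \<rho>_cont grid_nn] in auto)
  with split[OF m, of v n]
  show "prob {om \<in> space M. a < ss dI n om} \<le> prob (?O v n) + (exp 1 * (real CARD('d))^2 / a) * v"
   by simp
 qed (use a in auto)
 obtain B where B: "0 < B" "\<And>x. norm (g x) \<le> B" using supp_bounded[OF g_cont] supp by metis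
 show "(\<lambda>n. prob {om \<in> space M. a < \<bar>gs dI n om\<bar>}) \<longlonglongrightarrow> 0"
 proof (rule tendsto_0_by_split[OF _ _ _ osc0])
  fix v :: real and n assume v: "v > 0"
  let ?t = "tg n"
  let ?S = "\<lambda>om. \<Sum>i<Suc n. g (X (?t i) om) \<bullet> dI n i om"
  have m: "?S \<in> borel_measurable M" by (intro borel_measurable_sum borel_measurable_inner dI_meas X_comp_meas[OF g_cont grid_nn])
  let ?u = "\<lambda>i om. g (X (?t i) om)" and ?w = "\<lambda>i om. - (transpose (\<rho> (X (?t i) om)) *v g (X (?t i) om))"
  let ?d = "\<lambda>i s om. \<rho> (X s om) - \<rho> (X (?t i) om)"
  let ?R = "{om \<in> space M. a \<le> \<bar>\<Sum>i<Suc n. ito_sum ?t ?u ?w i om\<bar> \<and> (\<Sum>i<Suc n. ito_QV ?t ?u ?w i om) \<le> B^2 * v}"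
  have S: "?S om = (\<Sum>i<Suc n. ito_sum ?t ?u ?w i om)" for om
  proof -
   have "u \<bullet> (a - A *v z) = u \<bullet> a + (- (transpose A *v u)) \<bullet> z" for u a z :: "real^'d" and A :: "real^'d^'d"
    using inner_mult_transpose[of u A z] by (simp add: inner_diff_right)
   thus ?thesis unfolding ito_sum_def dI_def dW_def by simp
  qed
  have Q: "(\<Sum>i<Suc n. ito_QV ?t ?u ?w i om) \<le> B^2 * osc n om" if om: "om \<in> space M" for om unfolding osc_def sum_distrib_left
  proof (rule sum_mono)
   fix i assume "i \<in> {..<Suc n}"
   have c: "continuous_on {?t i..?t (Suc i)} (\<lambda>s. \<rho> (X s om))" by (rule X_comp_cont[OF \<rho>_cont om]) (use grid_nn[of n i] in auto)
   have "ito_QV ?t ?u ?w i om \<le> (LBINT s:{?t i..?t (Suc i)}. B^2 * (norm (?d i s om))^2)" unfolding ito_QV_def QV_def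
   proof (rule set_integral_mono)
    show "set_integrable lborel {?t i..?t (Suc i)} (\<lambda>s. (norm (transpose (\<rho> (X s om)) *v ?u i om + ?w i om))^2)"
     by (rule borel_integrable_atLeastAtMost'[OF continuous_on_QV_integrand[OF om grid_nn]])
    show "set_integrable lborel {?t i..?t (Suc i)} (\<lambda>s. B^2 * (norm (?d i s om))^2)"
     by (intro borel_integrable_atLeastAtMost' continuous_intros c)
    fix s
    have "transpose (\<rho> (X s om)) *v ?u i om + ?w i om = transpose (?d i s om) *v g (X (?t i) om)"
     by (simp add: vec_eq_iff matrix_vector_mult_def transpose_def algebra_simps sum_subtractf)
    hence "norm (transpose (\<rho> (X s om)) *v ?u i om + ?w i om) \<le> norm (?d i s om) * norm (g (X (?t i) om))"
     using norm_transpose_mult_le by metis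
    also have "... \<le> norm (?d i s om) * B" by (intro mult_left_mono B) auto
    finally show "(norm (transpose (\<rho> (X s om)) *v ?u i om + ?w i om))^2 \<le> B^2 * (norm (?d i s om))^2"
     using power_mono[of _ "norm (?d i s om) * B" 2] by (simp only: power_mult_distrib mult.commute norm_ge_zero)
   qed
   thus "ito_QV ?t ?u ?w i om \<le> B^2 * (LBINT s:{?t i..?t (Suc i)}. (norm (?d i s om))^2)" by simp
  qed
  have u_m: "?u i \<in> borel_measurable (\<F> (?t i))" for i by (rule X_comp_adapted[OF g_cont grid_nn])
  have w_m: "?w i \<in> borel_measurable (\<F> (?t i))" for i
   by (intro borel_measurable_uminus borel_measurable_transpose_mult X_comp_adapted \<rho>_cont g_cont grid_nn)
  note sm = ito_sums_meas[of ?t "Suc n" ?u ?w, OF _ less_imp_le[OF grid_lt] u_m w_m]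
  have "prob {om \<in> space M. a \<le> \<bar>?S om\<bar> \<and> osc n om \<le> v}
   \<le> prob ?R"
  proof (rule finite_measure_mono)
   show "{om \<in> space M. a \<le> \<bar>?S om\<bar> \<and> osc n om \<le> v}
    \<subseteq> ?R"
    unfolding S using Q mult_left_mono[of "osc n _" v "B^2"] by (auto simp del: sum.lessThan_Suc intro: order_trans)
   show "?R \<in> sets M"
    using sm by measurable
  qed
  also have "... \<le> 2 * exp (- (a^2 / (2 * (B^2 * v))))"
   by (rule ito_tail[where t="?t" and u="?u" and w="?w", OF _ less_imp_le[OF grid_lt] u_m w_m a]) (use B v in auto)
  \<comment> \<open>The exponential is weakened to the reciprocal of its argument, giving the linear
    dependence on \<open>v\<close> that \<open>tendsto_0_by_split\<close> expects.\<close>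
  also have "... \<le> 2 * (1 / (a^2 / (2 * (B^2 * v))))"
  proof (intro mult_left_mono)
   have "exp (- x) \<le> 1 / x" if "x > 0" for x :: real
    using that order_trans[OF _ exp_ge_add_one_self, of x x] by (simp add: exp_minus field_simps)
   thus "exp (- (a^2 / (2 * (B^2 * v)))) \<le> 1 / (a^2 / (2 * (B^2 * v)))"
    using a B(1) v by (auto intro!: divide_pos_pos mult_pos_pos simp del: divide_divide_eq_right)
  qed simp
  finally have "prob {om \<in> space M. a \<le> \<bar>?S om\<bar> \<and> osc n om \<le> v} \<le> (4 * B^2 / a^2) * v" by simp
  with split[of "\<lambda>om. \<bar>?S om\<bar>" v n] m
  show "prob {om \<in> space M. a < \<bar>?S om\<bar>} \<le> prob (?O v n) + (4 * B^2 / a^2) * v"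
   by (simp del: sum.lessThan_Suc)
 qed auto
qed

lemma error_subsequence:
 obtains k :: "nat \<Rightarrow> nat" where "strict_mono k"
  "AE om in M. (\<lambda>n. ss dI (k n) om) \<longlonglongrightarrow> 0"
  "AE om in M. (\<lambda>n. \<bar>gs dI (k n) om\<bar>) \<longlonglongrightarrow> 0"
proof -
 let ?A = "\<lambda>n om. ss dI n om"
 let ?B = "\<lambda>n om. \<bar>gs dI n om\<bar>"
 let ?Y = "\<lambda>j n om. ennreal (if j then ?A n om else ?B n om)"
 have A_m: "?A n \<in> borel_measurable M" for n using dI_meas by measurable
 have B_m: "?B n \<in> borel_measurable M" for n
  by (intro borel_measurable_abs borel_measurable_sum borel_measurable_inner dI_meas X_comp_meas[OF g_cont grid_nn])
 obtain k :: "nat \<Rightarrow> nat" where k: "strict_mono k" "AE om in M. \<forall>j\<in>UNIV. (\<lambda>n. ?Y j (k n) om) \<longlonglongrightarrow> 0"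
 proof (rule AE_subsequence[of UNIV ?Y])
  show "?Y j n \<in> borel_measurable M" for j n using A_m[of n] B_m[of n] by (cases j) simp_all
  show "(\<lambda>n. prob {om \<in> space M. ennreal \<eta> < ?Y j n om}) \<longlonglongrightarrow> 0" if "\<eta> > 0" for j \<eta>
   using error_prob_tendsto[OF that] that by (cases j) (simp_all add: ennreal_less_iff del: sum.lessThan_Suc)
 qed auto
 have conv: "(\<lambda>n. x n) \<longlonglongrightarrow> (0::real)" if "(\<lambda>n. ennreal (x n)) \<longlonglongrightarrow> 0" "\<And>n. 0 \<le> x n" for x :: "nat \<Rightarrow> real"
  using that tendsto_ennreal_iff[of x sequentially 0] by simp
 show ?thesis
 proof (rule that[OF k(1)])
  show "AE om in M. (\<lambda>n. ?A (k n) om) \<longlonglongrightarrow> 0" using k(2)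
  proof eventually_elim
   case (elim om)
   from bspec[OF elim, of True] show ?case by (intro conv) (auto intro!: sum_nonneg simp del: sum.lessThan_Suc)
  qed
  show "AE om in M. (\<lambda>n. ?B (k n) om) \<longlonglongrightarrow> 0" using k(2)
  proof eventually_elim
   case (elim om)
   from bspec[OF elim, of False] show ?case by (intro conv) (auto simp del: sum.lessThan_Suc)
  qed
 qed
qed

text \<open>On a fixed path the drift is bounded over the time interval, so its cell increments are
  of order \<open>1 / n\<close>; their squares sum to zero in the limit, and freezing the gradient
  costs only its modulus of continuity.\<close>

lemma drift_tendsto:
 assumes om: "om \<in> space M"
 shows "(\<lambda>n. gs db n om) \<longlonglongrightarrow> (LBINT s:{0..T}. g (X s om) \<bullet> \<beta> (X s om))"
  "(\<lambda>n. ss db n om) \<longlonglongrightarrow> 0"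
proof -
 let ?e = "\<lambda>s. g (X s om) \<bullet> \<beta> (X s om)"
 have c: "continuous_on {a..b} (\<lambda>s. h (X s om))" if "0 \<le> a" "continuous_on UNIV h" for a b and h :: "real^'d \<Rightarrow> real^'d"
  by (rule X_comp_cont[OF that(2) om]) (use that in auto)
 have "compact ((\<lambda>s. \<beta> (X s om)) ` {0..T})" by (intro compact_continuous_image c \<beta>_cont) auto
 then obtain K where K: "0 < K" "\<And>s. s \<in> {0..T} \<Longrightarrow> norm (\<beta> (X s om)) \<le> K"
  by (auto dest!: compact_imp_bounded simp: bounded_pos)
 have db: "norm (db n i om) \<le> K * (T / real (Suc n))" if i: "i < Suc n" for n i
 proof -
  have "norm (db n i om) \<le> K * (tg n (Suc i) - tg n i)"
   unfolding db_def by (intro LINT_norm_le c \<beta>_cont K) (use unif_grid_range[OF T' i] in auto)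
  thus ?thesis by (simp only: unif_grid_step)
 qed
 show "(\<lambda>n. ss db n om) \<longlonglongrightarrow> 0"
 proof (rule tendsto_sandwich[OF _ _ tendsto_const])
  show "\<forall>\<^sub>F n in sequentially. ss db n om \<le> (K * T)^2 / real (Suc n)"
  proof (intro always_eventually allI)
   fix n
   have "ss db n om \<le> (\<Sum>i<Suc n. (K * (T / real (Suc n)))^2)" by (intro sum_mono power_mono db) auto
   thus "ss db n om \<le> (K * T)^2 / real (Suc n)"
    by (simp add: power_divide power2_eq_square field_simps del: of_nat_Suc sum.lessThan_Suc)
  qed
  show "(\<lambda>n. (K * T)^2 / real (Suc n)) \<longlonglongrightarrow> 0" by (rule LIMSEQ_Suc[OF lim_const_over_n])
 qed (auto intro!: always_eventually sum_nonneg simp del: sum.lessThan_Suc)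
 show "(\<lambda>n. gs db n om) \<longlonglongrightarrow> (LBINT s:{0..T}. ?e s)"
 proof (rule LIMSEQ_I)
  fix e :: real assume e: "e > 0"
  define d where "d = e / (2 * K * T)"
  have d: "d > 0" "d * K * T < e" using e T K by (auto simp: d_def field_simps)
  from unif_grid_approx[OF T' c[OF order_refl g_cont] d(1)] obtain n0 where n0: "\<And>n i s. n \<ge> n0 \<Longrightarrow> i < Suc n \<Longrightarrow>
   s \<in> {tg n i..tg n (Suc i)} \<Longrightarrow> dist (g (X s om)) (g (XG n i om)) \<le> d"
   unfolding eventually_sequentially by blast
  show "\<exists>n0. \<forall>n\<ge>n0. norm (gs db n om - (LBINT s:{0..T}. ?e s)) < e"
  proof (intro exI allI impI)
   fix n assume n: "n \<ge> n0"
   let ?t = "tg n"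
   let ?J = "\<lambda>i. {?t i..?t (Suc i)}" and ?G = "\<lambda>i s. g (X (?t i) om) \<bullet> \<beta> (X s om)"
   have gc: "continuous_on (?J i) ?e" for i
    by (intro continuous_intros c grid_nn g_cont \<beta>_cont)
   have "(LBINT s:{0..T}. ?e s) = (\<Sum>i<Suc n. LBINT s:?J i. ?e s)"
    using LINT_split_grid[of "Suc n" ?t ?e] unif_grid_range[OF T'] by (simp add: continuous_intros c g_cont \<beta>_cont)
   moreover have "g (X (?t i) om) \<bullet> db n i om = (LBINT s:?J i. ?G i s)" for i
   proof -
    have "set_integrable lborel (?J i) (\<lambda>s. \<beta> (X s om))" by (intro borel_integrable_atLeastAtMost' c grid_nn \<beta>_cont)
    thus ?thesis unfolding db_def set_lebesgue_integral_def set_integrable_def by (subst integral_inner_right[symmetric]) auto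
   qed
   ultimately have "norm ((\<Sum>i<Suc n. g (X (?t i) om) \<bullet> db n i om) - (LBINT s:{0..T}. ?e s))
    = norm (\<Sum>i<Suc n. (LBINT s:?J i. ?G i s) - (LBINT s:?J i. ?e s))"
    by (simp only: sum_subtractf)
   also have "... \<le> (\<Sum>i<Suc n. (d * K) * (T / real (Suc n)))"
   proof (rule sum_norm_le)
    fix i assume "i \<in> {..<Suc n}"
    hence i: "i < Suc n" by simp
    have "(LBINT s:?J i. ?G i s) - (LBINT s:?J i. ?e s)
     = (LBINT s:?J i. ?G i s - ?e s)"
     by (rule set_integral_diff(2)[symmetric]) (intro borel_integrable_atLeastAtMost' continuous_intros c grid_nn g_cont \<beta>_cont)+
    also have "norm ... \<le> (d * K) * (?t (Suc i) - ?t i)"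
    proof (intro LINT_norm_le continuous_intros c grid_nn g_cont \<beta>_cont)
     fix s assume s: "s \<in> ?J i"
     have "norm (?G i s - ?e s) = \<bar>(g (X (?t i) om) - g (X s om)) \<bullet> \<beta> (X s om)\<bar>"
      by (simp add: inner_diff_left)
     also have "... \<le> norm (g (X (?t i) om) - g (X s om)) * norm (\<beta> (X s om))" by (rule Cauchy_Schwarz_ineq2)
     also have "... \<le> d * K" using n0[OF n i s] K(2)[of s] s unif_grid_range[OF T' i] d
      by (intro mult_mono) (auto simp: dist_norm norm_minus_commute)
     finally show "norm (?G i s - ?e s) \<le> d * K" .
    qed (use unif_grid_range[OF T' i] in auto)
    finally show "norm ((LBINT s:?J i. ?G i s) - (LBINT s:?J i. ?e s)) \<le> (d * K) * (T / real (Suc n))"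
     by (simp only: unif_grid_step)
   qed
   also have "... = d * K * T" by simp
   finally show "norm ((\<Sum>i<Suc n. g (X (?t i) om) \<bullet> db n i om) - (LBINT s:{0..T}. ?e s)) < e" using d by simp
  qed
 qed
qed

text \<open>The generator applied to \<open>f\<close>: by cyclicity the trace of
  \<open>quad x\<close> is that of the Hessian times the diffusion matrix.\<close>

definition "gen x = g x \<bullet> \<beta> x + trace (quad x) / 2"

definition "drift om = (LBINT s:{0..T}. g (X s om) \<bullet> \<beta> (X s om))"

lemma trace_quad_supp: "r \<le> norm x \<Longrightarrow> trace (quad x) = 0" by (simp add: quad_supp trace_def)

lemma approx_expectation_tendsto:
 "(\<lambda>n. expectation (approx n)) \<longlonglongrightarrow> expectation (\<lambda>om. LBINT s:{0..T}. trace (quad (X s om)) / 2)"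
proof -
 have tc: "continuous_on UNIV (\<lambda>x. trace (quad x))" by (intro continuous_intros quad_cont)
 obtain B where B: "\<And>x. norm (trace (quad x)) \<le> B" using supp_bounded[OF tc trace_quad_supp] by metis
 let ?S = "\<lambda>n om. \<Sum>i<Suc n. trace (quad (XG n i om)) / 2 * (T / real (Suc n))"
 have int: "integrable M (\<lambda>om. trace (quad (XG n i om)))" for n i
  by (rule integrable_const_bound[where B=B]) (use B X_comp_meas[OF tc grid_nn] in auto)
 have "expectation (approx n) = expectation (?S n)" for n
  using int by (simp add: approx_expectation Bochner_Integration.integral_sum sum_divide_distrib mult.commute del: sum.lessThan_Suc of_nat_Suc)
 moreover have "(\<lambda>n. expectation (?S n)) \<longlonglongrightarrow> expectation (\<lambda>om. LBINT s:{0..T}. trace (quad (X s om)) / 2)"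
 proof (rule integral_dominated_convergence[where w="\<lambda>_. B * T"])
  show "(\<lambda>om. LBINT s:{0..T}. trace (quad (X s om)) / 2) \<in> borel_measurable M" by (rule borel_measurable_set_LINT)
     (auto intro!: borel_measurable_divide X_comp_meas[OF tc] continuous_on_divide X_comp_cont[OF tc])
  show "?S n \<in> borel_measurable M" for n
   by (intro borel_measurable_sum borel_measurable_times borel_measurable_divide X_comp_meas[OF tc grid_nn]) simp_all
  show "AE om in M. (\<lambda>n. ?S n om) \<longlonglongrightarrow> (LBINT s:{0..T}. trace (quad (X s om)) / 2)" using AE_space
  proof eventually_elim
   case (elim om)
   show ?case by (rule Riemann_sum_tendsto[OF T']) (auto intro!: continuous_on_divide X_comp_cont[OF tc elim])
  qed
  show "AE om in M. norm (?S n om) \<le> B * T" for n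
  proof (rule AE_I2)
   fix om
   have "norm (?S n om) \<le> (\<Sum>i<Suc n. B * (T / real (Suc n)))"
   proof (rule sum_norm_le)
    fix i
    have "\<bar>trace (quad (XG n i om))\<bar> / 2 \<le> B" using B[of "XG n i om"] by simp
    hence "\<bar>trace (quad (XG n i om))\<bar> / 2 * (T / real (Suc n)) \<le> B * (T / real (Suc n))"
     using T by (intro mult_right_mono) auto
    thus "norm (trace (quad (XG n i om)) / 2 * (T / real (Suc n))) \<le> B * (T / real (Suc n))" using T by (simp add: abs_mult)
   qed
   thus "norm (?S n om) \<le> B * T" by simp
  qed
 qed simp
 ultimately show ?thesis by simp
qed

abbreviation "near d n om \<equiv> \<forall>i<Suc n. norm (X (tg n (Suc i)) om - XG n i om) \<le> d"
abbreviation "err c n om \<equiv> \<bar>gs db n om - drift om\<bar> + \<bar>gs dI n om\<bar> + c * (ss db n om + ss dI n om)"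

text \<open>The order of quantifiers is the point: the constant in front of the non-vanishing sum of
  squared Brownian increments is fixed before \<kappa>, whereas \<open>c'\<close> and
  \<open>\<rho>0\<close> may degenerate with \<kappa> since they only meet quantities that vanish
  along a subsequence.\<close>

lemma pathwise_bound:
 assumes \<kappa>: "\<kappa> > 0"
 obtains c where "0 \<le> c" "\<And>\<kappa>. \<kappa> > 0 \<Longrightarrow> \<exists>c' \<rho>0. 0 < \<rho>0 \<and> (AE om in M. \<forall>n.
  near \<rho>0 n om \<longrightarrow> \<bar>f (X T om) - f (X 0 om) - approx n om - drift om\<bar> \<le> c * \<kappa> * ss dW n om + err c' n om)"
proof -
 obtain CD where CD: "0 < CD" "\<And>x. norm (D x) \<le> CD" using supp_bounded[OF D_cont] supp by metis
 have "compact (\<rho> ` cball 0 (r + 1))" by (intro compact_continuous_image continuous_on_subset[OF \<rho>_cont]) auto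
 then obtain M1 where M1: "0 < M1" "\<And>x. x \<in> cball 0 (r + 1) \<Longrightarrow> norm (\<rho> x) \<le> M1"
  by (auto dest!: compact_imp_bounded simp: bounded_pos)
 show ?thesis
 proof (rule that[of "(CD + 2) * M1^2"])
  fix \<kappa> :: real assume \<kappa>: "\<kappa> > 0"
  obtain \<rho>0 where \<rho>0: "0 < \<rho>0"
   "\<And>x y. norm (y - x) \<le> \<rho>0 \<Longrightarrow> \<bar>f y - f x - g x \<bullet> (y - x) - (y - x) \<bullet> (D x *v (y - x)) / 2\<bar>
    \<le> \<kappa> * (if norm x \<le> r + 1 then (norm (y - x))^2 else 0)" by (rule taylor_remainder[OF \<kappa>]) blast
  define c' where "c' = 2 * (CD / \<kappa> + CD + 2 * \<kappa>)"
  have "AE om in M. \<forall>n.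
  near \<rho>0 n om \<longrightarrow> \<bar>f (X T om) - f (X 0 om) - approx n om - drift om\<bar> \<le> (CD + 2) * M1^2 * \<kappa> * ss dW n om + err c' n om" using X_increment
  proof eventually_elim
   case (elim om)
   show ?case
   proof (intro allI impI)
    fix n
    assume small: "near \<rho>0 n om"
    let ?x = "\<lambda>i. XG n i om"
    let ?a = "\<lambda>i. lin (?x i) \<bullet> dW n i om + dW n i om \<bullet> (quad (?x i) *v dW n i om) / 2"
    let ?z = "\<lambda>i. f (?x (Suc i)) - f (?x i) - ?a i - g (?x i) \<bullet> db n i om - g (?x i) \<bullet> dI n i om"
    let ?A = "(CD + 2) * M1^2 * \<kappa>"
    have step: "\<bar>?z i\<bar> \<le> ?A * (norm (dW n i om))^2 + c' * ((norm (db n i om))^2 + (norm (dI n i om))^2)" if "i < Suc n" for i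
     unfolding lin_def quad_def c'_def
    proof (rule one_step_bound[OF \<kappa> CD(2) _ less_imp_le[OF M1(1)]])
     show "?x (Suc i) - ?x i = \<rho> (?x i) *v dW n i om + (db n i om + dI n i om)"
      using elim[rule_format, OF grid_nn less_imp_le[OF grid_lt], of n i] by (simp add: db_def dI_def)
     show "norm (\<rho> (?x i)) \<le> M1" if "norm (?x i) \<le> r + 1" using M1(2) that by simp
    qed (use \<rho>0(2) small that in auto)
    \<comment> \<open>The increments of \<open>f\<close> telescope; what each \<open>?z i\<close>
      leaves over is covered by \<open>one_step_bound\<close>.\<close>
    have tele: "(\<Sum>i<Suc n. f (?x (Suc i)) - f (?x i)) = f (X T om) - f (X 0 om)"
     using sum_lessThan_telescope[of "\<lambda>i. f (?x i)" "Suc n"] by (simp only: unif_grid_simps)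
    have eq: "f (X T om) - f (X 0 om) - approx n om - drift om
     = (\<Sum>i<Suc n. ?z i) + (gs db n om - drift om) + gs dI n om"
    proof -
     have "(\<Sum>i<Suc n. ?z i) = (\<Sum>i<Suc n. f (?x (Suc i)) - f (?x i)) - (\<Sum>i<Suc n. ?a i)
      - gs db n om - gs dI n om" by (simp only: sum_subtractf)
     thus ?thesis unfolding tele approx_def by linarith
    qed
    have "\<bar>\<Sum>i<Suc n. ?z i\<bar> \<le> (\<Sum>i<Suc n. ?A * (norm (dW n i om))^2 + c' * ((norm (db n i om))^2 + (norm (dI n i om))^2))"
     by (rule order_trans[OF sum_abs sum_mono]) (rule step, simp)
    also have "... = ?A * ss dW n om + c' * (ss db n om + ss dI n om)"
     by (simp only: sum.distrib sum_distrib_left distrib_left)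
    finally have z_le: "\<bar>\<Sum>i<Suc n. ?z i\<bar> \<le> ?A * ss dW n om + c' * (ss db n om + ss dI n om)" .
    have aux: "\<bar>a + b + c\<bar> \<le> p + (\<bar>b\<bar> + \<bar>c\<bar> + q)" if "\<bar>a\<bar> \<le> p + q" for a b c p q :: real using that by linarith
    show "\<bar>f (X T om) - f (X 0 om) - approx n om - drift om\<bar> \<le> ?A * ss dW n om + err c' n om" unfolding eq by (rule aux[OF z_le])
   qed
  qed
  with \<rho>0(1) show "\<exists>c' \<rho>0. 0 < \<rho>0 \<and> (AE om in M. \<forall>n.
  near \<rho>0 n om \<longrightarrow> \<bar>f (X T om) - f (X 0 om) - approx n om - drift om\<bar> \<le> (CD + 2) * M1^2 * \<kappa> * ss dW n om + err c' n om)" by blast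
 qed (use CD in simp)
qed

text \<open>The expected remainder \<Delta> converges along the subsequence to the defect
  \<open>z\<close> of the formula. Pathwise the remainder is at most \<kappa> times the sum of
  squared Brownian increments, whose mean is the dimension times \<open>T\<close>, plus a vanishing
  term. As \<kappa> is arbitrary, the defect is zero.\<close>

theorem dynkin:
 assumes f_bounded: "\<And>x. \<bar>f x\<bar> \<le> Bf"
 shows "expectation (\<lambda>om. f (X T om)) = expectation (\<lambda>om. f (X 0 om)) + expectation (\<lambda>om. LBINT s:{0..T}. gen (X s om))"
proof -
 define \<Delta> where "\<Delta> n om = f (X T om) - f (X 0 om) - approx n om - drift om" for n om
 have gb_cont: "continuous_on UNIV (\<lambda>x. g x \<bullet> \<beta> x)" by (intro continuous_intros g_cont \<beta>_cont)
 obtain Bg where Bg: "\<And>x. norm (g x \<bullet> \<beta> x) \<le> Bg" using supp_bounded[OF gb_cont] supp by (metis inner_zero_left)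
 have drift_meas: "drift \<in> borel_measurable M" unfolding drift_def[abs_def]
  by (rule borel_measurable_set_LINT) (auto intro!: X_comp_meas[OF gb_cont] X_comp_cont[OF gb_cont])
 have drift_le: "\<bar>drift om\<bar> \<le> Bg * T" if "om \<in> space M" for om
 proof -
  have "norm (LBINT s:{0..T}. g (X s om) \<bullet> \<beta> (X s om)) \<le> Bg * (T - 0)"
   by (intro LINT_norm_le Bg T' X_comp_cont[OF gb_cont that]) auto
  thus ?thesis by (simp add: drift_def)
 qed
 note f_meas = X_comp_meas[OF f_cont]
 have \<Delta>_meas: "\<Delta> n \<in> borel_measurable M" for n
  unfolding \<Delta>_def[abs_def] by (intro borel_measurable_diff f_meas approx_meas' drift_meas T' order_refl)
 obtain K where K: "\<And>n. integrable M (\<lambda>om. (approx n om)^2)" "\<And>n. expectation (\<lambda>om. (approx n om)^2) \<le> K"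
  by (rule approx_square_bounded) blast
 define C where "C = 2 * Bf + Bg * T"
 have \<Delta>_sq: "(\<Delta> n om)^2 \<le> 2 * C^2 + 2 * (approx n om)^2" if "om \<in> space M" for n om
 proof -
  have "\<bar>f (X T om) - f (X 0 om) - drift om\<bar> \<le> C"
   using f_bounded[of "X T om"] f_bounded[of "X 0 om"] drift_le[OF that] unfolding C_def by linarith
  hence "(f (X T om) - f (X 0 om) - drift om)^2 \<le> C^2" using power_mono[of _ C 2] by fastforce
  moreover have "(\<Delta> n om)^2 \<le> 2 * (f (X T om) - f (X 0 om) - drift om)^2 + 2 * (approx n om)^2"
   using norm_add_square_le[of 1 "f (X T om) - f (X 0 om) - drift om" "- approx n om"] by (simp add: \<Delta>_def algebra_simps)
  ultimately show ?thesis by linarith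
 qed
 have i2: "integrable M (\<lambda>om. 2 * C^2 + 2 * (approx n om)^2)" for n using K(1) by simp
 have E2: "expectation (\<lambda>om. 2 * C^2 + 2 * (approx n om)^2) \<le> 2 * C^2 + 2 * K" for n using K(1,2)[of n] by (simp add: prob_space)
 have f_int: "integrable M (\<lambda>om. f (X t om))" if "0 \<le> t" for t
  by (rule integrable_const_bound[where B=Bf]) (use f_bounded f_meas[OF that] in auto)
 have drift_int: "integrable M drift" by (rule integrable_const_bound[where B="Bg * T"]) (use drift_le drift_meas in auto)
 have \<Delta>_int: "integrable M (\<Delta> n)" for n
  unfolding \<Delta>_def[abs_def] using f_int[of T] f_int[of 0] T' approx_expectation(1) drift_int by simp
 obtain k where k: "strict_mono (k :: nat \<Rightarrow> nat)"
  and k1: "AE om in M. (\<lambda>n. ss dI (k n) om) \<longlonglongrightarrow> 0"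
  and k2: "AE om in M. (\<lambda>n. \<bar>gs dI (k n) om\<bar>) \<longlonglongrightarrow> 0"
  by (rule error_subsequence)
 obtain c where c: "0 \<le> c" and pb: "\<And>\<kappa>. \<kappa> > 0 \<Longrightarrow> \<exists>c' \<rho>0. 0 < \<rho>0 \<and> (AE om in M. \<forall>n.
  near \<rho>0 n om \<longrightarrow> \<bar>\<Delta> n om\<bar> \<le> c * \<kappa> * ss dW n om + err c' n om)"
  unfolding \<Delta>_def by (rule pathwise_bound[OF zero_less_one]) blast
 let ?qi = "\<lambda>om. LBINT s:{0..T}. trace (quad (X s om)) / 2"
 define z where "z = expectation (\<lambda>om. f (X T om)) - expectation (\<lambda>om. f (X 0 om))
   - expectation ?qi - expectation drift"
 have \<Delta>_E: "(\<lambda>n. expectation (\<Delta> (k n))) \<longlonglongrightarrow> z"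
 proof -
  have "expectation (\<Delta> n) = expectation (\<lambda>om. f (X T om)) - expectation (\<lambda>om. f (X 0 om)) - expectation (approx n) - expectation drift" for n
   unfolding \<Delta>_def[abs_def] using f_int[of T] f_int[of 0] T' approx_expectation(1) drift_int by simp
  thus ?thesis unfolding z_def by (simp only:) (intro tendsto_intros LIMSEQ_subseq_LIMSEQ[OF approx_expectation_tendsto k, unfolded o_def])
 qed
 have z_le: "\<bar>z\<bar> \<le> c * \<kappa> * (real CARD('d) * T)" if \<kappa>: "\<kappa> > 0" for \<kappa>
 proof -
  \<comment> \<open>The excess of the remainder over its non-vanishing bound. It tends to zero
    almost surely, and in mean because its second moments are bounded.\<close>
  define Y where "Y n om = max 0 (\<bar>\<Delta> (k n) om\<bar> - c * \<kappa> * ss dW (k n) om)" for n om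
  have W_meas: "ss dW n \<in> borel_measurable M" for n using dW_meas by measurable
  have Y_meas: "Y n \<in> borel_measurable M" for n unfolding Y_def[abs_def] using \<Delta>_meas W_meas by measurable
  have W_nn: "0 \<le> ss dW n om" for n om by (intro sum_nonneg) simp
  have Y_nn: "0 \<le> Y n om" for n om by (simp add: Y_def)
  have Y_le: "Y n om \<le> \<bar>\<Delta> (k n) om\<bar>" for n om
   unfolding Y_def using c \<kappa> W_nn[of "k n" om] by (simp add: mult_nonneg_nonneg del: sum.lessThan_Suc)
  have Y_sq: "(Y n om)^2 \<le> 2 * C^2 + 2 * (approx (k n) om)^2" if "om \<in> space M" for n om
   using power_mono[OF Y_le Y_nn, of n om 2] \<Delta>_sq[OF that, of "k n"] by simp
  have Y2_int: "integrable M (\<lambda>om. (Y n om)^2)" for n by (rule Bochner_Integration.integrable_bound[OF i2[of "k n"]])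
     (use Y_meas Y_sq in \<open>auto intro!: AE_I2 order_trans[OF _ abs_ge_self]\<close>)
  obtain c' \<rho>0 where \<rho>0: "0 < \<rho>0" and pb': "AE om in M. \<forall>n.
  near \<rho>0 n om \<longrightarrow> \<bar>\<Delta> n om\<bar> \<le> c * \<kappa> * ss dW n om + err c' n om" using pb[OF \<kappa>] by blast
  have Y_lim: "AE om in M. (\<lambda>n. Y n om) \<longlonglongrightarrow> 0" using pb' k1 k2 AE_space
  proof eventually_elim
   case (elim om)
   note pw = elim(1)
   \<comment> \<open>Uniform continuity of the path makes all grid increments small enough for the
     Taylor bound.\<close>
   have "\<forall>\<^sub>F n in sequentially. \<forall>i<Suc n. \<forall>s\<in>{tg n i..tg n (Suc i)}. dist (X s om) (XG n i om) \<le> \<rho>0"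
    by (rule unif_grid_approx[OF T' _ \<rho>0]) (rule continuous_on_subset[OF X_cont[OF elim(4)]], simp)
   hence "\<forall>\<^sub>F n in sequentially. near \<rho>0 n om"
    by eventually_elim (use less_imp_le[OF grid_lt] in \<open>auto simp: dist_norm\<close>)
   hence "\<forall>\<^sub>F n in sequentially. near \<rho>0 (k n) om"
    by (rule eventually_subseq[OF k])
   hence le: "\<forall>\<^sub>F n in sequentially. Y n om \<le> err \<bar>c'\<bar> (k n) om"
   proof eventually_elim
    case (elim n)
    have aux: "max 0 (a - b) \<le> p + q + \<bar>d\<bar> * e" if "a \<le> b + (p + q + d * e)" "0 \<le> p" "0 \<le> q" "0 \<le> e" for a b p q d e :: real
     using that mult_right_mono[OF abs_ge_self, of e d] mult_nonneg_nonneg[of "\<bar>d\<bar>" e] by (simp add: max_def)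
    show ?case unfolding Y_def by (rule aux[OF pw[rule_format, OF elim[rule_format]]])
       (simp_all add: sum_nonneg add_nonneg_nonneg del: sum.lessThan_Suc)
   qed
   have "(\<lambda>n. err \<bar>c'\<bar> (k n) om)
     \<longlonglongrightarrow> \<bar>drift om - drift om\<bar> + 0 + \<bar>c'\<bar> * (0 + 0)"
    by (intro tendsto_intros elim(2,3) LIMSEQ_subseq_LIMSEQ[OF drift_tendsto(1)[OF elim(4)] k, unfolded o_def drift_def[symmetric]]
      LIMSEQ_subseq_LIMSEQ[OF drift_tendsto(2)[OF elim(4)] k, unfolded o_def])
   thus ?case by (intro tendsto_sandwich[OF always_eventually le tendsto_const]) (simp_all add: Y_nn)
  qed
  have Y_E: "(\<lambda>n. expectation (Y n)) \<longlonglongrightarrow> 0"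
  proof (rule expectation_tendsto_0_square_bounded[OF Y_meas Y_nn Y_lim Y2_int])
   show "expectation (\<lambda>om. (Y n om)^2) \<le> 2 * C^2 + 2 * K" for n by (rule order_trans[OF integral_mono[OF Y2_int i2 Y_sq] E2])
  qed
  have W_int: "integrable M (ss dW n)" "expectation (ss dW n) = real CARD('d) * T" for n
  proof -
   note m = increment_norm_moments(1,2)[OF grid_nn grid_lt, of n, folded dW_def, unfolded unif_grid_step]
   show "integrable M (ss dW n)" using m by (intro Bochner_Integration.integrable_sum)
   have "expectation (ss dW n) = (\<Sum>i<Suc n. real CARD('d) * (T / real (Suc n)))"
    using m by (simp add: Bochner_Integration.integral_sum del: sum.lessThan_Suc)
   thus "expectation (ss dW n) = real CARD('d) * T" by simp
  qed
  have Y_int: "integrable M (Y n)" for n using Y2_int by (rule square_integrable_imp_integrable[OF Y_meas])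
  have "\<bar>expectation (\<Delta> (k n))\<bar> \<le> expectation (Y n) + c * \<kappa> * (real CARD('d) * T)" for n
  proof -
   have "\<bar>expectation (\<Delta> (k n))\<bar> \<le> expectation (\<lambda>om. \<bar>\<Delta> (k n) om\<bar>)"
    using integral_norm_bound[of M "\<Delta> (k n)"] by simp
   also have "... \<le> expectation (\<lambda>om. Y n om + c * \<kappa> * ss dW (k n) om)"
    using \<Delta>_int W_int(1) Y_int by (intro integral_mono Bochner_Integration.integrable_add integrable_mult_right) (auto simp: Y_def simp del: sum.lessThan_Suc)
   also have "... = expectation (Y n) + c * \<kappa> * expectation (ss dW (k n))" using W_int(1) Y_int by (simp del: sum.lessThan_Suc)
   finally show ?thesis unfolding W_int(2) .
  qed
  moreover have "(\<lambda>n. expectation (Y n) + c * \<kappa> * (real CARD('d) * T)) \<longlonglongrightarrow> 0 + c * \<kappa> * (real CARD('d) * T)"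
   by (intro tendsto_intros Y_E)
  ultimately show ?thesis
   using LIMSEQ_le[OF tendsto_rabs[OF \<Delta>_E], of "\<lambda>n. expectation (Y n) + c * \<kappa> * (real CARD('d) * T)"] by auto
 qed
 have "z = 0"
 proof (rule ccontr)
  assume "z \<noteq> 0"
  define d where "d = c * (real CARD('d) * T)"
  have d: "0 \<le> d" using c T by (simp add: d_def)
  \<comment> \<open>A multiple of the modulus of \<open>z\<close> is inserted for \<kappa>, which
    leaves less than half of it on the right.\<close>
  have "\<bar>z\<bar> \<le> d * (\<bar>z\<bar> / (2 * (d + 1)))"
   using z_le[of "\<bar>z\<bar> / (2 * (d + 1))"] \<open>z \<noteq> 0\<close> d by (simp add: d_def mult.commute mult.left_commute)
  also have "... = \<bar>z\<bar> * (d / (2 * (d + 1)))" by simp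
  also have "... < \<bar>z\<bar> * 1" using d \<open>z \<noteq> 0\<close> by (intro mult_strict_left_mono) (auto simp: field_simps)
  finally show False by simp
 qed
 moreover have "expectation (\<lambda>om. LBINT s:{0..T}. gen (X s om))
   = expectation drift + expectation ?qi"
 proof -
  have tc: "continuous_on UNIV (\<lambda>x. trace (quad x) / 2)" by (intro continuous_intros quad_cont) simp
  obtain B where B: "\<And>x. norm (trace (quad x) / 2) \<le> B" using supp_bounded[OF tc] trace_quad_supp by (metis div_0)
  have "(LBINT s:{0..T}. gen (X s om)) = drift om + ?qi om" if "om \<in> space M" for om
   unfolding gen_def drift_def by (rule set_integral_add(2); rule borel_integrable_atLeastAtMost')
     (rule X_comp_cont[OF gb_cont that] X_comp_cont[OF tc that]; simp)+
  hence "expectation (\<lambda>om. LBINT s:{0..T}. gen (X s om)) = expectation (\<lambda>om. drift om + ?qi om)"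
   by (intro Bochner_Integration.integral_cong) auto
  also have "... = expectation drift + expectation ?qi"
  proof (rule Bochner_Integration.integral_add[OF drift_int])
   show "integrable M ?qi"
   proof (rule integrable_const_bound[where B="B * (T - 0)"])
    show "AE om in M. norm (?qi om) \<le> B * (T - 0)"
     by (rule AE_I2, rule LINT_norm_le[OF T' X_comp_cont[OF tc] B]) simp_all
    show "?qi \<in> borel_measurable M"
     by (rule borel_measurable_set_LINT[OF order_refl X_comp_meas[OF tc] X_comp_cont[OF tc]]) simp_all
   qed
  qed
  finally show ?thesis .
 qed
 ultimately show ?thesis unfolding z_def by simp
qed

end

section \<open>Derivatives and smooth truncation\<close>

lemma grad_has_derivative:
 assumes "f differentiable at x"
 shows "(f has_derivative (\<lambda>h. grad f x \<bullet> h)) (at x)"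
proof -
 have f': "(f has_derivative frechet_derivative f (at x)) (at x)" using assms by (simp add: frechet_derivative_works)
 hence lin: "linear (frechet_derivative f (at x))" by (rule has_derivative_linear)
 have "frechet_derivative f (at x) h = grad f x \<bullet> h" for h
 proof -
  have "frechet_derivative f (at x) h = frechet_derivative f (at x) (\<Sum>i\<in>UNIV. (h $ i) *\<^sub>R axis i 1)"
   by (simp only: basis_expansion scalar_mult_eq_scaleR[symmetric])
  also have "... = (\<Sum>i\<in>UNIV. h $ i * frechet_derivative f (at x) (axis i 1))" by (simp add: linear_sum[OF lin] linear_scale[OF lin])
  finally show ?thesis by (simp add: grad_def inner_vec_def mult.commute)
 qed
 hence "frechet_derivative f (at x) = (\<lambda>h. grad f x \<bullet> h)" by auto
 with f' show ?thesis by simp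
qed

lemma hess_has_derivative:
 assumes "grad f differentiable at x"
 shows "(grad f has_derivative (\<lambda>h. hess f x *v h)) (at x)"
proof -
 let ?G = "frechet_derivative (grad f) (at x)"
 have g': "(grad f has_derivative ?G) (at x)" using assms by (simp add: frechet_derivative_works)
 have "frechet_derivative (\<lambda>y. grad f y $ i) (at x) = (\<lambda>h. ?G h $ i)" for i
  by (rule frechet_derivative_at[symmetric]) (rule bounded_linear.has_derivative[OF bounded_linear_vec_nth g'])
 hence H: "hess f x $ i $ j = ?G (axis j 1) $ i" for i j by (simp add: hess_def)
 have lin: "linear ?G" using g' by (rule has_derivative_linear)
 have "hess f x *v h = ?G h" for h
 proof -
  have "?G h = ?G (\<Sum>j\<in>UNIV. (h $ j) *\<^sub>R axis j 1)" by (simp only: basis_expansion scalar_mult_eq_scaleR[symmetric])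
  also have "... = (\<Sum>j\<in>UNIV. (h $ j) *\<^sub>R ?G (axis j 1))" by (simp add: linear_sum[OF lin] linear_scale[OF lin])
  finally show ?thesis by (simp add: vec_eq_iff matrix_vector_mult_def H mult.commute)
 qed
 thus ?thesis using g' by simp
qed

text \<open>An exponent of at least two smooths the kink of \<open>max 0\<close>: at the origin the
  difference quotient is dominated by a positive power. Applied twice, it makes \<open>cap\<close>
  twice continuously differentiable.\<close>

lemma max_power_has_derivative:
 "((\<lambda>u::real. (max 0 u) ^ Suc (Suc n)) has_real_derivative (real (n + 2) * (max 0 u) ^ Suc n)) (at u)"
proof (cases u "0::real" rule: linorder_cases)
 case less
 have "((\<lambda>u::real. 0) has_real_derivative 0) (at u)" by simp
 hence "((\<lambda>u::real. (max 0 u) ^ Suc (Suc n)) has_real_derivative 0) (at u)" by (rule DERIV_cong_ev[THEN iffD1, rotated 3])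
    (use eventually_nhds_in_open[of "{..<0}" u] less in \<open>auto elim!: eventually_mono\<close>)
 thus ?thesis using less by (simp add: max_def)
next
 case greater
 have "((\<lambda>u::real. u ^ Suc (Suc n)) has_real_derivative (real (n + 2) * u ^ Suc n)) (at u)" using DERIV_pow[of "Suc (Suc n)" u] by simp
 hence "((\<lambda>u::real. (max 0 u) ^ Suc (Suc n)) has_real_derivative (real (n + 2) * u ^ Suc n)) (at u)"
  by (rule DERIV_cong_ev[THEN iffD1, rotated 3])
    (use eventually_nhds_in_open[of "{0<..}" u] greater in \<open>auto elim!: eventually_mono\<close>)
 thus ?thesis using greater by (simp add: max_def)
next
 case equal
 have "((\<lambda>y. ((max 0 y) ^ Suc (Suc n) - (max 0 0) ^ Suc (Suc n)) / (y - 0)) \<longlongrightarrow> 0) (at (0::real))"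
 proof (rule Lim_null_comparison)
  show "\<forall>\<^sub>F y in at (0::real). norm (((max 0 y) ^ Suc (Suc n) - (max 0 0) ^ Suc (Suc n)) / (y - 0)) \<le> \<bar>y\<bar> ^ Suc n"
  proof (intro always_eventually allI)
   fix y :: real
   show "norm (((max 0 y) ^ Suc (Suc n) - (max 0 0) ^ Suc (Suc n)) / (y - 0)) \<le> \<bar>y\<bar> ^ Suc n"
   proof (cases "0 < y")
    case False
    hence "max 0 y = 0" by simp
    hence "norm (((max 0 y) ^ Suc (Suc n) - (max 0 0) ^ Suc (Suc n)) / (y - 0)) = 0" by simp
    thus ?thesis by (simp only: zero_le_power abs_ge_zero)
   qed (simp add: max_def)
  qed
  have "((\<lambda>y::real. \<bar>y\<bar> ^ Suc n) \<longlongrightarrow> \<bar>0\<bar> ^ Suc n) (at 0)" by (intro tendsto_intros)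
  thus "((\<lambda>y::real. \<bar>y\<bar> ^ Suc n) \<longlongrightarrow> 0) (at 0)" by simp
 qed
 hence "((\<lambda>u::real. (max 0 u) ^ Suc (Suc n)) has_real_derivative 0) (at 0)" by (simp add: has_field_derivative_iff)
 thus ?thesis using equal by simp
qed

text \<open>Composing powers of \<open>V\<close> with the concave function \<open>cap\<close>, which is constant from 1 on, gives test
 functions with compactly supported derivatives; \<open>n * cap (w / n)\<close> increases to \<open>3 * w\<close>.\<close>

definition cap :: "real \<Rightarrow> real" where "cap w = 1 - (max 0 (1 - w)) ^ 3"
definition cap' :: "real \<Rightarrow> real" where "cap' w = 3 * (max 0 (1 - w)) ^ 2"
definition cap'' :: "real \<Rightarrow> real" where "cap'' w = - 6 * max 0 (1 - w)"

lemma cap_deriv [derivative_intros]: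
 assumes "(f has_real_derivative f') (at x)"
 shows "((\<lambda>x. cap (f x)) has_real_derivative cap' (f x) * f') (at x)"
  "((\<lambda>x. cap' (f x)) has_real_derivative cap'' (f x) * f') (at x)"
proof -
 have 1: "((\<lambda>x. 1 - f x) has_real_derivative - f') (at x)" using assms by (auto intro!: derivative_eq_intros)
 show "((\<lambda>x. cap (f x)) has_real_derivative cap' (f x) * f') (at x)" unfolding cap_def cap'_def
  using DERIV_diff[OF DERIV_const DERIV_chain2[OF max_power_has_derivative[of 1 "1 - f x"] 1], of 1] by (simp add: numeral_3_eq_3 numeral_2_eq_2)
 show "((\<lambda>x. cap' (f x)) has_real_derivative cap'' (f x) * f') (at x)" unfolding cap'_def cap''_def
  using DERIV_cmult[OF DERIV_chain2[OF max_power_has_derivative[of 0 "1 - f x"] 1], of 3] by (simp add: numeral_3_eq_3 numeral_2_eq_2 mult.assoc)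
qed

lemma cap''_cont: "continuous_on S f \<Longrightarrow> continuous_on S (\<lambda>x. cap'' (f x))" unfolding cap''_def by (intro continuous_intros)

lemma cap'_range: "0 \<le> w \<Longrightarrow> 0 \<le> cap' w \<and> cap' w \<le> 3" unfolding cap'_def by (auto simp: max_def power_le_one)

lemma cap''_nonpos: "cap'' w \<le> 0" unfolding cap''_def by (simp add: max_def)

lemma cap_zero: "1 \<le> w \<Longrightarrow> cap' w = 0 \<and> cap'' w = 0" by (simp add: cap'_def cap''_def max_def)

lemma cap_range: "0 \<le> w \<Longrightarrow> 0 \<le> cap w \<and> cap w \<le> 1 \<and> cap w \<le> 3 * w"
proof -
 assume w: "0 \<le> w"
 have "3 * w - cap w = (w ^ 2) * (3 - w)" if "w \<le> 1" using that by (simp add: cap_def max_def power3_eq_cube power2_eq_square algebra_simps)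
 moreover have "cap w = 1" if "w > 1" using that by (simp add: cap_def max_def)
 moreover have "0 \<le> (w ^ 2) * (3 - w)" if "w \<le> 1" using that by simp
 ultimately have "cap w \<le> 3 * w" using w by (cases "w \<le> 1") linarith+
 moreover have "(max 0 (1 - w)) ^ 3 \<le> 1" using w by (intro power_le_one) auto
 ultimately show ?thesis by (simp add: cap_def)
qed

lemma cap_scaled_tendsto: "(\<lambda>n. real (Suc n) * cap (w / real (Suc n))) \<longlonglongrightarrow> 3 * w"
proof -
 have "\<forall>\<^sub>F n in sequentially. w < real (Suc n)"
  using eventually_sequentially reals_Archimedean2 by (metis (no_types, lifting) less_trans of_nat_less_iff less_Suc_eq_le)
 hence ev: "\<forall>\<^sub>F n in sequentially. 3 * w - 3 * w^2 * (1 / real (Suc n)) + w ^ 3 * ((1 / real (Suc n)) * (1 / real (Suc n))) = real (Suc n) * cap (w / real (Suc n))"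
 proof eventually_elim
  case (elim n)
  hence "cap (w / real (Suc n)) = 1 - (1 - w / real (Suc n)) ^ 3" by (simp add: cap_def max_def)
  also have "1 - (1 - x) ^ 3 = 3 * x - 3 * x^2 + x ^ 3" for x :: real by (simp add: power3_eq_cube power2_eq_square algebra_simps)
  finally have cap: "cap (w / real (Suc n)) = 3 * (w / real (Suc n)) - 3 * (w / real (Suc n))^2 + (w / real (Suc n)) ^ 3" .
  have "3 * w - 3 * w^2 * (1 / N) + w ^ 3 * ((1 / N) * (1 / N)) = N * (3 * (w / N) - 3 * (w / N)^2 + (w / N) ^ 3)" if "N \<noteq> 0" for N
   using that by (simp add: power3_eq_cube power2_eq_square field_simps)
  thus ?case unfolding cap by simp
 qed
 have "(\<lambda>n. 3 * w - 3 * w^2 * (1 / real (Suc n)) + w ^ 3 * ((1 / real (Suc n)) * (1 / real (Suc n)))) \<longlonglongrightarrow> 3 * w - 3 * w^2 * 0 + w ^ 3 * (0 * 0)"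
  by (intro tendsto_intros LIMSEQ_Suc[OF lim_1_over_n])
 thus ?thesis using ev by (auto intro: Lim_transform_eventually)
qed

lemma cap'_scaled_tendsto: "(\<lambda>n. cap' (w / real (Suc n))) \<longlonglongrightarrow> 3"
proof -
 have "(\<lambda>n. 3 * (max 0 (1 - w * (1 / real (Suc n))))^2) \<longlonglongrightarrow> 3 * (max 0 (1 - w * 0))^2"
  by (intro tendsto_intros LIMSEQ_Suc[OF lim_1_over_n])
 thus ?thesis by (simp add: cap'_def)
qed

definition outer :: "real^'n \<Rightarrow> real^'n^'n" where
 "outer v = (\<chi> i j. v $ i * v $ j)"

lemma outer_mult: "outer v *v h = (v \<bullet> h) *\<^sub>R v"
 by (simp add: outer_def vec_eq_iff matrix_vector_mult_def inner_vec_def sum_distrib_left sum_distrib_right mult_ac)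

lemma continuous_on_outer [continuous_intros]:
 "continuous_on S f \<Longrightarrow> continuous_on S (\<lambda>x. outer (f x))" unfolding outer_def by (intro continuous_intros)

lemma trace_outer_mult: "trace (outer v ** A) = v \<bullet> (A *v v)"
proof -
 have "trace (outer v ** A) = (\<Sum>i\<in>UNIV. \<Sum>k\<in>UNIV. v $ i * v $ k * A $ k $ i)"
  by (simp add: trace_def matrix_matrix_mult_def outer_def)
 also have "... = (\<Sum>k\<in>UNIV. \<Sum>i\<in>UNIV. v $ i * v $ k * A $ k $ i)" by (rule sum.swap)
 also have "... = v \<bullet> (A *v v)" by (simp add: inner_vec_def matrix_vector_mult_def sum_distrib_left mult_ac)
 finally show ?thesis .
qed

lemma trace_linear_mult:
 fixes A B C :: "real^'n^'n"
 shows "trace ((a *\<^sub>R A + b *\<^sub>R B) ** C) = a * trace (A ** C) + b * trace (B ** C)"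
 by (simp add: trace_def matrix_matrix_mult_def sum.distrib sum_distrib_left algebra_simps)

text \<open>Fatou's lemma for the counting measure on two points.\<close>

lemma liminf_add_le:
 fixes a b :: "nat \<Rightarrow> ennreal"
 shows "liminf a + liminf b \<le> liminf (\<lambda>n. a n + b n)"
 using nn_integral_liminf[of "\<lambda>n i. if i then a n else b n" "count_space (UNIV :: bool set)"]
 by (simp add: nn_integral_count_space_finite UNIV_bool add.commute)

section \<open>Moment inequalities from the Lyapunov function\<close>

locale lyapunov_diffusion = diffusion M \<F> W X \<beta> \<rho> I
 for M :: "'w measure" and \<F> and W :: "real \<Rightarrow> 'w \<Rightarrow> real^'d" and X \<beta> \<rho> I +
 fixes V :: "real^'d \<Rightarrow> real" and x0 :: "real^'d"
 assumes V: "lyapunov_function V" and X0: "AE om in M. X 0 om = x0"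
  and drift: "- Limsup at_infinity (\<lambda>x. ereal (\<beta> x \<bullet> grad V x + 1/2 * trace ((\<rho> x ** transpose (\<rho> x)) ** hess V x))) > 0"
  and ratio: "((\<lambda>x. (grad V x \<bullet> ((\<rho> x ** transpose (\<rho> x)) *v grad V x)) /
    (V x * \<bar>\<beta> x \<bullet> grad V x + 1/2 * trace ((\<rho> x ** transpose (\<rho> x)) ** hess V x)\<bar>)) \<longlongrightarrow> 0) at_infinity"
begin

definition "LV x = \<beta> x \<bullet> grad V x + 1/2 * trace ((\<rho> x ** transpose (\<rho> x)) ** hess V x)"
text \<open>The rate of quadratic variation of \<open>V\<close> along the diffusion, which the
  second derivative of a power of \<open>V\<close> brings into the generator.\<close>

definition "qV x = grad V x \<bullet> ((\<rho> x ** transpose (\<rho> x)) *v grad V x)"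

lemma V_ge_1: "1 \<le> V x" and V_sublevel: "compact {x. V x \<le> R}" using V by (auto simp: lyapunov_function_def)

lemma V_pos: "0 < V x" using V_ge_1[of x] by simp

lemma V_deriv: "(V has_derivative (\<lambda>h. grad V x \<bullet> h)) (at x)"
 using V by (intro grad_has_derivative) (simp add: lyapunov_function_def C2_def)

lemma V_grad_deriv: "(grad V has_derivative (\<lambda>h. hess V x *v h)) (at x)"
 using V by (intro hess_has_derivative) (simp add: lyapunov_function_def C2_def)

lemma V_cont: "continuous_on UNIV V" by (intro continuous_at_imp_continuous_on ballI has_derivative_continuous[OF V_deriv])

lemma grad_V_cont: "continuous_on UNIV (grad V)" by (intro continuous_at_imp_continuous_on ballI has_derivative_continuous[OF V_grad_deriv])

lemma hess_V_cont: "continuous_on UNIV (hess V)" using V by (simp add: lyapunov_function_def C2_def)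

lemma LV_cont: "continuous_on UNIV LV" unfolding LV_def by (intro continuous_intros \<rho>_cont \<beta>_cont grad_V_cont hess_V_cont)

lemma qV_cont: "continuous_on UNIV qV" unfolding qV_def by (intro continuous_intros \<rho>_cont grad_V_cont)

lemma V_powr_cont: "continuous_on UNIV (\<lambda>x. V x powr q)"
 using V_pos by (intro continuous_on_powr V_cont continuous_on_const) (metis less_irrefl)

lemma V_powr_ge_1: "0 \<le> q \<Longrightarrow> 1 \<le> V x powr q" using V_ge_1 by (intro ge_one_powr_ge_zero)

lemma V_powr_mono: "q \<le> q' \<Longrightarrow> V x powr q \<le> V x powr q'" using V_ge_1 by (intro powr_mono)

lemma qV_nonneg: "0 \<le> qV x"
proof -
 have "qV x = (transpose (\<rho> x) *v grad V x) \<bullet> (transpose (\<rho> x) *v grad V x)"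
  unfolding qV_def matrix_vector_mul_assoc[symmetric] by (rule inner_mult_transpose)
 thus ?thesis by simp
qed

text \<open>The generator applied to \<open>V powr p\<close>, by the chain rule.\<close>

definition "GU p x = p * V x powr (p - 1) * LV x + p * (p - 1) * V x powr (p - 2) * qV x / 2"

text \<open>Far out, \<open>LV\<close> is negative and bounded away from zero, and \<open>qV\<close>
  is at most \<open>V * \<bar>LV\<bar> / p\<close>; this threshold leaves the coefficient
  \<open>p - (p - 1) / 2 = (p + 1) / 2\<close>, at least 1, on the negative part. On the remaining
  ball continuity provides \<open>C\<close>.\<close>

lemma GU_bound:
 assumes p: "1 \<le> p"
 obtains c C where "0 < c" "0 \<le> C" "\<And>x. GU p x \<le> C - c * V x powr (p - 1)"
proof -
 have "Limsup at_infinity (\<lambda>x. ereal (LV x)) < 0" using drift unfolding LV_def ereal_less_uminus_reorder by simp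
 then obtain c' where c': "Limsup at_infinity (\<lambda>x. ereal (LV x)) < c'" "c' < 0" using dense by blast
 then obtain b where b: "c' < ereal b" "ereal b < 0" using ereal_dense2 by blast
 have "\<forall>\<^sub>F x in at_infinity. ereal (LV x) < ereal b" using order.strict_trans[OF c'(1) b(1)] by (rule Limsup_lessD)
 hence e1: "\<forall>\<^sub>F x in at_infinity. LV x < b" by simp
 have b0: "b < 0" using b(2) by simp
 have e2: "\<forall>\<^sub>F x in at_infinity. qV x / (V x * \<bar>LV x\<bar>) < 1 / p"
  using p by (intro order_tendstoD(2)[OF ratio[folded LV_def qV_def]]) simp
 from eventually_conj[OF e1 e2] obtain r where r: "\<And>x. r \<le> norm x \<Longrightarrow> LV x < b \<and> qV x / (V x * \<bar>LV x\<bar>) < 1 / p"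
  unfolding eventually_at_infinity by blast
 have out: "GU p x \<le> - (- b) * V x powr (p - 1)" if "r \<le> norm x" for x
 proof -
  let ?L = "\<bar>LV x\<bar>"
  have L: "LV x = - ?L" "- b \<le> ?L" "0 < ?L" using r[OF that] b0 by auto
  have "0 < V x * ?L" by (rule mult_pos_pos[OF V_pos L(3)])
  hence "qV x < V x * ?L / p" using r[OF that] pos_divide_less_eq[of "V x * ?L" "qV x" "1 / p"] by simp
  hence "p * (p - 1) * V x powr (p - 2) * qV x \<le> p * (p - 1) * V x powr (p - 2) * (V x * ?L / p)" using p by (intro mult_left_mono) auto
  also have "... = (p - 1) * (V x powr (p - 2) * V x) * ?L" using p by simp
  also have "V x powr (p - 2) * V x = V x powr (p - 1)" using powr_add[of "V x" "p - 2" 1] V_pos[of x] by (simp add: powr_one)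
  finally have "GU p x \<le> p * V x powr (p - 1) * (- ?L) + (p - 1) * V x powr (p - 1) * ?L / 2" unfolding GU_def L(1)[symmetric] by simp
  also have "... = - ((p + 1) / 2 * (V x powr (p - 1) * ?L))" by (simp add: field_simps)
  also have "... \<le> - (1 * (V x powr (p - 1) * - b))" using p L b0 by (intro le_imp_neg_le mult_mono) (auto simp: mult_nonneg_nonpos)
  finally show ?thesis by (simp add: mult.commute)
 qed
 have "continuous_on UNIV (\<lambda>x. GU p x + (- b) * V x powr (p - 1))" unfolding GU_def
  by (intro continuous_on_add continuous_on_mult continuous_on_divide continuous_on_const LV_cont qV_cont V_powr_cont) simp
 hence "continuous_on (cball 0 r) (\<lambda>x. GU p x + (- b) * V x powr (p - 1))" by (rule continuous_on_subset) simp
 hence "bounded ((\<lambda>x. GU p x + (- b) * V x powr (p - 1)) ` cball 0 r)" by (intro compact_imp_bounded compact_continuous_image) auto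
 then obtain C where C: "0 < C" "\<And>x. x \<in> cball 0 r \<Longrightarrow> norm (GU p x + (- b) * V x powr (p - 1)) \<le> C"
  unfolding bounded_pos by auto
 have "GU p x \<le> C - (- b) * V x powr (p - 1)" for x using out[of x] C(1) C(2)[of x] by (cases "r \<le> norm x") auto
 thus ?thesis using b0 C(1) by (intro that[of "- b" C]) auto
qed

text \<open>\<open>slope\<close> and \<open>curv\<close> are the first and second derivative of the
  truncated power \<open>R * cap (v powr p / R)\<close> at the value \<open>V x\<close>.\<close>

definition "slope p R x = cap' (V x powr p / R) * (p * V x powr (p - 1))"
definition "curv p R x = cap'' (V x powr p / R) * (p * V x powr (p - 1))^2 / R + cap' (V x powr p / R) * (p * (p - 1) * V x powr (p - 2))"

lemma V_powr_deriv: "((\<lambda>v. v powr p) has_real_derivative p * V x powr (p - 1)) (at (V x))" by (rule has_real_derivative_powr) (rule V_pos)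

text \<open>Sublevel sets of \<open>V\<close> are bounded, so beyond some radius
  \<open>V powr p\<close> exceeds \<open>R\<close>, where \<open>cap\<close> is constant and all
  derivatives vanish.\<close>

lemma test_function:
 assumes R: "0 < R" and p: "0 < p"
 obtains r where "c2_test_function (\<lambda>x. R * cap (V x powr p / R)) (\<lambda>x. slope p R x *\<^sub>R grad V x)
   (\<lambda>x. curv p R x *\<^sub>R outer (grad V x) + slope p R x *\<^sub>R hess V x) r"
  "\<And>x. r \<le> norm x \<Longrightarrow> cap' (V x powr p / R) = 0"
proof -
 have "bounded {x. V x \<le> R powr (1 / p)}" using V_sublevel by (rule compact_imp_bounded)
 then obtain r where r: "\<And>x. V x \<le> R powr (1 / p) \<Longrightarrow> norm x < r" unfolding bounded_pos_less by auto
 have big: "1 \<le> V x powr p / R" if "r \<le> norm x" for x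
 proof -
  have "R powr (1 / p) \<le> V x" using r[of x] that by force
  hence "(R powr (1 / p)) powr p \<le> V x powr p" using p by (intro powr_mono2) auto
  thus ?thesis using R p by (simp add: powr_powr)
 qed
 have inner_deriv: "((\<lambda>v. v powr p / R) has_real_derivative p * V x powr (p - 1) / R) (at (V x))" for x
  using DERIV_cdivide[OF V_powr_deriv] .
 show ?thesis
 proof (rule that)
  show "c2_test_function (\<lambda>x. R * cap (V x powr p / R)) (\<lambda>x. slope p R x *\<^sub>R grad V x)
   (\<lambda>x. curv p R x *\<^sub>R outer (grad V x) + slope p R x *\<^sub>R hess V x) r"
  proof
   fix x
   have "((\<lambda>v. R * cap (v powr p / R)) has_real_derivative slope p R x) (at (V x))"
    using DERIV_cmult[OF cap_deriv(1)[OF inner_deriv[of x]], of R] R by (simp add: slope_def)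
   from DERIV_compose_FDERIV[OF this V_deriv]
   show "((\<lambda>x. R * cap (V x powr p / R)) has_derivative (\<lambda>h. (slope p R x *\<^sub>R grad V x) \<bullet> h)) (at x)"
    by (simp add: mult.commute)
   have d2: "((\<lambda>v. p * v powr (p - 1)) has_real_derivative p * ((p - 1) * V x powr (p - 2))) (at (V x))"
    using DERIV_cmult[OF has_real_derivative_powr[OF V_pos[of x], of "p - 1"], of p] by simp
   have "((\<lambda>v. cap' (v powr p / R) * (p * v powr (p - 1))) has_real_derivative curv p R x) (at (V x))"
    using DERIV_mult[OF cap_deriv(2)[OF inner_deriv[of x]] d2] by (simp add: curv_def power2_eq_square mult_ac add.commute)
   from DERIV_compose_FDERIV[OF this V_deriv]
   have "(slope p R has_derivative (\<lambda>h. (grad V x \<bullet> h) * curv p R x)) (at x)" by (simp add: slope_def[abs_def])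
   from has_derivative_scaleR[OF this V_grad_deriv]
   show "((\<lambda>x. slope p R x *\<^sub>R grad V x) has_derivative
     (\<lambda>h. (curv p R x *\<^sub>R outer (grad V x) + slope p R x *\<^sub>R hess V x) *v h)) (at x)" by (rule has_derivative_eq_rhs)
      (simp add: fun_eq_iff matrix_vector_mult_add_rdistrib scaleR_matrix_vector_assoc[symmetric] outer_mult mult.commute)
   show "slope p R x *\<^sub>R grad V x = 0 \<and> curv p R x *\<^sub>R outer (grad V x) + slope p R x *\<^sub>R hess V x = 0" if "r \<le> norm x"
    using cap_zero[OF big[OF that]] by (simp add: slope_def curv_def)
  next
   have "continuous_on UNIV (\<lambda>x. cap' (V x powr p / R))" unfolding cap'_def using R by (intro continuous_intros V_powr_cont) simp
   note c1 = this
   have c2: "continuous_on UNIV (\<lambda>x. cap'' (V x powr p / R))" using R by (intro cap''_cont continuous_intros V_powr_cont) simp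
   show "continuous_on UNIV (\<lambda>x. curv p R x *\<^sub>R outer (grad V x) + slope p R x *\<^sub>R hess V x)" unfolding curv_def slope_def using R
    by (intro continuous_on_add continuous_on_scaleR continuous_on_mult continuous_on_divide continuous_on_power
      continuous_on_const continuous_on_outer c1 c2 V_powr_cont grad_V_cont hess_V_cont) simp
  qed
  show "cap' (V x powr p / R) = 0" if "r \<le> norm x" for x using cap_zero[OF big[OF that]] by simp
 qed
qed

text \<open>Dynkin's formula for the truncated power. Its generator is at most \<open>cap'\<close>
  times \<open>GU\<close>, and the bounds 0 and 3 on \<open>cap'\<close> turn
  \<open>GU_bound\<close> into a dissipation term and the constant \<open>3 * C\<close>.\<close>

lemma truncated_moment_inequality:
 assumes R: "0 < R" and p: "1 \<le> p" and C: "\<And>x. GU p x \<le> C - c * V x powr (p - 1)" "0 \<le> C" and st: "0 \<le> s" "s \<le> t"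
 shows "expectation (\<lambda>om. R * cap (V (X t om) powr p / R))
   + c * expectation (\<lambda>om. LBINT u:{s..t}. cap' (V (X u om) powr p / R) * V (X u om) powr (p - 1))
  \<le> expectation (\<lambda>om. R * cap (V (X s om) powr p / R)) + 3 * C * (t - s)"
proof (cases "s = t")
 case True
 have "(LBINT u:{t..t}. h u) = 0" for h :: "real \<Rightarrow> real"
  using set_borel_integral_eq_integral(2)[OF borel_integrable_atLeastAtMost'[of t t h]] by simp
 thus ?thesis using True by simp
next
 case False
 hence "s < t" using st by simp
 have p0: "0 < p" using p by simp
 let ?f = "\<lambda>x. R * cap (V x powr p / R)" and ?g = "\<lambda>x. slope p R x *\<^sub>R grad V x"
  and ?D = "\<lambda>x. curv p R x *\<^sub>R outer (grad V x) + slope p R x *\<^sub>R hess V x"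
 let ?k = "\<lambda>x. cap' (V x powr p / R) * V x powr (p - 1)"
 obtain r where test: "c2_test_function ?f ?g ?D r" and r: "\<And>x. r \<le> norm x \<Longrightarrow> cap' (V x powr p / R) = 0"
  by (rule test_function[OF R p0]) blast
 have w: "0 \<le> V x powr p / R" for x using R by simp
 have fb: "\<bar>?f x\<bar> \<le> R" for x using cap_range[OF w[of x]] R by (simp add: abs_mult mult_left_le)
 have f_cont: "continuous_on UNIV ?f" by (rule c2_test_function.f_cont[OF test])
 have k_cont: "continuous_on UNIV ?k" unfolding cap'_def using R by (intro continuous_intros V_powr_cont) simp
 obtain Bk where Bk: "\<And>x. norm (?k x) \<le> Bk" using c2_test_function.supp_bounded[OF test k_cont] r by (metis mult_zero_left)
 define L where "L x = ?g x \<bullet> \<beta> x + trace (transpose (\<rho> x) ** (?D x ** \<rho> x)) / 2" for x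
 have L_cont: "continuous_on UNIV L"
  unfolding L_def by (intro continuous_intros \<beta>_cont \<rho>_cont c2_test_function.g_cont[OF test] c2_test_function.D_cont[OF test]) simp
 have "L x = 0" if "r \<le> norm x" for x using c2_test_function.supp[OF test that] by (auto simp: L_def trace_def)
 then obtain BL where BL: "\<And>x. norm (L x) \<le> BL" using c2_test_function.supp_bounded[OF test L_cont] by metis
 have dynkin: "expectation (\<lambda>om. ?f (X T om)) = expectation (\<lambda>om. ?f (X 0 om)) + expectation (\<lambda>om. LBINT u:{0..T}. L (X u om))"
  if T: "T > 0" for T
 proof -
  interpret diffusion_test M \<F> W X \<beta> \<rho> I ?f ?g ?D r T
   by (intro diffusion_test.intro diffusion_axioms test diffusion_test_axioms.intro T)
  show ?thesis using dynkin[OF fb] unfolding gen_def quad_def L_def by simp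
 qed
 have L_le: "L x \<le> cap' (V x powr p / R) * GU p x" for x
 proof -
  have "trace (transpose (\<rho> x) ** (?D x ** \<rho> x)) = trace (?D x ** (\<rho> x ** transpose (\<rho> x)))"
   by (metis matrix_mul_assoc trace_mul_sym)
  also have "... = curv p R x * qV x + slope p R x * trace ((\<rho> x ** transpose (\<rho> x)) ** hess V x)"
   unfolding trace_linear_mult trace_outer_mult qV_def trace_mul_sym[of "hess V x"] ..
  finally have "L x = slope p R x * LV x + curv p R x * qV x / 2" unfolding L_def LV_def by (simp add: inner_commute algebra_simps add_divide_distrib)
  also have "... = cap' (V x powr p / R) * GU p x + cap'' (V x powr p / R) * ((p * V x powr (p - 1))^2 / R * qV x / 2)"
   unfolding slope_def curv_def GU_def using R by (simp add: field_simps)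
  \<comment> \<open>Concavity of \<open>cap\<close> gives the additional curvature term a favourable
    sign.\<close>
  also have "... \<le> cap' (V x powr p / R) * GU p x"
  proof -
   have "cap'' (V x powr p / R) * ((p * V x powr (p - 1))^2 / R * qV x / 2) \<le> 0"
    using R qV_nonneg[of x] by (intro mult_nonpos_nonneg cap''_nonpos) simp
   thus ?thesis by simp
  qed
  finally show ?thesis .
 qed
 have L_le': "L x \<le> 3 * C - c * ?k x" for x
 proof -
  have "L x \<le> cap' (V x powr p / R) * (C - c * V x powr (p - 1))"
   using L_le[of x] mult_left_mono[OF C(1)[of x]] cap'_range[OF w[of x]] by (meson order_trans)
  also have "... \<le> 3 * C - c * ?k x"
   using mult_right_mono[of "cap' (V x powr p / R)" 3 C] cap'_range[OF w[of x]] C(2) by (simp add: algebra_simps)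
  finally show ?thesis .
 qed
 have cont: "continuous_on {a..b} (\<lambda>u. h (X u om))" if "continuous_on UNIV h" "om \<in> space M" "0 \<le> a" for h :: "real^'d \<Rightarrow> real" and om a b
  by (rule X_comp_cont[OF that(1,2)]) (use that in auto)
 have LINT_int: "integrable M (\<lambda>om. LBINT u:{a..b}. h (X u om))"
  if "continuous_on UNIV h" "\<And>x. norm (h x) \<le> B" "0 \<le> a" "a \<le> b" for h :: "real^'d \<Rightarrow> real" and a b B
 proof (rule integrable_const_bound[where B="B * (b - a)"])
  show "AE om in M. norm (LBINT u:{a..b}. h (X u om)) \<le> B * (b - a)"
   by (rule AE_I2, rule LINT_norm_le[OF that(4) cont[OF that(1) _ that(3)] that(2)])
  show "(\<lambda>om. LBINT u:{a..b}. h (X u om)) \<in> borel_measurable M"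
   by (rule borel_measurable_set_LINT[OF that(3) X_comp_meas[OF that(1)] X_comp_cont[OF that(1)]]) simp_all
 qed
 have split: "expectation (\<lambda>om. LBINT u:{0..t}. L (X u om))
   = expectation (\<lambda>om. LBINT u:{0..s}. L (X u om)) + expectation (\<lambda>om. LBINT u:{s..t}. L (X u om))"
 proof -
  have "(LBINT u:{0..t}. L (X u om)) = (LBINT u:{0..s}. L (X u om)) + (LBINT u:{s..t}. L (X u om))" if "om \<in> space M" for om
   using st cont[OF L_cont that]
   by (simp add: set_borel_integral_eq_integral(2)[OF borel_integrable_atLeastAtMost'] Henstock_Kurzweil_Integration.integral_combine integrable_continuous_real)
  hence "expectation (\<lambda>om. LBINT u:{0..t}. L (X u om))
   = expectation (\<lambda>om. (LBINT u:{0..s}. L (X u om)) + (LBINT u:{s..t}. L (X u om)))" by (intro Bochner_Integration.integral_cong) auto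
  thus ?thesis using LINT_int[OF L_cont BL] st by simp
 qed
 have diff: "expectation (\<lambda>om. ?f (X t om)) = expectation (\<lambda>om. ?f (X s om)) + expectation (\<lambda>om. LBINT u:{s..t}. L (X u om))"
 \<comment> \<open>\<open>dynkin\<close> starts at time 0 and has a positive horizon, so the
   increment from \<open>s\<close> to \<open>t\<close> is a difference of two instances unless
   \<open>s\<close> is 0.\<close>
 proof (cases "s = 0")
  case True
  thus ?thesis using dynkin[of t] \<open>s < t\<close> by simp
 next
  case False
  thus ?thesis using dynkin[of t] dynkin[of s] split \<open>s < t\<close> st by simp
 qed
 have "expectation (\<lambda>om. LBINT u:{s..t}. L (X u om)) \<le> expectation (\<lambda>om. 3 * C * (t - s) - c * (LBINT u:{s..t}. ?k (X u om)))"
 proof (intro integral_mono)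
  show "integrable M (\<lambda>om. LBINT u:{s..t}. L (X u om))" by (rule LINT_int[OF L_cont BL st])
  show "integrable M (\<lambda>om. 3 * C * (t - s) - c * (LBINT u:{s..t}. ?k (X u om)))" using LINT_int[OF k_cont Bk st] by simp
  fix om assume om: "om \<in> space M"
  have "(LBINT u:{s..t}. L (X u om)) \<le> (LBINT u:{s..t}. 3 * C - c * ?k (X u om))" by (rule set_integral_mono)
     (auto intro!: borel_integrable_atLeastAtMost' cont[OF L_cont om st(1)] continuous_on_diff continuous_on_mult continuous_on_const cont[OF k_cont om st(1)] L_le')
  also have "... = (LBINT u:{s..t}. 3 * C) - (LBINT u:{s..t}. c * ?k (X u om))"
   by (rule set_integral_diff(2)) (intro borel_integrable_atLeastAtMost' continuous_on_const continuous_on_mult cont[OF k_cont om st(1)])+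
  also have "... = 3 * C * (t - s) - c * (LBINT u:{s..t}. ?k (X u om))" using st by (simp add: LINT_const_interval)
  finally show "(LBINT u:{s..t}. L (X u om)) \<le> 3 * C * (t - s) - c * (LBINT u:{s..t}. ?k (X u om))" .
 qed
 also have "... = 3 * C * (t - s) - c * expectation (\<lambda>om. LBINT u:{s..t}. ?k (X u om))"
  using LINT_int[OF k_cont Bk st] by (simp add: prob_space)
 finally show ?thesis using diff by simp
qed

lemma path_cont: "continuous_on UNIV h \<Longrightarrow> om \<in> space M \<Longrightarrow> 0 \<le> a \<Longrightarrow> continuous_on {a..b} (\<lambda>u. h (X u om))"
 by (rule X_comp_cont) auto

lemma LINT_path_meas:
 fixes h :: "real^'d \<Rightarrow> 'b::{banach, second_countable_topology}"
 assumes "continuous_on UNIV h" "0 \<le> a"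
 shows "(\<lambda>om. LBINT u:{a..b}. h (X u om)) \<in> borel_measurable M"
 by (rule borel_measurable_set_LINT[OF assms(2) X_comp_meas[OF assms(1)] X_comp_cont[OF assms(1)]]) simp_all

lemma LINT_path_mono:
 fixes h k :: "real^'d \<Rightarrow> real"
 assumes "continuous_on UNIV h" "continuous_on UNIV k" "om \<in> space M" "0 \<le> a" "\<And>x. h x \<le> k x"
 shows "(LBINT u:{a..b}. h (X u om)) \<le> (LBINT u:{a..b}. k (X u om))"
 by (rule set_integral_mono) (auto intro!: borel_integrable_atLeastAtMost' path_cont assms)

lemma LINT_path_nonneg:
 fixes h :: "real^'d \<Rightarrow> real"
 assumes "\<And>x. 0 \<le> h x"
 shows "0 \<le> (LBINT u:{a..b}. h (X u om))" unfolding set_lebesgue_integral_def using assms by (intro integral_nonneg_AE) auto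

text \<open>The truncation level tends to infinity and Fatou's lemma handles the left side. Both
  terms there and the bound for the right side contain the slope 3 of \<open>cap\<close> at zero,
  which cancels.\<close>

lemma moment_inequality_ennreal:
 assumes p: "1 \<le> p"
 obtains c C where "0 < c" "0 \<le> C" "\<And>s t. 0 \<le> s \<Longrightarrow> s \<le> t \<Longrightarrow>
  (EE M (\<lambda>om. V (X t om) powr p)) + ennreal c * (EE M (\<lambda>om. LBINT u:{s..t}. V (X u om) powr (p - 1)))
  \<le> (EE M (\<lambda>om. V (X s om) powr p)) + ennreal (C * (t - s))"
proof -
 obtain c C where c: "0 < c" and C: "0 \<le> C" and GU: "\<And>x. GU p x \<le> C - c * V x powr (p - 1)" by (rule GU_bound[OF p]) blast
 show ?thesis
 proof (rule that[OF c C])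
  fix s t :: real assume st: "0 \<le> s" "s \<le> t"
  hence t: "0 \<le> t" by simp
  let ?f = "\<lambda>n x. real (Suc n) * cap (V x powr p / real (Suc n))"
  let ?k = "\<lambda>n x. cap' (V x powr p / real (Suc n)) * V x powr (p - 1)"
  have w: "0 \<le> V x powr p / real (Suc n)" for n x by simp
  have f_range: "0 \<le> ?f n x" "?f n x \<le> 3 * V x powr p" "?f n x \<le> real (Suc n)" for n x
   using cap_range[OF w[of x n]] by (auto simp: field_simps simp del: of_nat_Suc)
  have k_range: "0 \<le> ?k n x" "?k n x \<le> 3 * V x powr (p - 1)" for n x using cap'_range[OF w[of x n]] by (auto intro: mult_right_mono)
  have f_cont: "continuous_on UNIV (?f n)" for n unfolding cap_def by (intro continuous_intros V_powr_cont) simp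
  have k_cont: "continuous_on UNIV (?k n)" for n unfolding cap'_def by (intro continuous_intros V_powr_cont) simp
  have f_int: "integrable M (\<lambda>om. ?f n (X u om))" if "0 \<le> u" for n u by (rule integrable_const_bound[where B="real (Suc n)"])
     (use f_range X_comp_meas[OF f_cont that] in \<open>auto simp del: of_nat_Suc\<close>)
  have k_int: "integrable M (\<lambda>om. LBINT u:{s..t}. ?k n (X u om))" for n
  proof -
   have p0: "0 < p" using p by simp
   obtain r where test: "c2_test_function (\<lambda>x. real (Suc n) * cap (V x powr p / real (Suc n))) (\<lambda>x. slope p (real (Suc n)) x *\<^sub>R grad V x)
     (\<lambda>x. curv p (real (Suc n)) x *\<^sub>R outer (grad V x) + slope p (real (Suc n)) x *\<^sub>R hess V x) r"
    and r: "\<And>x. r \<le> norm x \<Longrightarrow> cap' (V x powr p / real (Suc n)) = 0" by (rule test_function[OF _ p0, of "real (Suc n)"]) auto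
   obtain B where B: "\<And>x. norm (?k n x) \<le> B" using c2_test_function.supp_bounded[OF test k_cont] r by (metis mult_zero_left)
   show ?thesis
   proof (rule integrable_const_bound[where B="B * (t - s)"])
    show "AE om in M. norm (LBINT u:{s..t}. ?k n (X u om)) \<le> B * (t - s)"
     by (rule AE_I2, rule LINT_norm_le[OF st(2) path_cont[OF k_cont _ st(1)] B])
   qed (rule LINT_path_meas[OF k_cont st(1)])
  qed
  let ?L = "\<lambda>om. LBINT u:{s..t}. V (X u om) powr (p - 1)"
  let ?A = "\<lambda>n. \<integral>\<^sup>+om. ennreal (?f n (X t om)) \<partial>M"
  let ?B = "\<lambda>n. \<integral>\<^sup>+om. ennreal (LBINT u:{s..t}. ?k n (X u om)) \<partial>M"
  let ?D = "(EE M (\<lambda>om. 3 * V (X s om) powr p)) + ennreal (3 * C * (t - s))"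
  have trunc: "?A n + ennreal c * ?B n \<le> ?D" for n
  proof -
   have Bn: "?B n = ennreal (expectation (\<lambda>om. LBINT u:{s..t}. ?k n (X u om)))"
    by (intro nn_integral_eq_integral[OF k_int] AE_I2 LINT_path_nonneg k_range)
   have An: "(EE M (\<lambda>om. ?f n (X u om))) = ennreal (expectation (\<lambda>om. ?f n (X u om)))" if "0 \<le> u" for u
    by (intro nn_integral_eq_integral[OF f_int[OF that]] AE_I2 f_range)
   have A_nn: "0 \<le> expectation (\<lambda>om. ?f n (X u om))" for u by (intro integral_nonneg_AE AE_I2 f_range)
   have B_nn: "0 \<le> expectation (\<lambda>om. LBINT u:{s..t}. ?k n (X u om))" by (intro integral_nonneg_AE AE_I2 LINT_path_nonneg k_range)
   have "?A n + ennreal c * ?B n = ennreal (expectation (\<lambda>om. ?f n (X t om)) + c * expectation (\<lambda>om. LBINT u:{s..t}. ?k n (X u om)))"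
    unfolding An[OF t] Bn using A_nn[of t] B_nn c by (subst ennreal_plus) (auto simp only: ennreal_mult' less_imp_le mult_nonneg_nonneg)
   also have "... \<le> ennreal (expectation (\<lambda>om. ?f n (X s om)) + 3 * C * (t - s))"
    by (intro ennreal_leI truncated_moment_inequality[OF _ p GU C st]) simp
   also have "... = (EE M (\<lambda>om. ?f n (X s om))) + ennreal (3 * C * (t - s))"
    unfolding An[OF st(1)] using A_nn[of s] C st by (subst ennreal_plus) auto
   also have "... \<le> ?D" using f_range by (intro add_right_mono nn_integral_mono ennreal_leI) auto
   finally show ?thesis .
  qed
  have lim_A: "(EE M (\<lambda>om. 3 * V (X t om) powr p)) \<le> liminf ?A"
  proof -
   have "ennreal (3 * V (X t om) powr p) = liminf (\<lambda>n. ennreal (?f n (X t om)))" for om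
    by (rule lim_imp_Liminf[OF sequentially_bot tendsto_ennrealI[OF cap_scaled_tendsto], symmetric])
   hence "(EE M (\<lambda>om. 3 * V (X t om) powr p)) = (\<integral>\<^sup>+om. liminf (\<lambda>n. ennreal (?f n (X t om))) \<partial>M)" by simp
   also have "... \<le> liminf ?A" by (intro nn_integral_liminf measurable_compose[OF X_comp_meas[OF f_cont t] measurable_ennreal])
   finally show ?thesis .
  qed
  have lim_B: "(EE M (\<lambda>om. 3 * ?L om)) \<le> liminf ?B"
  proof -
   have "(EE M (\<lambda>om. 3 * ?L om))
    = (\<integral>\<^sup>+om. liminf (\<lambda>n. ennreal (LBINT u:{s..t}. ?k n (X u om))) \<partial>M)"
   proof (rule nn_integral_cong)
    fix om assume om: "om \<in> space M"
    have "(\<lambda>n. LBINT u:{s..t}. ?k n (X u om)) \<longlonglongrightarrow> (LBINT u:{s..t}. 3 * V (X u om) powr (p - 1))"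
     unfolding set_lebesgue_integral_def
    proof (rule integral_dominated_convergence[where w="\<lambda>u. indicator {s..t} u *\<^sub>R (3 * V (X u om) powr (p - 1))"])
     have c3: "continuous_on UNIV (\<lambda>x. 3 * V x powr (p - 1))" by (intro continuous_on_mult continuous_on_const V_powr_cont)
     show i3: "integrable lborel (\<lambda>u. indicat_real {s..t} u *\<^sub>R (3 * V (X u om) powr (p - 1)))"
      using borel_integrable_atLeastAtMost'[OF path_cont[OF c3 om st(1)]] by (simp add: set_integrable_def)
     thus "(\<lambda>u. indicat_real {s..t} u *\<^sub>R (3 * V (X u om) powr (p - 1))) \<in> borel_measurable lborel" by simp
     show "(\<lambda>u. indicat_real {s..t} u *\<^sub>R ?k n (X u om)) \<in> borel_measurable lborel" for n
      using borel_integrable_atLeastAtMost'[OF path_cont[OF k_cont[of n] om st(1), of t]]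
      unfolding set_integrable_def by (rule borel_measurable_integrable)
     show "AE u in lborel. norm (indicat_real {s..t} u *\<^sub>R ?k n (X u om)) \<le> indicat_real {s..t} u *\<^sub>R (3 * V (X u om) powr (p - 1))" for n
      using k_range[of _ n] by (auto simp: indicator_def simp del: of_nat_Suc)
     show "AE u in lborel. (\<lambda>n. indicat_real {s..t} u *\<^sub>R ?k n (X u om)) \<longlonglongrightarrow> indicat_real {s..t} u *\<^sub>R (3 * V (X u om) powr (p - 1))"
      by (rule AE_I2, rule tendsto_scaleR[OF tendsto_const tendsto_mult[OF cap'_scaled_tendsto tendsto_const]])
    qed
    hence "liminf (\<lambda>n. ennreal (LBINT u:{s..t}. ?k n (X u om))) = ennreal (LBINT u:{s..t}. 3 * V (X u om) powr (p - 1))"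
     by (intro lim_imp_Liminf tendsto_ennrealI) auto
    thus "ennreal (3 * ?L om) = liminf (\<lambda>n. ennreal (LBINT u:{s..t}. ?k n (X u om)))" by simp
   qed
   also have "... \<le> liminf ?B" by (intro nn_integral_liminf measurable_compose[OF LINT_path_meas[OF k_cont st(1)] measurable_ennreal])
   finally show ?thesis .
  qed
  let ?a = "\<integral>\<^sup>+om. ennreal (V (X t om) powr p) \<partial>M" and ?b = "\<integral>\<^sup>+om. ennreal (?L om) \<partial>M"
   and ?d = "\<integral>\<^sup>+om. ennreal (V (X s om) powr p) \<partial>M"
  have m3: "(EE M (\<lambda>om. 3 * g om)) = 3 * (EE M (\<lambda>om. g om))" if "g \<in> borel_measurable M" "\<And>om. 0 \<le> g om" for g
   using that by (subst nn_integral_cmult[symmetric]) (auto simp: ennreal_mult)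
  have a3: "(EE M (\<lambda>om. 3 * V (X u om) powr p)) = 3 * (EE M (\<lambda>om. V (X u om) powr p))" if "0 \<le> u" for u
   by (rule m3[OF X_comp_meas[OF V_powr_cont that]]) simp
  have b3: "(EE M (\<lambda>om. 3 * ?L om)) = 3 * ?b"
   by (rule m3[OF LINT_path_meas[OF V_powr_cont st(1)]]) (rule LINT_path_nonneg, simp)
  have "3 * (?a + ennreal c * ?b) = (EE M (\<lambda>om. 3 * V (X t om) powr p)) + ennreal c * (EE M (\<lambda>om. 3 * ?L om))"
   unfolding a3[OF t] b3 by (simp add: distrib_left mult.left_commute)
  also have "... \<le> liminf ?A + ennreal c * liminf ?B" by (intro add_mono mult_left_mono lim_A lim_B) auto
  \<comment> \<open>Multiplication by a finite constant is continuous and monotone on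
    \<open>ennreal\<close>, hence commutes with the limit inferior.\<close>
  also have "liminf ?A + ennreal c * liminf ?B = liminf ?A + liminf (\<lambda>n. ennreal c * ?B n)"
  proof -
   have "ennreal c * liminf ?B = liminf (\<lambda>n. ennreal c * ?B n)"
    by (rule Liminf_compose_continuous_mono[symmetric, where f="\<lambda>x. ennreal c * x"])
      (auto simp: mono_def intro!: mult_left_mono ennreal_continuous_on_cmult)
   thus ?thesis by simp
  qed
  also have "liminf ?A + liminf (\<lambda>n. ennreal c * ?B n) \<le> liminf (\<lambda>n. ?A n + ennreal c * ?B n)" by (rule liminf_add_le)
  also have "... \<le> liminf (\<lambda>n. ?D)" by (intro Liminf_mono always_eventually allI trunc)
  also have "... = ?D" by (simp add: Liminf_const)
  also have "... = 3 * (?d + ennreal (C * (t - s)))" unfolding a3[OF st(1)] using C st by (simp add: distrib_left ennreal_mult mult.assoc)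
  finally have "3 * (?a + ennreal c * ?b) \<le> 3 * (?d + ennreal (C * (t - s)))" .
  thus "?a + ennreal c * ?b \<le> ?d + ennreal (C * (t - s))" by (subst (asm) ennreal_mult_le_mult_iff) auto
 qed
qed

end

section \<open>Averages over time cells\<close>

text \<open>The integral of the squared deviation from the mean \<open>c\<close> is
  nonnegative.\<close>

lemma LINT_square_le:
 fixes g :: "real \<Rightarrow> real"
 assumes ab: "a \<le> b" and g: "continuous_on {a..b} g"
 shows "(LBINT s:{a..b}. g s)^2 \<le> (b - a) * (LBINT s:{a..b}. (g s)^2)"
proof (cases "a = b")
 case True
 thus ?thesis using LINT_norm_le[of a b g "\<bar>g a\<bar>"] g by simp
next
 case False
 define c where "c = (LBINT s:{a..b}. g s) / (b - a)"
 have i: "set_integrable lborel {a..b} (\<lambda>s. (g s)^2)" "set_integrable lborel {a..b} (\<lambda>s. 2 * c * g s)"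
  by (intro borel_integrable_atLeastAtMost' continuous_intros g)+
 have "0 \<le> (LBINT s:{a..b}. (g s - c)^2)" unfolding set_lebesgue_integral_def by (intro integral_nonneg_AE) auto
 also have "... = (LBINT s:{a..b}. ((g s)^2 - 2 * c * g s) + c^2)" by (simp add: power2_diff algebra_simps)
 also have "... = (LBINT s:{a..b}. (g s)^2) - 2 * c * (LBINT s:{a..b}. g s) + c^2 * (b - a)"
  using i ab borel_integrable_atLeastAtMost'[OF continuous_on_const[of "{a..b}" "c^2"]]
  by (subst set_integral_add) (auto intro!: set_integral_diff simp: set_integral_diff LINT_const_interval)
 finally have "0 \<le> (b - a) * ((LBINT s:{a..b}. (g s)^2) - 2 * c * (LBINT s:{a..b}. g s) + c^2 * (b - a))" using ab by simp
 also have "... = (b - a) * (LBINT s:{a..b}. (g s)^2) - 2 * ((b - a) * c) * (LBINT s:{a..b}. g s) + ((b - a) * c)^2"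
  by (simp add: algebra_simps power2_eq_square)
 also have "(b - a) * c = (LBINT s:{a..b}. g s)" using False by (simp add: c_def)
 finally show ?thesis by (simp add: power2_eq_square)
qed

lemma LINT_square_norm_le:
 fixes f :: "real \<Rightarrow> 'b::euclidean_space"
 assumes ab: "a \<le> b" and f: "continuous_on {a..b} f"
 shows "(norm (LBINT s:{a..b}. f s))^2 \<le> (b - a) * (LBINT s:{a..b}. (norm (f s))^2)"
proof -
 have "norm (LBINT s:{a..b}. f s) \<le> (LBINT s:{a..b}. norm (f s))"
  using set_integral_norm_bound[OF borel_integrable_atLeastAtMost'[OF f]] by simp
 hence "(norm (LBINT s:{a..b}. f s))^2 \<le> (LBINT s:{a..b}. norm (f s))^2" by (rule power_mono) simp
 also have "... \<le> (b - a) * (LBINT s:{a..b}. (norm (f s))^2)" by (rule LINT_square_le[OF ab]) (intro continuous_intros f)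
 finally show ?thesis .
qed

abbreviation cont2 :: "('a::topological_space \<Rightarrow> 'b::topological_space \<Rightarrow> 'c::topological_space) \<Rightarrow> bool" where
 "cont2 h \<equiv> continuous_on UNIV (\<lambda>p. h (fst p) (snd p))"

lemma cont_snd: "continuous_on UNIV h \<Longrightarrow> continuous_on UNIV (\<lambda>p. h (snd p))"
 and cont_fst: "continuous_on UNIV h \<Longrightarrow> continuous_on UNIV (\<lambda>p. h (fst p))"
 by (rule continuous_on_compose2[OF _ continuous_on_snd[OF continuous_on_id]], auto,
   rule continuous_on_compose2[OF _ continuous_on_fst[OF continuous_on_id]], auto)

abbreviation cell :: "real \<Rightarrow> nat \<Rightarrow> real set" where
 "cell d i \<equiv> {real i * d..real (Suc i) * d}"

context lyapunov_diffusion
begin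

lemma path2_cont:
 assumes "cont2 h" "om \<in> space M" "S \<subseteq> {0..}"
 shows "continuous_on S (\<lambda>s. h y (X s om))"
proof -
 have "continuous_on S (\<lambda>s. (y, X s om))"
  by (intro continuous_on_Pair continuous_on_const continuous_on_subset[OF X_cont[OF assms(2)] assms(3)])
 from continuous_on_compose2[OF assms(1) this] show ?thesis by simp
qed

lemma path2_meas:
 fixes h :: "real^'d \<Rightarrow> real^'d \<Rightarrow> 'b::topological_space"
 assumes "cont2 h" "0 \<le> a" "0 \<le> s"
 shows "(\<lambda>om. h (X a om) (X s om)) \<in> borel_measurable M"
 using measurable_compose[OF borel_measurable_Pair[OF X_meas[OF assms(2)] X_meas[OF assms(3)]]
   borel_measurable_continuous_onI[OF assms(1)]] by simp

lemma LINT_path2_meas: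
 fixes h :: "real^'d \<Rightarrow> real^'d \<Rightarrow> 'b::{banach, second_countable_topology}"
 assumes h: "cont2 h" and "0 \<le> a'" "0 \<le> a"
 shows "(\<lambda>om. LBINT s:{a..b}. h (X a' om) (X s om)) \<in> borel_measurable M"
 by (rule borel_measurable_set_LINT[OF assms(3) path2_meas[OF h assms(2)] path2_cont[OF h]]) auto

text \<open>Tonelli's theorem; time is clamped at zero to have joint measurability on the whole
  line.\<close>

lemma nn_integral_LINT_path2:
 fixes h :: "real^'d \<Rightarrow> real^'d \<Rightarrow> real"
 assumes h: "cont2 h" and a: "0 \<le> a'" "0 \<le> a" and nn: "\<And>x y. 0 \<le> h x y"
 shows "EE M (\<lambda>om. LBINT s:{a..b}. h (X a' om) (X s om)) = (\<integral>\<^sup>+s\<in>{a..b}. EE M (\<lambda>om. h (X a' om) (X s om)) \<partial>lborel)"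
proof -
 interpret pair_sigma_finite M lborel by unfold_locales
 have [measurable]: "(\<lambda>p. h (X a' (fst p)) (X (max 0 (snd p)) (fst p))) \<in> borel_measurable (M \<Otimes>\<^sub>M lborel)"
  by (rule joint_measurable_continuous'[OF path2_meas[OF h a(1)] path2_cont[OF h]]) auto
 have "EE M (\<lambda>om. LBINT s:{a..b}. h (X a' om) (X s om)) = (\<integral>\<^sup>+om. (\<integral>\<^sup>+s\<in>{a..b}. ennreal (h (X a' om) (X s om)) \<partial>lborel) \<partial>M)"
  using a by (intro nn_integral_cong set_nn_integral_eq_LINT_continuous[symmetric] path2_cont h nn) auto
 also have "... = (\<integral>\<^sup>+om. (\<integral>\<^sup>+s. ennreal (h (X a' om) (X (max 0 s) om)) * indicator {a..b} s \<partial>lborel) \<partial>M)"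
  using a by (intro nn_integral_cong) (auto simp: indicator_def max_def)
 also have "... = (\<integral>\<^sup>+s. (\<integral>\<^sup>+om. ennreal (h (X a' om) (X (max 0 s) om)) * indicator {a..b} s \<partial>M) \<partial>lborel)"
  by (rule Fubini'[symmetric]) (simp add: split_def)
 also have "... = (\<integral>\<^sup>+s\<in>{a..b}. EE M (\<lambda>om. h (X a' om) (X s om)) \<partial>lborel)"
  using a by (intro nn_integral_cong) (auto simp: indicator_def max_def)
 finally show ?thesis .
qed

text \<open>A kernel of the left grid value and the running value covers three cases: functions of
  the second argument give time integrals, functions of the first give sums over observations, and
  kernels vanishing on the diagonal give discretization errors.\<close>

definition KA :: "nat \<Rightarrow> real \<Rightarrow> (real^'d \<Rightarrow> real^'d \<Rightarrow> real) \<Rightarrow> 'w \<Rightarrow> real" where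
 "KA n d h om = (\<Sum>i<n. LBINT s:cell d i. h (X (real i * d) om) (X s om))"

lemma cell_integrable:
 fixes h :: "real^'d \<Rightarrow> real^'d \<Rightarrow> 'b::euclidean_space"
 shows "cont2 h \<Longrightarrow> om \<in> space M \<Longrightarrow> 0 \<le> d \<Longrightarrow> set_integrable lborel (cell d i) (\<lambda>s. h x (X s om))"
 by (intro borel_integrable_atLeastAtMost' path2_cont) auto

lemma LINT_cell_const:
 fixes c :: "'b::euclidean_space"
 shows "0 \<le> d \<Longrightarrow> (LBINT s:cell d i. c) = d *\<^sub>R c" by (subst LINT_const_interval) (auto simp: algebra_simps)

lemma LINT_nonneg: "(\<And>s. 0 \<le> f s) \<Longrightarrow> 0 \<le> (LBINT s:A. (f s :: real))"
 unfolding set_lebesgue_integral_def by (intro integral_nonneg_AE) auto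

lemma KA_meas: "cont2 h \<Longrightarrow> 0 \<le> d \<Longrightarrow> KA n d h \<in> borel_measurable M"
 unfolding KA_def[abs_def] by (intro borel_measurable_sum LINT_path2_meas) auto

lemma KA_nonneg: "(\<And>x y. 0 \<le> h x y) \<Longrightarrow> 0 \<le> KA n d h om" unfolding KA_def by (intro sum_nonneg LINT_nonneg)

lemma KA_mono:
 "cont2 h \<Longrightarrow> cont2 k \<Longrightarrow> (\<And>x y. h x y \<le> k x y) \<Longrightarrow> om \<in> space M \<Longrightarrow> 0 \<le> d \<Longrightarrow> KA n d h om \<le> KA n d k om"
 unfolding KA_def by (intro sum_mono set_integral_mono cell_integrable)

lemma KA_add:
 "cont2 h \<Longrightarrow> cont2 k \<Longrightarrow> om \<in> space M \<Longrightarrow> 0 \<le> d \<Longrightarrow> KA n d (\<lambda>x y. h x y + k x y) om = KA n d h om + KA n d k om"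
 unfolding KA_def sum.distrib[symmetric] by (intro sum.cong refl set_integral_add(2) cell_integrable)

lemma KA_cmult: "KA n d (\<lambda>x y. c * h x y) om = c * KA n d h om" unfolding KA_def by (simp add: sum_distrib_left)

lemma KA_fst: "0 \<le> d \<Longrightarrow> KA n d (\<lambda>x y. f x) om = d * (\<Sum>i<n. f (X (real i * d) om))"
 unfolding KA_def by (simp add: LINT_cell_const sum_distrib_left del: of_nat_Suc)

lemma KA_snd:
 assumes "continuous_on UNIV f" "om \<in> space M" "0 \<le> d"
 shows "KA n d (\<lambda>x. f) om = (LBINT s:{0..real n * d}. f (X s om))" unfolding KA_def
 using LINT_split_grid[of n "\<lambda>i. real i * d" "\<lambda>s. f (X s om)"] path_cont[OF assms(1,2), of 0 "real n * d"] assms(3)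
 by (simp add: mult_right_mono)

lemma EE_KA:
 assumes "cont2 h" "0 \<le> d" "\<And>x y. 0 \<le> h x y"
 shows "EE M (KA n d h) = (\<Sum>i<n. EE M (\<lambda>om. LBINT s:cell d i. h (X (real i * d) om) (X s om)))"
proof -
 have "EE M (KA n d h) = (\<integral>\<^sup>+om. (\<Sum>i<n. ennreal (LBINT s:cell d i. h (X (real i * d) om) (X s om))) \<partial>M)"
  by (intro nn_integral_cong) (simp add: KA_def sum_ennreal LINT_nonneg assms del: of_nat_Suc)
 also have "... = (\<Sum>i<n. EE M (\<lambda>om. LBINT s:cell d i. h (X (real i * d) om) (X s om)))"
  using assms(2) by (intro nn_integral_sum measurable_compose[OF LINT_path2_meas measurable_ennreal] assms(1)) simp_all
 finally show ?thesis .
qed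

lemma start_moment: "EE M (\<lambda>om. V (X 0 om) powr p) = ennreal (V x0 powr p)"
proof -
 have "EE M (\<lambda>om. V (X 0 om) powr p) = EE M (\<lambda>om. V x0 powr p)" using X0 by (intro nn_integral_cong_AE) auto
 thus ?thesis by (simp add: emeasure_space_1)
qed

text \<open>The moment inequality with exponent \<open>q + 1\<close>: the moment at the start is
  deterministic, the one at the end is discarded, and the dissipation term remains.\<close>

lemma time_average:
 assumes q: "0 \<le> q"
 obtains K where "0 \<le> K" "\<And>T. 0 \<le> T \<Longrightarrow> EE M (\<lambda>om. LBINT u:{0..T}. V (X u om) powr q) \<le> ennreal (K * (1 + T))"
proof -
 have "1 \<le> q + 1" using q by simp
 then obtain c C where c: "0 < c" and C: "0 \<le> C" and ineq: "\<And>s t. 0 \<le> s \<Longrightarrow> s \<le> t \<Longrightarrow>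
  EE M (\<lambda>om. V (X t om) powr (q + 1)) + ennreal c * EE M (\<lambda>om. LBINT u:{s..t}. V (X u om) powr (q + 1 - 1))
  \<le> EE M (\<lambda>om. V (X s om) powr (q + 1)) + ennreal (C * (t - s))" by (rule moment_inequality_ennreal) blast
 let ?K = "(V x0 powr (q + 1) + C) / c"
 show ?thesis
 proof (rule that)
  show "0 \<le> ?K" using c C by simp
  fix T :: real assume T: "0 \<le> T"
  let ?I = "EE M (\<lambda>om. LBINT u:{0..T}. V (X u om) powr q)"
  have "ennreal c * ?I \<le> EE M (\<lambda>om. V (X T om) powr (q + 1)) + ennreal c * ?I" by simp
  also have "... \<le> ennreal (V x0 powr (q + 1)) + ennreal (C * T)" using ineq[of 0 T] T start_moment by simp
  also have "... \<le> ennreal c * ennreal (?K * (1 + T))"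
   using c C T by (simp add: ennreal_plus[symmetric] ennreal_mult[symmetric] field_simps del: ennreal_plus)
  finally show "?I \<le> ennreal (?K * (1 + T))" using c by (subst (asm) ennreal_mult_le_mult_iff) auto
 qed
qed

text \<open>Time averages say nothing about fixed times. But the moment inequality prevents the
  moment from growing by more than \<open>C * d\<close> within a cell, so a grid value is dominated
  by an average over the cell to its left.\<close>

lemma grid_average:
 assumes q: "0 \<le> q"
 obtains K where "0 \<le> K" "\<And>n d. 0 < d \<Longrightarrow> d \<le> 1 \<Longrightarrow> EE M (KA n d (\<lambda>x y. V x powr q)) \<le> ennreal (K * (1 + real n * d))"
proof -
 define p where "p = q + 1"
 have p: "1 \<le> p" "0 \<le> p" using q by (auto simp: p_def)
 obtain c C where c: "0 < c" and C: "0 \<le> C" and ineq: "\<And>s t. 0 \<le> s \<Longrightarrow> s \<le> t \<Longrightarrow>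
  EE M (\<lambda>om. V (X t om) powr p) + ennreal c * EE M (\<lambda>om. LBINT u:{s..t}. V (X u om) powr (p - 1))
  \<le> EE M (\<lambda>om. V (X s om) powr p) + ennreal (C * (t - s))" by (rule moment_inequality_ennreal[OF p(1)]) blast
 obtain K where K: "0 \<le> K" "\<And>T. 0 \<le> T \<Longrightarrow> EE M (\<lambda>om. LBINT u:{0..T}. V (X u om) powr p) \<le> ennreal (K * (1 + T))"
  by (rule time_average[OF p(2)]) blast
 let ?V = "\<lambda>t. EE M (\<lambda>om. V (X t om) powr p)"
 show ?thesis
 proof (rule that)
  show "0 \<le> V x0 powr p + K + C" using K C by simp
  fix n :: nat and d :: real assume d: "0 < d" "d \<le> 1"
  let ?h = "\<lambda>x y. V y powr p + C * d"
  have h: "cont2 ?h" "\<And>x y. 0 \<le> ?h x y" using C d by (auto intro!: continuous_on_add continuous_on_const cont_snd V_powr_cont)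
  have meas: "(\<lambda>om. V (X t om) powr p) \<in> borel_measurable M" if "0 \<le> t" for t p using that by (intro X_comp_meas V_powr_cont)
  \<comment> \<open>The bound holds for each \<open>s\<close> in the cell; integrating over
    \<open>s\<close> exchanges the right end point for a time integral.\<close>
  have step: "ennreal d * ?V (real (Suc i) * d) \<le> EE M (\<lambda>om. LBINT s:cell d i. ?h (X (real i * d) om) (X s om))" for i
  proof -
   have a: "0 \<le> real i * d" using d by simp
   have "?V (real (Suc i) * d) \<le> EE M (\<lambda>om. V (X s om) powr p + C * d)" if "s \<in> cell d i" for s
   proof -
    have s: "0 \<le> s" using that a by (auto intro: order_trans)
    have "?V (real (Suc i) * d) \<le> ?V (real (Suc i) * d) + ennreal c * EE M (\<lambda>om. LBINT u:{s..real (Suc i) * d}. V (X u om) powr (p - 1))" by simp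
    also have "... \<le> ?V s + ennreal (C * (real (Suc i) * d - s))" using that s by (intro ineq) auto
    also have "... \<le> ?V s + ennreal (C * d)" using that C by (intro add_left_mono ennreal_leI mult_left_mono) (auto simp: algebra_simps)
    also have "... = EE M (\<lambda>om. V (X s om) powr p + C * d)"
     using C d meas[OF s] by (subst ennreal_plus) (auto simp: nn_integral_add emeasure_space_1)
    finally show ?thesis .
   qed
   hence "(\<integral>\<^sup>+s\<in>cell d i. ?V (real (Suc i) * d) \<partial>lborel) \<le> (\<integral>\<^sup>+s\<in>cell d i. EE M (\<lambda>om. V (X s om) powr p + C * d) \<partial>lborel)"
    by (intro nn_integral_mono) (simp add: indicator_def)
   also have "(\<integral>\<^sup>+s\<in>cell d i. ?V (real (Suc i) * d) \<partial>lborel) = ennreal d * ?V (real (Suc i) * d)"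
    using d by (subst nn_integral_cmult_indicator) (auto simp: algebra_simps)
   finally show ?thesis unfolding nn_integral_LINT_path2[OF h(1) a a h(2)] .
  qed
  have "EE M (KA n d (\<lambda>x y. V x powr q)) \<le> (\<integral>\<^sup>+om. (\<Sum>i<n. ennreal d * ennreal (V (X (real i * d) om) powr p)) \<partial>M)"
  proof (rule nn_integral_mono)
   fix om
   have "d * (\<Sum>i<n. V (X (real i * d) om) powr q) \<le> (\<Sum>i<n. d * V (X (real i * d) om) powr p)"
    unfolding sum_distrib_left using d by (intro sum_mono mult_left_mono V_powr_mono) (auto simp: p_def)
   thus "ennreal (KA n d (\<lambda>x y. V x powr q) om) \<le> (\<Sum>i<n. ennreal d * ennreal (V (X (real i * d) om) powr p))"
    using d by (simp add: KA_fst ennreal_mult[symmetric] sum_ennreal ennreal_leI)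
  qed
  also have "... = (\<Sum>i<n. ennreal d * ?V (real i * d))" using meas d by (subst nn_integral_sum) (auto intro!: sum.cong nn_integral_cmult)
  also have "... \<le> (\<Sum>i<Suc n. ennreal d * ?V (real i * d))" by simp
  \<comment> \<open>The first grid point has no cell to its left, but there the diffusion starts at
    \<open>x0\<close>.\<close>
  also have "... = ennreal d * ?V 0 + (\<Sum>i<n. ennreal d * ?V (real (Suc i) * d))" by (subst sum.lessThan_Suc_shift) simp
  also have "... \<le> ennreal (d * V x0 powr p) + EE M (KA n d ?h)" unfolding EE_KA[OF h(1) less_imp_le[OF d(1)] h(2)] using d
   by (intro add_mono sum_mono step) (simp add: start_moment ennreal_mult)
  also have "EE M (KA n d ?h) \<le> ennreal (K * (1 + real n * d)) + ennreal (C * d * (real n * d))"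
  proof -
   have "EE M (KA n d ?h) = EE M (\<lambda>om. (LBINT u:{0..real n * d}. V (X u om) powr p) + C * d * (real n * d))"
    using d by (intro nn_integral_cong) (simp add: KA_add[OF cont_snd[OF V_powr_cont] continuous_on_const] KA_snd[OF V_powr_cont] KA_fst mult_ac)
   also have "... = EE M (\<lambda>om. LBINT u:{0..real n * d}. V (X u om) powr p) + ennreal (C * d * (real n * d))"
    using C d LINT_path_meas[OF V_powr_cont order_refl, of "real n * d" p]
    by (subst ennreal_plus) (auto intro!: LINT_path_nonneg simp: nn_integral_add emeasure_space_1)
   finally show ?thesis using K(2)[of "real n * d"] d by (simp add: add_right_mono)
  qed
  also have "ennreal (d * V x0 powr p) + (ennreal (K * (1 + real n * d)) + ennreal (C * d * (real n * d)))
   = ennreal (d * V x0 powr p + (K * (1 + real n * d) + C * d * (real n * d)))" using d K C by (simp add: ennreal_plus)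
  also have "... \<le> ennreal ((V x0 powr p + K + C) * (1 + real n * d))"
  proof (rule ennreal_leI)
   have "d * V x0 powr p \<le> 1 * V x0 powr p" "C * d * (real n * d) \<le> C * 1 * (real n * d)"
    using d C by (intro mult_right_mono mult_left_mono; simp)+
   moreover have "0 \<le> V x0 powr p * (real n * d)" using d by simp
   ultimately show "d * V x0 powr p + (K * (1 + real n * d) + C * d * (real n * d)) \<le> (V x0 powr p + K + C) * (1 + real n * d)"
    using C by (simp add: algebra_simps)
  qed
  finally show "EE M (KA n d (\<lambda>x y. V x powr q)) \<le> ennreal ((V x0 powr p + K + C) * (1 + real n * d))" by (simp add: add_left_mono)
 qed
qed

end

section \<open>Discretization errors\<close>

locale growth_diffusion = lyapunov_diffusion M \<F> W X \<beta> \<rho> I V x0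
 for M :: "'w measure" and \<F> and W :: "real \<Rightarrow> 'w \<Rightarrow> real^'d" and X \<beta> \<rho> I V x0 +
 fixes C\<beta> q\<beta> :: real
 assumes C\<beta>: "0 \<le> C\<beta>" and q\<beta>: "0 \<le> q\<beta>" and growth: "\<And>x. (norm (\<beta> x))^2 + (norm (\<rho> x))^2 \<le> C\<beta> * V x powr q\<beta>"
begin

text \<open>Cauchy-Schwarz in time for the drift, where the length at most 1 is used, and
  \<open>ito_isometry_le\<close> for the noise. The bound involves the whole cell so that it does
  not depend on \<open>s\<close>.\<close>

lemma increment_second_moment:
 assumes h: "0 \<le> a" "s \<in> {a..b}" "b - a \<le> 1"
 shows "EE M (\<lambda>om. (norm (X s om - X a om))^2) \<le> ennreal (2 * C\<beta>) * EE M (\<lambda>om. LBINT u:{a..b}. V (X u om) powr q\<beta>)"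
proof -
 have s: "0 \<le> s" "a \<le> s" "s \<le> b" using h by auto
 have cb: "continuous_on UNIV (\<lambda>x. (norm (\<beta> x))^2)" and cr: "continuous_on UNIV (\<lambda>x. (norm (\<rho> x))^2)"
  by (intro continuous_intros \<beta>_cont \<rho>_cont)+
 let ?b = "\<lambda>om. LBINT u:{a..s}. (norm (\<beta> (X u om)))^2" and ?r = "\<lambda>om. LBINT u:{a..s}. (norm (\<rho> (X u om)))^2"
  and ?v = "\<lambda>om. LBINT u:{a..b}. V (X u om) powr q\<beta>" and ?I = "\<lambda>om. (norm (I s om - I a om))^2"
 have [measurable]: "?b \<in> borel_measurable M" "?r \<in> borel_measurable M" "?v \<in> borel_measurable M"
  by (intro LINT_path_meas cb cr V_powr_cont h(1))+
 have [measurable]: "I s \<in> borel_measurable M" "I a \<in> borel_measurable M" using s h by (auto intro: I_meas)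
 have "EE M (\<lambda>om. (norm (X s om - X a om))^2) \<le> (\<integral>\<^sup>+om. ennreal (2 * ?b om) + ennreal (2 * ?I om) \<partial>M)"
 proof (rule nn_integral_mono_AE)
  show "AE om in M. ennreal ((norm (X s om - X a om))^2) \<le> ennreal (2 * ?b om) + ennreal (2 * ?I om)" using X_increment AE_space
  proof eventually_elim
   case (elim om)
   hence eq: "X s om - X a om = (LBINT u:{a..s}. \<beta> (X u om)) + (I s om - I a om)" using h(1) s(2) by blast
   have "(norm (LBINT u:{a..s}. \<beta> (X u om)))^2 \<le> (s - a) * ?b om"
    by (rule LINT_square_norm_le[OF s(2) path_cont[OF \<beta>_cont elim(2) h(1)]])
   also have "... \<le> 1 * ?b om" using s h by (intro mult_right_mono LINT_path_nonneg) auto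
   finally have "(norm (X s om - X a om))^2 \<le> 2 * ?b om + 2 * ?I om"
    using norm_add_square_le[of 1 "LBINT u:{a..s}. \<beta> (X u om)" "I s om - I a om"] eq by simp
   from ennreal_leI[OF this] show ?case by (subst (asm) ennreal_plus) (auto intro!: mult_nonneg_nonneg LINT_path_nonneg)
  qed
 qed
 also have "... = 2 * EE M ?b + 2 * EE M ?I" by (simp add: nn_integral_add ennreal_mult' nn_integral_cmult)
 also have "... \<le> 2 * EE M ?b + 2 * EE M ?r" using ito_isometry_le[OF h(1) s(2)] by (intro add_left_mono mult_left_mono) auto
 also have "... = 2 * (\<integral>\<^sup>+om. ennreal (?b om) + ennreal (?r om) \<partial>M)" by (subst nn_integral_add) (auto simp: distrib_left)
 also have "(\<integral>\<^sup>+om. ennreal (?b om) + ennreal (?r om) \<partial>M) \<le> (\<integral>\<^sup>+om. ennreal C\<beta> * ennreal (?v om) \<partial>M)"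
 proof (rule nn_integral_mono)
  fix om assume om: "om \<in> space M"
  have cV: "continuous_on UNIV (\<lambda>x. C\<beta> * V x powr q\<beta>)" by (intro continuous_on_mult continuous_on_const V_powr_cont)
  have i: "set_integrable lborel {a..t} (\<lambda>u. C\<beta> * V (X u om) powr q\<beta>)" for t
   by (intro borel_integrable_atLeastAtMost' path_cont[OF cV] om h)
  have "?b om + ?r om = (LBINT u:{a..s}. (norm (\<beta> (X u om)))^2 + (norm (\<rho> (X u om)))^2)"
   by (intro set_integral_add(2)[symmetric] borel_integrable_atLeastAtMost' path_cont cb cr om h)
  also have "... \<le> (LBINT u:{a..s}. C\<beta> * V (X u om) powr q\<beta>)" by (intro LINT_path_mono continuous_on_add cb cr cV om h growth)
  also have "... \<le> (LBINT u:{a..b}. C\<beta> * V (X u om) powr q\<beta>)"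
   unfolding set_lebesgue_integral_def using i s C\<beta> by (intro integral_mono) (auto simp: set_integrable_def indicator_def)
  finally have "ennreal (?b om + ?r om) \<le> ennreal (C\<beta> * ?v om)" by (intro ennreal_leI) simp
  thus "ennreal (?b om) + ennreal (?r om) \<le> ennreal C\<beta> * ennreal (?v om)"
   using C\<beta> by (subst ennreal_plus[symmetric], (intro LINT_path_nonneg zero_le_power2)+, subst ennreal_mult[symmetric]) (auto intro!: LINT_path_nonneg)
 qed
 also have "... = ennreal C\<beta> * EE M ?v" by (intro nn_integral_cmult) measurable
 finally show ?thesis using C\<beta> by (simp add: ennreal_mult mult.assoc mult_left_mono)
qed

lemma cont2_dist: "cont2 (\<lambda>x y::real^'d. (norm (y - x))^2)" by (intro continuous_intros)

text \<open>Integrating the previous bound over a cell gains a factor \<open>d\<close>; summing the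
  cells reassembles a time integral of a power of \<open>V\<close>.\<close>

lemma increments_average:
 obtains K where "0 \<le> K" "\<And>n d. 0 < d \<Longrightarrow> d \<le> 1 \<Longrightarrow> EE M (KA n d (\<lambda>x y. (norm (y - x))^2)) \<le> ennreal (K * d * (1 + real n * d))"
proof -
 obtain K where K: "0 \<le> K" "\<And>T. 0 \<le> T \<Longrightarrow> EE M (\<lambda>om. LBINT u:{0..T}. V (X u om) powr q\<beta>) \<le> ennreal (K * (1 + T))"
  by (rule time_average[OF q\<beta>]) blast
 show ?thesis
 proof (rule that)
  show "0 \<le> 2 * C\<beta> * K" using C\<beta> K by simp
  fix n :: nat and d :: real assume d: "0 < d" "d \<le> 1"
  let ?J = "\<lambda>i. EE M (\<lambda>om. LBINT u:cell d i. V (X u om) powr q\<beta>)"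
  have one: "EE M (\<lambda>om. LBINT s:cell d i. (norm (X s om - X (real i * d) om))^2) \<le> ennreal (2 * C\<beta> * d) * ?J i" for i
  proof -
   have a: "0 \<le> real i * d" using d by simp
   have "EE M (\<lambda>om. LBINT s:cell d i. (norm (X s om - X (real i * d) om))^2)
    = (\<integral>\<^sup>+s\<in>cell d i. EE M (\<lambda>om. (norm (X s om - X (real i * d) om))^2) \<partial>lborel)"
    by (rule nn_integral_LINT_path2[OF cont2_dist a a]) simp
   also have "... \<le> (\<integral>\<^sup>+s\<in>cell d i. (ennreal (2 * C\<beta>) * ?J i) \<partial>lborel)"
   proof (rule nn_integral_mono)
    fix s
    have "EE M (\<lambda>om. (norm (X s om - X (real i * d) om))^2) \<le> ennreal (2 * C\<beta>) * ?J i" if "s \<in> cell d i"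
     by (rule increment_second_moment[OF a that]) (use d in \<open>simp add: algebra_simps\<close>)
    thus "EE M (\<lambda>om. (norm (X s om - X (real i * d) om))^2) * indicator (cell d i) s \<le> (ennreal (2 * C\<beta>) * ?J i) * indicator (cell d i) s"
     by (simp add: indicator_def)
   qed
   also have "... = (ennreal (2 * C\<beta>) * ?J i) * ennreal d" using d by (subst nn_integral_cmult_indicator) (auto simp: algebra_simps)
   finally show ?thesis using C\<beta> d by (simp add: ennreal_mult mult_ac)
  qed
  have "EE M (KA n d (\<lambda>x y. (norm (y - x))^2)) \<le> (\<Sum>i<n. ennreal (2 * C\<beta> * d) * ?J i)"
   using d by (subst EE_KA[OF cont2_dist]) (auto intro!: sum_mono one simp del: of_nat_Suc)
  also have "... = ennreal (2 * C\<beta> * d) * EE M (KA n d (\<lambda>x y. V y powr q\<beta>))"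
   using d by (subst EE_KA[OF cont_snd[OF V_powr_cont]]) (auto simp: sum_distrib_left simp del: of_nat_Suc)
  also have "EE M (KA n d (\<lambda>x y. V y powr q\<beta>)) = EE M (\<lambda>om. LBINT u:{0..real n * d}. V (X u om) powr q\<beta>)"
   using d by (intro nn_integral_cong) (simp add: KA_snd[OF V_powr_cont])
  also have "ennreal (2 * C\<beta> * d) * ... \<le> ennreal (2 * C\<beta> * d) * ennreal (K * (1 + real n * d))"
   using d K(2) by (intro mult_left_mono) auto
  also have "... = ennreal (2 * C\<beta> * K * d * (1 + real n * d))" using C\<beta> K d by (subst ennreal_mult[symmetric]) (auto simp: mult_ac)
  finally show "EE M (KA n d (\<lambda>x y. (norm (y - x))^2)) \<le> ennreal (2 * C\<beta> * K * d * (1 + real n * d))" .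
 qed
qed

text \<open>The three averages of time, grid and increments are combined into one master estimate.
  All later kernels are bounded in this form; the factor \<open>d\<close> on \<open>A\<close> is
  what makes large \<open>A\<close> harmless.\<close>

lemma kernel_average:
 assumes p: "0 \<le> p"
 obtains K where "0 \<le> K" "\<And>h \<kappa> A B n d. cont2 h \<Longrightarrow> 0 \<le> \<kappa> \<Longrightarrow> 0 \<le> A \<Longrightarrow> 0 \<le> B \<Longrightarrow>
  (\<And>x y. h x y \<le> \<kappa> + A * (norm (y - x))^2 + B * (V x powr p + V y powr p)) \<Longrightarrow> 0 < d \<Longrightarrow> d \<le> 1 \<Longrightarrow>
  EE M (KA n d h) \<le> ennreal (\<kappa> * (real n * d) + (A * d + B) * (K * (1 + real n * d)))"
proof -
 obtain K1 where K1: "0 \<le> K1" "\<And>T. 0 \<le> T \<Longrightarrow> EE M (\<lambda>om. LBINT u:{0..T}. V (X u om) powr p) \<le> ennreal (K1 * (1 + T))"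
  by (rule time_average[OF p]) blast
 obtain K2 where K2: "0 \<le> K2" "\<And>n d. 0 < d \<Longrightarrow> d \<le> 1 \<Longrightarrow> EE M (KA n d (\<lambda>x y. V x powr p)) \<le> ennreal (K2 * (1 + real n * d))"
  by (rule grid_average[OF p]) blast
 obtain K3 where K3: "0 \<le> K3" "\<And>n d. 0 < d \<Longrightarrow> d \<le> 1 \<Longrightarrow> EE M (KA n d (\<lambda>x y. (norm (y - x))^2)) \<le> ennreal (K3 * d * (1 + real n * d))"
  by (rule increments_average) blast
 show ?thesis
 proof (rule that)
  show "0 \<le> K1 + K2 + K3" using K1 K2 K3 by simp
  fix h :: "real^'d \<Rightarrow> real^'d \<Rightarrow> real" and \<kappa> A B :: real and n :: nat and d :: real
  assume h: "cont2 h" and pos: "0 \<le> \<kappa>" "0 \<le> A" "0 \<le> B" and d: "0 < d" "d \<le> 1"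
   and le: "\<And>x y. h x y \<le> \<kappa> + A * (norm (y - x))^2 + B * (V x powr p + V y powr p)"
  define T where "T = real n * d"
  have T: "0 \<le> T" using d by (simp add: T_def)
  let ?a = "KA n d (\<lambda>x y. (norm (y - x))^2)" and ?b = "KA n d (\<lambda>x y. V x powr p)" and ?c = "KA n d (\<lambda>x y. V y powr p)"
  have c: "cont2 (\<lambda>x y::real^'d. A * (norm (y - x))^2)" "cont2 (\<lambda>x y::real^'d. \<kappa>)"
   "cont2 (\<lambda>x y. B * V x powr p)" "cont2 (\<lambda>x y. B * V y powr p)"
   by (intro continuous_on_mult continuous_on_const cont2_dist cont_fst cont_snd V_powr_cont)+
  note c' = continuous_on_add[OF continuous_on_add[OF continuous_on_add[OF c(2,1)] c(3)] c(4)]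
   continuous_on_add[OF continuous_on_add[OF c(2,1)] c(3)] continuous_on_add[OF c(2,1)]
  have m: "?a \<in> borel_measurable M" "?b \<in> borel_measurable M" "?c \<in> borel_measurable M"
   using d by (auto intro!: KA_meas cont2_dist cont_fst cont_snd V_powr_cont)
  have nn: "0 \<le> ?a om" "0 \<le> ?b om" "0 \<le> ?c om" for om by (auto intro: KA_nonneg)
  have "KA n d h om \<le> \<kappa> * T + A * ?a om + B * ?b om + B * ?c om" if om: "om \<in> space M" for om
  proof -
   have "KA n d h om \<le> KA n d (\<lambda>x y. \<kappa> + A * (norm (y - x))^2 + B * V x powr p + B * V y powr p) om"
    using le d om by (intro KA_mono h c') (auto simp: algebra_simps)
   thus ?thesis
    using d om by (simp add: KA_add[OF c'(2) c(4)] KA_add[OF c'(3) c(3)] KA_add[OF c(2,1)] KA_cmult KA_fst[of d n "\<lambda>_. \<kappa>"] T_def mult_ac)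
  qed
  hence "EE M (KA n d h) \<le> (\<integral>\<^sup>+om. ennreal (\<kappa> * T) + ennreal A * ennreal (?a om) + ennreal B * ennreal (?b om) + ennreal B * ennreal (?c om) \<partial>M)"
   using pos T nn by (intro nn_integral_mono) (simp add: ennreal_mult[symmetric] ennreal_plus[symmetric] ennreal_leI del: ennreal_plus)
  also have "... = ennreal (\<kappa> * T) + ennreal A * EE M ?a + ennreal B * EE M ?b + ennreal B * EE M ?c"
   using measurable_compose[OF m(1) measurable_ennreal] measurable_compose[OF m(2) measurable_ennreal] measurable_compose[OF m(3) measurable_ennreal]
   by (simp add: nn_integral_add nn_integral_cmult emeasure_space_1)
  also have "EE M ?c = EE M (\<lambda>om. LBINT u:{0..T}. V (X u om) powr p)"
   using d by (intro nn_integral_cong) (simp add: KA_snd[OF V_powr_cont] T_def)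
  also have "ennreal (\<kappa> * T) + ennreal A * EE M ?a + ennreal B * EE M ?b + ennreal B * ...
   \<le> ennreal (\<kappa> * T) + ennreal A * ennreal (K3 * d * (1 + T)) + ennreal B * ennreal (K2 * (1 + T)) + ennreal B * ennreal (K1 * (1 + T))"
   using K3(2)[OF d, of n] K2(2)[OF d, of n] K1(2)[OF T] by (intro add_mono mult_left_mono order_refl) (auto simp: T_def)
  also have "... = ennreal (\<kappa> * T + A * (K3 * d * (1 + T)) + B * (K2 * (1 + T)) + B * (K1 * (1 + T)))"
   using pos K1(1) K2(1) K3(1) d T by (simp add: ennreal_mult[symmetric] ennreal_plus[symmetric] del: ennreal_plus)
  also have "... \<le> ennreal (\<kappa> * T + (A * d + B) * ((K1 + K2 + K3) * (1 + T)))"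
  proof (rule ennreal_leI)
   have "0 \<le> A * d * ((K1 + K2) * (1 + T))" "0 \<le> B * (K3 * (1 + T))" using pos d K1 K2 K3 T by auto
   thus "\<kappa> * T + A * (K3 * d * (1 + T)) + B * (K2 * (1 + T)) + B * (K1 * (1 + T)) \<le> \<kappa> * T + (A * d + B) * ((K1 + K2 + K3) * (1 + T))"
    by (simp add: algebra_simps)
  qed
  finally show "EE M (KA n d h) \<le> ennreal (\<kappa> * (real n * d) + (A * d + B) * ((K1 + K2 + K3) * (1 + real n * d)))" unfolding T_def .
 qed
qed

text \<open>There are three regimes. On a sublevel set, close pairs are handled by uniform
  continuity and distant pairs by a large multiple of the squared distance; off the sublevel set one
  additional power of \<open>V\<close> supplies the small factor.\<close>

lemma diagonal_kernel_bound:
 fixes F :: "real^'d \<Rightarrow> real^'d \<Rightarrow> real"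
 assumes F: "cont2 F" and diag: "\<And>x. F x x = 0"
  and C: "0 \<le> C" and q: "0 \<le> q" and growth: "\<And>x y. \<bar>F x y\<bar> \<le> C * (V x powr q + V y powr q)" and \<kappa>: "0 < \<kappa>"
 obtains A where "0 \<le> A" "\<And>x y. \<bar>F x y\<bar> \<le> \<kappa> + A * (norm (y - x))^2 + \<kappa> * (V x powr (q + 1) + V y powr (q + 1))"
proof -
 \<comment> \<open>With this level, \<open>2 * C\<close> is at most \<open>\<kappa> * w\<close> for
   every value \<open>w\<close> above it.\<close>
 define R where "R = 2 * C / \<kappa> + 1"
 have R: "1 \<le> R" using C \<kappa> by (simp add: R_def)
 let ?S = "{x. V x \<le> R}"
 have "compact (?S \<times> ?S)" by (intro compact_Times V_sublevel)
 hence "uniformly_continuous_on (?S \<times> ?S) (\<lambda>p. F (fst p) (snd p))"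
  by (intro compact_uniformly_continuous continuous_on_subset[OF F]) auto
 then obtain d where d: "0 < d" "\<And>p p'. p \<in> ?S \<times> ?S \<Longrightarrow> p' \<in> ?S \<times> ?S \<Longrightarrow> dist p' p < d \<Longrightarrow> dist (F (fst p') (snd p')) (F (fst p) (snd p)) < \<kappa>"
  using \<kappa> unfolding uniformly_continuous_on_def by metis
 define A where "A = 2 * C * R powr q / d^2"
 show ?thesis
 proof (rule that)
  show "0 \<le> A" using C by (simp add: A_def)
  fix x y
  have nn: "0 \<le> A * (norm (y - x))^2" "0 \<le> \<kappa> * V x powr (q + 1)" "0 \<le> \<kappa> * V y powr (q + 1)" using \<open>0 \<le> A\<close> \<kappa> by auto
  show "\<bar>F x y\<bar> \<le> \<kappa> + A * (norm (y - x))^2 + \<kappa> * (V x powr (q + 1) + V y powr (q + 1))"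
  proof (cases "V x \<le> R \<and> V y \<le> R")
   case True
   show ?thesis
   proof (cases "norm (y - x) < d")
    case True
    hence "dist (F x y) (F x x) < \<kappa>"
     using d(2)[of "(x, x)" "(x, y)"] \<open>V x \<le> R \<and> V y \<le> R\<close> by (simp add: dist_Pair_Pair dist_norm)
    thus ?thesis using nn by (simp only: diag dist_norm distrib_left real_norm_def)
   next
    case False
    have "V x powr q \<le> R powr q" "V y powr q \<le> R powr q"
     using \<open>V x \<le> R \<and> V y \<le> R\<close> q V_ge_1 by (auto intro!: powr_mono2 order_trans[OF zero_le_one])
    hence "C * (V x powr q + V y powr q) \<le> C * (R powr q + R powr q)" using C by (intro mult_left_mono add_mono)
    hence "\<bar>F x y\<bar> \<le> C * (R powr q + R powr q)" using growth[of x y] by linarith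
    also have "... = A * d^2" using d(1) by (simp add: A_def)
    also have "... \<le> A * (norm (y - x))^2" using False d(1) \<open>0 \<le> A\<close> by (intro mult_left_mono power_mono) auto
    finally show ?thesis using nn \<kappa> unfolding distrib_left by linarith
   qed
  next
   case False
   define w where "w = max (V x) (V y)"
   have w: "R < w" "1 \<le> w" "V x \<le> w" "V y \<le> w" using False V_ge_1[of x] by (auto simp: w_def)
   have "V x powr q \<le> w powr q" "V y powr q \<le> w powr q" using w q V_ge_1 by (auto intro!: powr_mono2 order_trans[OF zero_le_one])
   hence "C * (V x powr q + V y powr q) \<le> C * (w powr q + w powr q)" using C by (intro mult_left_mono add_mono)
   with growth[of x y] have "\<bar>F x y\<bar> \<le> C * (w powr q + w powr q)" by (rule order_trans)
   also have "C * (w powr q + w powr q) = 2 * C * w powr q" by simp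
   finally have "\<bar>F x y\<bar> \<le> 2 * C * w powr q" .
   also have "... \<le> (\<kappa> * w) * w powr q"
   proof (rule mult_right_mono)
    have "2 * C \<le> \<kappa> * R" using \<kappa> by (simp add: R_def field_simps)
    also have "... \<le> \<kappa> * w" using \<kappa> w by (intro mult_left_mono) auto
    finally show "2 * C \<le> \<kappa> * w" .
   qed simp
   also have "... = \<kappa> * w powr (q + 1)" using w by (simp add: powr_add)
   also have "... \<le> \<kappa> * (V x powr (q + 1) + V y powr (q + 1))" using \<kappa> by (intro mult_left_mono) (auto simp: w_def max_def)
   finally show ?thesis using nn \<kappa> by linarith
  qed
 qed
qed

text \<open>First \<kappa> is fixed in terms of \<open>e\<close>, which determines \<open>A\<close>;
  only then is the mesh chosen small relative to \<open>A\<close>. Each of the two contributions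
  takes half of \<open>e\<close>.\<close>

lemma diagonal_kernel_average:
 assumes F: "cont2 F" "\<And>x. F x x = 0" "0 \<le> C" "0 \<le> q" "\<And>x y. \<bar>F x y\<bar> \<le> C * (V x powr q + V y powr q)" and e: "0 < e"
 obtains \<delta> where "0 < \<delta>" "\<And>n d. 0 < d \<Longrightarrow> d \<le> \<delta> \<Longrightarrow> 1 \<le> real n * d \<Longrightarrow> EE M (KA n d (\<lambda>x y. \<bar>F x y\<bar>)) \<le> ennreal (e * (real n * d))"
proof -
 have q1: "0 \<le> q + 1" using F by simp
 obtain K where K: "0 \<le> K" "\<And>h \<kappa> A B n d. cont2 h \<Longrightarrow> 0 \<le> \<kappa> \<Longrightarrow> 0 \<le> A \<Longrightarrow> 0 \<le> B \<Longrightarrow>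
  (\<And>x y. h x y \<le> \<kappa> + A * (norm (y - x))^2 + B * (V x powr (q + 1) + V y powr (q + 1))) \<Longrightarrow> 0 < d \<Longrightarrow> d \<le> 1 \<Longrightarrow>
  EE M (KA n d h) \<le> ennreal (\<kappa> * (real n * d) + (A * d + B) * (K * (1 + real n * d)))" by (rule kernel_average[OF q1]) blast
 define \<kappa> where "\<kappa> = e / (2 * (1 + 2 * K))"
 have \<kappa>: "0 < \<kappa>" "\<kappa> * (1 + 2 * K) = e / 2" using e K(1) by (auto simp: \<kappa>_def field_simps intro!: divide_pos_pos)
 obtain A where A: "0 \<le> A" "\<And>x y. \<bar>F x y\<bar> \<le> \<kappa> + A * (norm (y - x))^2 + \<kappa> * (V x powr (q + 1) + V y powr (q + 1))"
  by (rule diagonal_kernel_bound[OF F \<kappa>(1)]) blast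
 have AK: "0 \<le> A * K" using A K by simp
 show ?thesis
 proof (rule that)
  \<comment> \<open>This bound on the mesh makes \<open>A * K * d\<close> at most
    \<open>e / 4\<close>; the remaining factor 2 comes from estimating \<open>1 + T\<close> by
    \<open>2 * T\<close>.\<close>
  show "0 < min 1 (e / (4 * (A * K + 1)))" using e AK by simp
  fix n :: nat and d :: real assume d: "0 < d" "d \<le> min 1 (e / (4 * (A * K + 1)))" and T: "1 \<le> real n * d"
  define T where "T = real n * d"
  have "d \<le> e / (4 * (A * K + 1))" using d by simp
  hence Ad: "A * K * d \<le> e / 4" using AK d by (simp add: field_simps)
  have "EE M (KA n d (\<lambda>x y. \<bar>F x y\<bar>)) \<le> ennreal (\<kappa> * T + (A * d + \<kappa>) * (K * (1 + T)))"
   unfolding T_def using d A \<kappa> by (intro K continuous_on_rabs F) auto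
  also have "... \<le> ennreal (e * T)"
  proof (rule ennreal_leI)
   have T1: "1 \<le> T" using T by (simp add: T_def)
   have "(A * d + \<kappa>) * (K * (1 + T)) \<le> (A * d + \<kappa>) * (K * (2 * T))" using A d \<kappa> K T1 by (intro mult_left_mono) auto
   also have "... = 2 * (A * K * d) * T + \<kappa> * (2 * K) * T" by (simp add: algebra_simps)
   also have "... \<le> 2 * (e / 4) * T + \<kappa> * (2 * K) * T" using Ad T1 by (intro add_right_mono mult_right_mono) auto
   finally have "\<kappa> * T + (A * d + \<kappa>) * (K * (1 + T)) \<le> \<kappa> * (1 + 2 * K) * T + e / 2 * T" by (simp add: algebra_simps)
   thus "\<kappa> * T + (A * d + \<kappa>) * (K * (1 + T)) \<le> e * T" unfolding \<kappa>(2) by (simp add: mult.commute)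
  qed
  finally show "EE M (KA n d (\<lambda>x y. \<bar>F x y\<bar>)) \<le> ennreal (e * (real n * d))" unfolding T_def .
 qed
qed

end

section \<open>Events of high probability\<close>

context prob_space
begin

lemma prob_le_of_nn_integral:
 assumes f: "f \<in> borel_measurable M" "\<And>om. om \<in> space M \<Longrightarrow> 0 \<le> f om" and bnd: "(EE M (\<lambda>om. f om)) \<le> ennreal B" and c: "0 < c" "0 \<le> B"
 shows "prob {om \<in> space M. c \<le> f om} \<le> B / c"
proof -
 have "emeasure M {om \<in> space M. 1 \<le> ennreal (1 / c) * ennreal (f om)} \<le> ennreal (1 / c) * (\<integral>\<^sup>+om. ennreal (f om) * indicator (space M) om \<partial>M)"
  by (rule nn_integral_Markov_inequality) (use f in auto)
 also have "(\<integral>\<^sup>+om. ennreal (f om) * indicator (space M) om \<partial>M) = (EE M (\<lambda>om. f om))"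
  by (intro nn_integral_cong) simp
 also have "ennreal (1 / c) * (EE M (\<lambda>om. f om)) \<le> ennreal (1 / c) * ennreal B" by (intro mult_left_mono bnd) simp
 also have "... = ennreal (B / c)" using c by (simp add: ennreal_mult[symmetric])
 also have "{om \<in> space M. 1 \<le> ennreal (1 / c) * ennreal (f om)} = {om \<in> space M. c \<le> f om}"
  using c f(2) by (auto simp: ennreal_mult[symmetric] field_simps)
 finally show ?thesis using c by (simp add: emeasure_eq_measure)
qed

text \<open>The exceptional set is a measurable superset of the failure set, because
  \<open>Q\<close> may quantify over uncountably many parameters and need not define an
  event.\<close>

definition whp :: "'i filter \<Rightarrow> ('i \<Rightarrow> 'a \<Rightarrow> bool) \<Rightarrow> bool" where
 "whp Fl Q \<longleftrightarrow> (\<forall>\<delta>>0. \<forall>\<^sub>F i in Fl. \<exists>A\<in>events. prob A \<le> \<delta> \<and> (\<forall>om\<in>space M - A. Q i om))"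

lemma whp_mono:
 assumes "whp Fl P" "\<forall>\<^sub>F i in Fl. \<forall>om\<in>space M. P i om \<longrightarrow> Q i om"
 shows "whp Fl Q" unfolding whp_def
proof (intro allI impI)
 fix \<delta> :: real assume "0 < \<delta>"
 with assms(1) have "\<forall>\<^sub>F i in Fl. \<exists>A\<in>events. prob A \<le> \<delta> \<and> (\<forall>om\<in>space M - A. P i om)" by (simp add: whp_def)
 thus "\<forall>\<^sub>F i in Fl. \<exists>A\<in>events. prob A \<le> \<delta> \<and> (\<forall>om\<in>space M - A. Q i om)"
  using assms(2) by eventually_elim blast
qed

lemma whp_eventually: "\<forall>\<^sub>F i in Fl. \<forall>om\<in>space M. Q i om \<Longrightarrow> whp Fl Q"
 unfolding whp_def by (auto elim!: eventually_mono intro!: bexI[of _ "{}"])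

lemma whp_conj:
 assumes P: "whp Fl P" and Q: "whp Fl Q"
 shows "whp Fl (\<lambda>i om. P i om \<and> Q i om)" unfolding whp_def
proof (intro allI impI)
 fix \<delta> :: real assume "0 < \<delta>"
 hence "0 < \<delta> / 2" by simp
 with P Q have "\<forall>\<^sub>F i in Fl. \<exists>A\<in>events. prob A \<le> \<delta> / 2 \<and> (\<forall>om\<in>space M - A. P i om)"
  "\<forall>\<^sub>F i in Fl. \<exists>A\<in>events. prob A \<le> \<delta> / 2 \<and> (\<forall>om\<in>space M - A. Q i om)" unfolding whp_def by blast+
 thus "\<forall>\<^sub>F i in Fl. \<exists>A\<in>events. prob A \<le> \<delta> \<and> (\<forall>om\<in>space M - A. P i om \<and> Q i om)"
 proof eventually_elim
  case (elim i)
  then obtain A B where "A \<in> events" "prob A \<le> \<delta> / 2" "\<forall>om\<in>space M - A. P i om"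
   "B \<in> events" "prob B \<le> \<delta> / 2" "\<forall>om\<in>space M - B. Q i om" by blast
  thus ?case using measure_Un_le[of A M B] by (intro bexI[of _ "A \<union> B"]) auto
 qed
qed

lemma whp_ball_finite:
 assumes "finite N" "\<And>n. n \<in> N \<Longrightarrow> whp Fl (Q n)"
 shows "whp Fl (\<lambda>i om. \<forall>n\<in>N. Q n i om)" using assms
proof (induction N rule: finite_induct)
 case empty
 show ?case by (rule whp_eventually) simp
next
 case (insert n N)
 hence "whp Fl (\<lambda>i om. Q n i om \<and> (\<forall>n\<in>N. Q n i om))" by (intro whp_conj) auto
 thus ?case by simp
qed

lemma whp_AE:
 assumes "AE om in M. Q om"
 shows "whp Fl (\<lambda>_. Q)"
proof -
 obtain A where "{om \<in> space M. \<not> Q om} \<subseteq> A" "emeasure M A = 0" "A \<in> events" using assms by (rule AE_E)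
 thus ?thesis unfolding whp_def by (auto simp: measure_def intro!: always_eventually bexI[of _ A])
qed

lemma whp_of_tendsto:
 assumes meas: "\<forall>\<^sub>F i in Fl. {om \<in> space M. \<not> Q i om} \<in> events"
  and lim: "((\<lambda>i. prob {om \<in> space M. \<not> Q i om}) \<longlongrightarrow> 0) Fl"
 shows "whp Fl Q" unfolding whp_def
proof (intro allI impI)
 fix \<delta> :: real assume "0 < \<delta>"
 have "\<forall>\<^sub>F i in Fl. prob {om \<in> space M. \<not> Q i om} < \<delta>" using order_tendstoD(2)[OF lim \<open>0 < \<delta>\<close>] .
 thus "\<forall>\<^sub>F i in Fl. \<exists>A\<in>events. prob A \<le> \<delta> \<and> (\<forall>om\<in>space M - A. Q i om)" using meas
 proof eventually_elim
  case (elim i)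
  thus ?case by (intro bexI[of _ "{om \<in> space M. \<not> Q i om}"] conjI ballI) auto
 qed
qed

lemma tendsto_of_whp:
 assumes "whp Fl Q"
 shows "((\<lambda>i. prob {om \<in> space M. \<not> Q i om}) \<longlongrightarrow> 0) Fl"
proof (rule tendstoI)
 fix e :: real assume "0 < e"
 hence "0 < e / 2" by simp
 with assms have "\<forall>\<^sub>F i in Fl. \<exists>A\<in>events. prob A \<le> e / 2 \<and> (\<forall>om\<in>space M - A. Q i om)" unfolding whp_def by blast
 thus "\<forall>\<^sub>F i in Fl. dist (prob {om \<in> space M. \<not> Q i om}) 0 < e"
 proof eventually_elim
  case (elim i)
  then obtain A where A: "A \<in> events" "prob A \<le> e / 2" "\<forall>om\<in>space M - A. Q i om" by blast
  have "prob {om \<in> space M. \<not> Q i om} \<le> prob A" by (rule finite_measure_mono) (use A in auto)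
  thus ?case using A \<open>0 < e\<close> by simp
 qed
qed

text \<open>Auxiliary events and truncation levels may be chosen after the tolerance
  \<delta>.\<close>

lemma whp_approx:
 assumes "\<And>\<delta>. 0 < \<delta> \<Longrightarrow> \<exists>P B. whp Fl P \<and> (\<forall>\<^sub>F i in Fl. B i \<in> events \<and> prob (B i) \<le> \<delta> \<and> (\<forall>om\<in>space M - B i. P i om \<longrightarrow> Q i om))"
 shows "whp Fl Q" unfolding whp_def
proof (intro allI impI)
 fix \<delta> :: real assume "0 < \<delta>"
 hence \<delta>: "0 < \<delta> / 2" by simp
 from assms[OF this] obtain P B where P: "whp Fl P"
  and B: "\<forall>\<^sub>F i in Fl. B i \<in> events \<and> prob (B i) \<le> \<delta> / 2 \<and> (\<forall>om\<in>space M - B i. P i om \<longrightarrow> Q i om)" by blast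
 have "\<forall>\<^sub>F i in Fl. \<exists>A\<in>events. prob A \<le> \<delta> / 2 \<and> (\<forall>om\<in>space M - A. P i om)" using P \<delta> unfolding whp_def by blast
 with B show "\<forall>\<^sub>F i in Fl. \<exists>A\<in>events. prob A \<le> \<delta> \<and> (\<forall>om\<in>space M - A. Q i om)"
 proof eventually_elim
  case (elim i)
  then obtain A where "A \<in> events" "prob A \<le> \<delta> / 2" "\<forall>om\<in>space M - A. P i om" by blast
  thus ?case using elim(1) measure_Un_le[of A M "B i"] by (intro bexI[of _ "A \<union> B i"]) auto
 qed
qed

end

section \<open>Laws of large numbers for polynomially growing functions\<close>

locale sampled_diffusion = growth_diffusion M \<F> W X \<beta> \<rho> I V x0 C\<beta> q\<beta>
 for M :: "'w measure" and \<F> and W :: "real \<Rightarrow> 'w \<Rightarrow> real^'d" and X \<beta> \<rho> I V x0 C\<beta> q\<beta> +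
 fixes \<pi> :: "(real^'d) measure" and \<Delta> :: "real \<Rightarrow> real" and m :: "real \<Rightarrow> nat"
 assumes \<pi>_prob: "prob_space \<pi>" and \<pi>_sets: "sets \<pi> = sets borel" and erg: "ergodic_process M X \<pi>"
  and mesh: "\<And>eps. 0 < eps \<Longrightarrow> 0 < \<Delta> eps \<and> real (m eps) = 1 / (eps * \<Delta> eps)"
  and \<Delta>_lim: "(\<Delta> \<longlongrightarrow> 0) (at_right 0)"
begin

lemma borel_\<pi>: "f \<in> borel_measurable borel \<Longrightarrow> f \<in> borel_measurable \<pi>"
 using \<pi>_sets by (simp cong: measurable_cong_sets)

lemma cont_meas_\<pi>:
 fixes f :: "real^'d \<Rightarrow> 'b::topological_space"
 shows "continuous_on UNIV f \<Longrightarrow> f \<in> borel_measurable \<pi>" by (intro borel_\<pi> borel_measurable_continuous_onI)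

lemma ergodic_AE:
 fixes f :: "real^'d \<Rightarrow> real"
 assumes "continuous_on UNIV f" "\<And>x. \<bar>f x\<bar> \<le> B"
 shows "AE om in M. ((\<lambda>T. (1 / T) * (LBINT s:{0..T}. f (X s om))) \<longlongrightarrow> (\<integral>x. f x \<partial>\<pi>)) at_top"
proof -
 have "bounded (range f)" using assms(2) by (auto simp: bounded_iff)
 thus ?thesis using erg borel_measurable_continuous_onI[OF assms(1)] unfolding ergodic_process_def by blast
qed

text \<open>Ergodicity identifies the mean of the power cut at level \<open>n\<close> with a limit
  of time averages. Fatou's lemma in time bounds it by \<open>2 * K\<close>, uniformly in the level,
  and Fatou's lemma in the level removes the cut.\<close>

lemma \<pi>_moment:
 assumes q: "0 \<le> q"
 shows "integrable \<pi> (\<lambda>x. V x powr q)"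
proof -
 interpret \<pi>: prob_space \<pi> by (rule \<pi>_prob)
 obtain K where K: "0 \<le> K" "\<And>T. 0 \<le> T \<Longrightarrow>
  (EE M (\<lambda>om. LBINT u:{0..T}. V (X u om) powr q)) \<le> ennreal (K * (1 + T))" by (rule time_average[OF q]) blast
 let ?f = "\<lambda>n x. min (V x powr q) (real n)"
 have fc: "continuous_on UNIV (?f n)" for n by (intro continuous_on_min V_powr_cont continuous_on_const)
 have f_nn: "0 \<le> ?f n x" for n x by simp
 have bound: "(\<integral>\<^sup>+x. ennreal (?f n x) \<partial>\<pi>) \<le> ennreal (2 * K)" for n
 proof -
  have "(\<integral>\<^sup>+x. ennreal (?f n x) \<partial>\<pi>) = ennreal (\<integral>x. ?f n x \<partial>\<pi>)"
   by (intro nn_integral_eq_integral \<pi>.integrable_const_bound[where B="real n"]) (auto intro: cont_meas_\<pi> fc)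
  also have "ennreal (\<integral>x. ?f n x \<partial>\<pi>) = (EE M (\<lambda>om. \<integral>x. ?f n x \<partial>\<pi>))"
   by (simp add: emeasure_space_1)
  also have "... = (\<integral>\<^sup>+om. liminf (\<lambda>k. ennreal ((1 / real (Suc k)) * (LBINT s:{0..real (Suc k)}. ?f n (X s om)))) \<partial>M)"
  proof (rule nn_integral_cong_AE)
   have "AE om in M. ((\<lambda>T. (1 / T) * (LBINT s:{0..T}. ?f n (X s om))) \<longlongrightarrow> (\<integral>x. ?f n x \<partial>\<pi>)) at_top"
    by (rule ergodic_AE[OF fc, where B="real n"]) (simp add: abs_of_nonneg)
   thus "AE om in M. ennreal (\<integral>x. ?f n x \<partial>\<pi>) = liminf (\<lambda>k. ennreal ((1 / real (Suc k)) * (LBINT s:{0..real (Suc k)}. ?f n (X s om))))"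
   proof eventually_elim
    case (elim om)
    have "filterlim (\<lambda>k. real (Suc k)) at_top sequentially" using filterlim_compose[OF filterlim_real_sequentially filterlim_Suc] .
    from filterlim_compose[OF elim this]
    show ?case by (intro lim_imp_Liminf[symmetric] tendsto_ennrealI) auto
   qed
  qed
  also have "... \<le> liminf (\<lambda>k. \<integral>\<^sup>+om. ennreal ((1 / real (Suc k)) * (LBINT s:{0..real (Suc k)}. ?f n (X s om))) \<partial>M)"
   by (intro nn_integral_liminf measurable_compose[OF _ measurable_ennreal] borel_measurable_times borel_measurable_const LINT_path_meas fc) simp
  also have "... \<le> liminf (\<lambda>k::nat. ennreal (2 * K))"
  proof (intro Liminf_mono always_eventually allI)
   fix k
   define T where "T = real (Suc k)"
   have T: "1 \<le> T" by (simp add: T_def)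
   have "(EE M (\<lambda>om. (1 / T) * (LBINT s:{0..T}. ?f n (X s om))))
    \<le> (\<integral>\<^sup>+om. ennreal (1 / T) * ennreal (LBINT s:{0..T}. V (X s om) powr q) \<partial>M)"
   proof (rule nn_integral_mono)
    fix om assume "om \<in> space M"
    hence "(LBINT s:{0..T}. ?f n (X s om)) \<le> (LBINT s:{0..T}. V (X s om) powr q)" by (intro LINT_path_mono fc V_powr_cont) auto
    thus "ennreal ((1 / T) * (LBINT s:{0..T}. ?f n (X s om))) \<le> ennreal (1 / T) * ennreal (LBINT s:{0..T}. V (X s om) powr q)"
     using T by (subst ennreal_mult[symmetric]) (auto intro!: LINT_path_nonneg ennreal_leI divide_right_mono)
   qed
   also have "... = ennreal (1 / T) * (EE M (\<lambda>om. LBINT s:{0..T}. V (X s om) powr q))"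
    by (intro nn_integral_cmult measurable_compose[OF LINT_path_meas measurable_ennreal] V_powr_cont) simp
   also have "... \<le> ennreal (1 / T) * ennreal (K * (1 + T))" using T by (intro mult_left_mono K) auto
   also have "... = ennreal ((1 / T) * (K * (1 + T)))" using T K by (subst ennreal_mult) auto
   also have "... \<le> ennreal (2 * K)"
   proof (rule ennreal_leI)
    have "K * (1 + T) \<le> K * (2 * T)" using T K by (intro mult_left_mono) auto
    thus "(1 / T) * (K * (1 + T)) \<le> 2 * K" using T by (simp add: field_simps)
   qed
   finally show "(EE M (\<lambda>om. (1 / real (Suc k)) * (LBINT s:{0..real (Suc k)}. ?f n (X s om)))) \<le> ennreal (2 * K)" unfolding T_def .
  qed
  also have "... = ennreal (2 * K)" by (simp add: Liminf_const)
  finally show ?thesis .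
 qed
 have "(\<integral>\<^sup>+x. ennreal (V x powr q) \<partial>\<pi>) = (\<integral>\<^sup>+x. liminf (\<lambda>n. ennreal (?f n x)) \<partial>\<pi>)"
 proof (rule nn_integral_cong)
  fix x
  have "(\<lambda>n. ?f n x) \<longlonglongrightarrow> V x powr q"
  proof (rule tendsto_eventually)
   obtain N where "V x powr q \<le> real N" using real_arch_simple by blast
   thus "\<forall>\<^sub>F n in sequentially. ?f n x = V x powr q" by (intro eventually_sequentiallyI[of N]) (auto simp: min_def)
  qed
  thus "ennreal (V x powr q) = liminf (\<lambda>n. ennreal (?f n x))" by (intro lim_imp_Liminf[symmetric] tendsto_ennrealI) auto
 qed
 also have "... \<le> liminf (\<lambda>n. \<integral>\<^sup>+x. ennreal (?f n x) \<partial>\<pi>)"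
  by (intro nn_integral_liminf measurable_compose[OF cont_meas_\<pi>[OF fc] measurable_ennreal])
 also have "... \<le> liminf (\<lambda>n::nat. ennreal (2 * K))" by (intro Liminf_mono always_eventually allI bound)
 also have "... < \<infinity>" by (simp add: Liminf_const)
 finally show ?thesis by (intro integrableI_nonneg cont_meas_\<pi> V_powr_cont) auto
qed

lemma \<pi>_integrable:
 fixes F :: "real^'d \<Rightarrow> real"
 assumes F: "continuous_on UNIV F" "\<And>x. \<bar>F x\<bar> \<le> C * V x powr q" and q: "0 \<le> q"
 shows "integrable \<pi> F"
proof (rule Bochner_Integration.integrable_bound)
 show "integrable \<pi> (\<lambda>x. C * V x powr q)" using \<pi>_moment[OF q] by simp
 show "AE x in \<pi>. norm (F x) \<le> norm (C * V x powr q)" by (auto intro!: AE_I2 order_trans[OF F(2)])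
qed (rule cont_meas_\<pi>[OF F(1)])

abbreviation "obs eps i \<equiv> X (real i * \<Delta> eps)"
abbreviation "KS eps \<equiv> KA (m eps) (\<Delta> eps)"

lemma horizon: "0 < eps \<Longrightarrow> real (m eps) * \<Delta> eps = 1 / eps" using mesh[of eps] by (simp add: field_simps)

abbreviation "\<pi>E F \<equiv> \<integral>x. F x \<partial>\<pi>"
abbreviation "TA F t om \<equiv> LBINT s:{0..t}. F (X s om)"

lemma eventually_mesh:
 assumes "0 < d"
 shows "\<forall>\<^sub>F eps in at_right 0. 0 < eps \<and> 0 < \<Delta> eps \<and> \<Delta> eps \<le> d \<and> T \<le> real (m eps) * \<Delta> eps"
proof -
 have "\<forall>\<^sub>F eps in at_right 0. \<Delta> eps < d" using order_tendstoD(2)[OF \<Delta>_lim assms] .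
 moreover have "\<forall>\<^sub>F eps in at_right (0::real). T \<le> inverse eps"
  using filterlim_inverse_at_top_right unfolding filterlim_at_top by blast
 moreover have "\<forall>\<^sub>F eps in at_right (0::real). 0 < eps" by (simp add: eventually_at_right_less)
 ultimately show ?thesis
 proof eventually_elim
  case (elim eps)
  thus ?case using conjunct1[OF mesh[OF elim(3)]] horizon[OF elim(3)] by (simp add: inverse_eq_divide)
 qed
qed

lemma eventually_pos: "\<forall>\<^sub>F eps in at_right (0::real). 0 < eps" by (simp add: eventually_at_right_less)

text \<open>Markov's inequality: on fine grids the mean of the kernel average is at most
  \<open>\<delta> * \<eta>\<close> times the horizon.\<close>

lemma whp_diagonal:
 assumes F: "cont2 F" "\<And>x. F x x = 0" "0 \<le> C" "0 \<le> q" "\<And>x y. \<bar>F x y\<bar> \<le> C * (V x powr q + V y powr q)" and \<eta>: "0 < \<eta>"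
 shows "whp (at_right 0) (\<lambda>eps om. eps * KS eps (\<lambda>x y. \<bar>F x y\<bar>) om \<le> \<eta>)"
proof (rule whp_approx)
 fix \<delta> :: real assume \<delta>: "0 < \<delta>"
 hence "0 < \<delta> * \<eta>" using \<eta> by simp
 from diagonal_kernel_average[OF F this]
 obtain d where d: "0 < d" "\<And>n t. 0 < t \<Longrightarrow> t \<le> d \<Longrightarrow> 1 \<le> real n * t \<Longrightarrow> EE M (KA n t (\<lambda>x y. \<bar>F x y\<bar>)) \<le> ennreal (\<delta> * \<eta> * (real n * t))"
  by blast
 let ?S = "\<lambda>eps. KS eps (\<lambda>x y. \<bar>F x y\<bar>)"
 let ?B = "\<lambda>eps. {om \<in> space M. \<eta> / eps \<le> ?S eps om}"
 have "\<forall>\<^sub>F eps in at_right 0. ?B eps \<in> events \<and> prob (?B eps) \<le> \<delta> \<and> (\<forall>om\<in>space M - ?B eps. eps * ?S eps om \<le> \<eta>)"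
  using eventually_mesh[OF d(1), of 1]
 proof eventually_elim
  case (elim eps)
  have S_meas [measurable]: "?S eps \<in> borel_measurable M" using elim by (intro KA_meas continuous_on_rabs F) auto
  have "prob (?B eps) \<le> \<delta> * \<eta> * (1 / eps) / (\<eta> / eps)"
   using d(2)[of "\<Delta> eps" "m eps"] elim \<eta> \<delta> horizon[of eps] by (intro prob_le_of_nn_integral[OF S_meas] KA_nonneg) auto
  also have "... = \<delta>" using elim \<eta> by simp
  finally show ?case using elim by (auto simp: not_le pos_less_divide_eq mult.commute less_imp_le)
 qed
 thus "\<exists>P B. whp (at_right 0) P \<and> (\<forall>\<^sub>F eps in at_right 0. B eps \<in> events \<and> prob (B eps) \<le> \<delta> \<and>
  (\<forall>om\<in>space M - B eps. P eps om \<longrightarrow> eps * ?S eps om \<le> \<eta>))"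
  by (intro exI[of _ "\<lambda>_ _. True"] exI[of _ ?B] conjI whp_eventually) auto
qed

text \<open>Ergodicity is available for bounded functions, so \<open>F\<close> is cut at a level
  \<open>N\<close>. The cut-off part is dominated by a multiple of \<open>V powr (2 * q)\<close>
  with the small factor \<open>1 / N\<close>, both in the stationary mean and in the time
  average.\<close>

lemma whp_ergodic:
 fixes F :: "real^'d \<Rightarrow> real"
 assumes F: "continuous_on UNIV F" "\<And>x. \<bar>F x\<bar> \<le> C * V x powr q" and q: "0 \<le> q" and \<eta>: "0 < \<eta>"
 shows "whp (at_right 0) (\<lambda>eps om. \<bar>eps * TA F (1 / eps) om - \<pi>E F\<bar> \<le> \<eta>)"
proof (rule whp_approx)
 fix \<delta> :: real assume \<delta>: "0 < \<delta>"
 interpret \<pi>: prob_space \<pi> by (rule \<pi>_prob)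
 have q2: "0 \<le> 2 * q" using q by simp
 obtain K where K: "0 \<le> K" "\<And>T. 0 \<le> T \<Longrightarrow> EE M (\<lambda>om. LBINT u:{0..T}. V (X u om) powr (2 * q)) \<le> ennreal (K * (1 + T))"
  by (rule time_average[OF q2]) blast
 define K\<pi> where "K\<pi> = (\<integral>x. V x powr (2 * q) \<partial>\<pi>)"
 have K\<pi>: "0 \<le> K\<pi>" unfolding K\<pi>_def by (intro integral_nonneg_AE) auto
 \<comment> \<open>The first fraction gives the exceptional event probability at most \<delta>, the
   second keeps the stationary error below \<open>\<eta> / 3\<close>.\<close>
 define N where "N = 1 + C^2 * (6 * K / (\<delta> * \<eta>) + 3 * K\<pi> / \<eta>)"
 have N: "1 \<le> N" using K K\<pi> \<delta> \<eta> by (simp add: N_def)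
 define G where "G x = max (- N) (min N (F x))" for x
 have Gc: "continuous_on UNIV G" unfolding G_def by (intro continuous_intros F)
 have GB: "\<bar>G x\<bar> \<le> N" for x using N by (auto simp: G_def)
 let ?D = "\<lambda>x. C^2 / N * V x powr (2 * q)"
 have FG: "\<bar>F x - G x\<bar> \<le> ?D x" for x
 proof -
  \<comment> \<open>Where the cut acts, the modulus of \<open>F\<close> exceeds \<open>N\<close> and
    also dominates the difference.\<close>
  have "\<bar>F x - G x\<bar> * N \<le> (F x)^2"
  proof (cases "\<bar>F x\<bar> \<le> N")
   case False
   hence "\<bar>F x - G x\<bar> \<le> \<bar>F x\<bar>" using N by (auto simp: G_def abs_if min_def max_def)
   hence "\<bar>F x - G x\<bar> * N \<le> \<bar>F x\<bar> * \<bar>F x\<bar>" using False N by (intro mult_mono) auto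
   thus ?thesis by (simp add: power2_eq_square abs_mult_self_eq)
  qed (auto simp: G_def)
  also have "... \<le> (C * V x powr q)^2" using F(2)[of x] by (metis abs_ge_zero power2_abs power_mono)
  also have "... = C^2 * V x powr (2 * q)" by (simp add: power_mult_distrib power2_eq_square powr_add[symmetric])
  finally show ?thesis using N by (simp add: field_simps)
 qed
 have Dc: "continuous_on UNIV ?D" by (intro continuous_on_mult continuous_on_const V_powr_cont)
 have \<pi>_diff: "\<bar>\<pi>E F - \<pi>E G\<bar> \<le> \<eta> / 3"
 proof -
  have iG: "integrable \<pi> G" by (rule \<pi>.integrable_const_bound[where B=N]) (use GB in \<open>auto intro: cont_meas_\<pi> Gc\<close>)
  have iF: "integrable \<pi> F" by (rule \<pi>_integrable[OF F q])
  have "\<bar>\<pi>E F - \<pi>E G\<bar> = \<bar>\<integral>x. F x - G x \<partial>\<pi>\<bar>" using iF iG by simp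
  also have "... \<le> (\<integral>x. \<bar>F x - G x\<bar> \<partial>\<pi>)" by (rule integral_abs_bound)
  also have "... \<le> (\<integral>x. ?D x \<partial>\<pi>)" using \<pi>_moment[OF q2] iF iG FG by (intro integral_mono) auto
  also have "... = C^2 / N * K\<pi>" by (simp add: K\<pi>_def)
  also have "... \<le> \<eta> / 3"
  proof -
   have "C^2 * (3 * K\<pi> / \<eta>) \<le> N" using K \<delta> \<eta> by (simp add: N_def distrib_left)
   thus ?thesis using N \<eta> by (simp add: field_simps)
  qed
  finally show ?thesis .
 qed
 have G_meas: "(\<lambda>om. \<bar>eps * TA G (1 / eps) om - \<pi>E G\<bar>) \<in> borel_measurable M" for eps
  by (intro borel_measurable_abs borel_measurable_diff borel_measurable_times borel_measurable_const LINT_path_meas Gc) simp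
 let ?P = "\<lambda>eps om. \<not> \<eta> / 3 \<le> \<bar>eps * TA G (1 / eps) om - \<pi>E G\<bar>"
 have lim: "whp (at_right 0) ?P"
 proof (rule whp_of_tendsto)
  show "\<forall>\<^sub>F eps in at_right 0. {om \<in> space M. \<not> ?P eps om} \<in> events"
   by (intro always_eventually allI) (simp only: not_not borel_measurable_le[OF borel_measurable_const G_meas])
  \<comment> \<open>The horizon is a real parameter; convergence along every sequence tending to
    infinity suffices.\<close>
  have "((\<lambda>T. prob {om \<in> space M. \<eta> / 3 \<le> \<bar>1 / T * TA G T om - \<pi>E G\<bar>}) \<longlongrightarrow> 0) at_top"
  proof (rule tendsto_at_topI_sequentially)
   fix Z :: "nat \<Rightarrow> real" assume Z: "filterlim Z at_top sequentially"
   show "(\<lambda>n. prob {om \<in> space M. \<eta> / 3 \<le> \<bar>1 / Z n * TA G (Z n) om - \<pi>E G\<bar>}) \<longlonglongrightarrow> 0"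
   proof (rule AE_tendsto_imp_prob_tendsto)
    show "(\<lambda>om. \<bar>1 / Z n * TA G (Z n) om - \<pi>E G\<bar>) \<in> borel_measurable M" for n
     by (intro borel_measurable_abs borel_measurable_diff borel_measurable_times borel_measurable_const LINT_path_meas Gc) simp
    show "AE om in M. (\<lambda>n. \<bar>1 / Z n * TA G (Z n) om - \<pi>E G\<bar>) \<longlonglongrightarrow> 0"
     using ergodic_AE[OF Gc GB] by eventually_elim (rule tendsto_rabs_zero[OF LIM_zero[OF filterlim_compose[OF _ Z]]])
   qed (use \<eta> in simp)
  qed
  from filterlim_compose[OF this filterlim_inverse_at_top_right]
  show "((\<lambda>eps. prob {om \<in> space M. \<not> ?P eps om}) \<longlongrightarrow> 0) (at_right 0)" by (simp add: inverse_eq_divide)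
 qed
 let ?h = "\<lambda>eps om. LBINT s:{0..1 / eps}. ?D (X s om)"
 let ?B = "\<lambda>eps. {om \<in> space M. 1 / eps * (\<eta> / 3) \<le> ?h eps om}"
 have "\<forall>\<^sub>F eps in at_right 0. ?B eps \<in> events \<and> prob (?B eps) \<le> \<delta> \<and>
  (\<forall>om\<in>space M - ?B eps. ?P eps om \<longrightarrow> \<bar>eps * TA F (1 / eps) om - \<pi>E F\<bar> \<le> \<eta>)"
  using eventually_mesh[OF zero_less_one, of 1]
 proof eventually_elim
  case (elim eps)
  define T where "T = 1 / eps"
  have eps: "0 < eps" "eps = 1 / T" and T: "1 \<le> T" using elim horizon[of eps] by (auto simp: T_def)
  have hm [measurable]: "?h eps \<in> borel_measurable M" by (rule LINT_path_meas[OF Dc]) simp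
  have "prob (?B eps) \<le> (C^2 / N * (K * (1 + T))) / (T * (\<eta> / 3))" unfolding T_def[symmetric]
  proof (rule prob_le_of_nn_integral[OF hm[folded T_def] LINT_path_nonneg])
   have "EE M (\<lambda>om. LBINT s:{0..T}. ?D (X s om)) = (\<integral>\<^sup>+om. ennreal (C^2 / N) * ennreal (LBINT s:{0..T}. V (X s om) powr (2 * q)) \<partial>M)"
    using N by (intro nn_integral_cong) (simp only: set_integral_mult_right, subst ennreal_mult, auto intro: LINT_path_nonneg)
   also have "... = ennreal (C^2 / N) * EE M (\<lambda>om. LBINT s:{0..T}. V (X s om) powr (2 * q))"
    by (intro nn_integral_cmult measurable_compose[OF LINT_path_meas measurable_ennreal] V_powr_cont) simp
   also have "... \<le> ennreal (C^2 / N) * ennreal (K * (1 + T))" using T by (intro mult_left_mono K) auto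
   also have "... = ennreal (C^2 / N * (K * (1 + T)))" using N K T by (subst ennreal_mult) auto
   finally show "EE M (\<lambda>om. LBINT s:{0..T}. ?D (X s om)) \<le> ennreal (C^2 / N * (K * (1 + T)))" .
  qed (use T \<eta> N K in auto)
  also have "... \<le> \<delta>"
  proof -
   have "C^2 * (6 * K / (\<delta> * \<eta>)) \<le> N" using K\<pi> \<delta> \<eta> by (simp add: N_def distrib_left)
   hence 1: "C^2 * K * 6 \<le> N * (\<delta> * \<eta>)" using \<delta> \<eta> by (simp add: field_simps)
   have "C^2 * (K * (1 + T)) \<le> C^2 * (K * (2 * T))" using K T by (intro mult_left_mono) auto
   hence "3 * (C^2 * (K * (1 + T))) \<le> (C^2 * K * 6) * T" by (simp add: algebra_simps)
   also have "... \<le> N * (\<delta> * \<eta>) * T" using 1 T by (intro mult_right_mono) auto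
   finally show ?thesis using N \<delta> \<eta> T by (simp add: field_simps)
  qed
  finally have pB: "prob (?B eps) \<le> \<delta>" .
  have "\<bar>eps * TA F T om - \<pi>E F\<bar> \<le> \<eta>"
   if om: "om \<in> space M" and h: "(LBINT s:{0..T}. ?D (X s om)) < T * (\<eta> / 3)" and P: "?P eps om" for om
  proof -
   have i: "set_integrable lborel {0..T} (\<lambda>s. F (X s om))" "set_integrable lborel {0..T} (\<lambda>s. G (X s om))"
    by (auto intro!: borel_integrable_atLeastAtMost' path_cont F Gc om)
   have "\<bar>TA F T om - TA G T om\<bar> \<le> (LBINT s:{0..T}. norm (F (X s om) - G (X s om)))"
    using set_integral_norm_bound[OF set_integral_diff(1)[OF i]] i by simp
   also have "... \<le> (LBINT s:{0..T}. ?D (X s om))"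
    using LINT_path_mono[of "\<lambda>x. norm (F x - G x)" ?D om 0 T] FG Dc om by (simp add: continuous_intros F Gc)
   also note less_imp_le[OF h]
   finally have "eps * \<bar>TA F T om - TA G T om\<bar> \<le> eps * (T * (\<eta> / 3))"
    using eps(1) by (intro mult_left_mono) auto
   also have "eps * (T * (\<eta> / 3)) = \<eta> / 3" using eps T by simp
   finally have "\<bar>eps * TA F T om - eps * TA G T om\<bar> \<le> \<eta> / 3"
    unfolding right_diff_distrib[symmetric] abs_mult using eps by simp
   with P \<pi>_diff show ?thesis unfolding T_def by linarith
  qed
  note F_close = this[unfolded T_def]
  show ?case
  proof (intro conjI ballI impI pB borel_measurable_le[OF borel_measurable_const hm])
   fix om assume "om \<in> space M - ?B eps" and P: "?P eps om"
   hence om: "om \<in> space M" "\<not> 1 / eps * (\<eta> / 3) \<le> ?h eps om" by blast+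
   show "\<bar>eps * TA F (1 / eps) om - \<pi>E F\<bar> \<le> \<eta>"
    by (rule F_close[OF om(1) om(2)[unfolded not_le] P])
  qed
 qed
 with lim show "\<exists>P B. whp (at_right 0) P \<and> (\<forall>\<^sub>F eps in at_right 0. B eps \<in> events \<and> prob (B eps) \<le> \<delta> \<and>
  (\<forall>om\<in>space M - B eps. P eps om \<longrightarrow> \<bar>eps * TA F (1 / eps) om - \<pi>E F\<bar> \<le> \<eta>))" by (intro exI[of _ ?P] exI[of _ ?B] conjI)
qed

text \<open>The sum over observations differs from the time integral by the kernel
  \<open>f y - f x\<close>, which vanishes on the diagonal.\<close>

lemma whp_average:
 assumes f: "continuous_on UNIV f" "\<And>x. \<bar>f x\<bar> \<le> C * V x powr q" and C: "0 \<le> C" "0 \<le> q" and \<eta>: "0 < \<eta>"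
 shows "whp (at_right 0) (\<lambda>eps om. \<bar>eps * \<Delta> eps * (\<Sum>i<m eps. f (obs eps i om)) - \<pi>E f\<bar> \<le> \<eta>)"
proof -
 have \<eta>2: "0 < \<eta> / 2" using \<eta> by simp
 have bound: "\<bar>f y - f x\<bar> \<le> C * (V x powr q + V y powr q)" for x y using f(2)[of x] f(2)[of y] by (simp add: distrib_left)
 have c: "cont2 (\<lambda>x y. f y - f x)" "cont2 (\<lambda>x y. f x)" "cont2 (\<lambda>x y. \<bar>f y - f x\<bar>)"
  by (intro continuous_on_rabs continuous_on_diff cont_snd cont_fst f)+
 show ?thesis
 proof (rule whp_mono[OF whp_conj[OF whp_diagonal[OF c(1) _ C bound \<eta>2] whp_ergodic[OF f C(2) \<eta>2]]])
  show "\<forall>\<^sub>F eps in at_right 0. \<forall>om\<in>space M. eps * KS eps (\<lambda>x y. \<bar>f y - f x\<bar>) om \<le> \<eta> / 2 \<and>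
   \<bar>eps * TA f (1 / eps) om - \<pi>E f\<bar> \<le> \<eta> / 2 \<longrightarrow> \<bar>eps * \<Delta> eps * (\<Sum>i<m eps. f (obs eps i om)) - \<pi>E f\<bar> \<le> \<eta>"
   using eventually_pos
  proof (eventually_elim, intro ballI impI, elim conjE)
   fix eps om assume eps: "0 < eps" and om: "om \<in> space M" and 1: "eps * KS eps (\<lambda>x y. \<bar>f y - f x\<bar>) om \<le> \<eta> / 2"
    and 2: "\<bar>eps * TA f (1 / eps) om - \<pi>E f\<bar> \<le> \<eta> / 2"
   have d: "0 \<le> \<Delta> eps" using mesh[OF eps] by simp
   have "TA f (1 / eps) om = KS eps (\<lambda>x y. (f y - f x) + f x) om"
    using KA_snd[OF f(1) om d, of "m eps"] horizon[OF eps] by simp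
   also have "... = KS eps (\<lambda>x y. f y - f x) om + \<Delta> eps * (\<Sum>i<m eps. f (obs eps i om))"
    by (simp only: KA_add[OF c(1,2) om d] KA_fst[OF d])
   finally have "eps * TA f (1 / eps) om - eps * \<Delta> eps * (\<Sum>i<m eps. f (obs eps i om)) = eps * KS eps (\<lambda>x y. f y - f x) om"
    by (simp add: algebra_simps)
   moreover have "\<bar>eps * KS eps (\<lambda>x y. f y - f x) om\<bar> \<le> \<eta> / 2"
   proof -
    have "KS eps (\<lambda>x y. f y - f x) om \<le> KS eps (\<lambda>x y. \<bar>f y - f x\<bar>) om" by (rule KA_mono[OF c(1,3) _ om d]) simp
    moreover have "KS eps (\<lambda>x y. - 1 * (f y - f x)) om \<le> KS eps (\<lambda>x y. \<bar>f y - f x\<bar>) om"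
     by (rule KA_mono[OF continuous_on_mult[OF continuous_on_const c(1)] c(3) _ om d]) simp
    ultimately have "\<bar>KS eps (\<lambda>x y. f y - f x) om\<bar> \<le> KS eps (\<lambda>x y. \<bar>f y - f x\<bar>) om" unfolding KA_cmult by linarith
    from order_trans[OF mult_left_mono[OF this less_imp_le[OF eps]] 1] show ?thesis using eps by (simp add: abs_mult)
   qed
   ultimately show "\<bar>eps * \<Delta> eps * (\<Sum>i<m eps. f (obs eps i om)) - \<pi>E f\<bar> \<le> \<eta>" using 2 by linarith
  qed
 qed simp
qed

end

section \<open>Chaining over a bounded parameter set\<close>

lemma continuous_on_holder:
 fixes f :: "'a::metric_space \<Rightarrow> 'b::metric_space"
 assumes \<nu>: "0 < \<nu>" and f: "\<And>x y. x \<in> S \<Longrightarrow> y \<in> S \<Longrightarrow> dist (f x) (f y) \<le> D * dist x y powr \<nu>"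
 shows "continuous_on S f" unfolding continuous_on_def
proof
 fix x assume x: "x \<in> S"
 have "((\<lambda>y. D * dist y x powr \<nu>) \<longlongrightarrow> D * dist x x powr \<nu>) (at x within S)"
  using \<nu> by (intro tendsto_mult tendsto_const tendsto_powr' tendsto_dist tendsto_ident_at) auto
 hence "((\<lambda>y. D * dist y x powr \<nu>) \<longlongrightarrow> 0) (at x within S)" using \<nu> by simp
 thus "(f \<longlongrightarrow> f x) (at x within S)" unfolding tendsto_dist_iff[of f]
  by (rule tendsto_sandwich[OF _ _ tendsto_const, rotated 2]) (auto simp: eventually_at_filter intro!: always_eventually f x)
qed

text \<open>Space is cut into cubes of side \<open>1 / (c * 2 ^ n)\<close>, and one point of
  \<open>S\<close> represents each cube that \<open>S\<close> meets. The net thus lies in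
  \<open>S\<close>, where the processes are controlled.\<close>

lemma dyadic_net:
 fixes S :: "'e::euclidean_space set"
 assumes "bounded S"
 obtains A D :: nat where "1 \<le> A" "1 \<le> D"
  "\<And>n. \<exists>N. finite N \<and> N \<subseteq> S \<and> card N \<le> A * D ^ n \<and> (\<forall>x\<in>S. \<exists>y\<in>N. dist x y \<le> (1/2) ^ n)"
proof -
 obtain B where B: "0 < B" "\<And>x. x \<in> S \<Longrightarrow> norm x \<le> B" using assms bounded_pos by blast
 \<comment> \<open>With the dimension as divisor, coordinatewise closeness adds up to distance
   \<open>(1/2) ^ n\<close> in the sum norm.\<close>
 define c where "c = real DIM('e)"
 have c: "1 \<le> c" unfolding c_def by (simp add: Suc_leI)
 define M where "M = nat \<lceil>c * B\<rceil> + 1"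
 have M: "c * B \<le> real M" unfolding M_def by linarith
 show ?thesis
 proof (rule that[of "(2 * M + 1) ^ DIM('e)" "2 ^ DIM('e)"])
  fix n :: nat
  define cell where "cell x = (\<lambda>b\<in>Basis. \<lfloor>(x \<bullet> b) * (c * 2 ^ n)\<rfloor>)" for x :: 'e
  let ?R = "{- int (M * 2 ^ n)..int (M * 2 ^ n)}"
  have cell_in: "cell x \<in> (\<Pi>\<^sub>E b\<in>Basis. ?R)" if "x \<in> S" for x
  proof -
   have "\<lfloor>(x \<bullet> b) * (c * 2 ^ n)\<rfloor> \<in> ?R" if "b \<in> Basis" for b
   proof -
    have "\<bar>x \<bullet> b\<bar> \<le> B" using Basis_le_norm[OF that, of x] B(2)[OF \<open>x \<in> S\<close>] by linarith
    hence "\<bar>x \<bullet> b\<bar> * (c * 2 ^ n) \<le> B * (c * 2 ^ n)" using c by (intro mult_right_mono) auto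
    also have "... = (c * B) * 2 ^ n" by simp
    also have "... \<le> real M * 2 ^ n" using M by (intro mult_right_mono) auto
    finally have "\<bar>(x \<bullet> b) * (c * 2 ^ n)\<bar> \<le> real (M * 2 ^ n)" using c by (simp add: abs_mult)
    thus ?thesis by (simp add: abs_le_iff le_floor_iff floor_le_iff del: of_nat_mult of_nat_power)
   qed
   thus ?thesis by (auto simp: cell_def)
  qed
  define rep where "rep k = (SOME x. x \<in> S \<and> cell x = k)" for k
  have rep: "rep (cell x) \<in> S" "cell (rep (cell x)) = cell x" if "x \<in> S" for x
   using someI_ex[of "\<lambda>y. y \<in> S \<and> cell y = cell x"] that unfolding rep_def by blast+
  have fin: "finite (cell ` S)" by (rule finite_subset[of _ "\<Pi>\<^sub>E b\<in>Basis. ?R"]) (use cell_in in \<open>auto intro!: finite_PiE\<close>)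
  show "\<exists>N. finite N \<and> N \<subseteq> S \<and> card N \<le> (2 * M + 1) ^ DIM('e) * (2 ^ DIM('e)) ^ n \<and> (\<forall>x\<in>S. \<exists>y\<in>N. dist x y \<le> (1/2) ^ n)"
  proof (intro exI[of _ "rep ` cell ` S"] conjI ballI)
   show "finite (rep ` cell ` S)" using fin by simp
   show "rep ` cell ` S \<subseteq> S" using rep by blast
   have "card (rep ` cell ` S) \<le> card (cell ` S)" by (rule card_image_le[OF fin])
   also have "... \<le> card (\<Pi>\<^sub>E b\<in>(Basis :: 'e set). ?R)" by (rule card_mono) (use cell_in in \<open>auto intro!: finite_PiE\<close>)
   also have "... = (2 * (M * 2 ^ n) + 1) ^ DIM('e)"
   proof -
    have "nat (2 * (int M * 2 ^ n) + 1) = nat (int (2 * (M * 2 ^ n) + 1))" by simp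
    also have "... = 2 * (M * 2 ^ n) + 1" by (rule nat_int)
    finally show ?thesis by (simp add: card_PiE)
   qed
   also have "... \<le> ((2 * M + 1) * 2 ^ n) ^ DIM('e)" by (intro power_mono) auto
   also have "... = (2 * M + 1) ^ DIM('e) * (2 ^ DIM('e)) ^ n" by (simp only: power_mult_distrib power_mult[symmetric] mult.commute)
   finally show "card (rep ` cell ` S) \<le> (2 * M + 1) ^ DIM('e) * (2 ^ DIM('e)) ^ n" .
   fix x assume x: "x \<in> S"
   let ?y = "rep (cell x)"
   have "\<bar>(x - ?y) \<bullet> b\<bar> \<le> 1 / (c * 2 ^ n)" if "b \<in> Basis" for b
   proof -
    have "cell ?y b = cell x b" using rep(2)[OF x] by simp
    hence "\<lfloor>(?y \<bullet> b) * (c * 2 ^ n)\<rfloor> = \<lfloor>(x \<bullet> b) * (c * 2 ^ n)\<rfloor>" using that by (simp add: cell_def)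
    hence "\<bar>(x \<bullet> b) * (c * 2 ^ n) - (?y \<bullet> b) * (c * 2 ^ n)\<bar> \<le> 1" by linarith
    hence "\<bar>(x - ?y) \<bullet> b\<bar> * (c * 2 ^ n) \<le> 1" using c by (simp add: inner_diff_left left_diff_distrib[symmetric] abs_mult)
    thus ?thesis using c by (simp add: pos_le_divide_eq)
   qed
   hence "(\<Sum>b\<in>Basis. \<bar>(x - ?y) \<bullet> b\<bar>) \<le> (\<Sum>b\<in>(Basis :: 'e set). 1 / (c * 2 ^ n))" by (rule sum_mono)
   also have "... = (1/2) ^ n" using c by (simp add: c_def field_simps)
   finally have "dist x ?y \<le> (1/2) ^ n" unfolding dist_norm using norm_le_l1[of "x - ?y"] by linarith
   thus "\<exists>y\<in>rep ` cell ` S. dist x y \<le> (1/2) ^ n" using x by blast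
  qed
 qed simp_all
qed

text \<open>From \<open>(1 + y / k) ^ k \<le> exp y\<close>. Any polynomial decay is available, with
  \<open>k\<close> at choice.\<close>

lemma exp_minus_le_power:
 fixes y :: real
 assumes "0 < y" "1 \<le> k"
 shows "exp (- y) \<le> (real k / y) ^ k"
proof -
 have "(y / real k) ^ k \<le> (1 + y / real k) ^ k" using assms by (intro power_mono) auto
 also have "... \<le> exp y" using assms by (intro exp_ge_one_plus_x_over_n_power_n) auto
 finally have "inverse (exp y) \<le> inverse ((y / real k) ^ k)" using assms by (intro le_imp_inverse_le) auto
 thus ?thesis by (simp add: exp_minus power_inverse[symmetric])
qed

text \<open>A point is reached along links between nets of consecutive levels. The thresholds for
  the links decrease geometrically, yet more slowly than the scale of the increments, so the
  Gaussian exponents grow geometrically and outweigh the number of links. Tails are assumed on an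
  event \<open>G\<close> only, and \<kappa> depends on \<open>K\<close> and \<nu> alone.\<close>

lemma (in prob_space) chaining:
 fixes K :: "'e::euclidean_space set"
 assumes K: "bounded K" and \<nu>: "0 < (\<nu>::real)"
 obtains \<kappa> where "0 < \<kappa>" "\<And>S G \<tau> \<rho>. (\<And>p. p \<in> K \<Longrightarrow> S p \<in> borel_measurable M) \<Longrightarrow> G \<in> sets M \<Longrightarrow>
  (\<And>om. om \<in> space M \<Longrightarrow> continuous_on K (\<lambda>p. S p om)) \<Longrightarrow> 0 < \<tau> \<Longrightarrow> 0 < \<rho> \<Longrightarrow> \<tau> \<le> \<rho>^2 \<Longrightarrow>
  (\<And>p p' a d. p \<in> K \<Longrightarrow> p' \<in> K \<Longrightarrow> 0 < a \<Longrightarrow> 0 < d \<Longrightarrow> dist p p' \<le> d \<Longrightarrow>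
    prob {om \<in> G. a \<le> \<bar>S p om - S p' om\<bar>} \<le> 2 * exp (- (a^2 / (\<tau> * d powr (2 * \<nu>))))) \<Longrightarrow>
  (\<And>p a. p \<in> K \<Longrightarrow> 0 < a \<Longrightarrow> prob {om \<in> G. a \<le> \<bar>S p om\<bar>} \<le> 2 * exp (- (a^2 / \<tau>))) \<Longrightarrow>
  \<exists>A\<in>sets M. prob A \<le> \<kappa> * (\<tau> / \<rho>^2) \<and> (\<forall>om\<in>G - A. \<forall>p\<in>K. \<bar>S p om\<bar> \<le> \<rho>)"
proof -
 obtain A D :: nat where AD: "1 \<le> A" "1 \<le> D" 
  and "\<And>n. \<exists>N. finite N \<and> N \<subseteq> K \<and> card N \<le> A * D ^ n \<and> (\<forall>x\<in>K. \<exists>y\<in>N. dist x y \<le> (1/2) ^ n)"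
  by (rule dyadic_net[OF K]) blast
 then obtain N where N: "\<And>n. finite (N n)" "\<And>n. N n \<subseteq> K" "\<And>n. card (N n) \<le> A * D ^ n"
  and near: "\<And>n x. x \<in> K \<Longrightarrow> \<exists>y\<in>N n. dist x y \<le> (1/2) ^ n" by metis
 define s where "s = 2 powr \<nu>"
 have s: "1 < s" using \<nu> by (simp add: s_def)
 \<comment> \<open>The increments scale like \<open>(1 / s) ^ n\<close>; thresholds with the square
   root as ratio remain summable and leave an exponent of order \<open>s ^ n\<close>.\<close>
 define r where "r = 1 / sqrt s"
 have r: "0 < r" "r < 1" "r^2 = 1 / s" using s by (auto simp: r_def power_divide)
 have d_pow: "(2 * (1/2) ^ n) powr (2 * \<nu>) = s^2 * (1 / s^2) ^ n" for n
 proof -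
  have "(2 * (1/2) ^ n) powr (2 * \<nu>) = 2 powr (2 * \<nu>) * (((1/2) ^ n) powr (2 * \<nu>))" by (rule powr_mult)
  also have "2 powr (2 * \<nu>) = s^2" by (simp add: s_def power2_eq_square powr_add[symmetric])
  also have "((1/2::real) ^ n) powr (2 * \<nu>) = ((1/2) powr (2 * \<nu>)) ^ n" by (simp add: powr_realpow[symmetric] powr_powr mult.commute)
  also have "(1/2::real) powr (2 * \<nu>) = 1 / s^2" by (simp add: s_def power2_eq_square powr_add[symmetric] powr_divide)
  finally show ?thesis .
 qed
 define L where "L = (1 - r)^2 / (4 * s^2)"
 have L: "0 < L" using r s by (simp add: L_def)
 \<comment> \<open>The power \<open>k\<close> is large enough that \<open>s ^ k\<close> beats
   \<open>D^2\<close>, the growth rate of the number of links, with a factor 2 to spare for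
   summation.\<close>
 obtain k0 where k0: "2 * (real D)^2 < s ^ k0" using real_arch_pow[OF s] by blast
 define k where "k = k0 + 1"
 have k: "1 \<le> k" "2 * (real D)^2 \<le> s ^ k"
 proof -
  have "s ^ k0 * 1 \<le> s ^ k0 * s" using s by (intro mult_left_mono) auto
  thus "2 * (real D)^2 \<le> s ^ k" using k0 by (simp add: k_def mult.commute)
 qed (simp add: k_def)
 define c1 where "c1 = 2 * (real A)^2 * real D * (real k / L) ^ k"
 have c1: "0 < c1" using AD k L by (simp add: c1_def)
 show ?thesis
 proof (rule that[of "2 * c1 + 8 * real A"])
  show "0 < 2 * c1 + 8 * real A" using c1 by simp
  fix S :: "'e \<Rightarrow> 'a \<Rightarrow> real" and G \<tau> \<rho>
  assume meas: "\<And>p. p \<in> K \<Longrightarrow> S p \<in> borel_measurable M" and G: "G \<in> sets M"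
   and cont: "\<And>om. om \<in> space M \<Longrightarrow> continuous_on K (\<lambda>p. S p om)" and \<tau>: "0 < \<tau>" and \<rho>: "0 < \<rho>" and \<tau>\<rho>: "\<tau> \<le> \<rho>^2"
   and tail: "\<And>p p' a d. p \<in> K \<Longrightarrow> p' \<in> K \<Longrightarrow> 0 < a \<Longrightarrow> 0 < d \<Longrightarrow> dist p p' \<le> d \<Longrightarrow>
    prob {om \<in> G. a \<le> \<bar>S p om - S p' om\<bar>} \<le> 2 * exp (- (a^2 / (\<tau> * d powr (2 * \<nu>))))"
   and tail0: "\<And>p a. p \<in> K \<Longrightarrow> 0 < a \<Longrightarrow> prob {om \<in> G. a \<le> \<bar>S p om\<bar>} \<le> 2 * exp (- (a^2 / \<tau>))"
  define x where "x = \<rho>^2 / \<tau>"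
  have x: "1 \<le> x" using \<tau> \<tau>\<rho> by (simp add: x_def)
  \<comment> \<open>These thresholds sum to \<open>\<rho> / 2\<close>; the other half is reserved
    for the starting net.\<close>
  define a where "a n = \<rho> / 2 * (1 - r) * r ^ n" for n
  have a: "0 < a n" for n using \<rho> r by (simp add: a_def)
  define P where "P n = {(p, p') \<in> N (Suc n) \<times> N n. dist p p' \<le> 2 * (1/2) ^ n}" for n
  define E where "E n = (\<Union>(p, p')\<in>P n. {om \<in> G. a n \<le> \<bar>S p om - S p' om\<bar>})" for n
  define E0 where "E0 = (\<Union>p\<in>N 0. {om \<in> G. \<rho> / 2 \<le> \<bar>S p om\<bar>})"
  have finP: "finite (P n)" for n unfolding P_def by (rule finite_subset[of _ "N (Suc n) \<times> N n"]) (use N in auto)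
  have NK: "p \<in> K" if "p \<in> N n" for p n using N(2) that by blast
  have sets1: "{om \<in> G. b \<le> \<bar>S p om - S p' om\<bar>} \<in> sets M" if "p \<in> K" "p' \<in> K" for p p' b
  proof -
   have "{om \<in> G. b \<le> \<bar>S p om - S p' om\<bar>} = G \<inter> {om \<in> space M. b \<le> \<bar>S p om - S p' om\<bar>}"
    using sets.sets_into_space[OF G] by auto
   also have "... \<in> sets M" using meas[OF that(1)] meas[OF that(2)] G by measurable
   finally show ?thesis .
  qed
  have sets0: "{om \<in> G. b \<le> \<bar>S p om\<bar>} \<in> sets M" if "p \<in> K" for p b
  proof -
   have "{om \<in> G. b \<le> \<bar>S p om\<bar>} = G \<inter> {om \<in> space M. b \<le> \<bar>S p om\<bar>}"
    using sets.sets_into_space[OF G] by auto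
   also have "... \<in> sets M" using meas[OF that(1)] G by measurable
   finally show ?thesis .
  qed
  have E_sets: "E n \<in> sets M" for n unfolding E_def using finP by (intro sets.finite_UN) (auto simp: P_def intro!: sets1 NK)
  have E0_sets: "E0 \<in> sets M" unfolding E0_def by (rule sets.finite_UN[OF N(1) sets0[OF NK]])
  have prob_E: "prob (E n) \<le> c1 / x * (1/2) ^ n" for n
  proof -
   define y where "y = x * L * s ^ n"
   have y: "0 < y" using x L s by (simp add: y_def)
   \<comment> \<open>The squared threshold contributes \<open>(1 / s) ^ n\<close> and the squared
     scale \<open>(1 / s) ^ (2 * n)\<close>, so the quotient grows like
     \<open>s ^ n\<close>.\<close>
   have y_eq: "(a n)^2 / (\<tau> * (2 * (1/2) ^ n) powr (2 * \<nu>)) = y"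
   proof -
    have "(a n)^2 = \<rho>^2 / 4 * (1 - r)^2 * (1 / s) ^ n"
    proof -
     have "(r ^ n)^2 = (1 / s) ^ n" by (simp only: r(3)[symmetric] power_mult[symmetric] mult.commute)
     thus ?thesis by (simp add: a_def power_mult_distrib power_divide)
    qed
    moreover have "\<rho>^2 / 4 * (1 - r)^2 * u / (\<tau> * (s^2 * (u * u))) = \<rho>^2 / \<tau> * ((1 - r)^2 / (4 * s^2)) * (1 / u)" if "0 < u" for u
     using that \<tau> s by simp
    moreover have "0 < (1 / s) ^ n" "(1 / s^2) ^ n = (1 / s) ^ n * (1 / s) ^ n" "s ^ n = 1 / (1 / s) ^ n"
     using s by (simp_all add: power_divide power_mult_distrib[symmetric] power2_eq_square)
    ultimately show ?thesis unfolding d_pow y_def x_def L_def by metis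
   qed
   have "prob (E n) \<le> (\<Sum>(p, p')\<in>P n. prob {om \<in> G. a n \<le> \<bar>S p om - S p' om\<bar>})" unfolding E_def split_def
    by (rule measure_UNION_le[OF finP]) (auto simp: P_def intro!: sets1 NK)
   also have "... \<le> (\<Sum>(p, p')\<in>P n. 2 * exp (- y))"
   proof (rule sum_mono, clarify)
    fix p p' assume "(p, p') \<in> P n"
    hence "p \<in> K" "p' \<in> K" "dist p p' \<le> 2 * (1/2) ^ n" by (auto simp: P_def NK)
    from tail[OF this(1,2) a _ this(3), of n] show "prob {om \<in> G. a n \<le> \<bar>S p om - S p' om\<bar>} \<le> 2 * exp (- y)"
     unfolding y_eq by simp
   qed
   also have "... = real (card (P n)) * (2 * exp (- y))" by (simp add: split_def)
   also have "... \<le> ((real A)^2 * real D * ((real D)^2) ^ n) * (2 * exp (- y))"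
   proof (rule mult_right_mono)
    have "card (P n) \<le> card (N (Suc n) \<times> N n)" unfolding P_def by (rule card_mono) (use N in auto)
    also have "... \<le> (A * D ^ Suc n) * (A * D ^ n)" unfolding card_cartesian_product by (intro mult_mono N) auto
    also have "... = A^2 * D * (D^2) ^ n" by (simp add: power2_eq_square power_mult_distrib)
    finally have "real (card (P n)) \<le> real (A^2 * D * (D^2) ^ n)" by (rule of_nat_mono)
    thus "real (card (P n)) \<le> (real A)^2 * real D * ((real D)^2) ^ n" by simp
   qed simp
   also have "... \<le> ((real A)^2 * real D * ((real D)^2) ^ n) * (2 * (real k / y) ^ k)"
    using exp_minus_le_power[OF y k(1)] by (intro mult_left_mono) auto
   also have "... = c1 * (1 / x ^ k) * ((real D)^2 / s ^ k) ^ n"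
    using x L s by (simp add: c1_def y_def power_divide power_mult_distrib power_mult[symmetric] mult.commute[of n k] field_simps)
   also have "... \<le> c1 * (1 / x) * (1/2) ^ n"
   proof (intro mult_mono power_mono mult_left_mono)
    show "1 / x ^ k \<le> 1 / x" using x k(1) by (intro divide_left_mono) (auto intro: self_le_power)
    show "(real D)^2 / s ^ k \<le> 1/2" using k(2) s by (simp add: field_simps)
   qed (use c1 x s in auto)
   finally show ?thesis by simp
  qed
  have prob_E0: "prob E0 \<le> 8 * real A / x"
  proof -
   have "prob E0 \<le> (\<Sum>p\<in>N 0. prob {om \<in> G. \<rho> / 2 \<le> \<bar>S p om\<bar>})"
    unfolding E0_def by (rule measure_UNION_le[OF N(1) sets0[OF NK]])
   also have "... \<le> (\<Sum>p\<in>N 0. 2 * exp (- (x / 4)))"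
   proof (rule sum_mono)
    fix p assume "p \<in> N 0"
    from tail0[OF NK[OF this], of "\<rho> / 2"] \<rho> show "prob {om \<in> G. \<rho> / 2 \<le> \<bar>S p om\<bar>} \<le> 2 * exp (- (x / 4))"
     by (simp add: x_def power_divide mult.commute)
   qed
   also have "... = real (card (N 0)) * (2 * exp (- (x / 4)))" by simp
   also have "... \<le> real A * (2 * (1 / (x / 4)) ^ 1)" using N(3)[of 0] exp_minus_le_power[of "x / 4" 1] x by (intro mult_mono) auto
   finally show ?thesis by (simp add: mult.commute)
  qed
  have sum: "summable (\<lambda>n. c1 / x * (1/2) ^ n)" "(\<Sum>n. c1 / x * (1/2) ^ n) = 2 * (c1 / x)"
   using suminf_mult[of "\<lambda>n. (1/2::real) ^ n" "c1 / x"] by (auto intro!: summable_mult summable_geometric simp: suminf_geometric summable_geometric)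
  have sE: "summable (\<lambda>n. prob (E n))" by (rule summable_comparison_test'[OF sum(1), of 0]) (use prob_E in auto)
  have prob_UE: "prob (\<Union>n. E n) \<le> 2 * (c1 / x)"
  proof -
   have "prob (\<Union>n. E n) \<le> (\<Sum>n. prob (E n))" by (rule finite_measure_subadditive_countably) (use E_sets sE in auto)
   also have "... \<le> 2 * (c1 / x)" unfolding sum(2)[symmetric] by (rule suminf_le[OF prob_E sE sum(1)])
   finally show ?thesis .
  qed
  show "\<exists>A'\<in>sets M. prob A' \<le> (2 * c1 + 8 * real A) * (\<tau> / \<rho>^2) \<and> (\<forall>om\<in>G - A'. \<forall>p\<in>K. \<bar>S p om\<bar> \<le> \<rho>)"
  proof (intro bexI conjI ballI)
   show "E0 \<union> (\<Union>n. E n) \<in> sets M" using E0_sets E_sets by blast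
   have "prob (E0 \<union> (\<Union>n. E n)) \<le> prob E0 + prob (\<Union>n. E n)" using E0_sets E_sets by (intro measure_Un_le) auto
   also have "... \<le> (2 * c1 + 8 * real A) / x" using prob_E0 prob_UE by (simp add: add_divide_distrib)
   also have "... = (2 * c1 + 8 * real A) * (\<tau> / \<rho>^2)" by (simp add: x_def)
   finally show "prob (E0 \<union> (\<Union>n. E n)) \<le> (2 * c1 + 8 * real A) * (\<tau> / \<rho>^2)" .
   fix om p assume om: "om \<in> G - (E0 \<union> (\<Union>n. E n))" and p: "p \<in> K"
   obtain \<xi> where \<xi>: "\<And>n. \<xi> n \<in> N n" "\<And>n. dist p (\<xi> n) \<le> (1/2) ^ n" using near[OF p] by metis
   have step: "\<bar>S (\<xi> (Suc n)) om - S (\<xi> n) om\<bar> \<le> a n" for n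
   proof -
    have "dist (\<xi> (Suc n)) (\<xi> n) \<le> dist p (\<xi> (Suc n)) + dist p (\<xi> n)" by (metis dist_triangle3 dist_commute add.commute)
    also have "... \<le> (1/2) ^ Suc n + (1/2) ^ n" by (intro add_mono \<xi>)
    also have "... \<le> 2 * (1/2) ^ n" by simp
    finally have "(\<xi> (Suc n), \<xi> n) \<in> P n" using \<xi> by (auto simp: P_def)
    hence "\<not> (a n \<le> \<bar>S (\<xi> (Suc n)) om - S (\<xi> n) om\<bar>)" using om unfolding E_def by fastforce
    thus ?thesis by simp
   qed
   have first: "\<bar>S (\<xi> 0) om\<bar> \<le> \<rho> / 2" using om \<xi>(1)[of 0] by (auto simp: E0_def)
   have partial: "\<bar>S (\<xi> n) om\<bar> \<le> \<rho> / 2 + \<rho> / 2 * (1 - r ^ n)" for n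
   proof (induction n)
    case (Suc n)
    have "\<rho> / 2 * (1 - r ^ n) + a n = \<rho> / 2 * (1 - r ^ Suc n)" by (simp add: a_def field_simps)
    thus ?case using Suc step[of n] by linarith
   qed (use first in simp)
   have bound: "\<bar>S (\<xi> n) om\<bar> \<le> \<rho>" for n
   proof -
    have "\<rho> / 2 * (1 - r ^ n) \<le> \<rho> / 2 * 1" using \<rho> r by (intro mult_left_mono) auto
    thus ?thesis using partial[of n] by linarith
   qed
   \<comment> \<open>Continuity in the parameter transfers the bound from the nets to the point
     itself.\<close>
   have "\<xi> \<longlonglongrightarrow> p"
   proof (rule metric_LIMSEQ_I)
    fix e :: real assume "0 < e"
    then obtain n0 where n0: "(1/2) ^ n0 < e" using real_arch_pow_inv[of e "1/2"] by auto
    have "dist (\<xi> n) p < e" if "n \<ge> n0" for n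
    proof -
     have "dist (\<xi> n) p \<le> (1/2) ^ n" using \<xi>(2) by (simp only: dist_commute)
     also have "(1/2::real) ^ n \<le> (1/2) ^ n0" using that by (intro power_decreasing) auto
     also note n0
     finally show ?thesis .
    qed
    thus "\<exists>no. \<forall>n\<ge>no. dist (\<xi> n) p < e" by blast
   qed
   moreover have "om \<in> space M" using om sets.sets_into_space[OF G] by blast
   ultimately have "(\<lambda>n. S (\<xi> n) om) \<longlonglongrightarrow> S p om"
    using cont[unfolded continuous_on_sequentially] p NK[OF \<xi>(1)] by (auto simp: comp_def)
   hence "(\<lambda>n. \<bar>S (\<xi> n) om\<bar>) \<longlonglongrightarrow> \<bar>S p om\<bar>" by (rule tendsto_rabs)
   thus "\<bar>S p om\<bar> \<le> \<rho>" by (rule LIMSEQ_le_const2) (use bound in auto)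
  qed
 qed
qed

section \<open>The martingale part\<close>

context sampled_diffusion
begin

text \<open>Chaining over the parameter makes the law of large numbers for the martingale part uniform on compact sets.\<close>

lemma whp_martingale:
 fixes h :: "'e::euclidean_space \<Rightarrow> real^'d \<Rightarrow> real^'d"
 assumes K: "bounded K" and \<nu>: "0 < \<nu>" and C: "0 < C" and q: "0 \<le> q"
  and h_cont: "\<And>p. p \<in> K \<Longrightarrow> continuous_on UNIV (h p)"
  and h_bound: "\<And>p x. p \<in> K \<Longrightarrow> norm (h p x) \<le> C * V x powr q"
  and h_holder: "\<And>p p' x. p \<in> K \<Longrightarrow> p' \<in> K \<Longrightarrow> norm (h p x - h p' x) \<le> C * V x powr q * dist p p' powr \<nu>"
  and \<rho>: "0 < \<eta>"
 shows "whp (at_right 0) (\<lambda>eps om. \<forall>p\<in>K. eps * \<bar>\<Sum>i<m eps. h p (obs eps i om) \<bullet> (I (real (Suc i) * \<Delta> eps) om - I (real i * \<Delta> eps) om)\<bar> \<le> \<eta>)"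
 unfolding whp_def
proof (intro allI impI)
 fix \<delta> :: real assume \<delta>: "0 < \<delta>"
 obtain \<kappa> where \<kappa>: "0 < \<kappa>" and chain: "\<And>S G \<tau> \<rho>. (\<And>p. p \<in> K \<Longrightarrow> S p \<in> borel_measurable M) \<Longrightarrow> G \<in> sets M \<Longrightarrow>
  (\<And>om. om \<in> space M \<Longrightarrow> continuous_on K (\<lambda>p. S p om)) \<Longrightarrow> 0 < \<tau> \<Longrightarrow> 0 < \<rho> \<Longrightarrow> \<tau> \<le> \<rho>^2 \<Longrightarrow>
  (\<And>p p' a d. p \<in> K \<Longrightarrow> p' \<in> K \<Longrightarrow> 0 < a \<Longrightarrow> 0 < d \<Longrightarrow> dist p p' \<le> d \<Longrightarrow>
    prob {om \<in> G. a \<le> \<bar>S p om - S p' om\<bar>} \<le> 2 * exp (- (a^2 / (\<tau> * d powr (2 * \<nu>))))) \<Longrightarrow>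
  (\<And>p a. p \<in> K \<Longrightarrow> 0 < a \<Longrightarrow> prob {om \<in> G. a \<le> \<bar>S p om\<bar>} \<le> 2 * exp (- (a^2 / \<tau>))) \<Longrightarrow>
  \<exists>A\<in>sets M. prob A \<le> \<kappa> * (\<tau> / \<rho>^2) \<and> (\<forall>om\<in>G - A. \<forall>p\<in>K. \<bar>S p om\<bar> \<le> \<rho>)"
  by (rule chaining[OF K \<nu>]) blast
 \<comment> \<open>Large enough to dominate both squares produced by separating the product
   \<open>?w\<close> into a function of \<open>x\<close> and one of \<open>y\<close>.\<close>
 define p0 where "p0 = 2 * (2 * q + q\<beta>)"
 have p0: "0 \<le> p0" using q q\<beta> by (simp add: p0_def)
 let ?w = "\<lambda>x y. V x powr (2 * q) * V y powr q\<beta>"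
 have w: "cont2 ?w" by (intro continuous_on_mult cont_fst cont_snd V_powr_cont)
 have w_le: "?w x y \<le> 0 + 0 * (norm (y - x))^2 + 1 * (V x powr p0 + V y powr p0)" for x y
 proof -
  have "2 * V x powr (2 * q) * V y powr q\<beta> \<le> (V x powr (2 * q))^2 + (V y powr q\<beta>)^2" by (rule sum_squares_bound)
  also have "... = V x powr (2 * (2 * q)) + V y powr (2 * q\<beta>)" by (simp add: power2_eq_square powr_add[symmetric])
  also have "... \<le> V x powr p0 + V y powr p0" using q q\<beta> by (intro add_mono V_powr_mono) (auto simp: p0_def)
  finally have "2 * ?w x y \<le> V x powr p0 + V y powr p0" by (simp only: mult.assoc)
  from order_trans[OF _ this, of "?w x y"] show ?thesis by simp
 qed
 obtain B where B: "0 \<le> B" "\<And>n d. 0 < d \<Longrightarrow> d \<le> 1 \<Longrightarrow> EE M (KA n d ?w) \<le> ennreal (B * (1 + real n * d))"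
 proof (rule kernel_average[OF p0])
  fix B :: real
  assume B: "0 \<le> B" "\<And>h \<kappa> A B' n d. cont2 h \<Longrightarrow> 0 \<le> \<kappa> \<Longrightarrow> 0 \<le> A \<Longrightarrow> 0 \<le> B' \<Longrightarrow>
   (\<And>x y. h x y \<le> \<kappa> + A * (norm (y - x))^2 + B' * (V x powr p0 + V y powr p0)) \<Longrightarrow> 0 < d \<Longrightarrow> d \<le> 1 \<Longrightarrow>
   EE M (KA n d h) \<le> ennreal (\<kappa> * (real n * d) + (A * d + B') * (B * (1 + real n * d)))"
  show thesis by (rule that[OF B(1)]) (use B(2)[OF w order_refl order_refl zero_le_one w_le] in simp)
 qed
 \<comment> \<open>At this level Markov's inequality gives the event that the weight sum exceeds
   \<open>R * T\<close> probability at most \<open>\<delta> / 2\<close>.\<close>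
 define R where "R = 4 * B / \<delta> + 1"
 have R: "0 < R" using B \<delta> by (simp add: R_def add_nonneg_pos)
 \<comment> \<open>The 2 stems from the sub-Gaussian exponent; \<open>C\<beta> + 1\<close> instead
   of \<open>C\<beta>\<close> keeps the variance bound positive.\<close>
 define \<tau>0 where "\<tau>0 = 2 * C^2 * (C\<beta> + 1) * R"
 have \<tau>0: "0 < \<tau>0" using C C\<beta> R by (auto simp: \<tau>0_def intro!: mult_pos_pos)
 \<comment> \<open>Beyond this horizon \<open>chaining\<close> is applicable with threshold
   \<open>\<eta> * T\<close>, and its exceptional set has probability at most
   \<open>\<delta> / 2\<close>.\<close>
 define T0 where "T0 = Max {1, \<tau>0 / \<eta>^2, 2 * \<kappa> * \<tau>0 / (\<delta> * \<eta>^2)}"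
 show "\<forall>\<^sub>F eps in at_right 0. \<exists>A\<in>events. prob A \<le> \<delta> \<and> (\<forall>om\<in>space M - A. \<forall>p\<in>K.
  eps * \<bar>\<Sum>i<m eps. h p (obs eps i om) \<bullet> (I (real (Suc i) * \<Delta> eps) om - I (real i * \<Delta> eps) om)\<bar> \<le> \<eta>)"
  using eventually_mesh[OF zero_less_one, of T0]
 proof eventually_elim
  case (elim eps)
  define n d where "n = m eps" and "d = \<Delta> eps"
  have d: "0 < d" "d \<le> 1" and "T0 \<le> real n * d" using elim by (auto simp: n_def d_def)
  define T where "T = real n * d"
  have "1 \<le> T0" "\<tau>0 / \<eta>^2 \<le> T0" "2 * \<kappa> * \<tau>0 / (\<delta> * \<eta>^2) \<le> T0" by (simp_all add: T0_def)
  hence T: "1 \<le> T" "\<tau>0 / \<eta>^2 \<le> T" "2 * \<kappa> * \<tau>0 / (\<delta> * \<eta>^2) \<le> T" 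
   using \<open>T0 \<le> real n * d\<close> unfolding T_def by (meson order_trans)+
  let ?a = "\<lambda>i. real i * d"
  have a: "0 \<le> ?a i" "?a i \<le> ?a (Suc i)" for i using d by (auto simp: mult_right_mono)
  let ?Z = "\<lambda>f om. \<Sum>i<n. f (X (?a i) om) \<bullet> (I (?a (Suc i)) om - I (?a i) om)"
  let ?S = "\<lambda>p. ?Z (h p)"
  let ?k = "\<lambda>i om. LBINT s:cell d i. V (X (?a i) om) powr (2 * q) * V (X s om) powr q\<beta>"
  let ?Q = "KA n d ?w"
  have Q_eq: "?Q om = (\<Sum>i<n. ?k i om)" for om by (simp add: KA_def)
  have Q_meas: "?Q \<in> borel_measurable M" using d by (intro KA_meas w) simp
  define G where "G = {om \<in> space M. ?Q om < R * T}"
  have G: "G \<in> sets M" unfolding G_def using Q_meas by measurable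
  \<comment> \<open>The scale \<open>w\<close> lets one estimate serve single weights, with
    \<open>w = 1\<close>, and differences of weights, with \<open>w\<close> a power of the distance
    of the parameters. On \<open>G\<close> the quadratic variation has a deterministic
    bound.\<close>
  have tail: "prob {om \<in> G. b \<le> \<bar>?Z f om\<bar>} \<le> 2 * exp (- (b^2 / (\<tau>0 * T * w^2)))"
   if f: "continuous_on UNIV f" "\<And>x. norm (f x) \<le> C * V x powr q * w" and b: "0 < b" and w: "0 < w" for f b w
  proof -
   let ?u = "\<lambda>i om. f (X (?a i) om)"
   let ?Y = "\<lambda>om. \<Sum>i<n. ito_sum ?a ?u (\<lambda>_ _. 0) i om" and ?QV = "\<lambda>om. \<Sum>i<n. ito_QV ?a ?u (\<lambda>_ _. 0) i om"
   have u: "?u i \<in> borel_measurable (\<F> (?a i))" for i by (rule X_comp_adapted[OF f(1) a(1)])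
   have QV_le: "ito_QV ?a ?u (\<lambda>_ _. 0) i om \<le> C^2 * w^2 * (C\<beta> + 1) * ?k i om" if om: "om \<in> space M" for i om
   proof -
    have f2: "(norm (f x))^2 \<le> C^2 * w^2 * V x powr (2 * q)" for x
    proof -
     have "(norm (f x))^2 \<le> (C * V x powr q * w)^2" using f(2) by (rule power_mono) simp
     thus ?thesis by (simp add: power_mult_distrib power2_eq_square powr_add[symmetric] mult_ac)
    qed
    have "ito_QV ?a ?u (\<lambda>_ _. 0) i om = (LBINT s:cell d i. (norm (transpose (\<rho> (X s om)) *v f (X (?a i) om)))^2)"
     by (simp only: ito_QV_def QV_def add_0_right)
    also have "... \<le> (LBINT s:cell d i. C^2 * w^2 * (C\<beta> + 1) * (V (X (?a i) om) powr (2 * q) * V (X s om) powr q\<beta>))"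
    proof (rule set_integral_mono)
     show "set_integrable lborel (cell d i) (\<lambda>s. (norm (transpose (\<rho> (X s om)) *v f (X (?a i) om)))^2)"
      by (intro borel_integrable_atLeastAtMost' continuous_on_power continuous_on_norm continuous_on_matrix_vector_mult
         continuous_on_transpose continuous_on_const path_cont[OF \<rho>_cont om a(1)])
     show "set_integrable lborel (cell d i) (\<lambda>s. C^2 * w^2 * (C\<beta> + 1) * (V (X (?a i) om) powr (2 * q) * V (X s om) powr q\<beta>))"
      by (intro borel_integrable_atLeastAtMost' continuous_on_mult continuous_on_const path_cont[OF V_powr_cont om a(1)])
     fix s
     let ?x = "X (?a i) om" and ?y = "X s om"
     have "(norm (transpose (\<rho> ?y) *v f ?x))^2 \<le> (norm (\<rho> ?y) * norm (f ?x))^2" by (rule power_mono[OF norm_transpose_mult_le]) simp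
     also have "... = (norm (f ?x))^2 * (norm (\<rho> ?y))^2" by (simp add: power_mult_distrib)
     also have "... \<le> (C^2 * w^2 * V ?x powr (2 * q)) * ((C\<beta> + 1) * V ?y powr q\<beta>)"
     proof (intro mult_mono f2)
      have "(norm (\<rho> ?y))^2 \<le> C\<beta> * V ?y powr q\<beta>" using growth[of ?y] zero_le_power2[of "norm (\<beta> ?y)"] by linarith
      also have "... \<le> (C\<beta> + 1) * V ?y powr q\<beta>" by (intro mult_right_mono) auto
      finally show "(norm (\<rho> ?y))^2 \<le> (C\<beta> + 1) * V ?y powr q\<beta>" .
     qed (use C w in auto)
     finally show "(norm (transpose (\<rho> ?y) *v f ?x))^2 \<le> C^2 * w^2 * (C\<beta> + 1) * (V ?x powr (2 * q) * V ?y powr q\<beta>)"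
      by (simp only: mult_ac)
    qed
    also have "... = C^2 * w^2 * (C\<beta> + 1) * ?k i om" by (rule set_integral_mult_right)
    finally show ?thesis .
   qed
   have sum_eq: "?Y om = ?Z f om" for om by (simp add: ito_sum_def)
   define v where "v = C^2 * w^2 * (C\<beta> + 1) * (R * T)"
   let ?L = "{om \<in> G. b \<le> \<bar>?Z f om\<bar>}" and ?R = "{om \<in> space M. b \<le> \<bar>?Y om\<bar> \<and> ?QV om \<le> v}"
   have v: "0 < v" using C w C\<beta> R T by (auto simp: v_def intro!: mult_pos_pos)
   have pos: "0 \<le> ?a 0" "\<And>i. i < n \<Longrightarrow> ?a i \<le> ?a (Suc i)" using a by auto
   have "prob ?L \<le> prob ?R"
   proof (rule finite_measure_mono)
    show "?L \<subseteq> ?R"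
    proof
     fix om assume "om \<in> ?L"
     hence om: "om \<in> space M" "?Q om < R * T" and b': "b \<le> \<bar>?Z f om\<bar>" unfolding G_def by blast+
     have "?QV om \<le> (\<Sum>i<n. C^2 * w^2 * (C\<beta> + 1) * ?k i om)" by (intro sum_mono QV_le om)
     also have "... = C^2 * w^2 * (C\<beta> + 1) * ?Q om" unfolding Q_eq by (rule sum_distrib_left[symmetric])
     also have "... \<le> v" unfolding v_def using om(2) C\<beta> by (intro mult_left_mono) auto
     finally show "om \<in> ?R" using om(1) b' unfolding sum_eq by blast
    qed
    have m1: "?Y \<in> borel_measurable M"
     "?QV \<in> borel_measurable M" by (rule ito_sums_meas[OF pos u borel_measurable_const]; assumption)+
    thus "?R \<in> sets M" by measurable
   qed
   also have "... \<le> 2 * exp (- (b^2 / (2 * v)))" by (rule ito_tail[OF pos u borel_measurable_const b v])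
   also have "2 * v = \<tau>0 * T * w^2" by (simp add: v_def \<tau>0_def)
   finally show ?thesis .
  qed
  have "\<exists>A\<in>sets M. prob A \<le> \<kappa> * (\<tau>0 * T / (\<eta> * T)^2) \<and> (\<forall>om\<in>G - A. \<forall>p\<in>K. \<bar>?S p om\<bar> \<le> \<eta> * T)"
  proof (rule chain[OF _ G])
   show "?S p \<in> borel_measurable M" if "p \<in> K" for p
    by (intro borel_measurable_sum borel_measurable_inner borel_measurable_diff X_comp_meas h_cont that I_meas a)
   show "0 < \<tau>0 * T" "0 < \<eta> * T" using \<tau>0 T \<rho> by auto
   have "\<tau>0 \<le> \<eta>^2 * T" using T \<rho> by (simp add: field_simps)
   hence "\<tau>0 * T \<le> (\<eta>^2 * T) * T" using T by (intro mult_right_mono) auto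
   thus "\<tau>0 * T \<le> (\<eta> * T)^2" by (simp add: power2_eq_square mult_ac)
   show "continuous_on K (\<lambda>p. ?S p om)" if om: "om \<in> space M" for om
   proof -
    have "continuous_on K (\<lambda>p. h p x)" for x by (rule continuous_on_holder[OF \<nu> h_holder[folded dist_norm]])
    thus ?thesis by (intro continuous_on_sum continuous_on_inner continuous_on_const)
   qed
   show "prob {om \<in> G. b \<le> \<bar>?S p om - ?S p' om\<bar>} \<le> 2 * exp (- (b^2 / (\<tau>0 * T * e powr (2 * \<nu>))))"
    if pp: "p \<in> K" "p' \<in> K" and b: "0 < b" and e: "0 < e" "dist p p' \<le> e" for p p' b e
   proof -
    have eq: "?S p om - ?S p' om = ?Z (\<lambda>x. h p x - h p' x) om" for om by (simp only: sum_subtractf[symmetric] inner_diff_left)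
    have e2: "(e powr \<nu>)^2 = e powr (2 * \<nu>)" by (simp add: power2_eq_square powr_add[symmetric])
    have "prob {om \<in> G. b \<le> \<bar>?Z (\<lambda>x. h p x - h p' x) om\<bar>} \<le> 2 * exp (- (b^2 / (\<tau>0 * T * (e powr \<nu>)^2)))"
    proof (rule tail[OF _ _ b])
     show "continuous_on UNIV (\<lambda>x. h p x - h p' x)" by (intro continuous_on_diff h_cont pp)
     fix x
     have "norm (h p x - h p' x) \<le> C * V x powr q * dist p p' powr \<nu>" by (rule h_holder[OF pp])
     also have "... \<le> C * V x powr q * e powr \<nu>" using C e \<nu> by (intro mult_left_mono powr_mono2) auto
     finally show "norm (h p x - h p' x) \<le> C * V x powr q * e powr \<nu>" .
    qed (use e in simp)
    thus ?thesis unfolding eq e2 .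
   qed
   show "prob {om \<in> G. b \<le> \<bar>?S p om\<bar>} \<le> 2 * exp (- (b^2 / (\<tau>0 * T)))" if "p \<in> K" "0 < b" for p b
    using tail[OF h_cont[OF that(1)] _ that(2), of 1] h_bound[OF that(1)] by simp
  qed
  then obtain A where A: "A \<in> sets M" "prob A \<le> \<kappa> * (\<tau>0 * T / (\<eta> * T)^2)" "\<And>om p. om \<in> G - A \<Longrightarrow> p \<in> K \<Longrightarrow> \<bar>?S p om\<bar> \<le> \<eta> * T"
   by blast
  define Gc where "Gc = {om \<in> space M. R * T \<le> ?Q om}"
  have Gc: "Gc \<in> sets M" unfolding Gc_def using Q_meas by measurable
  show ?case
  proof (intro bexI conjI ballI)
   show "A \<union> Gc \<in> sets M" using A(1) Gc by blast
   have "prob A \<le> \<delta> / 2"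
   proof -
    have "\<kappa> * (\<tau>0 * T / (\<eta> * T)^2) = \<kappa> * \<tau>0 / (\<eta>^2 * T)" using T by (simp add: power2_eq_square)
    also have "... \<le> \<delta> / 2"
    proof -
     have "2 * \<kappa> * \<tau>0 \<le> T * (\<delta> * \<eta>^2)" using T(3) \<delta> \<rho> by (simp add: pos_divide_le_eq)
     moreover have "0 < \<eta>^2 * T" using T \<rho> by simp
     ultimately show ?thesis by (simp add: pos_divide_le_eq) (simp add: mult_ac)
    qed
    finally show ?thesis using A(2) by linarith
   qed
   moreover have "prob Gc \<le> \<delta> / 2"
   proof -
    have "prob Gc \<le> B * (1 + T) / (R * T)" unfolding Gc_def using B(1) R T B(2)[OF d, of n]
     by (intro prob_le_of_nn_integral[OF Q_meas] KA_nonneg) (auto simp: T_def)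
    also have "... \<le> \<delta> / 2"
    proof -
     have "B * (1 + T) \<le> B * (2 * T)" using B T by (intro mult_left_mono) auto
     also have "... \<le> \<delta> / 2 * (R * T)"
     proof -
      have "4 * B \<le> \<delta> * R" using \<delta> by (simp add: R_def field_simps)
      hence "(4 * B) * T \<le> (\<delta> * R) * T" using T by (intro mult_right_mono) auto
      thus ?thesis by (simp add: mult_ac)
     qed
     finally show ?thesis using R T by (simp add: pos_divide_le_eq)
    qed
    finally show ?thesis .
   qed
   ultimately show "prob (A \<union> Gc) \<le> \<delta>" using measure_Un_le[OF A(1) Gc] by linarith
   fix om p assume om: "om \<in> space M - (A \<union> Gc)" and p: "p \<in> K"
   hence "om \<in> G - A" unfolding G_def Gc_def by (simp add: not_le)
   from mult_left_mono[OF A(3)[OF this p], of eps] elim horizon[of eps]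
   show "eps * \<bar>\<Sum>i<m eps. h p (obs eps i om) \<bullet> (I (real (Suc i) * \<Delta> eps) om - I (real i * \<Delta> eps) om)\<bar> \<le> \<eta>"
    by (simp add: T_def n_def d_def del: of_nat_Suc)
  qed
 qed
qed

end

section \<open>The contrast function and its uniform limit\<close>

text \<open>Different exponents and constants are brought to a common form; lowering the exponent of
  a distance bounded by \<open>D\<close> costs at most a factor \<open>D\<close>.\<close>

lemma holder_weaken:
 fixes d :: real
 assumes z: "z \<le> C1 * v powr q1 * d powr \<nu>1" and d: "0 \<le> d" "d \<le> D" and D: "1 \<le> D" and \<nu>: "\<nu> \<le> \<nu>1" "0 < \<nu>" "\<nu>1 \<le> 1"
  and v: "1 \<le> v" and q: "q1 \<le> q" and C: "\<bar>C1\<bar> * D \<le> C"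
 shows "z \<le> C * v powr q * d powr \<nu>"
proof -
 have dd: "d powr \<nu>1 \<le> D * d powr \<nu>"
 proof -
  have "d powr \<nu>1 = d powr (\<nu>1 - \<nu>) * d powr \<nu>" by (simp add: powr_add[symmetric])
  also have "d powr (\<nu>1 - \<nu>) \<le> D powr (\<nu>1 - \<nu>)" using d \<nu> by (intro powr_mono2) auto
  also have "D powr (\<nu>1 - \<nu>) \<le> D powr 1" using D \<nu> by (intro powr_mono) auto
  finally show ?thesis using D by (simp add: mult_right_mono)
 qed
 have vv: "v powr q1 \<le> v powr q" using v q by (intro powr_mono)
 have "z \<le> \<bar>C1\<bar> * v powr q1 * d powr \<nu>1" using z by (rule order_trans) (intro mult_right_mono abs_ge_self, auto)
 also have "... \<le> \<bar>C1\<bar> * v powr q * (D * d powr \<nu>)" using dd vv by (intro mult_mono mult_left_mono) auto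
 also have "... = (\<bar>C1\<bar> * D) * (v powr q * d powr \<nu>)" by simp
 also have "... \<le> C * (v powr q * d powr \<nu>)" using C by (intro mult_right_mono) auto
 finally show ?thesis by simp
qed

lemma growth_weaken:
 fixes z :: real
 assumes "z \<le> C1 * v powr q1" "1 \<le> v" "q1 \<le> q" "\<bar>C1\<bar> \<le> C"
 shows "z \<le> C * v powr q"
proof (rule order_trans[OF assms(1)])
 have "C1 * v powr q1 \<le> \<bar>C1\<bar> * v powr q" using assms by (intro mult_mono powr_mono) auto
 also have "... \<le> C * v powr q" using assms by (intro mult_right_mono) auto
 finally show "C1 * v powr q1 \<le> C * v powr q" .
qed

lemma norm_matrix_vector_diff_le:
 fixes A A' :: "real^'n^'m"
 shows "norm (A *v v - A' *v v') \<le> norm (A - A') * norm v + norm A' * norm (v - v')"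
proof -
 have "A *v v - A' *v v' = (A - A') *v v + A' *v (v - v')" by (simp add: matrix_vector_mult_diff_distrib matrix_vector_mult_diff_rdistrib)
 thus ?thesis
  using norm_triangle_ineq[of "(A - A') *v v" "A' *v (v - v')"] norm_matrix_vector_mult_le[of "A - A'" v] norm_matrix_vector_mult_le[of A' "v - v'"]
  by simp
qed

lemma inner_diff_le:
 fixes u u' :: "'a::real_inner"
 shows "\<bar>u \<bullet> v - u' \<bullet> v'\<bar> \<le> norm (u - u') * norm v + norm u' * norm (v - v')"
proof -
 have "u \<bullet> v - u' \<bullet> v' = (u - u') \<bullet> v + u' \<bullet> (v - v')" by (simp add: inner_diff_left inner_diff_right)
 thus ?thesis using Cauchy_Schwarz_ineq2[of "u - u'" v] Cauchy_Schwarz_ineq2[of u' "v - v'"] by linarith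
qed

text \<open>\<open>nbhd\<close> and \<open>vshat_SS\<close> state what the open and the closed case
  for \<open>SS\<close> have in common, so the distinction disappears from here on.\<close>

locale contrast = sampled_diffusion M \<F> W X "b \<mu>0" \<rho> I V x0 C\<beta> q\<beta> \<pi> \<Delta> m
 for M :: "'w measure" and \<F> and W :: "real \<Rightarrow> 'w \<Rightarrow> real^'d" and X
  and b :: "'m::euclidean_space \<Rightarrow> real^'d \<Rightarrow> real^'d" and \<mu>0 \<rho> I V x0 C\<beta> q\<beta> \<pi> \<Delta> m +
 fixes MM :: "'m set" and SS :: "'s::euclidean_space set" and ainv :: "'s \<Rightarrow> real^'d \<Rightarrow> real^'d^'d"
  and vs0 :: 's and vshat :: "real \<Rightarrow> 'w \<Rightarrow> 's"
 assumes \<mu>0: "\<mu>0 \<in> MM" and vs0: "vs0 \<in> SS"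
  and b_cont: "\<And>\<mu>. \<mu> \<in> MM \<Longrightarrow> continuous_on UNIV (b \<mu>)"
  and ainv_cont: "\<And>vs. vs \<in> SS \<Longrightarrow> continuous_on UNIV (ainv vs)"
  and ainv_sym: "\<And>x. transpose (ainv vs0 x) = ainv vs0 x"
  and b_growth: "\<And>K. compact K \<Longrightarrow> K \<subseteq> MM \<Longrightarrow> \<exists>C q. 0 \<le> q \<and> (\<forall>\<mu>\<in>K. \<forall>x. norm (b \<mu> x) \<le> C * V x powr q)"
  and ainv_growth: "\<And>L. compact L \<Longrightarrow> L \<subseteq> SS \<Longrightarrow> \<exists>C q. 0 \<le> q \<and> (\<forall>vs\<in>L. \<forall>x. norm (ainv vs x) \<le> C * V x powr q)"
  and b_holder: "local_holder_cond MM V b" and ainv_holder: "local_holder_cond SS V ainv"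
  and nbhd: "\<exists>r>0. compact (cball vs0 r \<inter> SS)"
  and vshat_SS: "whp (at_right 0) (\<lambda>eps om. vshat eps om \<in> SS)"
  and vshat_cons: "\<And>r. 0 < r \<Longrightarrow> whp (at_right 0) (\<lambda>eps om. dist (vshat eps om) vs0 \<le> r)"
begin

definition "hh p x = ainv (snd p) x *v b (fst p) x"
text \<open>The limiting integrand of minus the likelihood per unit of time: half the quadratic term
  minus the linear term, in which the increment is replaced by the true drift.\<close>

definition "gg p x = hh p x \<bullet> ((1/2) *\<^sub>R b (fst p) x - b \<mu>0 x)"
abbreviation "LB \<equiv> Lambda_bar b ainv \<pi> \<mu>0 vs0"
abbreviation "drift eps i om \<equiv> LBINT s:cell (\<Delta> eps) i. b \<mu>0 (X s om) - b \<mu>0 (obs eps i om)"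
abbreviation "noise eps i om \<equiv> I (real (Suc i) * \<Delta> eps) om - I (real i * \<Delta> eps) om"
definition "crit eps vs \<mu> om = - eps * loglik b ainv (m eps) (\<Delta> eps) \<mu> vs (\<lambda>i. obs eps i om)"
abbreviation "obj \<gamma> eps \<mu> om \<equiv> crit eps (vshat eps om) \<mu> om + \<gamma> eps \<mu>"
definition "Lam \<mu> = (\<integral>x. gg (\<mu>, vs0) x \<partial>\<pi>)"

lemma hh_cont: "\<mu> \<in> MM \<Longrightarrow> vs \<in> SS \<Longrightarrow> continuous_on UNIV (hh (\<mu>, vs))"
 unfolding hh_def by (simp add: continuous_on_matrix_vector_mult b_cont ainv_cont)

lemma gg_cont: "\<mu> \<in> MM \<Longrightarrow> vs \<in> SS \<Longrightarrow> continuous_on UNIV (gg (\<mu>, vs))"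
 unfolding gg_def by (intro continuous_on_inner hh_cont continuous_on_diff continuous_on_scaleR continuous_on_const) (auto intro: b_cont \<mu>0)

text \<open>At most three factors of growth \<open>v x\<close> occur in a product, whence the cubes
  and the exponent \<open>3 * q\<close>. Since \<open>v x\<close> is at least 1, lower powers are
  absorbed.\<close>

lemma param_bounds:
 assumes K: "compact K" "K \<subseteq> MM" and L: "compact L" "L \<subseteq> SS"
 obtains C q \<nu> where "0 < C" "0 \<le> q" "0 < \<nu>"
  "\<And>p x. p \<in> K \<times> L \<Longrightarrow> norm (hh p x) \<le> C * V x powr q"
  "\<And>p p' x. p \<in> K \<times> L \<Longrightarrow> p' \<in> K \<times> L \<Longrightarrow> norm (hh p x - hh p' x) \<le> C * V x powr q * dist p p' powr \<nu>"
  "\<And>p x. p \<in> K \<times> L \<Longrightarrow> \<bar>gg p x\<bar> \<le> C * V x powr q"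
  "\<And>p p' x. p \<in> K \<times> L \<Longrightarrow> p' \<in> K \<times> L \<Longrightarrow> \<bar>gg p x - gg p' x\<bar> \<le> C * V x powr q * dist p p' powr \<nu>"
  "\<And>x. norm (b \<mu>0 x) \<le> C * V x powr q"
proof -
 \<comment> \<open>The growth bound must also cover the true drift, whether or not its parameter
   lies in \<open>K\<close>.\<close>
 have K': "compact (insert \<mu>0 K)" "insert \<mu>0 K \<subseteq> MM" using K \<mu>0 by (auto intro: compact_insert)
 obtain C1 q1 where 1: "0 \<le> q1" "\<And>\<mu> x. \<mu> \<in> insert \<mu>0 K \<Longrightarrow> norm (b \<mu> x) \<le> C1 * V x powr q1"
  using b_growth[OF K'] by blast
 obtain C2 q2 where 2: "0 \<le> q2" "\<And>vs x. vs \<in> L \<Longrightarrow> norm (ainv vs x) \<le> C2 * V x powr q2"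
  using ainv_growth[OF L] by blast
 obtain C3 \<nu>3 q3 where 3: "0 < \<nu>3" "\<nu>3 \<le> 1" "0 \<le> q3"
  "\<And>\<mu> \<mu>' x. \<mu> \<in> K \<Longrightarrow> \<mu>' \<in> K \<Longrightarrow> norm (b \<mu> x - b \<mu>' x) \<le> C3 * V x powr q3 * norm (\<mu> - \<mu>') powr \<nu>3"
  using b_holder K unfolding local_holder_cond_def by meson
 obtain C4 \<nu>4 q4 where 4: "0 < \<nu>4" "\<nu>4 \<le> 1" "0 \<le> q4"
  "\<And>vs vs' x. vs \<in> L \<Longrightarrow> vs' \<in> L \<Longrightarrow> norm (ainv vs x - ainv vs' x) \<le> C4 * V x powr q4 * norm (vs - vs') powr \<nu>4"
  using ainv_holder L unfolding local_holder_cond_def by meson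
 obtain B1 where B1: "0 < B1" "\<And>\<mu>. \<mu> \<in> K \<Longrightarrow> norm \<mu> \<le> B1" using compact_imp_bounded[OF K(1)] bounded_pos by blast
 obtain B2 where B2: "0 < B2" "\<And>vs. vs \<in> L \<Longrightarrow> norm vs \<le> B2" using compact_imp_bounded[OF L(1)] bounded_pos by blast
 \<comment> \<open>An upper bound for distances within both compact sets.\<close>
 define D where "D = 1 + 2 * B1 + 2 * B2"
 have D: "1 \<le> D" using B1 B2 by (simp add: D_def)
 define q where "q = Max {q1, q2, q3, q4}"
 have q: "q1 \<le> q" "q2 \<le> q" "q3 \<le> q" "q4 \<le> q" "0 \<le> q" using 1(1) by (auto simp: q_def le_max_iff_disj)
 define C where "C = 1 + \<bar>C1\<bar> + \<bar>C2\<bar> + \<bar>C3\<bar> * D + \<bar>C4\<bar> * D"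
 have C: "1 \<le> C" "\<bar>C1\<bar> \<le> C" "\<bar>C2\<bar> \<le> C" "\<bar>C3\<bar> * D \<le> C" "\<bar>C4\<bar> * D \<le> C" using D by (auto simp: C_def)
 define \<nu> where "\<nu> = min \<nu>3 \<nu>4"
 have \<nu>: "0 < \<nu>" "\<nu> \<le> \<nu>3" "\<nu> \<le> \<nu>4" using 3 4 by (auto simp: \<nu>_def)
 have bb: "norm (b \<mu> x) \<le> C * V x powr q" if "\<mu> \<in> insert \<mu>0 K" for \<mu> x
  by (rule growth_weaken[OF 1(2)[OF that] V_ge_1 q(1) C(2)])
 have aa: "norm (ainv vs x) \<le> C * V x powr q" if "vs \<in> L" for vs x by (rule growth_weaken[OF 2(2)[OF that] V_ge_1 q(2) C(3)])
 have bd: "norm (b \<mu> x - b \<mu>' x) \<le> C * V x powr q * norm (\<mu> - \<mu>') powr \<nu>" if "\<mu> \<in> K" "\<mu>' \<in> K" for \<mu> \<mu>' x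
 proof (rule holder_weaken[OF 3(4)[OF that] _ _ D \<nu>(2,1) 3(2) V_ge_1 q(3) C(4)])
  show "norm (\<mu> - \<mu>') \<le> D" using norm_triangle_ineq4[of \<mu> \<mu>'] B1(2)[OF that(1)] B1(2)[OF that(2)] B2(1) unfolding D_def by linarith
 qed simp
 have ad: "norm (ainv vs x - ainv vs' x) \<le> C * V x powr q * norm (vs - vs') powr \<nu>" if "vs \<in> L" "vs' \<in> L" for vs vs' x
 proof (rule holder_weaken[OF 4(4)[OF that] _ _ D \<nu>(3,1) 4(2) V_ge_1 q(4) C(5)])
  show "norm (vs - vs') \<le> D" using norm_triangle_ineq4[of vs vs'] B2(2)[OF that(1)] B2(2)[OF that(2)] B1(1) unfolding D_def by linarith
 qed simp
 define v where "v x = C * V x powr q" for x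
 have v: "1 \<le> v x" for x unfolding v_def using mult_mono[OF C(1) V_powr_ge_1[OF q(5), of x]] C by simp
 have v_nn: "0 \<le> v x" for x using v[of x] by linarith
 have v_pow: "v x ^ 2 \<le> v x ^ 3" "v x \<le> v x ^ 3" for x using v[of x] power_increasing[of 2 3 "v x"] power_increasing[of 1 3 "v x"] by auto
 have v3: "4 * v x ^ 3 = 4 * C ^ 3 * V x powr (3 * q)" for x
  by (simp add: v_def power_mult_distrib powr_powr powr_realpow[symmetric] mult.commute V_pos less_imp_neq[symmetric] powr_power)
 define d where "d p p' = dist p p' powr \<nu>" for p p' :: "'m \<times> 's"
 have d_nn: "0 \<le> d p p'" for p p' by (simp add: d_def)
 have b_d: "norm (b (fst p) x - b (fst p') x) \<le> v x * d p p'" if "p \<in> K \<times> L" "p' \<in> K \<times> L" for p p' x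
 proof -
  have "norm (b (fst p) x - b (fst p') x) \<le> v x * norm (fst p - fst p') powr \<nu>" unfolding v_def using that by (intro bd) auto
  also have "... \<le> v x * d p p'"
   unfolding d_def using dist_fst_le[of p p'] \<nu> v_nn by (intro mult_left_mono powr_mono2) (auto simp: dist_norm)
  finally show ?thesis .
 qed
 have a_d: "norm (ainv (snd p) x - ainv (snd p') x) \<le> v x * d p p'" if "p \<in> K \<times> L" "p' \<in> K \<times> L" for p p' x
 proof -
  have "norm (ainv (snd p) x - ainv (snd p') x) \<le> v x * norm (snd p - snd p') powr \<nu>" unfolding v_def using that by (intro ad) auto
  also have "... \<le> v x * d p p'"
   unfolding d_def using dist_snd_le[of p p'] \<nu> v_nn by (intro mult_left_mono powr_mono2) (auto simp: dist_norm)
  finally show ?thesis .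
 qed
 have b_v: "norm (b (fst p) x) \<le> v x" if "p \<in> K \<times> L" for p x unfolding v_def using that by (intro bb) auto
 have b0_v: "norm (b \<mu>0 x) \<le> v x" for x unfolding v_def by (intro bb) auto
 have a_v: "norm (ainv (snd p) x) \<le> v x" if "p \<in> K \<times> L" for p x unfolding v_def using that by (intro aa) auto
 have h_v: "norm (hh p x) \<le> v x ^ 2" if "p \<in> K \<times> L" for p x
 proof -
  have "norm (hh p x) \<le> norm (ainv (snd p) x) * norm (b (fst p) x)" unfolding hh_def by (rule norm_matrix_vector_mult_le)
  also have "... \<le> v x * v x" using a_v[OF that] b_v[OF that] v_nn by (intro mult_mono) auto
  finally show ?thesis by (simp add: power2_eq_square)
 qed
 have h_d: "norm (hh p x - hh p' x) \<le> 2 * v x ^ 2 * d p p'" if "p \<in> K \<times> L" "p' \<in> K \<times> L" for p p' x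
 proof -
  have "norm (hh p x - hh p' x) \<le> norm (ainv (snd p) x - ainv (snd p') x) * norm (b (fst p) x) + norm (ainv (snd p') x) * norm (b (fst p) x - b (fst p') x)"
   unfolding hh_def by (rule norm_matrix_vector_diff_le)
  also have "... \<le> (v x * d p p') * v x + v x * (v x * d p p')"
   using a_d[OF that] b_d[OF that] a_v[OF that(2)] b_v[OF that(1)] v_nn d_nn by (intro add_mono mult_mono) auto
  finally show ?thesis by (simp add: power2_eq_square)
 qed
 define w where "w p x = (1/2) *\<^sub>R b (fst p) x - b \<mu>0 x" for p :: "'m \<times> 's" and x
 have w_v: "norm (w p x) \<le> 3 / 2 * v x" if "p \<in> K \<times> L" for p x
  unfolding w_def using norm_triangle_ineq4[of "(1/2) *\<^sub>R b (fst p) x" "b \<mu>0 x"] b_v[OF that, of x] b0_v[of x] by simp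
 have w_d: "norm (w p x - w p' x) \<le> 1 / 2 * (v x * d p p')" if "p \<in> K \<times> L" "p' \<in> K \<times> L" for p p' x
 proof -
  have "w p x - w p' x = (1/2) *\<^sub>R (b (fst p) x - b (fst p') x)" by (simp add: w_def algebra_simps)
  thus ?thesis using b_d[OF that, of x] by simp
 qed
 have g_v: "\<bar>gg p x\<bar> \<le> 4 * v x ^ 3" if "p \<in> K \<times> L" for p x
 proof -
  have "\<bar>gg p x\<bar> \<le> norm (hh p x) * norm (w p x)" unfolding gg_def w_def by (rule Cauchy_Schwarz_ineq2)
  also have "... \<le> v x ^ 2 * (3 / 2 * v x)" using h_v[OF that] w_v[OF that] by (intro mult_mono) auto
  also have "... = 3 / 2 * v x ^ 3" by (simp add: power2_eq_square power3_eq_cube)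
  also have "... \<le> 4 * v x ^ 3" using v_nn by (intro mult_right_mono) auto
  finally show ?thesis .
 qed
 have g_d: "\<bar>gg p x - gg p' x\<bar> \<le> 4 * v x ^ 3 * d p p'" if "p \<in> K \<times> L" "p' \<in> K \<times> L" for p p' x
 proof -
  have "\<bar>gg p x - gg p' x\<bar> \<le> norm (hh p x - hh p' x) * norm (w p x) + norm (hh p' x) * norm (w p x - w p' x)"
   unfolding gg_def w_def by (rule inner_diff_le)
  also have "... \<le> (2 * v x ^ 2 * d p p') * (3 / 2 * v x) + v x ^ 2 * (1 / 2 * (v x * d p p'))"
   using h_d[OF that] w_d[OF that] h_v[OF that(2)] w_v[OF that(1)] v_nn d_nn by (intro add_mono mult_mono) auto
  also have "... = (7 / 2) * (v x ^ 3 * d p p')" by (simp add: power2_eq_square power3_eq_cube)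
  also have "... \<le> 4 * (v x ^ 3 * d p p')" using v_nn d_nn by (intro mult_right_mono) auto
  finally show ?thesis by simp
 qed
 show ?thesis
 proof (rule that[of "4 * C ^ 3" "3 * q" \<nu>])
  show "0 < 4 * C ^ 3" "0 \<le> 3 * q" "0 < \<nu>" using C q \<nu> by auto
  fix p p' x assume p: "p \<in> K \<times> L"
  show "norm (hh p x) \<le> 4 * C ^ 3 * V x powr (3 * q)" unfolding v3[symmetric] using h_v[OF p, of x] v_pow[of x] v_nn[of x] by linarith
  show "\<bar>gg p x\<bar> \<le> 4 * C ^ 3 * V x powr (3 * q)" unfolding v3[symmetric] by (rule g_v[OF p])
  assume p': "p' \<in> K \<times> L"
  show "norm (hh p x - hh p' x) \<le> 4 * C ^ 3 * V x powr (3 * q) * dist p p' powr \<nu>"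
  proof -
   have "2 * v x ^ 2 * d p p' \<le> 4 * v x ^ 3 * d p p'" using v_pow[of x] v_nn[of x] d_nn by (intro mult_right_mono) auto
   thus ?thesis unfolding v3[symmetric] d_def[symmetric] using h_d[OF p p', of x] by linarith
  qed
  show "\<bar>gg p x - gg p' x\<bar> \<le> 4 * C ^ 3 * V x powr (3 * q) * dist p p' powr \<nu>"
   unfolding v3[symmetric] d_def[symmetric] by (rule g_d[OF p p'])
 next
  fix x
  show "norm (b \<mu>0 x) \<le> 4 * C ^ 3 * V x powr (3 * q)" unfolding v3[symmetric] using b0_v[of x] v_pow(2)[of x] v_nn[of x] by linarith
 qed
qed

lemma gg_integrable: "\<mu> \<in> MM \<Longrightarrow> integrable \<pi> (gg (\<mu>, vs0))"
proof -
 assume \<mu>: "\<mu> \<in> MM"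
 have K: "compact {\<mu>}" "{\<mu>} \<subseteq> MM" "compact {vs0}" "{vs0} \<subseteq> SS" using \<mu> vs0 by auto
 obtain C q \<nu> where "0 < C" "0 \<le> q" "0 < (\<nu>::real)" "\<And>p x. p \<in> {\<mu>} \<times> {vs0} \<Longrightarrow> \<bar>gg p x\<bar> \<le> C * V x powr q"
  by (rule param_bounds[OF K]) blast
 thus ?thesis by (intro \<pi>_integrable gg_cont \<mu> vs0) auto
qed

lemma Lam_diff_le:
 assumes \<mu>: "\<mu> \<in> MM" "\<mu>' \<in> MM" and q: "0 \<le> q" and le: "\<And>x. \<bar>gg (\<mu>, vs0) x - gg (\<mu>', vs0) x\<bar> \<le> C * V x powr q * e"
 shows "\<bar>Lam \<mu> - Lam \<mu>'\<bar> \<le> C * (\<integral>x. V x powr q \<partial>\<pi>) * e"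
proof -
 note i = \<mu>[THEN gg_integrable]
 have "\<bar>Lam \<mu> - Lam \<mu>'\<bar> = \<bar>\<integral>x. gg (\<mu>, vs0) x - gg (\<mu>', vs0) x \<partial>\<pi>\<bar>"
  unfolding Lam_def using i by simp
 also have "... \<le> (\<integral>x. \<bar>gg (\<mu>, vs0) x - gg (\<mu>', vs0) x\<bar> \<partial>\<pi>)" by (rule integral_abs_bound)
 also have "... \<le> (\<integral>x. C * V x powr q * e \<partial>\<pi>)" by (rule integral_mono[OF _ _ le]) (use i \<pi>_moment[OF q] in auto)
 finally show ?thesis by simp
qed

text \<open>Symmetry of the inverse matrix merges the two mixed terms, and what is then left over is
  half the quadratic form of the true drift, which is \<open>- gg (\<mu>0, vs0)\<close>.\<close>

lemma Lambda_bar_eq: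
 assumes \<mu>: "\<mu> \<in> MM"
 shows "LB \<mu> = Lam \<mu> - Lam \<mu>0"
proof -
 have "1/2 * ((b \<mu> x - b \<mu>0 x) \<bullet> (ainv vs0 x *v (b \<mu> x - b \<mu>0 x))) = gg (\<mu>, vs0) x - gg (\<mu>0, vs0) x" for x
 proof -
  have sym: "u \<bullet> (ainv vs0 x *v v) = (ainv vs0 x *v u) \<bullet> v" for u v
   using dot_lmul_matrix[of u "ainv vs0 x" v] transpose_matrix_vector[of "ainv vs0 x" u] ainv_sym[of x] by simp
  have swap: "b \<mu>0 x \<bullet> (ainv vs0 x *v b \<mu> x) = b \<mu> x \<bullet> (ainv vs0 x *v b \<mu>0 x)"
   using sym[of "b \<mu>0 x" "b \<mu> x"] by (simp only: inner_commute)
  show ?thesis unfolding gg_def hh_def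
   using swap by (simp add: matrix_vector_mult_diff_distrib inner_diff_left inner_diff_right inner_commute algebra_simps)
 qed
 hence "LB \<mu> = (\<integral>x. gg (\<mu>, vs0) x - gg (\<mu>0, vs0) x \<partial>\<pi>)"
  by (simp only: Lambda_bar_def integral_mult_right_zero[symmetric])
 also have "... = Lam \<mu> - Lam \<mu>0"
  unfolding Lam_def by (rule Bochner_Integration.integral_diff[OF gg_integrable[OF \<mu>] gg_integrable[OF \<mu>0]])
 finally show ?thesis .
qed

text \<open>Each observed increment is mesh times frozen drift, plus drift error, plus noise; the
  first part joins the quadratic term to form \<open>gg\<close>. The identity is pathwise, so a
  random \<open>vs\<close> may be inserted.\<close>

lemma crit_decomposition:
 assumes eps: "0 < eps" and om: "om \<in> space M"
  and eq: "\<forall>s t. 0 \<le> s \<longrightarrow> s \<le> t \<longrightarrow> X t om - X s om = (LBINT u:{s..t}. b \<mu>0 (X u om)) + (I t om - I s om)"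
 shows "crit eps vs \<mu> om = eps * \<Delta> eps * (\<Sum>i<m eps. gg (\<mu>, vs) (obs eps i om))
  - eps * (\<Sum>i<m eps. hh (\<mu>, vs) (obs eps i om) \<bullet> drift eps i om)
  - eps * (\<Sum>i<m eps. hh (\<mu>, vs) (obs eps i om) \<bullet> noise eps i om)"
proof -
 have \<Delta>: "0 < \<Delta> eps" using mesh[OF eps] by simp
 let ?h = "\<lambda>i. hh (\<mu>, vs) (obs eps i om)"
 have inc: "obs eps (Suc i) om - obs eps i om = \<Delta> eps *\<^sub>R b \<mu>0 (obs eps i om) + drift eps i om + noise eps i om" for i
 proof -
  have d: "0 \<le> \<Delta> eps" using \<Delta> by simp
  have "drift eps i om = (LBINT s:cell (\<Delta> eps) i. b \<mu>0 (X s om)) - \<Delta> eps *\<^sub>R b \<mu>0 (obs eps i om)"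
   using cell_integrable[of "\<lambda>_. b \<mu>0", OF cont_snd[OF \<beta>_cont] om d] cell_integrable[of "\<lambda>x _. b \<mu>0 x", OF cont_fst[OF \<beta>_cont] om d]
   by (simp only: set_integral_diff(2) LINT_cell_const[OF d])
  moreover have "obs eps (Suc i) om - obs eps i om = (LBINT u:cell (\<Delta> eps) i. b \<mu>0 (X u om)) + noise eps i om"
   using eq d by (simp add: mult_right_mono del: of_nat_Suc)
  ultimately show ?thesis by (simp only:) (simp add: algebra_simps)
 qed
 have summand: "?h i \<bullet> (obs eps (Suc i) om - obs eps i om) - \<Delta> eps / 2 * (b \<mu> (obs eps i om) \<bullet> ?h i)
  = - (\<Delta> eps * gg (\<mu>, vs) (obs eps i om)) + ?h i \<bullet> drift eps i om + ?h i \<bullet> noise eps i om" for i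
  unfolding inc gg_def by (simp only: inner_add_right inner_diff_right inner_scaleR_right fst_conv inner_commute[of "b \<mu> _"]) (simp add: algebra_simps)
 \<comment> \<open>The likelihood counts cells by their right end points; the sum is reindexed by
   the left ones.\<close>
 have "loglik b ainv (m eps) (\<Delta> eps) \<mu> vs (\<lambda>i. obs eps i om)
  = (\<Sum>i<m eps. ?h i \<bullet> (obs eps (Suc i) om - obs eps i om)) - \<Delta> eps / 2 * (\<Sum>i<m eps. b \<mu> (obs eps i om) \<bullet> ?h i)"
  unfolding loglik_def hh_def by (simp only: One_nat_def sum.atLeast1_atMost_eq diff_Suc_Suc diff_zero fst_conv snd_conv)
 also have "... = (\<Sum>i<m eps. ?h i \<bullet> (obs eps (Suc i) om - obs eps i om) - \<Delta> eps / 2 * (b \<mu> (obs eps i om) \<bullet> ?h i))"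
  by (simp only: sum_subtractf sum_distrib_left)
 also have "... = - (\<Delta> eps * (\<Sum>i<m eps. gg (\<mu>, vs) (obs eps i om))) + (\<Sum>i<m eps. ?h i \<bullet> drift eps i om) + (\<Sum>i<m eps. ?h i \<bullet> noise eps i om)"
  by (simp only: summand sum.distrib sum_negf sum_distrib_left)
 finally show ?thesis unfolding crit_def by (simp only:) (simp add: algebra_simps)
qed

text \<open>The common growth bound for \<open>hh\<close> dominates all summands by one kernel
  vanishing on the diagonal, so uniformity over parameters comes for free.\<close>

lemma whp_drift:
 assumes C: "0 < C" "0 \<le> q" and b0: "\<And>x. norm (b \<mu>0 x) \<le> C * V x powr q" and \<eta>: "0 < \<eta>"
  and h: "\<And>p x. p \<in> P \<Longrightarrow> norm (hh p x) \<le> C * V x powr q"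
 shows "whp (at_right 0) (\<lambda>eps om. \<forall>p\<in>P. eps * \<bar>\<Sum>i<m eps. hh p (obs eps i om) \<bullet>
   drift eps i om\<bar> \<le> \<eta>)"
proof -
 let ?F = "\<lambda>x y. C * V x powr q * norm (b \<mu>0 y - b \<mu>0 x)"
 have Fc: "cont2 ?F"
  by (intro continuous_on_mult continuous_on_const cont_fst V_powr_cont continuous_on_norm continuous_on_diff cont_snd \<beta>_cont)
 have F_bound: "\<bar>?F x y\<bar> \<le> 2 * C^2 * (V x powr (2 * q) + V y powr (2 * q))" for x y
 proof -
  define u v where "u = V x powr q" and "v = V y powr q"
  have uv: "0 \<le> u" "0 \<le> v" by (auto simp: u_def v_def)
  have "norm (b \<mu>0 y - b \<mu>0 x) \<le> C * v + C * u"
   using norm_triangle_ineq4[of "b \<mu>0 y" "b \<mu>0 x"] b0[of x] b0[of y] by (simp add: u_def v_def)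
  hence "C * u * norm (b \<mu>0 y - b \<mu>0 x) \<le> C * u * (C * v + C * u)" using C uv by (intro mult_left_mono) auto
  also have "... = C^2 * (u * v + u * u)" by (simp add: power2_eq_square algebra_simps)
  also have "... \<le> C^2 * (2 * (u * u + v * v))"
  proof (rule mult_left_mono)
   have "2 * u * v \<le> u^2 + v^2" by (rule sum_squares_bound)
   thus "u * v + u * u \<le> 2 * (u * u + v * v)" using uv by (simp add: power2_eq_square algebra_simps) (use mult_nonneg_nonneg[OF uv(1,1)] mult_nonneg_nonneg[OF uv(2,2)] in linarith)
  qed simp
  also have "... = 2 * C^2 * (V x powr (2 * q) + V y powr (2 * q))" by (simp add: u_def v_def powr_add[symmetric])
  finally show ?thesis using C uv by (simp add: u_def abs_mult)
 qed
 have 1: "whp (at_right 0) (\<lambda>eps om. eps * KS eps (\<lambda>x y. \<bar>?F x y\<bar>) om \<le> \<eta>)"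
  by (rule whp_diagonal[OF Fc _ _ _ F_bound \<eta>]) (use C in auto)
 show ?thesis
 proof (rule whp_mono[OF 1], use eventually_pos in eventually_elim, intro ballI impI)
  fix eps om p assume eps: "0 < eps" and om: "om \<in> space M" and p: "p \<in> P"
   and 1: "eps * KS eps (\<lambda>x y. \<bar>?F x y\<bar>) om \<le> \<eta>"
  have \<Delta>: "0 < \<Delta> eps" using mesh[OF eps] by simp
  have one: "\<bar>hh p (obs eps i om) \<bullet> drift eps i om\<bar>
   \<le> (LBINT s:cell (\<Delta> eps) i. \<bar>?F (obs eps i om) (X s om)\<bar>)" for i
  proof -
   let ?J = "cell (\<Delta> eps) i" and ?x = "obs eps i om"
   let ?d = "\<lambda>s. b \<mu>0 (X s om) - b \<mu>0 ?x"
   have di: "set_integrable lborel ?J ?d"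
    using \<Delta> om by (intro cell_integrable[of "\<lambda>x y. b \<mu>0 y - b \<mu>0 x"] continuous_on_diff cont_fst cont_snd \<beta>_cont) auto
   have "\<bar>hh p ?x \<bullet> (LBINT s:?J. ?d s)\<bar> \<le> norm (hh p ?x) * norm (LBINT s:?J. ?d s)" by (rule Cauchy_Schwarz_ineq2)
   also have "... \<le> (C * V ?x powr q) * (LBINT s:?J. norm (?d s))"
    using set_integral_norm_bound[OF di] h[OF p, of ?x] C by (intro mult_mono) auto
   also have "... = (LBINT s:?J. (C * V ?x powr q) * norm (?d s))" by (rule set_integral_mult_right[symmetric])
   also have "... = (LBINT s:?J. \<bar>?F ?x (X s om)\<bar>)" using C by (simp add: abs_mult)
   finally show ?thesis .
  qed
  have "\<bar>\<Sum>i<m eps. hh p (obs eps i om) \<bullet> drift eps i om\<bar> \<le> KS eps (\<lambda>x y. \<bar>?F x y\<bar>) om"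
   unfolding KA_def by (rule order_trans[OF sum_abs sum_mono[OF one]])
  from order_trans[OF mult_left_mono[OF this less_imp_le[OF eps]] 1]
  show "eps * \<bar>\<Sum>i<m eps. hh p (obs eps i om) \<bullet> drift eps i om\<bar> \<le> \<eta>" .
 qed
qed

text \<open>On the compact product \<open>K \<times> L\<close> the martingale and drift parts are
  uniformly small, so the random \<open>vshat\<close> may be substituted. For the \<open>gg\<close>
  average a finite net in \<open>K\<close> suffices, because the Hoelder bound moves from the pair
  at hand to a net point paired with \<open>vs0\<close>.\<close>

theorem uniform_contrast:
 assumes K: "compact K" "K \<subseteq> MM" and \<eta>: "0 < \<eta>"
 shows "whp (at_right 0) (\<lambda>eps om. \<forall>\<mu>\<in>K. \<bar>crit eps (vshat eps om) \<mu> om - Lam \<mu>\<bar> \<le> \<eta>)"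
proof -
 obtain r0 where r0: "0 < r0" "compact (cball vs0 r0 \<inter> SS)" using nbhd by blast
 define L where "L = cball vs0 r0 \<inter> SS"
 have L: "compact L" "L \<subseteq> SS" "vs0 \<in> L" using r0 vs0 by (auto simp: L_def)
 obtain C q \<nu> where C: "0 < C" "0 \<le> q" "0 < (\<nu>::real)"
  and h1: "\<And>p x. p \<in> K \<times> L \<Longrightarrow> norm (hh p x) \<le> C * V x powr q"
  and h2: "\<And>p p' x. p \<in> K \<times> L \<Longrightarrow> p' \<in> K \<times> L \<Longrightarrow> norm (hh p x - hh p' x) \<le> C * V x powr q * dist p p' powr \<nu>"
  and g1: "\<And>p x. p \<in> K \<times> L \<Longrightarrow> \<bar>gg p x\<bar> \<le> C * V x powr q"
  and g2: "\<And>p p' x. p \<in> K \<times> L \<Longrightarrow> p' \<in> K \<times> L \<Longrightarrow> \<bar>gg p x - gg p' x\<bar> \<le> C * V x powr q * dist p p' powr \<nu>"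
  and b0: "\<And>x. norm (b \<mu>0 x) \<le> C * V x powr q" by (rule param_bounds[OF K L(1,2)]) blast
 have KL: "fst p \<in> MM" "snd p \<in> SS" if "p \<in> K \<times> L" for p using that K L by auto
 \<comment> \<open>Bounds the stationary mean of \<open>V powr q\<close> and, with high probability,
   its empirical average.\<close>
 define R where "R = (\<integral>x. V x powr q \<partial>\<pi>) + 1"
 have R: "1 \<le> R" unfolding R_def by (simp add: integral_nonneg_AE)
 \<comment> \<open>Five errors of this size occur: moving the average, moving the limit, the net
   point, drift and noise.\<close>
 define \<tau> where "\<tau> = \<eta> / 8"
 have \<tau>: "0 < \<tau>" using \<eta> by (simp add: \<tau>_def)
 \<comment> \<open>Parameter and estimator may each be off by \<open>r\<close>, hence the distance
   \<open>2 * r\<close> of the pairs; \<open>r0\<close> keeps the estimator inside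
   \<open>L\<close>.\<close>
 define r where "r = min r0 ((\<tau> / (C * R)) powr (1 / \<nu>) / 2)"
 have r: "0 < r" "r \<le> r0" using r0 \<tau> C R by (auto simp: r_def)
 have small: "C * R * (2 * r) powr \<nu> \<le> \<tau>"
 proof -
  have "2 * r \<le> (\<tau> / (C * R)) powr (1 / \<nu>)" by (simp add: r_def)
  hence "(2 * r) powr \<nu> \<le> ((\<tau> / (C * R)) powr (1 / \<nu>)) powr \<nu>" using r C by (intro powr_mono2) auto
  also have "... = \<tau> / (C * R)" using C \<tau> R by (simp add: powr_powr)
  finally show ?thesis using C R by (simp add: field_simps)
 qed
 obtain N where N: "finite N" "N \<subseteq> K" "K \<subseteq> (\<Union>x\<in>N. ball x r)"
 proof (rule compactE_image[OF K(1), of K "\<lambda>x. ball x r"])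
  show "K \<subseteq> (\<Union>x\<in>K. ball x r)" using r(1) by auto
 qed auto
 have gN: "whp (at_right 0) (\<lambda>eps om. \<forall>\<mu>\<in>N. \<bar>eps * \<Delta> eps * (\<Sum>i<m eps. gg (\<mu>, vs0) (obs eps i om)) - Lam \<mu>\<bar> \<le> \<tau>)"
 proof (rule whp_ball_finite[OF N(1)])
  fix \<mu> assume "\<mu> \<in> N"
  hence "\<mu> \<in> MM" "(\<mu>, vs0) \<in> K \<times> L" using N K L by auto
  thus "whp (at_right 0) (\<lambda>eps om. \<bar>eps * \<Delta> eps * (\<Sum>i<m eps. gg (\<mu>, vs0) (obs eps i om)) - Lam \<mu>\<bar> \<le> \<tau>)"
   unfolding Lam_def using C by (intro whp_average[OF gg_cont g1 _ C(2) \<tau>] vs0) auto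
 qed
 have vN: "whp (at_right 0) (\<lambda>eps om. \<bar>eps * \<Delta> eps * (\<Sum>i<m eps. V (obs eps i om) powr q) - (\<integral>x. V x powr q \<partial>\<pi>)\<bar> \<le> 1)"
  by (rule whp_average[OF V_powr_cont, where C=1 and q=q]) (use C in auto)
 have mart: "whp (at_right 0) (\<lambda>eps om. \<forall>p\<in>K \<times> L. eps * \<bar>\<Sum>i<m eps. hh p (obs eps i om) \<bullet> noise eps i om\<bar> \<le> \<tau>)"
 proof (rule whp_martingale[OF _ C(3,1,2) _ h1 h2 \<tau>])
  show "bounded (K \<times> L)" by (intro compact_imp_bounded compact_Times K L)
  fix p assume "p \<in> K \<times> L"
  with hh_cont[OF KL, of p p] show "continuous_on UNIV (hh p)" by simp
 qed
 have drift: "whp (at_right 0) (\<lambda>eps om. \<forall>p\<in>K \<times> L. eps * \<bar>\<Sum>i<m eps. hh p (obs eps i om) \<bullet>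
   drift eps i om\<bar> \<le> \<tau>)" by (rule whp_drift[OF C(1,2) b0 \<tau> h1])
 show ?thesis
 proof (rule whp_mono[OF whp_conj[OF whp_conj[OF whp_conj[OF gN vN] whp_conj[OF mart drift]]
    whp_conj[OF whp_conj[OF vshat_SS vshat_cons[OF r(1)]] whp_AE[OF X_increment]]]],
   use eventually_pos in eventually_elim, intro ballI impI, elim conjE)
  fix eps om \<mu>
  assume eps: "0 < eps" and om: "om \<in> space M" and \<mu>: "\<mu> \<in> K"
   and gN: "\<forall>\<mu>\<in>N. \<bar>eps * \<Delta> eps * (\<Sum>i<m eps. gg (\<mu>, vs0) (obs eps i om)) - Lam \<mu>\<bar> \<le> \<tau>"
   and vN: "\<bar>eps * \<Delta> eps * (\<Sum>i<m eps. V (obs eps i om) powr q) - (\<integral>x. V x powr q \<partial>\<pi>)\<bar> \<le> 1"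
   and mart: "\<forall>p\<in>K \<times> L. eps * \<bar>\<Sum>i<m eps. hh p (obs eps i om) \<bullet> noise eps i om\<bar> \<le> \<tau>"
   and drift: "\<forall>p\<in>K \<times> L. eps * \<bar>\<Sum>i<m eps. hh p (obs eps i om) \<bullet>
     drift eps i om\<bar> \<le> \<tau>"
   and vs: "vshat eps om \<in> SS" "dist (vshat eps om) vs0 \<le> r"
   and inc: "\<forall>s t. 0 \<le> s \<longrightarrow> s \<le> t \<longrightarrow> X t om - X s om = (LBINT u:{s..t}. b \<mu>0 (X u om)) + (I t om - I s om)"
  define vs where "vs = vshat eps om"
  have vsL: "vs \<in> L" using vs r by (auto simp: vs_def L_def dist_commute)
  obtain \<mu>' where \<mu>': "\<mu>' \<in> N" "dist \<mu> \<mu>' < r" using N(3) \<mu> by (auto simp: dist_commute)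
  have P: "(\<mu>, vs) \<in> K \<times> L" "(\<mu>', vs0) \<in> K \<times> L" "(\<mu>, vs0) \<in> K \<times> L" using \<mu> \<mu>' vsL L N by auto
  define av where "av f = eps * \<Delta> eps * (\<Sum>i<m eps. f (obs eps i om))" for f :: "real^'d \<Rightarrow> real"
  have av_nn: "0 < eps * \<Delta> eps" using mesh[OF eps] eps by simp
  have near: "dist (\<mu>, vs) (\<mu>', vs0) powr \<nu> \<le> (2 * r) powr \<nu>" "dist (\<mu>, vs0) (\<mu>', vs0) powr \<nu> \<le> (2 * r) powr \<nu>"
  proof -
   have "dist (\<mu>, vs) (\<mu>', vs0) \<le> dist \<mu> \<mu>' + dist vs vs0" unfolding dist_Pair_Pair by (rule sqrt_sum_squares_le_sum) auto
   hence "dist (\<mu>, vs) (\<mu>', vs0) \<le> 2 * r" "dist (\<mu>, vs0) (\<mu>', vs0) \<le> 2 * r"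
    using \<mu>'(2) vs(2) r(1) by (auto simp: vs_def dist_Pair_Pair)
   thus "dist (\<mu>, vs) (\<mu>', vs0) powr \<nu> \<le> (2 * r) powr \<nu>" "dist (\<mu>, vs0) (\<mu>', vs0) powr \<nu> \<le> (2 * r) powr \<nu>"
    using C by (auto intro!: powr_mono2)
  qed
  have 1: "\<bar>av (gg (\<mu>, vs)) - av (gg (\<mu>', vs0))\<bar> \<le> \<tau>"
  proof -
   have "\<bar>av (gg (\<mu>, vs)) - av (gg (\<mu>', vs0))\<bar> = eps * \<Delta> eps * \<bar>\<Sum>i<m eps. gg (\<mu>, vs) (obs eps i om) - gg (\<mu>', vs0) (obs eps i om)\<bar>"
    unfolding av_def right_diff_distrib[symmetric] sum_subtractf[symmetric] abs_mult[of "eps * \<Delta> eps"] abs_of_pos[OF av_nn] ..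
   also have "... \<le> eps * \<Delta> eps * (\<Sum>i<m eps. C * V (obs eps i om) powr q * (2 * r) powr \<nu>)"
   proof (intro mult_left_mono order_trans[OF sum_abs] sum_mono)
    fix i
    show "\<bar>gg (\<mu>, vs) (obs eps i om) - gg (\<mu>', vs0) (obs eps i om)\<bar> \<le> C * V (obs eps i om) powr q * (2 * r) powr \<nu>"
     using g2[OF P(1,2), of "obs eps i om"] near(1) C(1) by (elim order_trans) (intro mult_left_mono, auto)
   qed (use av_nn in simp)
   also have "... = C * (2 * r) powr \<nu> * av (\<lambda>x. V x powr q)" unfolding av_def sum_distrib_left by (intro sum.cong) auto
   also have "... \<le> C * (2 * r) powr \<nu> * R" using vN C unfolding av_def R_def by (intro mult_left_mono) (auto simp: abs_le_iff)
   also have "... \<le> \<tau>" using small by (simp add: mult_ac)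
   finally show ?thesis .
  qed
  have 2: "\<bar>Lam \<mu> - Lam \<mu>'\<bar> \<le> \<tau>"
  proof -
   have "\<bar>Lam \<mu> - Lam \<mu>'\<bar> \<le> C * (\<integral>x. V x powr q \<partial>\<pi>) * dist (\<mu>, vs0) (\<mu>', vs0) powr \<nu>"
    by (rule Lam_diff_le[OF _ _ C(2) g2[OF P(3,2)]]) (use \<mu> \<mu>' N K in auto)
   also have "... \<le> C * R * (2 * r) powr \<nu>" using near(2) C R by (intro mult_mono) (auto simp: R_def)
   finally show ?thesis using small by linarith
  qed
  have 3: "\<bar>av (gg (\<mu>', vs0)) - Lam \<mu>'\<bar> \<le> \<tau>" using gN \<mu>'(1) unfolding av_def by blast
  define A where "A = (\<Sum>i<m eps. hh (\<mu>, vs) (obs eps i om) \<bullet> drift eps i om)"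
  define B where "B = (\<Sum>i<m eps. hh (\<mu>, vs) (obs eps i om) \<bullet> noise eps i om)"
  have 4: "\<bar>eps * A\<bar> \<le> \<tau>" "\<bar>eps * B\<bar> \<le> \<tau>"
   using drift P(1) mart eps unfolding A_def B_def abs_mult abs_of_pos[OF eps] by blast+
  have "crit eps vs \<mu> om = av (gg (\<mu>, vs)) - eps * A - eps * B" unfolding av_def A_def B_def by (rule crit_decomposition[OF eps om inc])
  hence "\<bar>crit eps vs \<mu> om - Lam \<mu>\<bar> \<le> 5 * \<tau>" using 1 2 3 4 by linarith
  thus "\<bar>crit eps (vshat eps om) \<mu> om - Lam \<mu>\<bar> \<le> \<eta>" using \<eta> unfolding vs_def \<tau>_def by linarith
 qed
qed

lemma Lam_cont:
 assumes K: "compact K" "K \<subseteq> MM"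
 shows "continuous_on K Lam"
proof -
 have L: "compact {vs0}" "{vs0} \<subseteq> SS" using vs0 by auto
 obtain C q \<nu> where C: "0 < C" "0 \<le> q" "0 < (\<nu>::real)"
  and g: "\<And>p p' x. p \<in> K \<times> {vs0} \<Longrightarrow> p' \<in> K \<times> {vs0} \<Longrightarrow> \<bar>gg p x - gg p' x\<bar> \<le> C * V x powr q * dist p p' powr \<nu>"
  by (rule param_bounds[OF K L]) blast
 show ?thesis
 proof (rule continuous_on_holder[OF C(3)])
  fix \<mu> \<mu>' assume \<mu>: "\<mu> \<in> K" "\<mu>' \<in> K"
  have "\<bar>Lam \<mu> - Lam \<mu>'\<bar> \<le> C * (\<integral>x. V x powr q \<partial>\<pi>) * dist (\<mu>, vs0) (\<mu>', vs0) powr \<nu>"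
   by (rule Lam_diff_le[OF _ _ C(2) g]) (use \<mu> K in auto)
  thus "dist (Lam \<mu>) (Lam \<mu>') \<le> C * (\<integral>x. V x powr q \<partial>\<pi>) * dist \<mu> \<mu>' powr \<nu>"
   by (simp add: dist_real_def dist_Pair_Pair)
 qed
qed

text \<open>Away from \<open>\<mu>0\<close> the continuous function \<open>Lam\<close> exceeds its
  value at \<open>\<mu>0\<close> by a positive gap on the compact set, which uniform convergence
  cannot close.\<close>

lemma whp_separated:
 assumes K: "compact K" "K \<subseteq> MM" "\<mu>0 \<in> K" and e: "0 < e"
  and min: "\<And>\<mu>. \<mu> \<in> MM \<Longrightarrow> \<mu> \<noteq> \<mu>0 \<Longrightarrow> LB \<mu>0 < LB \<mu>"
  and \<gamma>: "uniform_limit K \<gamma> (\<lambda>_. 0) (at_right 0)"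
 shows "whp (at_right 0) (\<lambda>eps om. \<forall>\<mu>\<in>K. e \<le> dist \<mu> \<mu>0 \<longrightarrow>
  obj \<gamma> eps \<mu>0 om < obj \<gamma> eps \<mu> om)"
proof -
 let ?S = "K - ball \<mu>0 e"
 have S: "compact ?S" using K(1) by (rule compact_diff) simp
 have "\<exists>c>0. \<forall>\<mu>\<in>?S. Lam \<mu>0 + c \<le> Lam \<mu>"
 proof (cases "?S = {}")
  case True
  thus ?thesis by (metis empty_iff zero_less_one)
 next
  case False
  have "continuous_on ?S Lam" by (rule continuous_on_subset[OF Lam_cont[OF K(1,2)]]) auto
  from continuous_attains_inf[OF S False this]
  obtain \<mu>1 where \<mu>1: "\<mu>1 \<in> ?S" "\<And>\<mu>. \<mu> \<in> ?S \<Longrightarrow> Lam \<mu>1 \<le> Lam \<mu>" by blast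
  have "\<mu>1 \<in> MM" "\<mu>1 \<noteq> \<mu>0" using \<mu>1(1) K e by auto
  from min[OF this] have "Lam \<mu>0 < Lam \<mu>1" by (simp add: Lambda_bar_eq \<open>\<mu>1 \<in> MM\<close> \<mu>0)
  thus ?thesis using \<mu>1(2) by (intro exI[of _ "Lam \<mu>1 - Lam \<mu>0"]) auto
 qed
 then obtain c where c: "0 < c" "\<And>\<mu>. \<mu> \<in> ?S \<Longrightarrow> Lam \<mu>0 + c \<le> Lam \<mu>" by blast
 \<comment> \<open>Four errors enter, two from the contrast and two from the penalty; fifths leave a
   strict inequality.\<close>
 have c5: "0 < c / 5" using c by simp
 have g: "\<forall>\<^sub>F eps in at_right 0. \<forall>\<mu>\<in>K. \<bar>\<gamma> eps \<mu>\<bar> < c / 5"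
  using uniform_limitD[OF \<gamma> c5] by simp
 show ?thesis
 proof (rule whp_mono[OF uniform_contrast[OF K(1,2) c5]], use g in eventually_elim, intro ballI impI)
  fix eps om \<mu> assume g: "\<forall>\<mu>\<in>K. \<bar>\<gamma> eps \<mu>\<bar> < c / 5" and u: "\<forall>\<mu>\<in>K. \<bar>crit eps (vshat eps om) \<mu> om - Lam \<mu>\<bar> \<le> c / 5"
   and \<mu>: "\<mu> \<in> K" "e \<le> dist \<mu> \<mu>0"
  hence "Lam \<mu>0 + c \<le> Lam \<mu>" by (intro c(2)) (auto simp: dist_commute)
  with bspec[OF g \<mu>(1)] bspec[OF g K(3)] bspec[OF u \<mu>(1)] bspec[OF u K(3)] c5
  show "obj \<gamma> eps \<mu>0 om < obj \<gamma> eps \<mu> om" by linarith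
 qed
qed

text \<open>Tightness confines the estimator to a compact set, and closedness of \<open>MM\<close>
  keeps the intersection compact. There, a minimizer at distance at least \<open>e\<close> would be
  beaten by \<open>\<mu>0\<close>.\<close>

lemma consistency_tight:
 assumes closed: "closed MM" and tight: "tight_family M {0<..} \<mu>hat"
  and meas: "\<And>eps. 0 < eps \<Longrightarrow> \<mu>hat eps \<in> borel_measurable M"
  and argmin: "\<And>eps om. 0 < eps \<Longrightarrow> om \<in> space M \<Longrightarrow> is_arg_min (\<lambda>\<mu>. obj \<gamma> eps \<mu> om) (\<lambda>\<mu>. \<mu> \<in> MM) (\<mu>hat eps om)"
  and min: "\<And>\<mu>. \<mu> \<in> MM \<Longrightarrow> \<mu> \<noteq> \<mu>0 \<Longrightarrow> LB \<mu>0 < LB \<mu>"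
  and \<gamma>: "\<And>K. compact K \<Longrightarrow> K \<subseteq> MM \<Longrightarrow> uniform_limit K \<gamma> (\<lambda>_. 0) (at_right 0)"
  and e: "0 < e"
 shows "whp (at_right 0) (\<lambda>eps om. dist (\<mu>hat eps om) \<mu>0 \<le> e)" unfolding whp_def
proof (intro allI impI)
 fix \<delta> :: real assume \<delta>: "0 < \<delta>"
 hence \<delta>2: "0 < \<delta> / 2" by simp
 with tight obtain K0 where K0: "compact K0" "\<And>eps. 0 < eps \<Longrightarrow> prob {om \<in> space M. \<mu>hat eps om \<notin> K0} \<le> \<delta> / 2"
  unfolding tight_family_def by (metis greaterThan_iff)
 define K where "K = insert \<mu>0 (K0 \<inter> MM)"
 have K: "compact K" "K \<subseteq> MM" "\<mu>0 \<in> K" using K0 closed \<mu>0 by (auto simp: K_def intro: compact_insert compact_Int_closed)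
 have "\<forall>\<^sub>F eps in at_right 0. \<exists>A\<in>events. prob A \<le> \<delta> / 2 \<and> (\<forall>om\<in>space M - A. \<forall>\<mu>\<in>K. e \<le> dist \<mu> \<mu>0 \<longrightarrow>
  obj \<gamma> eps \<mu>0 om < obj \<gamma> eps \<mu> om)" using whp_separated[OF K e min \<gamma>[OF K(1,2)]] \<delta>2 unfolding whp_def by blast
 with eventually_pos show "\<forall>\<^sub>F eps in at_right 0. \<exists>A\<in>events. prob A \<le> \<delta> \<and> (\<forall>om\<in>space M - A. dist (\<mu>hat eps om) \<mu>0 \<le> e)"
 proof eventually_elim
  case (elim eps)
  then obtain A where A: "A \<in> events" "prob A \<le> \<delta> / 2" "\<And>om \<mu>. om \<in> space M - A \<Longrightarrow> \<mu> \<in> K \<Longrightarrow> e \<le> dist \<mu> \<mu>0 \<Longrightarrow>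
   obj \<gamma> eps \<mu>0 om < obj \<gamma> eps \<mu> om" by blast
  let ?B = "{om \<in> space M. \<mu>hat eps om \<notin> K0}"
  have "closed K0" by (rule compact_imp_closed[OF K0(1)])
  hence "space M - (\<mu>hat eps -` K0 \<inter> space M) \<in> events"
   by (intro sets.Diff sets.top measurable_sets[OF meas[OF elim(1)]] borel_closed)
  also have "space M - (\<mu>hat eps -` K0 \<inter> space M) = ?B" by auto
  finally have B: "?B \<in> events" .
  show ?case
  proof (intro bexI conjI ballI)
   show "A \<union> ?B \<in> events" using A(1) B by blast
   show "prob (A \<union> ?B) \<le> \<delta>" using measure_Un_le[OF A(1) B] A(2) K0(2)[OF elim(1)] by linarith
   fix om assume om: "om \<in> space M - (A \<union> ?B)"
   hence am: "is_arg_min (\<lambda>\<mu>. obj \<gamma> eps \<mu> om) (\<lambda>\<mu>. \<mu> \<in> MM) (\<mu>hat eps om)" using argmin[OF elim(1)] by blast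
   hence "\<mu>hat eps om \<in> K" using om by (auto simp: is_arg_min_def K_def)
   moreover have "\<not> obj \<gamma> eps \<mu>0 om < obj \<gamma> eps (\<mu>hat eps om) om" using am \<mu>0 unfolding is_arg_min_def by blast
   ultimately have "\<not> e \<le> dist (\<mu>hat eps om) \<mu>0" using A(3)[of om "\<mu>hat eps om"] om by blast
   thus "dist (\<mu>hat eps om) \<mu>0 \<le> e" by linarith
  qed
 qed
qed

end

section \<open>Consistency through the likelihood equation\<close>

lemma loglik_differentiable:
 fixes b :: "'m::euclidean_space \<Rightarrow> real^'d \<Rightarrow> real^'d"
 assumes b: "\<And>x. (\<lambda>\<mu>. b \<mu> x) differentiable (at \<mu>)"
 shows "(\<lambda>\<mu>. loglik b ainv k \<delta> \<mu> vs x) differentiable (at \<mu>)"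
proof -
 have A: "(\<lambda>\<mu>. A *v b \<mu> y) differentiable (at \<mu>)" for A :: "real^'d^'d" and y
 proof -
  obtain D where "((\<lambda>\<mu>. b \<mu> y) has_derivative D) (at \<mu>)" using b[of y] unfolding differentiable_def by blast
  from bounded_linear.has_derivative[OF matrix_vector_mul_bounded_linear this, of A] show ?thesis unfolding differentiable_def by blast
 qed
 show ?thesis unfolding loglik_def
  by (intro differentiable_diff differentiable_sum differentiable_mult differentiable_inner differentiable_const A b ballI) auto
qed

lemma critical_point_of_min:
 fixes l g :: "real^'n \<Rightarrow> real"
 assumes S: "open S" "\<mu> \<in> S" and min: "\<And>\<mu>'. \<mu>' \<in> S \<Longrightarrow> c * l \<mu> + g \<mu> \<le> c * l \<mu>' + g \<mu>'"
  and l: "l differentiable (at \<mu>)" and g: "g differentiable (at \<mu>)"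
 shows "c *\<^sub>R grad l \<mu> + grad g \<mu> = 0"
proof -
 have d: "((\<lambda>\<mu>. c * l \<mu> + g \<mu>) has_derivative (\<lambda>v. c * frechet_derivative l (at \<mu>) v + frechet_derivative g (at \<mu>) v)) (at \<mu>)"
  by (intro has_derivative_add has_derivative_mult_right frechet_derivative_works[THEN iffD1] l g)
 have "(\<lambda>v. c * frechet_derivative l (at \<mu>) v + frechet_derivative g (at \<mu>) v) = (\<lambda>v. 0)"
  by (rule differential_zero_maxmin[OF S(2,1) d]) (use min in blast)
 hence "c * frechet_derivative l (at \<mu>) v + frechet_derivative g (at \<mu>) v = 0" for v by meson
 thus ?thesis by (simp add: grad_def vec_eq_iff)
qed

text \<open>The parameter is now a coordinate vector, the setting in which \<open>grad\<close> is
  defined.\<close>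

locale vector_contrast = contrast M \<F> W X b \<mu>0 \<rho> I V x0 C\<beta> q\<beta> \<pi> \<Delta> m MM SS ainv vs0 vshat
 for M :: "'w measure" and \<F> and W :: "real \<Rightarrow> 'w \<Rightarrow> real^'d" and X
  and b :: "real^'n \<Rightarrow> real^'d \<Rightarrow> real^'d" and \<mu>0 \<rho> I V x0 C\<beta> q\<beta> \<pi> \<Delta> m
  and MM :: "(real^'n) set" and SS :: "'s::euclidean_space set" and ainv vs0 vshat
begin

text \<open>By \<open>whp_separated\<close> the objective on a small sphere exceeds its value at the
  center, so the minimum over the closed ball is attained inside and is a critical point. The
  estimator, a minimizer over an open set, is one too, and uniqueness identifies them. This replaces
  tightness.\<close>

lemma consistency_unique_critical_point:
 assumes opn: "open MM"
  and b_diff: "\<And>x. (\<lambda>\<mu>. b \<mu> x) differentiable_on MM" and \<gamma>_diff: "\<And>eps. 0 < eps \<Longrightarrow> \<gamma> eps differentiable_on MM"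
  and unique: "\<And>k x vs \<delta>. 1 \<le> k \<Longrightarrow> vs \<in> SS \<Longrightarrow> 0 < \<delta> \<Longrightarrow> \<delta> \<le> 1 \<Longrightarrow>
   \<exists>!\<mu>. \<mu> \<in> MM \<and> - (1 / (real k * \<delta>)) *\<^sub>R grad (\<lambda>\<mu>'. loglik b ainv k \<delta> \<mu>' vs x) \<mu> + grad (\<gamma> (1 / (real k * \<delta>))) \<mu> = 0"
  and argmin: "\<And>eps om. 0 < eps \<Longrightarrow> om \<in> space M \<Longrightarrow> is_arg_min (\<lambda>\<mu>. obj \<gamma> eps \<mu> om) (\<lambda>\<mu>. \<mu> \<in> MM) (\<mu>hat eps om)"
  and min: "\<And>\<mu>. \<mu> \<in> MM \<Longrightarrow> \<mu> \<noteq> \<mu>0 \<Longrightarrow> LB \<mu>0 < LB \<mu>"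
  and \<gamma>: "\<And>K. compact K \<Longrightarrow> K \<subseteq> MM \<Longrightarrow> uniform_limit K \<gamma> (\<lambda>_. 0) (at_right 0)"
  and e: "0 < e"
 shows "whp (at_right 0) (\<lambda>eps om. dist (\<mu>hat eps om) \<mu>0 \<le> e)"
proof -
 obtain e0 where e0: "0 < e0" "cball \<mu>0 e0 \<subseteq> MM" using opn \<mu>0 open_contains_cball by blast
 define r where "r = min e e0"
 have r: "0 < r" "r \<le> e" "cball \<mu>0 r \<subseteq> MM" using e e0 by (auto simp: r_def)
 let ?K = "cball \<mu>0 r"
 have K: "compact ?K" "\<mu>0 \<in> ?K" using r by auto
 have ev: "\<forall>\<^sub>F eps in at_right 0. 0 < eps \<and> 0 < \<Delta> eps \<and> \<Delta> eps \<le> 1 \<and> 1 \<le> real (m eps) * \<Delta> eps"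
  by (rule eventually_mesh) simp
 show ?thesis
 proof (rule whp_mono[OF whp_conj[OF whp_separated[OF K(1) r(3) K(2) r(1) min \<gamma>[OF K(1) r(3)]] vshat_SS]],
   assumption, assumption, use ev in eventually_elim, intro ballI impI, elim conjE)
  fix eps om assume eps: "0 < eps" and \<Delta>: "0 < \<Delta> eps" "\<Delta> eps \<le> 1" "1 \<le> real (m eps) * \<Delta> eps" and om: "om \<in> space M"
   and sep: "\<forall>\<mu>\<in>?K. r \<le> dist \<mu> \<mu>0 \<longrightarrow> obj \<gamma> eps \<mu>0 om < obj \<gamma> eps \<mu> om"
   and vs: "vshat eps om \<in> SS"
  let ?x = "\<lambda>i. X (real i * \<Delta> eps) om"
  let ?l = "\<lambda>\<mu>. loglik b ainv (m eps) (\<Delta> eps) \<mu> (vshat eps om) ?x"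
  let ?G = "\<lambda>\<mu>. - eps * ?l \<mu> + \<gamma> eps \<mu>"
  have G: "obj \<gamma> eps \<mu> om = ?G \<mu>" for \<mu> by (simp add: crit_def)
  have b_at: "(\<lambda>\<mu>. b \<mu> x) differentiable (at \<mu>)" if "\<mu> \<in> MM" for \<mu> x
   using b_diff[of x] differentiable_on_eq_differentiable_at[OF opn] that by blast
  have l_at: "?l differentiable (at \<mu>)" if "\<mu> \<in> MM" for \<mu> by (rule loglik_differentiable) (rule b_at[OF that])
  have g_at: "\<gamma> eps differentiable (at \<mu>)" if "\<mu> \<in> MM" for \<mu>
   using \<gamma>_diff[OF eps] differentiable_on_eq_differentiable_at[OF opn] that by blast
  have crit_pt: "- eps *\<^sub>R grad ?l \<mu> + grad (\<gamma> eps) \<mu> = 0" if "open S" "S \<subseteq> MM" "\<mu> \<in> S" "\<And>\<mu>'. \<mu>' \<in> S \<Longrightarrow> ?G \<mu> \<le> ?G \<mu>'" for S \<mu>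
   by (rule critical_point_of_min[OF that(1,3,4) l_at g_at]) (use that in auto)
  have am: "\<mu>hat eps om \<in> MM" "\<And>\<mu>'. \<mu>' \<in> MM \<Longrightarrow> ?G (\<mu>hat eps om) \<le> ?G \<mu>'"
   using argmin[OF eps om] unfolding is_arg_min_def G by (auto simp: not_less)
  have "continuous_on ?K ?G" by (intro continuous_on_add continuous_on_mult continuous_on_const differentiable_imp_continuous_on)
     (use r l_at g_at in \<open>auto intro: differentiable_at_imp_differentiable_on\<close>)
  from continuous_attains_inf[OF K(1) _ this] K(2)
  obtain \<mu>1 where \<mu>1: "\<mu>1 \<in> ?K" "\<And>\<mu>. \<mu> \<in> ?K \<Longrightarrow> ?G \<mu>1 \<le> ?G \<mu>" by blast
  have near: "dist \<mu>1 \<mu>0 < r"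
  proof (rule ccontr)
   assume "\<not> dist \<mu>1 \<mu>0 < r"
   hence "?G \<mu>0 < ?G \<mu>1" using sep \<mu>1(1) unfolding G by simp
   with \<mu>1(2)[OF K(2)] show False by linarith
  qed
  have c1: "- eps *\<^sub>R grad ?l \<mu>1 + grad (\<gamma> eps) \<mu>1 = 0"
   by (rule crit_pt[of "ball \<mu>0 r"]) (use near \<mu>1 r in \<open>auto simp: dist_commute\<close>)
  have c2: "- eps *\<^sub>R grad ?l (\<mu>hat eps om) + grad (\<gamma> eps) (\<mu>hat eps om) = 0" by (rule crit_pt[OF opn order_refl am]) auto
  \<comment> \<open>The uniqueness assumption is used with \<open>k = m eps\<close> and mesh
    \<open>\<Delta> eps\<close>, for which the index of the penalty is exactly
    \<open>eps\<close>.\<close>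
  have k: "1 \<le> m eps" using \<Delta>(3) by (cases "m eps") auto
  have "1 / (real (m eps) * \<Delta> eps) = eps" using horizon[OF eps] by simp
  from unique[OF k vs \<Delta>(1,2), of ?x, unfolded this] c1 c2 \<mu>1(1) r(3) am(1)
  have "\<mu>hat eps om = \<mu>1" by blast
  thus "dist (\<mu>hat eps om) \<mu>0 \<le> e" using near r(2) by simp
 qed
qed

end

section \<open>Regularity of the coefficients and assembly\<close>

lemma holder_continuous:
 fixes f :: "real^'d \<Rightarrow> 'b::real_normed_vector"
 assumes V: "continuous_on UNIV V" "\<And>x. 0 < V x" and \<alpha>: "0 < \<alpha>"
  and f: "\<And>x x'. norm (f x - f x') \<le> J * (V x powr q + V x' powr q) * norm (x - x') powr \<alpha>"
 shows "continuous_on UNIV f"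
proof (rule continuous_at_imp_continuous_on, rule ballI)
 fix x
 have Vx: "isCont V x" using V(1) by (simp add: continuous_on_eq_continuous_at)
 have "((\<lambda>y. J * (V y powr q + V x powr q) * norm (y - x) powr \<alpha>) \<longlongrightarrow> J * (V x powr q + V x powr q) * norm (x - x) powr \<alpha>) (at x)"
  using V(2)[of x] \<alpha> Vx unfolding isCont_def
  by (intro tendsto_mult tendsto_add tendsto_const tendsto_powr' tendsto_norm tendsto_diff tendsto_ident_at) auto
 hence "((\<lambda>y. J * (V y powr q + V x powr q) * norm (y - x) powr \<alpha>) \<longlongrightarrow> 0) (at x)" by simp
 hence "((\<lambda>y. f y - f x) \<longlongrightarrow> 0) (at x)" by (rule Lim_null_comparison[rotated]) (intro always_eventually allI f)
 thus "isCont f x" unfolding isCont_def by (rule LIM_zero_cancel)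
qed

lemma matrix_inv_works:
 fixes A :: "real^'n^'n"
 assumes "invertible A"
 shows "A ** matrix_inv A = mat 1" "matrix_inv A ** A = mat 1" using someI_ex[OF assms[unfolded invertible_def]] by (auto simp: matrix_inv_def)

lemma positive_definite_invertible:
 fixes A :: "real^'n^'n"
 assumes "positive_definite A"
 shows "invertible A"
proof -
 have "v = 0" if "A *v v = 0" for v using assms that unfolding positive_definite_def by (metis inner_zero_right less_irrefl)
 hence "\<exists>B. B ** A = mat 1" unfolding matrix_left_invertible_ker by blast
 then obtain B where B: "B ** A = mat 1" by blast
 hence "A ** B = mat 1" by (simp add: matrix_left_right_inverse)
 with B show ?thesis unfolding invertible_def by blast
qed

lemma transpose_matrix_inv:
 fixes A :: "real^'n^'n"
 assumes A: "invertible A" and sym: "transpose A = A"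
 shows "transpose (matrix_inv A) = matrix_inv A"
proof -
 have "transpose (matrix_inv A) ** A = mat 1"
  using arg_cong[OF matrix_inv_works(1)[OF A], of transpose] by (simp add: matrix_transpose_mul sym transpose_mat)
 hence "transpose (matrix_inv A) ** (A ** matrix_inv A) = mat 1 ** matrix_inv A" by (simp only: matrix_mul_assoc)
 thus ?thesis by (simp add: matrix_inv_works[OF A])
qed

lemma continuous_on_matrix_columns:
 fixes A :: "'a::topological_space \<Rightarrow> real^'n^'m"
 assumes "\<And>v. continuous_on S (\<lambda>x. A x *v v)"
 shows "continuous_on S A"
proof -
 have "A x $ i $ j = (A x *v axis j 1) $ i" for x i j by (simp add: matrix_vector_mult_basis column_def)
 moreover have "continuous_on S (\<lambda>x. (A x *v axis j 1) $ i)" for i j by (rule continuous_on_component[OF assms])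
 ultimately have "continuous_on S (\<lambda>x. A x $ i $ j)" for i j by simp
 hence "continuous_on S (\<lambda>x. \<chi> i. \<chi> j. A x $ i $ j)" by (intro continuous_on_vec_lambda)
 thus ?thesis by simp
qed

text \<open>The difference of two inverses is one inverse times the difference of the matrices times
  the other inverse; the growth bound \<open>g\<close> controls the factor at the moving
  point.\<close>

lemma continuous_on_matrix_inv:
 fixes A :: "real^'d \<Rightarrow> real^'n^'n"
 assumes A: "continuous_on UNIV A" and inv: "\<And>x. invertible (A x)"
  and bound: "\<And>x. norm (matrix_inv (A x)) \<le> g x" and g: "continuous_on UNIV g"
 shows "continuous_on UNIV (\<lambda>x. matrix_inv (A x))"
proof (rule continuous_on_matrix_columns, rule continuous_at_imp_continuous_on, rule ballI)
 fix v x
 have eq: "matrix_inv (A y) *v v - matrix_inv (A x) *v v = matrix_inv (A y) *v ((A x - A y) *v (matrix_inv (A x) *v v))" for y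
 proof -
  have "matrix_inv (A y) *v ((A x - A y) *v (matrix_inv (A x) *v v))
   = (matrix_inv (A y) ** (A x ** matrix_inv (A x))) *v v - ((matrix_inv (A y) ** A y) ** matrix_inv (A x)) *v v"
   unfolding matrix_vector_mult_diff_rdistrib matrix_vector_mult_diff_distrib by (simp only: matrix_vector_mul_assoc matrix_mul_assoc)
  thus ?thesis by (simp only: matrix_inv_works[OF inv] matrix_mul_rid matrix_mul_lid)
 qed
 have "((\<lambda>y. g y * (norm (A x - A y) * norm (matrix_inv (A x) *v v))) \<longlongrightarrow> g x * (norm (A x - A x) * norm (matrix_inv (A x) *v v))) (at x)"
  using A g unfolding continuous_on_eq_continuous_at[OF open_UNIV] isCont_def by (intro tendsto_mult tendsto_norm tendsto_diff tendsto_const) auto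
 hence "((\<lambda>y. g y * (norm (A x - A y) * norm (matrix_inv (A x) *v v))) \<longlongrightarrow> 0) (at x)" by simp
 hence "((\<lambda>y. matrix_inv (A y) *v v - matrix_inv (A x) *v v) \<longlongrightarrow> 0) (at x)"
 proof (rule Lim_null_comparison[rotated], intro always_eventually allI)
  fix y
  have "norm (matrix_inv (A y) *v v - matrix_inv (A x) *v v) \<le> norm (matrix_inv (A y)) * norm ((A x - A y) *v (matrix_inv (A x) *v v))"
   unfolding eq by (rule norm_matrix_vector_mult_le)
  also have "... \<le> g y * (norm (A x - A y) * norm (matrix_inv (A x) *v v))"
   using bound[of y] order_trans[OF norm_ge_zero bound[of y]] by (intro mult_mono norm_matrix_vector_mult_le) auto
  finally show "norm (matrix_inv (A y) *v v - matrix_inv (A x) *v v) \<le> g y * (norm (A x - A y) * norm (matrix_inv (A x) *v v))" .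
 qed
 thus "isCont (\<lambda>y. matrix_inv (A y) *v v) x" unfolding isCont_def by (rule LIM_zero_cancel)
qed

lemma locally_bounded_growth:
 assumes "locally_bounded_on S J" "compact K" "K \<subseteq> S" "0 \<le> q"
  and f: "\<forall>\<mu>\<in>S. \<forall>x. norm (f \<mu> x) \<le> J \<mu> * V x powr q"
 shows "\<exists>C q. 0 \<le> q \<and> (\<forall>\<mu>\<in>K. \<forall>x. norm (f \<mu> x) \<le> C * V x powr q)"
proof -
 have "bounded (J ` K)" using assms(1-3) unfolding locally_bounded_on_def by blast
 then obtain B where B: "\<And>\<mu>. \<mu> \<in> K \<Longrightarrow> \<bar>J \<mu>\<bar> \<le> B" unfolding bounded_iff by auto
 have "norm (f \<mu> x) \<le> B * V x powr q" if "\<mu> \<in> K" for \<mu> x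
 proof -
  have "norm (f \<mu> x) \<le> J \<mu> * V x powr q" using f \<open>K \<subseteq> S\<close> that by blast
  also have "... \<le> B * V x powr q" using B[OF that] by (intro mult_right_mono) auto
  finally show ?thesis .
 qed
 with \<open>0 \<le> q\<close> show ?thesis by blast
qed

lemma growth_square:
 fixes J v :: real
 assumes "norm f \<le> J * v powr q" "q \<le> q'" "1 \<le> v"
 shows "(norm f)^2 \<le> J^2 * v powr (2 * q')"
proof -
 have "(norm f)^2 \<le> (J * v powr q)^2" using assms(1) by (rule power_mono) simp
 also have "... = J^2 * v powr (2 * q)" by (simp add: power_mult_distrib power2_eq_square powr_add[symmetric])
 also have "... \<le> J^2 * v powr (2 * q')" using assms by (intro mult_left_mono powr_mono) auto
 finally show ?thesis .
qed

theorem theorem3p3: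
  fixes MM :: "(real^'n0) set" and SS :: "(real^'n2^'n1) set"
    and b :: "real^'n0 \<Rightarrow> real^'d \<Rightarrow> real^'d"
    and \<sigma> :: "real^'n2^'n1 \<Rightarrow> real^'d \<Rightarrow> real^'d^'d"
    and ainv :: "real^'n2^'n1 \<Rightarrow> real^'d \<Rightarrow> real^'d^'d"
    and \<Omega> :: "'w measure"
    and P :: "real^'n0 \<Rightarrow> real^'n2^'n1 \<Rightarrow> 'w measure"
    and X :: "real \<Rightarrow> 'w \<Rightarrow> real^'d" and x0 :: "real^'d"
    and \<pi>st :: "real^'n0 \<Rightarrow> real^'n2^'n1 \<Rightarrow> (real^'d) measure"
    and \<Delta> :: "real \<Rightarrow> real" and m :: "real \<Rightarrow> nat"
    and Fest :: "real \<Rightarrow> (nat \<Rightarrow> real^'d) \<Rightarrow> real^'n2^'n1"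
    and vshat :: "real \<Rightarrow> 'w \<Rightarrow> real^'n2^'n1"
    and \<gamma> :: "real \<Rightarrow> real^'n0 \<Rightarrow> real"
    and \<mu>hat :: "real \<Rightarrow> 'w \<Rightarrow> real^'n0"
    and V :: "real^'d \<Rightarrow> real"
    and qV0 JV0 qb0 qb1 q\<sigma>0 q\<sigma>1 qa0 \<alpha>b \<alpha>\<sigma> :: real
    and Jb0 Jb1 :: "real^'n0 \<Rightarrow> real"
    and J\<sigma>0 J\<sigma>1 Ja0 :: "real^'n2^'n1 \<Rightarrow> real"
  \<comment> \<open>the model\<close>
  assumes b_meas: "(\<lambda>(\<mu>, x). b \<mu> x) \<in> borel_measurable borel"
    and \<sigma>_meas: "(\<lambda>(vs, x). \<sigma> vs x) \<in> borel_measurable borel"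
    and a_pd: "\<forall>vs\<in>SS. \<forall>x. positive_definite (diffusion_matrix \<sigma> vs x)"
    and ainv_meas: "(\<lambda>(vs, x). ainv vs x) \<in> borel_measurable borel"
    and ainv: "\<forall>vs\<in>SS. \<forall>x. ainv vs x = matrix_inv (diffusion_matrix \<sigma> vs x)"
    and P_prob: "\<forall>\<mu>\<in>MM. \<forall>vs\<in>SS. prob_space (P \<mu> vs) \<and> sets (P \<mu> vs) = sets \<Omega>"
    and X_meas: "\<forall>t\<ge>0. X t \<in> borel_measurable \<Omega>"
    and X_sde: "\<forall>\<mu>\<in>MM. \<forall>vs\<in>SS. sde_solution (P \<mu> vs) (b \<mu>) (\<sigma> vs) X
                  \<and> (AE \<omega> in P \<mu> vs. X 0 \<omega> = x0)"
    and \<pi>st: "\<forall>\<mu>\<in>MM. \<forall>vs\<in>SS. stationary_distribution (b \<mu>) (\<sigma> vs) (\<pi>st \<mu> vs)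
                  \<and> (\<forall>\<pi>'. stationary_distribution (b \<mu>) (\<sigma> vs) \<pi>' \<longrightarrow> \<pi>' = \<pi>st \<mu> vs)"
    and X_ergodic: "\<forall>\<mu>\<in>MM. \<forall>vs\<in>SS. ergodic_process (P \<mu> vs) X (\<pi>st \<mu> vs)"
  \<comment> \<open>data, estimator of \<open>vs\<close>, and the approximate maximum likelihood estimator of \<open>\<mu>\<close>\<close>
    and m: "\<forall>\<epsilon>>0. \<Delta> \<epsilon> > 0 \<and> real (m \<epsilon>) = 1 / (\<epsilon> * \<Delta> \<epsilon>)"
    and Fest_meas: "\<forall>\<epsilon>>0. Fest \<epsilon> \<in> borel_measurable (\<Pi>\<^sub>M i\<in>{0..m \<epsilon>}. borel)"
    and vshat: "\<forall>\<epsilon>>0. \<forall>\<omega>\<in>space \<Omega>.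
                 vshat \<epsilon> \<omega> = Fest \<epsilon> (\<lambda>i\<in>{0..m \<epsilon>}. X (real i * \<Delta> \<epsilon>) \<omega>)"
    and \<mu>hat_meas: "\<forall>\<epsilon>>0. \<mu>hat \<epsilon> \<in> borel_measurable \<Omega>"
    and \<mu>hat: "\<forall>\<epsilon>>0. \<forall>\<omega>\<in>space \<Omega>.
                 is_arg_min
                   (\<lambda>\<mu>. - \<epsilon> * loglik b ainv (m \<epsilon>) (\<Delta> \<epsilon>) \<mu> (vshat \<epsilon> \<omega>) (\<lambda>i. X (real i * \<Delta> \<epsilon>) \<omega>) + \<gamma> \<epsilon> \<mu>)
                   (\<lambda>\<mu>. \<mu> \<in> MM) (\<mu>hat \<epsilon> \<omega>)"
    and SS: "open SS \<or> (closed SS \<and> (\<forall>\<epsilon>>0. \<forall>\<omega>\<in>space \<Omega>. vshat \<epsilon> \<omega> \<in> SS))"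
  \<comment> \<open>(A)\<close>
    and A_lyap: "lyapunov_function V"
    and A_drift: "\<forall>\<mu>\<in>MM. \<forall>vs\<in>SS. - Limsup at_infinity (\<lambda>x. ereal (generator b \<sigma> \<mu> vs V x)) > 0"
    and A_ratio: "\<forall>\<mu>\<in>MM. \<forall>vs\<in>SS.
          ((\<lambda>x. (grad V x \<bullet> (diffusion_matrix \<sigma> vs x *v grad V x)) / (V x * \<bar>generator b \<sigma> \<mu> vs V x\<bar>))
             \<longlongrightarrow> 0) at_infinity"
    and A_deriv: "qV0 \<ge> 0" "JV0 > 0"
          "\<forall>x. max (norm (grad V x)) (norm (hess V x)) \<le> JV0 * V x powr qV0"
    and A_Jb: "locally_bounded_on MM Jb0" "locally_bounded_on MM Jb1"
          "\<forall>\<mu>\<in>MM. Jb0 \<mu> \<ge> 0 \<and> Jb1 \<mu> \<ge> 0"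
    and A_J\<sigma>: "locally_bounded_on SS J\<sigma>0" "locally_bounded_on SS J\<sigma>1" "locally_bounded_on SS Ja0"
          "\<forall>vs\<in>SS. J\<sigma>0 vs \<ge> 0 \<and> J\<sigma>1 vs \<ge> 0 \<and> Ja0 vs \<ge> 0"
    and A_exps: "qb0 \<ge> 0" "qb1 \<ge> 0" "q\<sigma>0 \<ge> 0" "q\<sigma>1 \<ge> 0" "qa0 \<ge> 0"
          "0 < \<alpha>b" "\<alpha>b \<le> 1" "0 < \<alpha>\<sigma>" "\<alpha>\<sigma> \<le> 1"
    and A_b0: "\<forall>\<mu>\<in>MM. \<forall>x. norm (b \<mu> x) \<le> Jb0 \<mu> * V x powr qb0"
    and A_b1: "\<forall>\<mu>\<in>MM. \<forall>x x'. norm (b \<mu> x - b \<mu> x')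
                 \<le> Jb1 \<mu> * (V x powr qb1 + V x' powr qb1) * norm (x - x') powr \<alpha>b"
    and A_\<sigma>0: "\<forall>vs\<in>SS. \<forall>x. norm (\<sigma> vs x) \<le> J\<sigma>0 vs * V x powr q\<sigma>0"
    and A_\<sigma>1: "\<forall>vs\<in>SS. \<forall>x x'. norm (\<sigma> vs x - \<sigma> vs x')
                 \<le> J\<sigma>1 vs * (V x powr q\<sigma>1 + V x' powr q\<sigma>1) * norm (x - x') powr \<alpha>\<sigma>"
    and A_a0: "\<forall>vs\<in>SS. \<forall>x. norm (ainv vs x) \<le> Ja0 vs * V x powr qa0"
    and A_b_holder: "local_holder_cond MM V b"
    and A_a_holder: "local_holder_cond SS V ainv"
  \<comment> \<open>(B)\<close>
    and B: "\<forall>\<mu>0\<in>MM. \<forall>vs0\<in>SS. tendsto_in_prob (P \<mu>0 vs0) vshat (\<lambda>_. vs0) (at_right 0)"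
  \<comment> \<open>(C)\<close>
    and C: "\<forall>\<mu>0\<in>MM. \<forall>vs0\<in>SS. \<forall>\<mu>\<in>MM. \<mu> \<noteq> \<mu>0 \<longrightarrow>
              Lambda_bar b ainv (\<pi>st \<mu>0 vs0) \<mu>0 vs0 \<mu>0 < Lambda_bar b ainv (\<pi>st \<mu>0 vs0) \<mu>0 vs0 \<mu>"
  \<comment> \<open>(D)\<close>
    and D: "\<forall>\<epsilon>>0. continuous_on MM (\<gamma> \<epsilon>)"
           "\<forall>K. compact K \<and> K \<subseteq> MM \<longrightarrow> uniform_limit K \<gamma> (\<lambda>_. 0) (at_right 0)"
  \<comment> \<open>(E)\<close>
    and E: "(closed MM \<and> (\<forall>\<mu>0\<in>MM. \<forall>vs0\<in>SS. tight_family (P \<mu>0 vs0) {0<..} \<mu>hat))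
          \<or> (open MM \<and> convex MM
             \<and> (\<forall>x. (\<lambda>\<mu>. b \<mu> x) differentiable_on MM)
             \<and> (\<forall>\<epsilon>>0. \<gamma> \<epsilon> differentiable_on MM)
             \<and> (\<forall>k\<ge>1. \<forall>x :: nat \<Rightarrow> real^'d. \<forall>vs\<in>SS. \<forall>\<delta>. 0 < \<delta> \<and> \<delta> \<le> 1 \<longrightarrow>
                  (\<exists>!\<mu>. \<mu> \<in> MM \<and>
                     - (1 / (real k * \<delta>)) *\<^sub>R grad (\<lambda>\<mu>'. loglik b ainv k \<delta> \<mu>' vs x) \<mu>
                     + grad (\<gamma> (1 / (real k * \<delta>))) \<mu> = 0)))"
  \<comment> \<open>(F)\<close>
    and F: "(\<Delta> \<longlongrightarrow> 0) (at_right 0)"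
  shows "\<forall>\<mu>0\<in>MM. \<forall>vs0\<in>SS. tendsto_in_prob (P \<mu>0 vs0) \<mu>hat (\<lambda>_. \<mu>0) (at_right 0)"
proof (intro ballI)
 fix \<mu>0 vs0 assume \<mu>0: "\<mu>0 \<in> MM" and vs0: "vs0 \<in> SS"
 let ?M = "P \<mu>0 vs0"
 let ?\<pi> = "\<pi>st \<mu>0 vs0"
 have PM: "prob_space ?M" "sets ?M = sets \<Omega>" using P_prob \<mu>0 vs0 by auto
 have sp: "space ?M = space \<Omega>" using PM(2) by (rule sets_eq_imp_space_eq)
 have bm: "f \<in> borel_measurable \<Omega> \<Longrightarrow> f \<in> borel_measurable ?M" for f :: "'w \<Rightarrow> 'z::topological_space"
  using measurable_cong_sets[OF PM(2) refl] by blast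
 from X_sde \<mu>0 vs0 have "sde_solution ?M (b \<mu>0) (\<sigma> vs0) X" and X0: "AE om in ?M. X 0 om = x0" by auto
 then obtain \<F> W I where fp: "filtered_prob_space ?M \<F>" and bmn: "brownian_motion ?M \<F> W" and ad: "adapted \<F> X"
  and Xc: "\<And>om. om \<in> space ?M \<Longrightarrow> continuous_on {0..} (\<lambda>t. X t om)"
  and ito: "has_ito_integral ?M \<F> W (\<lambda>s om. \<sigma> vs0 (X s om)) I"
  and eq: "AE om in ?M. \<forall>t\<ge>0. set_integrable lborel {0..t} (\<lambda>s. b \<mu>0 (X s om)) \<and>
      X t om = X 0 om + (LBINT s:{0..t}. b \<mu>0 (X s om)) + I t om" unfolding sde_solution_def by blast
 have V1: "1 \<le> V x" for x using A_lyap by (simp add: lyapunov_function_def)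
 have Vpos: "0 < V x" for x using V1[of x] by linarith
 have V_diff: "V differentiable at x" for x using A_lyap by (simp add: lyapunov_function_def C2_def)
 have Vc: "continuous_on UNIV V" by (rule continuous_at_imp_continuous_on) (auto intro: differentiable_imp_continuous_within V_diff)
 have b_cont: "continuous_on UNIV (b \<mu>)" if "\<mu> \<in> MM" for \<mu> by (rule holder_continuous[OF Vc Vpos A_exps(6)]) (use A_b1 that in blast)
 have \<sigma>_cont: "continuous_on UNIV (\<sigma> vs)" if "vs \<in> SS" for vs
  by (rule holder_continuous[OF Vc Vpos A_exps(8)]) (use A_\<sigma>1 that in blast)
 have inv: "invertible (diffusion_matrix \<sigma> vs x)" if "vs \<in> SS" for vs x using a_pd that by (blast intro: positive_definite_invertible)
 have ainv_eq: "ainv vs = (\<lambda>x. matrix_inv (diffusion_matrix \<sigma> vs x))" if "vs \<in> SS" for vs using ainv that by (simp add: fun_eq_iff)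
 have ainv_cont: "continuous_on UNIV (ainv vs)" if vs: "vs \<in> SS" for vs unfolding ainv_eq[OF vs]
 proof (rule continuous_on_matrix_inv[OF _ inv[OF vs]])
  show "continuous_on UNIV (diffusion_matrix \<sigma> vs)" unfolding diffusion_matrix_def by (intro continuous_on_matrix_columns)
    (simp only: matrix_vector_mul_assoc[symmetric], intro continuous_on_matrix_vector_mult continuous_on_transpose continuous_on_const \<sigma>_cont vs)
  show "norm (matrix_inv (diffusion_matrix \<sigma> vs x)) \<le> Ja0 vs * V x powr qa0" for x using A_a0 ainv vs by simp
  show "continuous_on UNIV (\<lambda>x. Ja0 vs * V x powr qa0)"
   using Vpos by (intro continuous_on_mult continuous_on_const continuous_on_powr Vc) (metis less_irrefl)
 qed
 have ainv_sym: "transpose (ainv vs0 x) = ainv vs0 x" for x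
  using a_pd vs0 by (auto simp: ainv_eq[OF vs0] positive_definite_def intro!: transpose_matrix_inv inv)
 \<comment> \<open>The sum of the two exponents dominates each of them, so one power of
   \<open>V\<close> bounds drift and diffusion together.\<close>
 have growth: "(norm (b \<mu>0 x))^2 + (norm (\<sigma> vs0 x))^2 \<le> ((Jb0 \<mu>0)^2 + (J\<sigma>0 vs0)^2) * V x powr (2 * (qb0 + q\<sigma>0))" for x
  using growth_square[of "b \<mu>0 x" "Jb0 \<mu>0" "V x" qb0 "qb0 + q\<sigma>0"] growth_square[of "\<sigma> vs0 x" "J\<sigma>0 vs0" "V x" q\<sigma>0 "qb0 + q\<sigma>0"]
   A_b0 A_\<sigma>0 \<mu>0 vs0 A_exps V1[of x] by (simp add: distrib_right)
 interpret prob_space ?M by (rule PM(1))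
 have pos: "\<forall>\<^sub>F eps in at_right (0::real). 0 < eps" by (simp add: eventually_at_right_less)
 \<comment> \<open>Measurability turns consistency into a \<open>whp\<close> statement, whose
   exceptional sets are events.\<close>
 have vshat_meas: "vshat eps \<in> borel_measurable ?M" if eps: "0 < eps" for eps
 proof -
  have "0 < \<Delta> eps" using m eps by blast
  hence "(\<lambda>om. \<lambda>i\<in>{0..m eps}. X (real i * \<Delta> eps) om) \<in> measurable ?M (\<Pi>\<^sub>M i\<in>{0..m eps}. borel)"
   using X_meas by (intro measurable_restrict bm) auto
  from measurable_compose[OF this] Fest_meas eps
  have "(\<lambda>om. Fest eps (\<lambda>i\<in>{0..m eps}. X (real i * \<Delta> eps) om)) \<in> borel_measurable ?M" by blast
  thus ?thesis by (rule measurable_cong[THEN iffD1, rotated]) (use vshat eps sp in auto)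
 qed
 have vshat_cons: "whp (at_right 0) (\<lambda>eps om. dist (vshat eps om) vs0 \<le> r)" if r: "0 < r" for r
 proof (rule whp_of_tendsto)
  show "((\<lambda>eps. prob {om \<in> space ?M. \<not> dist (vshat eps om) vs0 \<le> r}) \<longlongrightarrow> 0) (at_right 0)"
   using B \<mu>0 vs0 r unfolding tendsto_in_prob_def not_le by blast
  show "\<forall>\<^sub>F eps in at_right 0. {om \<in> space ?M. \<not> dist (vshat eps om) vs0 \<le> r} \<in> events" using pos
  proof eventually_elim
   case (elim eps)
   have [measurable]: "vshat eps \<in> borel_measurable ?M" by (rule vshat_meas[OF elim])
   show ?case by measurable
  qed
 qed
 \<comment> \<open>In the open case a small closed ball lies inside \<open>SS\<close>; in the closed
   case any closed ball meets \<open>SS\<close> in a compact set.\<close>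
 have nbhd: "\<exists>r>0. compact (cball vs0 r \<inter> SS)" using SS
 proof (elim disjE conjE)
  assume "open SS"
  then obtain r where "0 < r" "cball vs0 r \<subseteq> SS" using vs0 open_contains_cball by blast
  moreover from this have "cball vs0 r \<inter> SS = cball vs0 r" by auto
  ultimately show ?thesis by auto
 next
  assume "closed SS"
  thus ?thesis by (intro exI[of _ 1] conjI compact_Int_closed) auto
 qed
 \<comment> \<open>In the open case consistency itself brings the estimator into a ball inside
   \<open>SS\<close>, with high probability.\<close>
 have vshat_SS: "whp (at_right 0) (\<lambda>eps om. vshat eps om \<in> SS)" using SS
 proof (elim disjE conjE)
  assume "open SS"
  then obtain r where r: "0 < r" "cball vs0 r \<subseteq> SS" using vs0 open_contains_cball by blast
  show ?thesis by (rule whp_mono[OF vshat_cons[OF r(1)]]) (use r(2) in \<open>auto simp: dist_commute subset_iff\<close>)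
 next
  assume "\<forall>eps>0. \<forall>om\<in>space \<Omega>. vshat eps om \<in> SS"
  thus ?thesis by (intro whp_eventually eventually_mono[OF pos]) (auto simp: sp)
 qed
 interpret \<pi>: prob_space ?\<pi> using \<pi>st \<mu>0 vs0 by (simp add: stationary_distribution_def)
 interpret vector_contrast ?M \<F> W X b \<mu>0 "\<sigma> vs0" I V x0 "(Jb0 \<mu>0)^2 + (J\<sigma>0 vs0)^2" "2 * (qb0 + q\<sigma>0)" ?\<pi> \<Delta> m MM SS ainv vs0 vshat
 proof (unfold_locales)
  show "X t \<in> borel_measurable (\<F> t)" if "0 \<le> t" for t using ad that by (simp add: adapted_def)
  show "AE om in ?M. \<forall>t\<ge>0. X t om = X 0 om + (LBINT s:{0..t}. b \<mu>0 (X s om)) + I t om" using eq by eventually_elim blast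
  show "- Limsup at_infinity (\<lambda>x. ereal (b \<mu>0 x \<bullet> grad V x + 1/2 * trace ((\<sigma> vs0 x ** transpose (\<sigma> vs0 x)) ** hess V x))) > 0"
   using A_drift \<mu>0 vs0 unfolding generator_def diffusion_matrix_def by blast
  show "((\<lambda>x. (grad V x \<bullet> ((\<sigma> vs0 x ** transpose (\<sigma> vs0 x)) *v grad V x)) /
    (V x * \<bar>b \<mu>0 x \<bullet> grad V x + 1/2 * trace ((\<sigma> vs0 x ** transpose (\<sigma> vs0 x)) ** hess V x)\<bar>)) \<longlongrightarrow> 0) at_infinity"
   using A_ratio \<mu>0 vs0 unfolding generator_def diffusion_matrix_def by blast
  show "0 \<le> (Jb0 \<mu>0)^2 + (J\<sigma>0 vs0)^2" by simp
  show "0 \<le> 2 * (qb0 + q\<sigma>0)" using A_exps by simp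
  show "sets ?\<pi> = sets borel" using \<pi>st \<mu>0 vs0 by (auto simp: stationary_distribution_def)
  show "ergodic_process ?M X ?\<pi>" using X_ergodic \<mu>0 vs0 by blast
  show "0 < \<Delta> eps \<and> real (m eps) = 1 / (eps * \<Delta> eps)" if "0 < eps" for eps using m that by blast
  show "\<exists>C q. 0 \<le> q \<and> (\<forall>\<mu>\<in>K. \<forall>x. norm (b \<mu> x) \<le> C * V x powr q)" if "compact K" "K \<subseteq> MM" for K
   by (rule locally_bounded_growth[OF A_Jb(1) that A_exps(1) A_b0])
  show "\<exists>C q. 0 \<le> q \<and> (\<forall>vs\<in>L. \<forall>x. norm (ainv vs x) \<le> C * V x powr q)" if "compact L" "L \<subseteq> SS" for L
   by (rule locally_bounded_growth[OF A_J\<sigma>(3) that A_exps(5) A_a0])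
 qed (fact fp bmn Xc ito A_lyap X0 growth F \<mu>0 vs0 b_cont ainv_cont ainv_sym A_b_holder A_a_holder nbhd vshat_SS vshat_cons b_cont[OF \<mu>0] \<sigma>_cont[OF vs0])+
 have argmin: "is_arg_min (\<lambda>\<mu>. crit eps (vshat eps om) \<mu> om + \<gamma> eps \<mu>) (\<lambda>\<mu>. \<mu> \<in> MM) (\<mu>hat eps om)" if "0 < eps" "om \<in> space ?M" for eps om
  using \<mu>hat that unfolding crit_def sp by blast
 have min: "Lambda_bar b ainv ?\<pi> \<mu>0 vs0 \<mu>0 < Lambda_bar b ainv ?\<pi> \<mu>0 vs0 \<mu>" if "\<mu> \<in> MM" "\<mu> \<noteq> \<mu>0" for \<mu>
  using C \<mu>0 vs0 that by blast
 have \<gamma>: "uniform_limit K \<gamma> (\<lambda>_. 0) (at_right 0)" if "compact K" "K \<subseteq> MM" for K using D(2) that by blast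
 have "whp (at_right 0) (\<lambda>eps om. dist (\<mu>hat eps om) \<mu>0 \<le> \<eta>)" if \<eta>: "0 < \<eta>" for \<eta> using E
 proof (elim disjE conjE)
  assume cl: "closed MM" and tight: "\<forall>\<mu>0\<in>MM. \<forall>vs0\<in>SS. tight_family (P \<mu>0 vs0) {0<..} \<mu>hat"
  show ?thesis
  proof (rule consistency_tight[OF cl _ _ argmin min \<gamma> \<eta>])
   show "tight_family ?M {0<..} \<mu>hat" using tight \<mu>0 vs0 by blast
   show "\<mu>hat eps \<in> borel_measurable ?M" if "0 < eps" for eps using \<mu>hat_meas that by (intro bm) blast
  qed
 next
  assume opn: "open MM" and diff: "\<forall>x. (\<lambda>\<mu>. b \<mu> x) differentiable_on MM" "\<forall>eps>0. \<gamma> eps differentiable_on MM"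
   and unique: "\<forall>k\<ge>1. \<forall>x :: nat \<Rightarrow> real^'d. \<forall>vs\<in>SS. \<forall>\<delta>. 0 < \<delta> \<and> \<delta> \<le> 1 \<longrightarrow>
    (\<exists>!\<mu>. \<mu> \<in> MM \<and> - (1 / (real k * \<delta>)) *\<^sub>R grad (\<lambda>\<mu>'. loglik b ainv k \<delta> \<mu>' vs x) \<mu> + grad (\<gamma> (1 / (real k * \<delta>))) \<mu> = 0)"
  show ?thesis by (rule consistency_unique_critical_point[OF opn _ _ _ argmin min \<gamma> \<eta>]) (use diff unique in blast)+
 qed
 from tendsto_of_whp[OF this] show "tendsto_in_prob ?M \<mu>hat (\<lambda>_. \<mu>0) (at_right 0)" unfolding tendsto_in_prob_def not_le by blast
qed

end
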